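(* Let $(M,g,\Upsilon)$ be an oriented Riemannian $5$-manifold with an irreducible $SO(3)$-structure, $\nabla$ an $SO(3)$-connection on $M$, $t>0$, and $\mathbb T$ the twistor space of $M$ with the almost contact metric structures $(\Phi^{(n)}_{\pm},\chi,h_t)$, $n=1,2$, defined by means of $\nabla$. The almost contact structures $(\Phi^{(1)}_{-},\chi,h_t)$, $(\Phi^{(2)}_{+},\chi,h_t)$ and $(\Phi^{(2)}_{-},\chi,h_t)$ are not normal.
   Context: **Algebra on $\mathbb R^5$.** Let $\Upsilon$ be the symmetric trilinear form on $\mathbb R^5$ with $\Upsilon(x,x,x)=\frac12x_1(6x_2^2+6x_4^2-2x_1^2-3x_3^2-3x_5^2)+\frac{3\sqrt3}{2}x_4(x_5^2-x_3^2)+3\sqrt3\,x_2x_3x_5$. An oriented orthonormal basis $a=(a_1,\dots,a_5)$ is *adapted* if $\Upsilon(x,x,x)$ is given by this formula in the coordinates with respect to $a$. For $a$ adapted put $\kappa_1(a)=\sqrt3a_1\wedge a_5+a_2\wedge a_3+a_4\wedge a_5$, $\kappa_2(a)=\sqrt3a_1\wedge a_3+a_2\wedge a_5+a_3\wedge a_4$, $\kappa_3(a)=2a_2\wedge a_4+a_3\wedge a_5$. The metric on bivectors is $g(x\wedge y,u\wedge v)=g(x,u)g(y,v)-g(x,v)g(y,u)$, so $|\kappa_i(a)|^2=5$. $\Lambda^2_3$ is the span of the $\kappa_i(a)$ (independent of $a$), with the vector product $\times$ for which $\kappa_1\times\kappa_2=\kappa_3$, $\kappa_2\times\kappa_3=\kappa_1$,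 $\kappa_3\times\kappa_1=\kappa_2$ (independent of $a$). **Manifolds.** An irreducible $SO(3)$-structure on an oriented Riemannian $5$-manifold $(M,g)$ is a symmetric $3$-tensor field $\Upsilon$ such that near each point there is a local oriented orthonormal frame $(E_1,\dots,E_5)$ (adapted frame) in which $\Upsilon(X,X,X)=\frac12x_1(6x_2^2+6x_4^2-2x_1^2-3x_3^2-3x_5^2)+\frac{3\sqrt3}{2}x_4(x_5^2-x_3^2)+3\sqrt3\,x_2x_3x_5$ for $X=\sum_{i=1}^5x_iE_i$; $\Lambda^2_3TM$ is the corresponding bundle. An $SO(3)$-connection is a linear connection $\nabla$ on $TM$ with $\nabla g=0$, $\nabla\Upsilon=0$. **Twistor space.** $\mathbb T=\{\sigma\in\Lambda^2_3TM:|\sigma|^2=5\}$, $\pi:\mathbb T\to M$. $\nabla$ induces a connection on $\Lambda^2_3TM$, whose horizontal spaces are tangent to $\mathbb T$; $T\mathbb T=\mathcal V\oplus\mathcal H$, with $\mathcal V_\sigma$ the vertical space (orthogonal complement of $\sigma$ in $\Lambda^2_3T_{\pi(\sigma)}M$). $X^h_\sigma$ is the horizontal lift. For $\sigma\in\mathbb T$, $\xi_\sigma=\frac14\ast(\sigma\wedge\sigma)$, a unit vector; $H^\sigma=\xi_\sigma^\perp\subset T_{\pi(\sigma)}M$, oriented so that $\mathbb R\xi_\sigma\oplus H^\sigma$ has the orientation of $T_{\pi(\sigma)}M$; $\sigma\in\Lambda^2H^\sigma$, with self-dual/anti-self-dual parts $\sigma_\pm$. $\varphi^\sigma_\pm$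 is the endomorphism of $T_{\pi(\sigma)}M$ with $g(\varphi^\sigma_\pm X,Y)=\frac{2}{2\pm1}g(\sigma_\pm,X\wedge Y)$; it kills $\xi_\sigma$ and is a complex structure on $H^\sigma$. (If $\sigma=\kappa_3(a)$: $\xi_\sigma=-a_1$, $\varphi_\pm^\sigma a_2=a_4$, $\varphi_\pm^\sigma a_3=\pm a_5$.) Define $\Phi^{(n)}_\pm V=(-1)^n\sigma\times V$ for $V\in\mathcal V_\sigma$, $\Phi^{(n)}_\pm X^h_\sigma=(\varphi^\sigma_\pm X)^h_\sigma$, $\chi_\sigma=(\xi_\sigma)^h_\sigma$, $h_t(X^h_\sigma+V,Y^h_\sigma+W)=g(X,Y)+t\,g(V,W)$, $\eta_t=h_t(\cdot,\chi)$. An almost contact structure $(\varphi,\xi,\eta)$ is *normal* if $\varphi^2[X,Y]+[\varphi X,\varphi Y]-\varphi[\varphi X,Y]-\varphi[X,\varphi Y]+d\eta(X,Y)\xi=0$ for all vector fields $X,Y$, where $d\eta(X,Y)=X\eta(Y)-Y\eta(X)-\eta([X,Y])$. *)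

theory Defs
  imports "HOL-Analysis.Analysis" "HOL-Library.Function_Algebras"
begin

section \<open>Functions as vectors\<close>

text \<open>Function_Algebras supplies the pointwise ring operations on functions; with scalar
  multiplication, tangent vectors and bivectors (functions of functions, see below) can be
  added, scaled, summed and spanned with the library operations.\<close>

instantiation "fun" :: (type, real_vector) real_vector
begin

definition scaleR_fun :: "real \<Rightarrow> ('a \<Rightarrow> 'b) \<Rightarrow> 'a \<Rightarrow> 'b"
  where "scaleR_fun r f = (\<lambda>x. r *\<^sub>R f x)"

instance
  by standard (auto simp: scaleR_fun_def fun_eq_iff scaleR_add_right scaleR_add_left)

end


section \<open>Smooth calculus from charts\<close>

primrec Ck_on :: "nat \<Rightarrow> 'a::real_normed_vector set \<Rightarrow> ('a \<Rightarrow> 'b::real_normed_vector) \<Rightarrow> bool"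
  where
    "Ck_on 0 S f \<longleftrightarrow> continuous_on S f"
  | "Ck_on (Suc k) S f \<longleftrightarrow>
       (\<forall>x\<in>S. f differentiable (at x)) \<and>
       (\<forall>v. Ck_on k S (\<lambda>x. frechet_derivative f (at x) v))"

text \<open>Only used for open \<open>S\<close>.\<close>

definition smooth_on :: "'a::real_normed_vector set \<Rightarrow> ('a \<Rightarrow> 'b::real_normed_vector) \<Rightarrow> bool"
  where "smooth_on S f \<longleftrightarrow> (\<forall>k. Ck_on k S f)"

type_synonym ('a, 'e) chart = "'a set \<times> ('a \<Rightarrow> 'e)"

text \<open>\<open>f\<close> is smooth on a neighbourhood of \<open>p\<close>. The image of a chart domain need not be open in
  \<open>'e\<close>: if it is an embedded submanifold, these are the functions on it that extend locally to
  smooth functions on \<open>'e\<close>. For \<open>M\<close> the images are open; for the twistor space they are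
  not. The neighbourhoods of \<open>p\<close> are the preimages of open sets \<open>W\<close>.\<close>

definition smooth_near :: "('a, 'e::euclidean_space) chart set \<Rightarrow> 'a \<Rightarrow> ('a \<Rightarrow> real) \<Rightarrow> bool"
  where "smooth_near C p f \<longleftrightarrow>
    (\<exists>(U, x)\<in>C. \<exists>W G. p \<in> U \<and> open W \<and> x p \<in> W \<and> smooth_on W G \<and>
       (\<forall>q\<in>U. x q \<in> W \<longrightarrow> f q = G (x q)))"

definition chart_space :: "('a, 'e::euclidean_space) chart set \<Rightarrow> 'a set"
  where "chart_space C = (\<Union>(U, x)\<in>C. U)"

text \<open>Tangent vectors at \<open>p\<close> are the derivations of the functions that are smooth near \<open>p\<close>.
  No locality axiom is needed: if \<open>f\<close> vanishes near \<open>p\<close> then \<open>f = k * f\<close>, where \<open>k\<close> is \<open>0\<close>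
  near \<open>p\<close> and \<open>1\<close> elsewhere (\<open>k\<close> is smooth near \<open>p\<close>), so \<open>v f = 0\<close>. The last
  clause makes a tangent vector determined by its values on smooth functions.\<close>

type_synonym 'a tvec = "('a \<Rightarrow> real) \<Rightarrow> real"

definition tangent_space :: "('a, 'e::euclidean_space) chart set \<Rightarrow> 'a \<Rightarrow> 'a tvec set"
  where "tangent_space C p = {v.
    (\<forall>f h. smooth_near C p f \<longrightarrow> smooth_near C p h \<longrightarrow> v (f + h) = v f + v h) \<and>
    (\<forall>r f. smooth_near C p f \<longrightarrow> v (r *\<^sub>R f) = r * v f) \<and>
    (\<forall>f h. smooth_near C p f \<longrightarrow> smooth_near C p h \<longrightarrow> v (f * h) = v f * h p + f p * v h) \<and>
    (\<forall>f. \<not> smooth_near C p f \<longrightarrow> v f = 0)}"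

definition vfield_on ::
  "('a, 'e::euclidean_space) chart set \<Rightarrow> 'a set \<Rightarrow> ('a \<Rightarrow> 'a tvec) \<Rightarrow> bool"
  where "vfield_on C S X \<longleftrightarrow>
    (\<forall>p\<in>S. X p \<in> tangent_space C p \<and>
       (\<forall>f. smooth_near C p f \<longrightarrow> smooth_near C p (\<lambda>q. X q f)))"

definition lie_bracket ::
  "('a, 'e::euclidean_space) chart set \<Rightarrow> ('a \<Rightarrow> 'a tvec) \<Rightarrow> ('a \<Rightarrow> 'a tvec) \<Rightarrow> 'a \<Rightarrow> 'a tvec"
  where "lie_bracket C X Y p =
    (\<lambda>f. if smooth_near C p f then X p (\<lambda>q. Y q f) - Y p (\<lambda>q. X q f) else 0)"

definition ext_deriv ::
  "('a, 'e::euclidean_space) chart set \<Rightarrow> ('a \<Rightarrow> 'a tvec \<Rightarrow> real) \<Rightarrow>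
     ('a \<Rightarrow> 'a tvec) \<Rightarrow> ('a \<Rightarrow> 'a tvec) \<Rightarrow> 'a \<Rightarrow> real"
  where "ext_deriv C \<eta> X Y p =
    X p (\<lambda>q. \<eta> q (Y q)) - Y p (\<lambda>q. \<eta> q (X q)) - \<eta> p (lie_bracket C X Y p)"

text \<open>Normality of an almost contact structure \<open>(\<phi>, \<xi>, \<eta>)\<close>.\<close>

definition normal_structure ::
  "('a, 'e::euclidean_space) chart set \<Rightarrow> ('a \<Rightarrow> 'a tvec \<Rightarrow> 'a tvec) \<Rightarrow> ('a \<Rightarrow> 'a tvec) \<Rightarrow>
     ('a \<Rightarrow> 'a tvec \<Rightarrow> real) \<Rightarrow> bool"
  where "normal_structure C \<phi> \<xi> \<eta> \<longleftrightarrow>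
    (\<forall>X Y. vfield_on C (chart_space C) X \<longrightarrow> vfield_on C (chart_space C) Y \<longrightarrow>
      (\<forall>p\<in>chart_space C.
         \<phi> p (\<phi> p (lie_bracket C X Y p))
         + lie_bracket C (\<lambda>q. \<phi> q (X q)) (\<lambda>q. \<phi> q (Y q)) p
         - \<phi> p (lie_bracket C (\<lambda>q. \<phi> q (X q)) Y p)
         - \<phi> p (lie_bracket C X (\<lambda>q. \<phi> q (Y q)) p)
         + ext_deriv C \<eta> X Y p *\<^sub>R \<xi> p = 0))"


section \<open>Multivectors\<close>

text \<open>Bivectors at a point are skew biderivations, 4-vectors skew 4-derivations. The second
  wedge product below is the sum over shuffles, so that \<open>(x \<and> y) \<and> (u \<and> v)\<close> evaluated at
  \<open>f\<^sub>1, \<dots>, f\<^sub>4\<close> is the determinant of the values of \<open>x, y, u, v\<close> at the \<open>f\<^sub>i\<close>.\<close>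

type_synonym 'a bivec = "('a \<Rightarrow> real) \<Rightarrow> ('a \<Rightarrow> real) \<Rightarrow> real"
type_synonym 'a fourvec = "('a \<Rightarrow> real) \<Rightarrow> ('a \<Rightarrow> real) \<Rightarrow> ('a \<Rightarrow> real) \<Rightarrow> ('a \<Rightarrow> real) \<Rightarrow> real"

definition wedge :: "'a tvec \<Rightarrow> 'a tvec \<Rightarrow> 'a bivec"  (infixl "\<and>\<^sub>1" 72)
  where "x \<and>\<^sub>1 y = (\<lambda>f h. x f * y h - x h * y f)"

definition wedge2 :: "'a bivec \<Rightarrow> 'a bivec \<Rightarrow> 'a fourvec"  (infixl "\<and>\<^sub>2" 71)
  where "\<sigma> \<and>\<^sub>2 \<tau> = (\<lambda>f1 f2 f3 f4.
     \<sigma> f1 f2 * \<tau> f3 f4 - \<sigma> f1 f3 * \<tau> f2 f4 + \<sigma> f1 f4 * \<tau> f2 f3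
     + \<sigma> f2 f3 * \<tau> f1 f4 - \<sigma> f2 f4 * \<tau> f1 f3 + \<sigma> f3 f4 * \<tau> f1 f2)"

text \<open>Bases of tangent spaces are indexed by the type \<open>5\<close>, in which \<open>5 = 0\<close>; the
  elements are \<open>1, \<dots>, 5\<close>.\<close>

definition kappa1 :: "(5 \<Rightarrow> 'a tvec) \<Rightarrow> 'a bivec"
  where "kappa1 a = sqrt 3 *\<^sub>R (a 1 \<and>\<^sub>1 a 5) + a 2 \<and>\<^sub>1 a 3 + a 4 \<and>\<^sub>1 a 5"

definition kappa2 :: "(5 \<Rightarrow> 'a tvec) \<Rightarrow> 'a bivec"
  where "kappa2 a = sqrt 3 *\<^sub>R (a 1 \<and>\<^sub>1 a 3) + a 2 \<and>\<^sub>1 a 5 + a 3 \<and>\<^sub>1 a 4"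

definition kappa3 :: "(5 \<Rightarrow> 'a tvec) \<Rightarrow> 'a bivec"
  where "kappa3 a = 2 *\<^sub>R (a 2 \<and>\<^sub>1 a 4) + a 3 \<and>\<^sub>1 a 5"

definition kappa_comb :: "(5 \<Rightarrow> 'a tvec) \<Rightarrow> real^3 \<Rightarrow> 'a bivec"
  where "kappa_comb a s = s $ 1 *\<^sub>R kappa1 a + s $ 2 *\<^sub>R kappa2 a + s $ 3 *\<^sub>R kappa3 a"

definition upsilon_cubic :: "real^5 \<Rightarrow> real"
  where "upsilon_cubic x =
    1/2 * x$1 * (6 * (x$2)\<^sup>2 + 6 * (x$4)\<^sup>2 - 2 * (x$1)\<^sup>2 - 3 * (x$3)\<^sup>2 - 3 * (x$5)\<^sup>2)
    + 3 * sqrt 3 / 2 * x$4 * ((x$5)\<^sup>2 - (x$3)\<^sup>2) + 3 * sqrt 3 * x$2 * x$3 * x$5"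


section \<open>Oriented Riemannian 5-manifolds\<close>

text \<open>The manifold is the whole type \<open>'m\<close>. Its orientation is carried by the atlas: all
  transition maps have positive Jacobian determinant.\<close>

locale oriented_manifold5 =
  fixes A :: "('m::{t2_space, second_countable_topology}, real^5) chart set"
  assumes cover: "chart_space A = UNIV"
    and chart: "(U, x) \<in> A \<Longrightarrow>
      open U \<and> open (x ` U) \<and> homeomorphism U (x ` U) x (inv_into U x)"
    and transition_smooth: "(U, x) \<in> A \<Longrightarrow> (V, y) \<in> A \<Longrightarrow>
      smooth_on (x ` (U \<inter> V)) (y \<circ> inv_into U x)"
    and transition_oriented: "(U, x) \<in> A \<Longrightarrow> (V, y) \<in> A \<Longrightarrow> z \<in> x ` (U \<inter> V) \<Longrightarrow>
      0 < det (matrix (frechet_derivative (y \<circ> inv_into U x) (at z)))"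
begin

abbreviation TM :: "'m \<Rightarrow> 'm tvec set"
  where "TM \<equiv> tangent_space A"

definition positively_oriented :: "'m \<Rightarrow> (5 \<Rightarrow> 'm tvec) \<Rightarrow> bool"
  where "positively_oriented p a \<longleftrightarrow>
    (\<exists>(U, x)\<in>A. p \<in> U \<and> 0 < det (\<chi> i j. a j (\<lambda>q. x q $ i)))"

end

locale oriented_riemannian5 = oriented_manifold5 A
  for A :: "('m::{t2_space, second_countable_topology}, real^5) chart set" +
  fixes g :: "'m \<Rightarrow> 'm tvec \<Rightarrow> 'm tvec \<Rightarrow> real"
  assumes g_add: "u \<in> TM p \<Longrightarrow> v \<in> TM p \<Longrightarrow> w \<in> TM p \<Longrightarrow> g p (u + v) w = g p u w + g p v w"
    and g_scale: "u \<in> TM p \<Longrightarrow> v \<in> TM p \<Longrightarrow> g p (r *\<^sub>R u) v = r * g p u v"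
    and g_sym: "u \<in> TM p \<Longrightarrow> v \<in> TM p \<Longrightarrow> g p u v = g p v u"
    and g_pos: "u \<in> TM p \<Longrightarrow> u \<noteq> 0 \<Longrightarrow> 0 < g p u u"
    and g_smooth: "open U \<Longrightarrow> vfield_on A U X \<Longrightarrow> vfield_on A U Y \<Longrightarrow> p \<in> U \<Longrightarrow>
      smooth_near A p (\<lambda>q. g q (X q) (Y q))"
begin

definition oriented_onb :: "'m \<Rightarrow> (5 \<Rightarrow> 'm tvec) \<Rightarrow> bool"
  where "oriented_onb p a \<longleftrightarrow>
    (\<forall>i. a i \<in> TM p) \<and> (\<forall>i j. g p (a i) (a j) = (if i = j then 1 else 0)) \<and>
    positively_oriented p a"

text \<open>The bilinear extension of
  \<open>g (x \<and> y, u \<and> v) = g (x, u) g (y, v) - g (x, v) g (y, u)\<close>.\<close>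

definition biv_inner :: "'m \<Rightarrow> 'm bivec \<Rightarrow> 'm bivec \<Rightarrow> real"
  where "biv_inner p \<sigma> \<tau> = (THE r. \<exists>(n::nat) (m::nat) x y u v.
    (\<forall>k<n. x k \<in> TM p \<and> y k \<in> TM p) \<and> (\<forall>l<m. u l \<in> TM p \<and> v l \<in> TM p) \<and>
    \<sigma> = (\<Sum>k<n. x k \<and>\<^sub>1 y k) \<and> \<tau> = (\<Sum>l<m. u l \<and>\<^sub>1 v l) \<and>
    r = (\<Sum>k<n. \<Sum>l<m. g p (x k) (u l) * g p (y k) (v l) - g p (x k) (v l) * g p (y k) (u l)))"

text \<open>The Hodge operator from 4-vectors to vectors: the linear map with
  \<open>\<ast> (a\<^sub>1 \<and> a\<^sub>2 \<and> a\<^sub>3 \<and> a\<^sub>4) = a\<^sub>5\<close> for every oriented orthonormal basis \<open>a\<close>.\<close>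

definition hodge4 :: "'m \<Rightarrow> 'm fourvec \<Rightarrow> 'm tvec"
  where "hodge4 p \<omega> = (THE v. \<exists>(n::nat) (c :: nat \<Rightarrow> real) (a :: nat \<Rightarrow> 5 \<Rightarrow> 'm tvec).
    (\<forall>k<n. oriented_onb p (a k)) \<and>
    \<omega> = (\<Sum>k<n. c k *\<^sub>R ((a k 1 \<and>\<^sub>1 a k 2) \<and>\<^sub>2 (a k 3 \<and>\<^sub>1 a k 4))) \<and>
    v = (\<Sum>k<n. c k *\<^sub>R a k 5))"

end


section \<open>Irreducible SO(3)-structures\<close>

locale irreducible_SO3_structure = oriented_riemannian5 A g
  for A :: "('m::{t2_space, second_countable_topology}, real^5) chart set"
    and g :: "'m \<Rightarrow> 'm tvec \<Rightarrow> 'm tvec \<Rightarrow> real" +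
  fixes \<Upsilon> :: "'m \<Rightarrow> 'm tvec \<Rightarrow> 'm tvec \<Rightarrow> 'm tvec \<Rightarrow> real"
  assumes Upsilon_add: "u \<in> TM p \<Longrightarrow> u' \<in> TM p \<Longrightarrow> v \<in> TM p \<Longrightarrow> w \<in> TM p \<Longrightarrow>
      \<Upsilon> p (u + u') v w = \<Upsilon> p u v w + \<Upsilon> p u' v w"
    and Upsilon_scale: "u \<in> TM p \<Longrightarrow> v \<in> TM p \<Longrightarrow> w \<in> TM p \<Longrightarrow>
      \<Upsilon> p (r *\<^sub>R u) v w = r * \<Upsilon> p u v w"
    and Upsilon_sym: "u \<in> TM p \<Longrightarrow> v \<in> TM p \<Longrightarrow> w \<in> TM p \<Longrightarrow>
      \<Upsilon> p u v w = \<Upsilon> p v u w \<and> \<Upsilon> p u v w = \<Upsilon> p u w v"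
    and Upsilon_smooth: "open U \<Longrightarrow> vfield_on A U X \<Longrightarrow> vfield_on A U Y \<Longrightarrow> vfield_on A U Z \<Longrightarrow>
      p \<in> U \<Longrightarrow> smooth_near A p (\<lambda>q. \<Upsilon> q (X q) (Y q) (Z q))"
    and adapted_frame: "\<exists>U (E :: 5 \<Rightarrow> 'm \<Rightarrow> 'm tvec). open U \<and> p \<in> U \<and> (\<forall>i. vfield_on A U (E i)) \<and>
      (\<forall>q\<in>U. oriented_onb q (\<lambda>i. E i q) \<and>
        (\<forall>x. let X = (\<Sum>i\<in>UNIV. x $ i *\<^sub>R E i q) in \<Upsilon> q X X X = upsilon_cubic x))"
begin

definition adapted :: "'m \<Rightarrow> (5 \<Rightarrow> 'm tvec) \<Rightarrow> bool"
  where "adapted p a \<longleftrightarrow> oriented_onb p a \<and>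
    (\<forall>x. let X = (\<Sum>i\<in>UNIV. x $ i *\<^sub>R a i) in \<Upsilon> p X X X = upsilon_cubic x)"

definition Lambda23 :: "'m \<Rightarrow> 'm bivec set"
  where "Lambda23 p = {\<sigma>. \<exists>a. adapted p a \<and> \<sigma> \<in> span {kappa1 a, kappa2 a, kappa3 a}}"

text \<open>The vector product making \<open>\<kappa>\<^sub>1, \<kappa>\<^sub>2, \<kappa>\<^sub>3\<close> behave as the standard basis of \<open>\<real>\<^sup>3\<close>.\<close>

definition vprod :: "'m \<Rightarrow> 'm bivec \<Rightarrow> 'm bivec \<Rightarrow> 'm bivec"
  where "vprod p \<sigma> \<tau> = (THE \<rho>. \<exists>a s t. adapted p a \<and>
    \<sigma> = kappa_comb a s \<and> \<tau> = kappa_comb a t \<and> \<rho> = kappa_comb a (cross3 s t))"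

definition twistor_space :: "('m \<times> 'm bivec) set"
  where "twistor_space = {(p, \<sigma>). \<sigma> \<in> Lambda23 p \<and> biv_inner p \<sigma> \<sigma> = 5}"

text \<open>A chart \<open>x\<close> of \<open>M\<close> gives coordinates \<open>(x, \<sigma>\<^sup>i\<^sup>j)\<close> on bivectors, where
  \<open>\<sigma>\<^sup>i\<^sup>j = \<sigma> (x\<^sub>i, x\<^sub>j)\<close>. The smooth structure of the twistor space is the one of a submanifold of
  the bundle of bivectors.\<close>

definition twistor_charts :: "('m \<times> 'm bivec, (real^5) \<times> (real^5^5)) chart set"
  where "twistor_charts =
    (\<lambda>(U, x). ({(p, \<sigma>) \<in> twistor_space. p \<in> U},
       \<lambda>(p, \<sigma>). (x p, \<chi> i j. \<sigma> (\<lambda>q. x q $ i) (\<lambda>q. x q $ j)))) ` A"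

definition local_section :: "'m set \<Rightarrow> ('m \<Rightarrow> 'm bivec) \<Rightarrow> bool"
  where "local_section U s \<longleftrightarrow>
    (\<forall>q\<in>U. (q, s q) \<in> twistor_space \<and>
      (\<forall>F. smooth_near twistor_charts (q, s q) F \<longrightarrow> smooth_near A q (\<lambda>q'. F (q', s q'))))"

text \<open>The tangent space of the fibre at \<open>(p, \<sigma>)\<close> is the orthogonal complement of \<open>\<sigma>\<close>;
  \<open>vert\<close> sends \<open>V\<close> in it to the velocity at \<open>s = 0\<close> of the curve in the fibre obtained by
  rescaling \<open>\<sigma> + s V\<close> to squared length \<open>5\<close>.\<close>

definition vertical :: "'m \<times> 'm bivec \<Rightarrow> 'm bivec set"
  where "vertical z = {V \<in> Lambda23 (fst z). biv_inner (fst z) V (snd z) = 0}"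

definition vert :: "'m \<times> 'm bivec \<Rightarrow> 'm bivec \<Rightarrow> ('m \<times> 'm bivec) tvec"
  where "vert z V = (\<lambda>F. if smooth_near twistor_charts z F
    then deriv (\<lambda>s. let \<tau> = snd z + s *\<^sub>R V
                     in F (fst z, sqrt (5 / biv_inner (fst z) \<tau> \<tau>) *\<^sub>R \<tau>)) 0
    else 0)"

definition xi :: "'m \<times> 'm bivec \<Rightarrow> 'm tvec"
  where "xi z = (1/4) *\<^sub>R hodge4 (fst z) (snd z \<and>\<^sub>2 snd z)"

text \<open>The Hodge operator on bivectors of the oriented 4-space orthogonal to \<open>\<xi>\<close>: the linear map
  with \<open>\<ast> (h\<^sub>2 \<and> h\<^sub>3) = h\<^sub>4 \<and> h\<^sub>5\<close> whenever \<open>(\<xi>, h\<^sub>2, \<dots>, h\<^sub>5)\<close> is an oriented orthonormal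
  basis of the tangent space of \<open>M\<close>.\<close>

definition hodgeH :: "'m \<times> 'm bivec \<Rightarrow> 'm bivec \<Rightarrow> 'm bivec"
  where "hodgeH z \<omega> = (THE \<tau>. \<exists>(n::nat) (c :: nat \<Rightarrow> real) (h :: nat \<Rightarrow> 5 \<Rightarrow> 'm tvec).
    (\<forall>k<n. oriented_onb (fst z) (h k) \<and> h k 1 = xi z) \<and>
    \<omega> = (\<Sum>k<n. c k *\<^sub>R (h k 2 \<and>\<^sub>1 h k 3)) \<and> \<tau> = (\<Sum>k<n. c k *\<^sub>R (h k 4 \<and>\<^sub>1 h k 5)))"

text \<open>From here on \<open>\<epsilon>\<close> is the sign, \<open>1\<close> or \<open>-1\<close>: \<open>dual_part \<epsilon>\<close> is the self-dual
  respectively anti-self-dual part of \<open>\<sigma>\<close>.\<close>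

definition dual_part :: "real \<Rightarrow> 'm \<times> 'm bivec \<Rightarrow> 'm bivec"
  where "dual_part \<epsilon> z = (1/2) *\<^sub>R (snd z + \<epsilon> *\<^sub>R hodgeH z (snd z))"

definition phi :: "real \<Rightarrow> 'm \<times> 'm bivec \<Rightarrow> 'm tvec \<Rightarrow> 'm tvec"
  where "phi \<epsilon> z X = (THE W. W \<in> TM (fst z) \<and>
    (\<forall>Y\<in>TM (fst z). g (fst z) W Y = 2 / (2 + \<epsilon>) * biv_inner (fst z) (dual_part \<epsilon> z) (X \<and>\<^sub>1 Y)))"

end


section \<open>SO(3)-connections and the structures on the twistor space\<close>

text \<open>\<open>D p v Y\<close> is the covariant derivative at \<open>p\<close> of the vector field \<open>Y\<close>, defined near \<open>p\<close>,
  in the direction of the tangent vector \<open>v\<close>. As for derivations, the product rule implies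
  that it depends only on the germ of \<open>Y\<close> at \<open>p\<close>.\<close>

locale SO3_connection = irreducible_SO3_structure A g \<Upsilon>
  for A :: "('m::{t2_space, second_countable_topology}, real^5) chart set"
    and g :: "'m \<Rightarrow> 'm tvec \<Rightarrow> 'm tvec \<Rightarrow> real"
    and \<Upsilon> :: "'m \<Rightarrow> 'm tvec \<Rightarrow> 'm tvec \<Rightarrow> 'm tvec \<Rightarrow> real" +
  fixes D :: "'m \<Rightarrow> 'm tvec \<Rightarrow> ('m \<Rightarrow> 'm tvec) \<Rightarrow> 'm tvec"
  assumes D_smooth: "open U \<Longrightarrow> vfield_on A U X \<Longrightarrow> vfield_on A U Y \<Longrightarrow>
      vfield_on A U (\<lambda>q. D q (X q) Y)"
    and D_tangent: "open U \<Longrightarrow> p \<in> U \<Longrightarrow> vfield_on A U Y \<Longrightarrow> v \<in> TM p \<Longrightarrow> D p v Y \<in> TM p"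
    and D_add_left: "open U \<Longrightarrow> p \<in> U \<Longrightarrow> vfield_on A U Y \<Longrightarrow> v \<in> TM p \<Longrightarrow> w \<in> TM p \<Longrightarrow>
      D p (v + w) Y = D p v Y + D p w Y"
    and D_scale_left: "open U \<Longrightarrow> p \<in> U \<Longrightarrow> vfield_on A U Y \<Longrightarrow> v \<in> TM p \<Longrightarrow>
      D p (r *\<^sub>R v) Y = r *\<^sub>R D p v Y"
    and D_add_right: "open U \<Longrightarrow> p \<in> U \<Longrightarrow> vfield_on A U Y \<Longrightarrow> vfield_on A U Z \<Longrightarrow> v \<in> TM p \<Longrightarrow>
      D p v (\<lambda>q. Y q + Z q) = D p v Y + D p v Z"
    and D_Leibniz: "open U \<Longrightarrow> p \<in> U \<Longrightarrow> vfield_on A U Y \<Longrightarrow> v \<in> TM p \<Longrightarrow> smooth_near A p f \<Longrightarrow>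
      D p v (\<lambda>q. f q *\<^sub>R Y q) = v f *\<^sub>R Y p + f p *\<^sub>R D p v Y"
    and D_metric: "open U \<Longrightarrow> p \<in> U \<Longrightarrow> vfield_on A U Y \<Longrightarrow> vfield_on A U Z \<Longrightarrow> v \<in> TM p \<Longrightarrow>
      v (\<lambda>q. g q (Y q) (Z q)) = g p (D p v Y) (Z p) + g p (Y p) (D p v Z)"
    and D_Upsilon: "open U \<Longrightarrow> p \<in> U \<Longrightarrow> vfield_on A U X \<Longrightarrow> vfield_on A U Y \<Longrightarrow> vfield_on A U Z \<Longrightarrow>
      v \<in> TM p \<Longrightarrow>
      v (\<lambda>q. \<Upsilon> q (X q) (Y q) (Z q)) =
        \<Upsilon> p (D p v X) (Y p) (Z p) + \<Upsilon> p (X p) (D p v Y) (Z p) + \<Upsilon> p (X p) (Y p) (D p v Z)"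
begin

text \<open>The induced connection on bivector fields.\<close>

definition D_biv :: "'m \<Rightarrow> 'm tvec \<Rightarrow> ('m \<Rightarrow> 'm bivec) \<Rightarrow> 'm bivec"
  where "D_biv p v s = (THE \<tau>. \<exists>U (n::nat) Y Z. open U \<and> p \<in> U \<and>
    (\<forall>k<n. vfield_on A U (Y k) \<and> vfield_on A U (Z k)) \<and>
    (\<forall>q\<in>U. s q = (\<Sum>k<n. Y k q \<and>\<^sub>1 Z k q)) \<and>
    \<tau> = (\<Sum>k<n. D p v (Y k) \<and>\<^sub>1 Z k p + Y k p \<and>\<^sub>1 D p v (Z k)))"

text \<open>For a local section \<open>s\<close> through \<open>z\<close>, the derivative of \<open>s\<close> along \<open>X\<close> has vertical part
  \<open>\<nabla>\<^sub>X s\<close>; the rest is the horizontal lift of \<open>X\<close>.\<close>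

definition hlift :: "'m \<times> 'm bivec \<Rightarrow> 'm tvec \<Rightarrow> ('m \<times> 'm bivec) tvec"
  where "hlift z X = (THE w. \<exists>U s. open U \<and> fst z \<in> U \<and> local_section U s \<and> s (fst z) = snd z \<and>
    w = (\<lambda>F. if smooth_near twistor_charts z F then X (\<lambda>q. F (q, s q)) else 0)
        - vert z (D_biv (fst z) X s))"

definition Phi :: "nat \<Rightarrow> real \<Rightarrow> 'm \<times> 'm bivec \<Rightarrow> ('m \<times> 'm bivec) tvec \<Rightarrow> ('m \<times> 'm bivec) tvec"
  where "Phi n \<epsilon> z w = (THE w'. \<exists>X\<in>TM (fst z). \<exists>V\<in>vertical z. w = hlift z X + vert z V \<and>
    w' = hlift z (phi \<epsilon> z X) + vert z ((-1) ^ n *\<^sub>R vprod (fst z) (snd z) V))"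

definition chi_field :: "'m \<times> 'm bivec \<Rightarrow> ('m \<times> 'm bivec) tvec"
  where "chi_field z = hlift z (xi z)"

definition h_metric ::
  "real \<Rightarrow> 'm \<times> 'm bivec \<Rightarrow> ('m \<times> 'm bivec) tvec \<Rightarrow> ('m \<times> 'm bivec) tvec \<Rightarrow> real"
  where "h_metric t z w w' = (THE r. \<exists>X\<in>TM (fst z). \<exists>Y\<in>TM (fst z). \<exists>V\<in>vertical z. \<exists>W\<in>vertical z.
    w = hlift z X + vert z V \<and> w' = hlift z Y + vert z W \<and>
    r = g (fst z) X Y + t * biv_inner (fst z) V W)"

definition eta :: "real \<Rightarrow> 'm \<times> 'm bivec \<Rightarrow> ('m \<times> 'm bivec) tvec \<Rightarrow> real"
  where "eta t z w = h_metric t z w (chi_field z)"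

definition normal_twistor :: "nat \<Rightarrow> real \<Rightarrow> real \<Rightarrow> bool"
  where "normal_twistor n \<epsilon> t \<longleftrightarrow> normal_structure twistor_charts (Phi n \<epsilon>) chi_field (eta t)"

end

end

(* Normality fails already in the horizontal component of the normality tensor on the pair of a
   vertical field V and a horizontal lift X.  Write sigma = sum_c s_c kappa_c in an adapted frame E.
   Then xi is a quadratic and the matrix P(s) of phi in E a cubic polynomial in s on the unit sphere,
   and brackets with vertical fields differentiate these polynomials.  At sigma = kappa_3, with V in the
   direction of kappa_1 and X the lift of E_3, the E_b-component of the tensor is
     (-1)^n d_2 P_3b - sum_j d_1 P_3j P_jb + d_1 xi_3 xi_b.
   It equals -2 sqrt 3 for b = 1 in the cases (n, sign) = (1, -), (2, +), and 4 for b = 4 in the case (2, -).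
   The irreducible so(3) is the stabiliser algebra of the cubic form in so(5); hence the span of the kappa_c
   and their vector product (the commutator of skew matrices) do not depend on the adapted frame, and the
   connection matrices in an adapted frame lie in this span. *)
theory Submission
  imports Defs "HOL-Real_Asymp.Real_Asymp"
begin

section \<open>Calculus of smooth functions\<close>

text \<open>The pair of fields is mixed because torsion and curvature of the connection are
  arbitrary: applied to functions of the base point, the bracket of a vertical and a horizontal
  field is a fibre derivative of the horizontal coefficients, and the connection does not occur in
  it. The component to be tested depends on the signs: in the case (2, -) the component b = 1
  vanishes, and for the remaining structure (1, +) the components b = 1 and b = 4 both vanish. Two
  obstacles shape the development. Normality quantifies over fields on the whole twistor space while
  adapted frames are local, so the test fields are cut off by a bump function on the base. And most
  geometric operations are definite descriptions over decompositions, sections or adapted bases;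
  each is shown to be independent of these choices before it can be evaluated in a frame.\<close>

lemma Ck_on_cong:
  assumes "open S" "\<And>x. x \<in> S \<Longrightarrow> f x = g x" "Ck_on k S f"
  shows "Ck_on k S g"
  using assms(2,3)
proof (induction k arbitrary: f g)
  case 0
  then show ?case by (simp cong: continuous_on_cong)
next
  case (Suc k)
  have der: "(g has_derivative frechet_derivative f (at x)) (at x)" if "x \<in> S" for x
    by (rule has_derivative_transform_within_open[of f _ x UNIV S])
       (use Suc.prems that assms(1) in \<open>auto simp: frechet_derivative_works\<close>)
  then have eq: "frechet_derivative g (at x) = frechet_derivative f (at x)" if "x \<in> S" for x
    using that by (metis frechet_derivative_at)
  show ?case
  proof (clarsimp, safe)
    show "g differentiable at x" if "x \<in> S" for x
      using der[OF that] by (auto simp: differentiable_def)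
    show "Ck_on k S (\<lambda>x. frechet_derivative g (at x) v)" for v
      by (rule Suc.IH[of "\<lambda>x. frechet_derivative f (at x) v"])
         (use eq Suc.prems in auto)
  qed
qed

lemma Ck_on_subset: "Ck_on k S f \<Longrightarrow> T \<subseteq> S \<Longrightarrow> Ck_on k T f"
  by (induction k arbitrary: f) (auto intro: continuous_on_subset)

text \<open>\<open>Ck_on\<close> is phrased with \<open>frechet_derivative\<close>; uniqueness of
  derivatives on an open set lets any explicit formula take its place.\<close>

lemma Ck_on_SucI:
  assumes "open S" "\<And>x. x \<in> S \<Longrightarrow> (f has_derivative f' x) (at x)"
    and "\<And>v. Ck_on k S (\<lambda>x. f' x v)"
  shows "Ck_on (Suc k) S f"
proof -
  have eq: "f' x = frechet_derivative f (at x)" if "x \<in> S" for x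
    using assms(2)[OF that] by (rule frechet_derivative_at)
  show ?thesis
    using assms(2) Ck_on_cong[OF assms(1) _ assms(3)] eq by (auto simp: differentiable_def)
qed

lemma Ck_on_Suc_imp: "open S \<Longrightarrow> Ck_on (Suc k) S f \<Longrightarrow> Ck_on k S f"
proof (induction k arbitrary: f)
  case 0
  then show ?case
    by (auto simp: continuous_on_eq_continuous_at intro!: differentiable_imp_continuous_within)
next
  case (Suc k)
  then show ?case by (simp del: Ck_on.simps(2) add: Ck_on.simps(2)[of "Suc k"] Ck_on.simps(2)[of k])
qed

lemma Ck_on_has_derivative:
  "Ck_on (Suc k) S f \<Longrightarrow> x \<in> S \<Longrightarrow> (f has_derivative frechet_derivative f (at x)) (at x)"
  by (simp add: frechet_derivative_works)

lemma Ck_on_const: "open S \<Longrightarrow> Ck_on k S (\<lambda>x. c)"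
proof (induction k arbitrary: c)
  case (Suc k)
  then show ?case by (intro Ck_on_SucI[where f' = "\<lambda>x v. 0"]) auto
qed simp

lemma Ck_on_linear:
  assumes "open S" "bounded_linear f"
  shows "Ck_on k S f"
proof (cases k)
  case 0
  then show ?thesis
    using assms(2) by (simp add: linear_continuous_on)
next
  case (Suc k)
  then show ?thesis
    using assms
    by (simp del: Ck_on.simps)
       (intro Ck_on_SucI[where f' = "\<lambda>x. f"] Ck_on_const bounded_linear_imp_has_derivative)
qed

lemma Ck_on_add:
  "open S \<Longrightarrow> Ck_on k S f \<Longrightarrow> Ck_on k S g \<Longrightarrow> Ck_on k S (\<lambda>x. f x + g x)"
proof (induction k arbitrary: f g)
  case (Suc k)
  show ?case
    by (rule Ck_on_SucI[where f' = "\<lambda>x v. frechet_derivative f (at x) v + frechet_derivative g (at x) v"])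
       (use Suc in \<open>auto intro!: has_derivative_add simp flip: frechet_derivative_works\<close>)
qed (simp add: continuous_on_add)

lemma Ck_on_sum:
  "open S \<Longrightarrow> (\<And>i. i \<in> I \<Longrightarrow> Ck_on k S (f i)) \<Longrightarrow> Ck_on k S (\<lambda>x. \<Sum>i\<in>I. f i x)"
  by (induction I rule: infinite_finite_induct) (auto intro: Ck_on_const Ck_on_add)

lemma Ck_on_bilinear:
  assumes "bounded_bilinear B" "open S"
  shows "Ck_on k S f \<Longrightarrow> Ck_on k S g \<Longrightarrow> Ck_on k S (\<lambda>x. B (f x) (g x))"
proof (induction k arbitrary: f g)
  case 0
  then show ?case using bounded_bilinear.continuous_on[OF assms(1)] by simp
next
  case (Suc k)
  note fg = Ck_on_Suc_imp[OF assms(2) Suc.prems(1)] Ck_on_Suc_imp[OF assms(2) Suc.prems(2)]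
  show ?case
    by (rule Ck_on_SucI[where f' = "\<lambda>x v. B (f x) (frechet_derivative g (at x) v)
                                         + B (frechet_derivative f (at x) v) (g x)"])
       (use Suc fg assms in \<open>auto intro!: bounded_bilinear.FDERIV Ck_on_add
          simp flip: frechet_derivative_works\<close>)
qed

text \<open>Restricting to basis directions separates the direction from the base point: when both
  vary with a parameter, the derivative becomes a finite sum of products, as the induction for
  compositions needs.\<close>

lemma frechet_derivative_basis_expansion:
  fixes f :: "'a::euclidean_space \<Rightarrow> 'b::real_normed_vector"
  assumes "f differentiable (at x)"
  shows "frechet_derivative f (at x) v = (\<Sum>b\<in>Basis. (v \<bullet> b) *\<^sub>R frechet_derivative f (at x) b)"
proof -
  have lin: "linear (frechet_derivative f (at x))"
    using assms by (rule linear_frechet_derivative)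
  have "frechet_derivative f (at x) v = frechet_derivative f (at x) (\<Sum>b\<in>Basis. (v \<bullet> b) *\<^sub>R b)"
    by (simp add: euclidean_representation)
  then show ?thesis
    by (simp add: linear_sum[OF lin] linear_cmul[OF lin])
qed

text \<open>By the chain rule the derivative of the composite is a sum of products of derivatives of
  \<open>g\<close> with partial derivatives of \<open>f\<close> composed with \<open>g\<close>. The
  latter are composites of the same kind one order lower, so the induction runs over all
  \<open>f\<close>.\<close>

lemma Ck_on_compose:
  fixes f :: "'b::euclidean_space \<Rightarrow> 'c::real_normed_vector"
  assumes "open S" "open T"
  shows "Ck_on k T f \<Longrightarrow> Ck_on k S g \<Longrightarrow> g ` S \<subseteq> T \<Longrightarrow> Ck_on k S (\<lambda>x. f (g x))"
proof (induction k arbitrary: f g)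
  case 0
  then show ?case using continuous_on_compose2[of T f S g] by simp
next
  case (Suc k)
  have fd: "f differentiable at (g x)" if "x \<in> S" for x
    using Suc.prems that by auto
  have gk: "Ck_on k S g"
    using Ck_on_Suc_imp[OF assms(1) Suc.prems(2)] .
  show ?case
  proof (rule Ck_on_SucI[where f' = "\<lambda>x v. \<Sum>b\<in>Basis.
          (frechet_derivative g (at x) v \<bullet> b) *\<^sub>R frechet_derivative f (at (g x)) b", OF assms(1)])
    show "((\<lambda>x. f (g x)) has_derivative (\<lambda>v. \<Sum>b\<in>Basis.
          (frechet_derivative g (at x) v \<bullet> b) *\<^sub>R frechet_derivative f (at (g x)) b)) (at x)"
      if "x \<in> S" for x
      using has_derivative_compose[OF Ck_on_has_derivative[OF Suc.prems(2) that]
          fd[OF that, unfolded frechet_derivative_works]]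
      by (simp flip: frechet_derivative_basis_expansion[OF fd[OF that]])
    show "Ck_on k S (\<lambda>x. \<Sum>b\<in>Basis.
          (frechet_derivative g (at x) v \<bullet> b) *\<^sub>R frechet_derivative f (at (g x)) b)" for v
    proof (intro Ck_on_sum assms Ck_on_bilinear[OF bounded_bilinear_scaleR])
      fix b :: 'b
      have "Ck_on k S (\<lambda>x. frechet_derivative g (at x) v)"
        using Suc.prems by simp
      from Ck_on_bilinear[OF bounded_bilinear_inner assms(1) this Ck_on_const[OF assms(1), of k b]]
      show "Ck_on k S (\<lambda>x. frechet_derivative g (at x) v \<bullet> b)" .
      have "Ck_on k T (\<lambda>x. frechet_derivative f (at x) b)"
        using Suc.prems by simp
      from Suc.IH[OF this gk Suc.prems(3)]
      show "Ck_on k S (\<lambda>x. frechet_derivative f (at (g x)) b)" .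
    qed
  qed
qed

lemma smooth_on_subset: "smooth_on S f \<Longrightarrow> T \<subseteq> S \<Longrightarrow> smooth_on T f"
  by (auto simp: smooth_on_def intro: Ck_on_subset)

lemma smooth_on_const: "open S \<Longrightarrow> smooth_on S (\<lambda>x. c)"
  by (simp add: smooth_on_def Ck_on_const)

lemma smooth_on_linear: "open S \<Longrightarrow> bounded_linear f \<Longrightarrow> smooth_on S f"
  by (simp add: smooth_on_def Ck_on_linear)

lemma smooth_on_add:
  "open S \<Longrightarrow> smooth_on S f \<Longrightarrow> smooth_on S g \<Longrightarrow> smooth_on S (\<lambda>x. f x + g x)"
  by (simp add: smooth_on_def Ck_on_add)

lemma smooth_on_bilinear:
  "bounded_bilinear B \<Longrightarrow> open S \<Longrightarrow> smooth_on S f \<Longrightarrow> smooth_on S g \<Longrightarrow>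
    smooth_on S (\<lambda>x. B (f x) (g x))"
  by (simp add: smooth_on_def Ck_on_bilinear)

lemma smooth_on_compose:
  fixes f :: "'b::euclidean_space \<Rightarrow> 'c::real_normed_vector"
  shows "open S \<Longrightarrow> open T \<Longrightarrow> smooth_on T f \<Longrightarrow> smooth_on S g \<Longrightarrow> g ` S \<subseteq> T \<Longrightarrow>
    smooth_on S (\<lambda>x. f (g x))"
  unfolding smooth_on_def by (blast intro: Ck_on_compose)

lemma smooth_on_has_derivative:
  "smooth_on S f \<Longrightarrow> x \<in> S \<Longrightarrow> (f has_derivative frechet_derivative f (at x)) (at x)"
  unfolding smooth_on_def by (blast intro: Ck_on_has_derivative)

lemma smooth_on_frechet_derivative:
  assumes "smooth_on S f" shows "smooth_on S (\<lambda>x. frechet_derivative f (at x) v)"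
  unfolding smooth_on_def
proof
  fix k
  show "Ck_on k S (\<lambda>x. frechet_derivative f (at x) v)"
    using assms unfolding smooth_on_def by (metis Ck_on.simps(2))
qed

lemma smooth_on_continuous: "smooth_on S f \<Longrightarrow> continuous_on S f"
  unfolding smooth_on_def by (metis Ck_on.simps(1))

section \<open>Hadamard's lemma and bump functions\<close>

text \<open>Each differentiation under the integral sign brings out one more factor
  \<open>t\<close>, so the claim is proved for every power \<open>t ^ m\<close> at once. In a ball
  the segment from the centre stays inside.\<close>

lemma Ck_on_segment_integral:
  fixes f :: "'a::euclidean_space \<Rightarrow> real"
  shows "Ck_on k (ball p r) f \<Longrightarrow>
    Ck_on k (ball p r) (\<lambda>x. integral (cbox 0 1) (\<lambda>t. t ^ m * f (p + t *\<^sub>R (x - p))))"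
proof (induction k arbitrary: f m)
  case 0
  have in_ball: "p + t *\<^sub>R (x - p) \<in> ball p r" if "x \<in> ball p r" "t \<in> cbox 0 1" for x t
  proof -
    have "norm (t *\<^sub>R (x - p)) \<le> norm (x - p)"
      using that(2) by (auto simp: mult_left_le_one_le)
    then show ?thesis using that(1) by (auto simp: dist_norm norm_minus_commute)
  qed
  have "continuous_on (ball p r \<times> cbox 0 1) (\<lambda>z. f (p + snd z *\<^sub>R (fst z - p)))"
    by (rule continuous_on_compose2[OF 0[simplified]]) (auto intro!: continuous_intros in_ball simp: in_ball)
  then have "continuous_on (ball p r \<times> cbox 0 1) (\<lambda>(x, t::real). t ^ m * f (p + t *\<^sub>R (x - p)))"
    by (auto simp: split_beta intro!: continuous_intros)
  from integral_continuous_on_param[OF this] show ?case by simp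
next
  case (Suc k)
  have in_ball: "p + t *\<^sub>R (x - p) \<in> ball p r" if "x \<in> ball p r" "t \<in> cbox 0 1" for x t
  proof -
    have "norm (t *\<^sub>R (x - p)) \<le> norm (x - p)"
      using that(2) by (auto simp: mult_left_le_one_le)
    then show ?thesis using that(1) by (auto simp: dist_norm norm_minus_commute)
  qed
  let ?d = "\<lambda>b x. frechet_derivative f (at x) b"
  \<comment> \<open>Differentiation under the integral sign wants the derivative as a bounded linear
    map, hence the expansion in \<open>blinfun_inner_left\<close>.\<close>
  let ?f' = "\<lambda>x t. \<Sum>b\<in>Basis. (t ^ Suc m * ?d b (p + t *\<^sub>R (x - p))) *\<^sub>R blinfun_inner_left b"
  have dk: "Ck_on k (ball p r) (?d b)" for b using Suc.prems by simp
  have cont: "continuous_on (ball p r) g" if "Ck_on k (ball p r) g" for g :: "'a \<Rightarrow> real"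
    using that by (cases k) (auto simp: continuous_on_eq_continuous_at intro!: differentiable_imp_continuous_within)
  have contf: "continuous_on (ball p r) f"
    by (rule cont[OF Ck_on_Suc_imp[OF open_ball Suc.prems]])
  have cont_seg: "continuous_on (ball p r \<times> cbox 0 1) (\<lambda>z. g (p + snd z *\<^sub>R (fst z - p)))"
    if "continuous_on (ball p r) g" for g :: "'a \<Rightarrow> real"
    by (rule continuous_on_compose2[OF that]) (auto intro!: continuous_intros in_ball simp: in_ball)
  have cont_seg1: "continuous_on (cbox 0 1) (\<lambda>t. g (p + t *\<^sub>R (x - p)))"
    if "continuous_on (ball p r) g" "x \<in> ball p r" for g :: "'a \<Rightarrow> real" and x
    by (rule continuous_on_compose2[OF that(1)], intro continuous_intros, intro image_subsetI in_ball that)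
  have fx: "((\<lambda>x. t ^ m * f (p + t *\<^sub>R (x - p))) has_derivative blinfun_apply (?f' x t))
      (at x within ball p r)" if "x \<in> ball p r" "t \<in> cbox 0 1" for x t
  proof -
    let ?y = "p + t *\<^sub>R (x - p)"
    have "f differentiable at ?y" using Suc.prems in_ball[OF that] by simp
    note e = frechet_derivative_basis_expansion[OF this] and w = this[unfolded frechet_derivative_works]
    have "((\<lambda>x. p + t *\<^sub>R (x - p)) has_derivative (\<lambda>h. t *\<^sub>R h)) (at x within ball p r)"
      by (auto intro!: derivative_eq_intros)
    from has_derivative_compose[OF this w]
    have "((\<lambda>x. f (p + t *\<^sub>R (x - p))) has_derivative
        (\<lambda>h. frechet_derivative f (at ?y) (t *\<^sub>R h))) (at x within ball p r)" .
    then have "((\<lambda>x. t ^ m * f (p + t *\<^sub>R (x - p))) has_derivative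
        (\<lambda>h. t ^ m * frechet_derivative f (at ?y) (t *\<^sub>R h))) (at x within ball p r)"
      by (rule has_derivative_mult_right)
    moreover have "(\<lambda>h. t ^ m * frechet_derivative f (at ?y) (t *\<^sub>R h)) = blinfun_apply (?f' x t)"
      by (rule ext, subst e)
         (simp add: blinfun.sum_left blinfun.scaleR_left sum_distrib_left inner_commute algebra_simps)
    ultimately show ?thesis by simp
  qed
  have der: "((\<lambda>x. integral (cbox 0 1) (\<lambda>t. t ^ m * f (p + t *\<^sub>R (x - p)))) has_derivative
      (\<lambda>h. \<Sum>b\<in>Basis. integral (cbox 0 1) (\<lambda>t. t ^ Suc m * ?d b (p + t *\<^sub>R (x - p))) * (h \<bullet> b))) (at x)"
    if x: "x \<in> ball p r" for x
  proof -
    have int: "(\<lambda>t. t ^ Suc m * ?d b (p + t *\<^sub>R (x - p))) integrable_on cbox 0 1" for b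
      by (rule integrable_continuous, rule continuous_on_mult[OF _ cont_seg1[OF cont[OF dk] x]], intro continuous_intros)
    have "((\<lambda>x. integral (cbox 0 1) (\<lambda>t. t ^ m * f (p + t *\<^sub>R (x - p)))) has_derivative
        integral (cbox 0 1) (?f' x)) (at x within ball p r)"
    proof (rule leibniz_rule[OF fx _ _ x])
      show "(\<lambda>t. t ^ m * f (p + t *\<^sub>R (x - p))) integrable_on cbox 0 1" if "x \<in> ball p r" for x
        by (rule integrable_continuous, rule continuous_on_mult[OF _ cont_seg1[OF contf that]], intro continuous_intros)
      show "continuous_on (ball p r \<times> cbox 0 1) (\<lambda>(x, t). ?f' x t)"
        unfolding split_beta by (intro continuous_intros cont_seg[OF cont[OF dk]])
    qed (assumption | rule convex_ball)+
    moreover have "integral (cbox 0 1) (?f' x) =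
        (\<Sum>b\<in>Basis. integral (cbox 0 1) (\<lambda>t. t ^ Suc m * ?d b (p + t *\<^sub>R (x - p))) *\<^sub>R blinfun_inner_left b)"
    proof (subst integral_sum)
      show "(\<lambda>t. (t ^ Suc m * ?d b (p + t *\<^sub>R (x - p))) *\<^sub>R blinfun_inner_left b) integrable_on cbox 0 1"
        for b
        by (rule has_integral_integrable[OF has_integral_scaleR_left[OF integrable_integral[OF int]]])
      show "(\<Sum>b\<in>Basis. integral (cbox 0 1) (\<lambda>t. (t ^ Suc m * ?d b (p + t *\<^sub>R (x - p))) *\<^sub>R blinfun_inner_left b))
        = (\<Sum>b\<in>Basis. integral (cbox 0 1) (\<lambda>t. t ^ Suc m * ?d b (p + t *\<^sub>R (x - p))) *\<^sub>R blinfun_inner_left b)"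
        by (rule sum.cong[OF refl], rule integral_unique, rule has_integral_scaleR_left, rule integrable_integral, rule int)
    qed simp
    moreover have "blinfun_apply (\<Sum>b\<in>Basis. c b *\<^sub>R blinfun_inner_left b) = (\<lambda>h. \<Sum>b\<in>Basis. c b * (h \<bullet> b))"
      for c :: "'a \<Rightarrow> real"
      by (rule ext) (simp add: blinfun.sum_left blinfun.scaleR_left inner_commute)
    ultimately show ?thesis
      using at_within_open[OF x open_ball] by (simp del: power_Suc)
  qed
  show ?case
    by (rule Ck_on_SucI[OF open_ball der], assumption)
       (intro Ck_on_sum open_ball Ck_on_bilinear[OF bounded_bilinear_mult] Ck_on_const Suc.IH dk)
qed

text \<open>The fundamental theorem of calculus along the segment from \<open>p\<close> to
  \<open>x\<close>. The coefficients are integrals of partial derivatives, smooth by the preceding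
  lemma.\<close>

lemma smooth_on_hadamard:
  fixes f :: "'a::euclidean_space \<Rightarrow> real"
  assumes "smooth_on (ball p r) f" "r > 0"
  obtains h where "\<And>b. smooth_on (ball p r) (h b)"
    "\<And>x. x \<in> ball p r \<Longrightarrow> f x = f p + (\<Sum>b\<in>Basis. (x \<bullet> b - p \<bullet> b) * h b x)"
    "\<And>b. h b p = frechet_derivative f (at p) b"
proof
  let ?h = "\<lambda>b x. integral (cbox 0 1) (\<lambda>t. t ^ 0 * frechet_derivative f (at (p + t *\<^sub>R (x - p))) b)"
  have dk: "Ck_on k (ball p r) (\<lambda>x. frechet_derivative f (at x) b)" for k b
    using smooth_on_frechet_derivative[OF assms(1)] by (simp add: smooth_on_def)
  show "smooth_on (ball p r) (?h b)" for b
    unfolding smooth_on_def by (intro allI Ck_on_segment_integral dk)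
  show "?h b p = frechet_derivative f (at p) b" for b by simp
  fix x assume x: "x \<in> ball p r"
  have in_ball: "p + t *\<^sub>R (x - p) \<in> ball p r" if "t \<in> cbox 0 1" for t
  proof -
    have "norm (t *\<^sub>R (x - p)) \<le> norm (x - p)"
      using that by (auto simp: mult_left_le_one_le)
    then show ?thesis using x by (auto simp: dist_norm norm_minus_commute)
  qed
  have fd: "f differentiable at y" if "y \<in> ball p r" for y
    using smooth_on_has_derivative[OF assms(1) that] by (auto simp: differentiable_def)
  have "((\<lambda>t. frechet_derivative f (at (p + t *\<^sub>R (x - p))) (x - p)) has_integral
      f (p + 1 *\<^sub>R (x - p)) - f (p + 0 *\<^sub>R (x - p))) {0..1}"
  proof (rule fundamental_theorem_of_calculus)
    fix t :: real assume "t \<in> {0..1}"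
    then have y: "p + t *\<^sub>R (x - p) \<in> ball p r" using in_ball by simp
    have "((\<lambda>t. p + t *\<^sub>R (x - p)) has_derivative (\<lambda>h. h *\<^sub>R (x - p))) (at t within {0..1})"
      by (auto intro!: derivative_eq_intros)
    from has_derivative_compose[OF this smooth_on_has_derivative[OF assms(1) y]]
    show "((\<lambda>t. f (p + t *\<^sub>R (x - p))) has_vector_derivative
        frechet_derivative f (at (p + t *\<^sub>R (x - p))) (x - p)) (at t within {0..1})"
      by (simp add: has_vector_derivative_def linear_cmul[OF linear_frechet_derivative[OF fd[OF y]]])
  qed simp
  then have "f x - f p = integral (cbox 0 1) (\<lambda>t. frechet_derivative f (at (p + t *\<^sub>R (x - p))) (x - p))"
    by (simp add: integral_unique)
  also have "\<dots> = integral (cbox 0 1)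
      (\<lambda>t. \<Sum>b\<in>Basis. ((x - p) \<bullet> b) * frechet_derivative f (at (p + t *\<^sub>R (x - p))) b)"
  proof (rule integral_cong)
    fix t :: real assume "t \<in> cbox 0 1"
    then show "frechet_derivative f (at (p + t *\<^sub>R (x - p))) (x - p) =
        (\<Sum>b\<in>Basis. ((x - p) \<bullet> b) * frechet_derivative f (at (p + t *\<^sub>R (x - p))) b)"
      using frechet_derivative_basis_expansion[OF fd[OF in_ball]] by simp
  qed
  also have "\<dots> = (\<Sum>b\<in>Basis. (x \<bullet> b - p \<bullet> b) * ?h b x)"
  proof (subst integral_sum)
    show "(\<lambda>t. ((x - p) \<bullet> b) * frechet_derivative f (at (p + t *\<^sub>R (x - p))) b) integrable_on cbox 0 1"
      for b
    proof (intro integrable_continuous continuous_on_mult_left)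
      show "continuous_on (cbox 0 1) (\<lambda>t. frechet_derivative f (at (p + t *\<^sub>R (x - p))) b)"
        by (rule continuous_on_compose2[OF smooth_on_continuous[OF smooth_on_frechet_derivative[OF assms(1)]]],
            intro continuous_intros, intro image_subsetI in_ball)
    qed
  qed (simp_all add: inner_diff_left)
  finally show "f x = f p + (\<Sum>b\<in>Basis. (x \<bullet> b - p \<bullet> b) * ?h b x)" by simp
qed

text \<open>The family over \<open>m\<close> is closed under differentiation: the derivative of a
  member is \<open>- m\<close> times the next one plus the one after that. So only first derivatives
  have to be found, at \<open>0\<close> by the decay of the exponential.\<close>

lemma Ck_on_exp_inverse:
  "Ck_on k UNIV (\<lambda>t::real. if t \<le> 0 then 0 else exp (- 1 / t) / t ^ m)"
proof (induction k arbitrary: m)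
  let ?\<psi> = "\<lambda>m t. if t \<le> 0 then 0 else exp (- 1 / t) / t ^ m :: real"
  have der: "(?\<psi> m has_real_derivative (- real m * ?\<psi> (Suc m) t + ?\<psi> (m + 2) t)) (at t)" for m t
  proof -
    consider "t < 0" | "t = 0" | "t > 0" by linarith
    then show ?thesis
    proof cases
      case 1
      have "((\<lambda>t. 0) has_real_derivative 0) (at t)" by simp
      then have "(?\<psi> m has_real_derivative 0) (at t)"
        by (rule has_field_derivative_transform_within_open[where S = "{..<0}"]) (use 1 in auto)
      then show ?thesis using 1 by simp
    next
      case 2
      have "((\<lambda>h::real. exp (- 1 / h) / h ^ m / h) \<longlongrightarrow> 0) (at_right 0)"
        by real_asymp
      then have "((\<lambda>h. (?\<psi> m (0 + h) - ?\<psi> m 0) / h) \<longlongrightarrow> 0) (at_right 0)"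
        by (rule Lim_transform_eventually) (auto simp: eventually_at_right_less eventually_at_filter)
      moreover have "((\<lambda>h. (?\<psi> m (0 + h) - ?\<psi> m 0) / h) \<longlongrightarrow> 0) (at_left 0)"
        by (rule tendsto_eventually) (auto simp: eventually_at_filter)
      ultimately have "((\<lambda>h. (?\<psi> m (0 + h) - ?\<psi> m 0) / h) \<longlongrightarrow> 0) (at 0)"
        using filterlim_split_at by blast
      then show ?thesis using 2 by (simp add: DERIV_def)
    next
      case 3
      have "((\<lambda>t. exp (- 1 / t) / t ^ m) has_real_derivative
          (- real m * (exp (- 1 / t) / t ^ Suc m) + exp (- 1 / t) / t ^ (m + 2))) (at t)"
      proof (cases m)
        case 0
        then show ?thesis using 3
          by (auto intro!: derivative_eq_intros simp: field_simps power2_eq_square)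
      next
        case (Suc l)
        have e: "((\<lambda>t. exp (- 1 / t)) has_real_derivative exp (- 1 / t) / t\<^sup>2) (at t)"
          using 3 by (auto intro!: derivative_eq_intros simp: power2_eq_square)
        have d: "((\<lambda>t. t ^ Suc l) has_real_derivative real (Suc l) * t ^ l) (at t)"
          by (auto intro!: derivative_eq_intros simp del: power_Suc)
        show ?thesis
          unfolding Suc
          by (rule DERIV_cong[OF DERIV_divide[OF e d]])
             (use 3 in \<open>auto simp: field_simps power2_eq_square power_add\<close>)
      qed
      then have "(?\<psi> m has_real_derivative
          (- real m * (exp (- 1 / t) / t ^ Suc m) + exp (- 1 / t) / t ^ (m + 2))) (at t)"
        by (rule has_field_derivative_transform_within_open[where S = "{0<..}"]) (use 3 in auto)
      then show ?thesis using 3 by simp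
    qed
  qed
  {
    case 0
    show ?case unfolding Ck_on.simps
      using DERIV_continuous_on[of UNIV "?\<psi> m", OF DERIV_subset[OF der]] by blast
  next
    case (Suc k)
    show ?case
    proof (rule Ck_on_SucI[OF open_UNIV der[unfolded has_field_derivative_def]])
      have "Ck_on k UNIV (\<lambda>t. v * (- real m * ?\<psi> (Suc m) t + ?\<psi> (m + 2) t))" for v
        by (intro Ck_on_bilinear[OF bounded_bilinear_mult] Ck_on_add Ck_on_const Suc.IH open_UNIV)
      then show "Ck_on k UNIV (\<lambda>t. (- real m * ?\<psi> (Suc m) t + ?\<psi> (m + 2) t) * v)" for v
        by (simp only: mult.commute)
    qed
  }
qed

text \<open>The flat function is applied to r^2 - |x - p|^2, which is positive exactly inside the
  ball. A nonzero value at \<open>p\<close> is all that is asked, since the cut-off is divided out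
  in the end.\<close>

lemma smooth_bump:
  fixes p :: "'a::euclidean_space"
  assumes "r > 0"
  obtains \<beta> :: "'a \<Rightarrow> real" where "smooth_on UNIV \<beta>" "\<beta> p \<noteq> 0"
    "\<And>x. x \<notin> cball p r \<Longrightarrow> \<beta> x = 0"
proof
  let ?\<psi> = "\<lambda>t::real. if t \<le> 0 then 0 else exp (- 1 / t) / t ^ 0"
  let ?\<beta> = "\<lambda>x. ?\<psi> (r\<^sup>2 + (- 1) * ((x - p) \<bullet> (x - p)))"
  have "smooth_on UNIV (\<lambda>x. x - p)"
    using smooth_on_add[OF open_UNIV smooth_on_linear[OF open_UNIV bounded_linear_ident]
        smooth_on_const[OF open_UNIV, of "- p"]] by simp
  then have "smooth_on UNIV (\<lambda>x. r\<^sup>2 + (- 1) * ((x - p) \<bullet> (x - p)))"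
    by (intro smooth_on_add smooth_on_const open_UNIV smooth_on_bilinear[OF bounded_bilinear_mult]
        smooth_on_bilinear[OF bounded_bilinear_inner])
  then show "smooth_on UNIV ?\<beta>"
    by (rule smooth_on_compose[OF open_UNIV open_UNIV, rotated 1])
       (auto simp: smooth_on_def Ck_on_exp_inverse simp del: power_0)
  show "?\<beta> p \<noteq> 0" using assms by simp
  show "?\<beta> x = 0" if "x \<notin> cball p r" for x
  proof -
    have "r < norm (x - p)" using that by (simp add: dist_norm norm_minus_commute)
    then have "r\<^sup>2 < (x - p) \<bullet> (x - p)"
      using assms by (simp add: power2_norm_eq_inner[symmetric] power_strict_mono)
    then show ?thesis by simp
  qed
qed

section \<open>Functions and derivations seen through one parametrisation\<close>

text \<open>Charts enter only through functions \<open>\<theta>\<close> on a set \<open>N\<close>, which need not be injective nor have open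
  image: \<open>param_nhds N \<theta> p\<close> consists of the preimages of the neighbourhoods of \<open>\<theta> p\<close>, and \<open>smooth_via\<close> functions
  are locally smooth functions of \<open>\<theta>\<close>. This covers the twistor space, whose points are described by a
  base point and a unit vector of \<open>\<real>\<^sup>3\<close>.\<close>

definition param_nhds :: "'a set \<Rightarrow> ('a \<Rightarrow> 'e::topological_space) \<Rightarrow> 'a \<Rightarrow> 'a filter"
  where "param_nhds N \<theta> p = inf (filtercomap \<theta> (nhds (\<theta> p))) (principal N)"

lemma eventually_param_nhds:
  "eventually P (param_nhds N \<theta> p) \<longleftrightarrow> (\<exists>W. open W \<and> \<theta> p \<in> W \<and> (\<forall>q\<in>N. \<theta> q \<in> W \<longrightarrow> P q))"
proof -
  have "eventually P (param_nhds N \<theta> p) \<longleftrightarrow>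
      (\<exists>Q. (\<exists>W. open W \<and> \<theta> p \<in> W \<and> (\<forall>x\<in>W. Q x)) \<and> (\<forall>q. Q (\<theta> q) \<longrightarrow> q \<in> N \<longrightarrow> P q))"
    unfolding param_nhds_def eventually_inf_principal eventually_filtercomap eventually_nhds ..
  also have "\<dots> \<longleftrightarrow> (\<exists>W. open W \<and> \<theta> p \<in> W \<and> (\<forall>q\<in>N. \<theta> q \<in> W \<longrightarrow> P q))"
  proof safe
    fix W assume "open W" "\<theta> p \<in> W" "\<forall>q\<in>N. \<theta> q \<in> W \<longrightarrow> P q"
    then show "\<exists>Q. (\<exists>W. open W \<and> \<theta> p \<in> W \<and> (\<forall>x\<in>W. Q x)) \<and> (\<forall>q. Q (\<theta> q) \<longrightarrow> q \<in> N \<longrightarrow> P q)"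
      by (intro exI[of _ "\<lambda>x. x \<in> W"]) auto
  qed auto
  finally show ?thesis .
qed

lemma eventually_param_nhdsI:
  "open W \<Longrightarrow> \<theta> p \<in> W \<Longrightarrow> (\<And>q. q \<in> N \<Longrightarrow> \<theta> q \<in> W \<Longrightarrow> P q) \<Longrightarrow> eventually P (param_nhds N \<theta> p)"
  unfolding eventually_param_nhds by auto

lemma eventually_param_nhds_self: "eventually P (param_nhds N \<theta> p) \<Longrightarrow> p \<in> N \<Longrightarrow> P p"
  unfolding eventually_param_nhds by auto

lemma eventually_param_nhds_mem: "eventually (\<lambda>q. q \<in> N) (param_nhds N \<theta> p)"
  unfolding eventually_param_nhds by auto

lemma eventually_param_nhds_nb:
  "eventually P (param_nhds N \<theta> p) \<Longrightarrow> eventually (\<lambda>q. eventually P (param_nhds N \<theta> q)) (param_nhds N \<theta> p)"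
  unfolding eventually_param_nhds by auto

definition smooth_via :: "'a set \<Rightarrow> ('a \<Rightarrow> 'e::euclidean_space) \<Rightarrow> 'a \<Rightarrow> ('a \<Rightarrow> 'b::real_normed_vector) \<Rightarrow> bool"
  where "smooth_via N \<theta> p f \<longleftrightarrow> p \<in> N \<and>
    (\<exists>W G. open W \<and> \<theta> p \<in> W \<and> smooth_on W G \<and> (\<forall>q\<in>N. \<theta> q \<in> W \<longrightarrow> f q = G (\<theta> q)))"

lemma smooth_near_single: "smooth_near {(N, \<theta>)} p f \<longleftrightarrow> smooth_via N \<theta> p f"
  unfolding smooth_near_def smooth_via_def by auto

lemma smooth_via_mem: "smooth_via N \<theta> p f \<Longrightarrow> p \<in> N"
  by (simp add: smooth_via_def)

lemma smooth_via_eventually: "smooth_via N \<theta> p f \<Longrightarrow> eventually (\<lambda>q. smooth_via N \<theta> q f) (param_nhds N \<theta> p)"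
  unfolding smooth_via_def eventually_param_nhds by blast

lemma smooth_via_cong:
  assumes "smooth_via N \<theta> p f" "eventually (\<lambda>q. f q = g q) (param_nhds N \<theta> p)"
  shows "smooth_via N \<theta> p g"
proof -
  obtain W G V where "p \<in> N" "open W" "\<theta> p \<in> W" "smooth_on W G" "\<forall>q\<in>N. \<theta> q \<in> W \<longrightarrow> f q = G (\<theta> q)"
    "open V" "\<theta> p \<in> V" "\<forall>q\<in>N. \<theta> q \<in> V \<longrightarrow> f q = g q"
    using assms unfolding smooth_via_def eventually_param_nhds by blast
  then show ?thesis
    unfolding smooth_via_def by (auto intro!: exI[of _ "W \<inter> V"] exI[of _ G] smooth_on_subset[of W])
qed

lemma smooth_via_const: "p \<in> N \<Longrightarrow> smooth_via N \<theta> p (\<lambda>q. c)"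
  unfolding smooth_via_def by (auto intro!: exI[of _ UNIV] exI[of _ "\<lambda>x. c"] smooth_on_const)

lemma smooth_via_param: "p \<in> N \<Longrightarrow> smooth_via N \<theta> p \<theta>"
  unfolding smooth_via_def
  by (auto intro!: exI[of _ UNIV] exI[of _ "\<lambda>x. x"] smooth_on_linear bounded_linear_ident)

text \<open>One rule for every change of parametrisation: \<open>m\<close> is the identity between
  two charts, the projection to the base, a section of the twistor space, or a map into a Euclidean
  space.\<close>

lemma smooth_via_pullback:
  fixes \<theta> :: "'a \<Rightarrow> 'e::euclidean_space" and \<theta>' :: "'c \<Rightarrow> 'd::euclidean_space"
  assumes "smooth_via N \<theta> (m p) f" "smooth_via N' \<theta>' p (\<lambda>q. \<theta> (m q))" "eventually (\<lambda>q. m q \<in> N) (param_nhds N' \<theta>' p)"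
  shows "smooth_via N' \<theta>' p (\<lambda>q. f (m q))"
proof -
  obtain W G where W: "open W" "\<theta> (m p) \<in> W" "smooth_on W G" "\<forall>q\<in>N. \<theta> q \<in> W \<longrightarrow> f q = G (\<theta> q)"
    using assms(1) unfolding smooth_via_def by blast
  obtain V H where V: "p \<in> N'" "open V" "\<theta>' p \<in> V" "smooth_on V H"
    "\<forall>q\<in>N'. \<theta>' q \<in> V \<longrightarrow> \<theta> (m q) = H (\<theta>' q)"
    using assms(2) unfolding smooth_via_def by blast
  obtain Z where Z: "open Z" "\<theta>' p \<in> Z" "\<forall>q\<in>N'. \<theta>' q \<in> Z \<longrightarrow> m q \<in> N"
    using assms(3) unfolding eventually_param_nhds by blast
  let ?V = "(V \<inter> H -` W) \<inter> Z"
  have "open (V \<inter> H -` W)"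
    using continuous_open_preimage[OF smooth_on_continuous[OF V(4)] V(2) W(1)] .
  then have op: "open ?V" using Z(1) by blast
  have "smooth_on ?V (\<lambda>x. G (H x))"
    by (rule smooth_on_compose[OF op W(1) W(3) smooth_on_subset[OF V(4)]]) auto
  moreover have "\<theta>' p \<in> ?V" using V W Z by auto
  ultimately show ?thesis
    unfolding smooth_via_def using op V W Z by (intro conjI exI[of _ ?V] exI[of _ "\<lambda>x. G (H x)"]) auto
qed

lemma smooth_via_compose:
  fixes f :: "'a \<Rightarrow> 'b::euclidean_space"
  assumes "smooth_via N \<theta> p f" "open V" "smooth_on V H" "f p \<in> V"
  shows "smooth_via N \<theta> p (\<lambda>q. H (f q))"
proof (rule smooth_via_pullback[where N = UNIV and \<theta> = "\<lambda>x. x"])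
  show "smooth_via UNIV (\<lambda>x. x) (f p) H"
    unfolding smooth_via_def using assms by auto
qed (use assms in auto)

lemma smooth_via_linear:
  fixes f :: "'a \<Rightarrow> 'b::euclidean_space"
  shows "smooth_via N \<theta> p f \<Longrightarrow> bounded_linear L \<Longrightarrow> smooth_via N \<theta> p (\<lambda>q. L (f q))"
  by (rule smooth_via_compose[where V = UNIV]) (auto intro: smooth_on_linear)

lemma smooth_via_common:
  assumes "smooth_via N \<theta> p f" "smooth_via N \<theta> p g"
  obtains W F G where "p \<in> N" "open W" "\<theta> p \<in> W" "smooth_on W F" "smooth_on W G"
    "\<forall>q\<in>N. \<theta> q \<in> W \<longrightarrow> f q = F (\<theta> q) \<and> g q = G (\<theta> q)"
proof -
  obtain W F V G where *: "p \<in> N" "open W" "\<theta> p \<in> W" "smooth_on W F" "\<forall>q\<in>N. \<theta> q \<in> W \<longrightarrow> f q = F (\<theta> q)"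
    "open V" "\<theta> p \<in> V" "smooth_on V G" "\<forall>q\<in>N. \<theta> q \<in> V \<longrightarrow> g q = G (\<theta> q)"
    using assms unfolding smooth_via_def by blast
  show ?thesis
    by (rule that[of "W \<inter> V" F G]) (use * in \<open>auto intro: smooth_on_subset\<close>)
qed

lemma smooth_via_add:
  assumes "smooth_via N \<theta> p f" "smooth_via N \<theta> p g" shows "smooth_via N \<theta> p (\<lambda>q. f q + g q)"
proof -
  obtain W F G where *: "p \<in> N" "open W" "\<theta> p \<in> W" "smooth_on W F" "smooth_on W G"
    "\<forall>q\<in>N. \<theta> q \<in> W \<longrightarrow> f q = F (\<theta> q) \<and> g q = G (\<theta> q)"
    using smooth_via_common[OF assms] .
  then show ?thesis
    unfolding smooth_via_def by (auto intro!: exI[of _ W] exI[of _ "\<lambda>x. F x + G x"] smooth_on_add)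
qed

lemma smooth_via_bilinear:
  assumes "bounded_bilinear B" "smooth_via N \<theta> p f" "smooth_via N \<theta> p g"
  shows "smooth_via N \<theta> p (\<lambda>q. B (f q) (g q))"
proof -
  obtain W F G where *: "p \<in> N" "open W" "\<theta> p \<in> W" "smooth_on W F" "smooth_on W G"
    "\<forall>q\<in>N. \<theta> q \<in> W \<longrightarrow> f q = F (\<theta> q) \<and> g q = G (\<theta> q)"
    using smooth_via_common[OF assms(2,3)] .
  show ?thesis
    unfolding smooth_via_def
    using *(1-3,6) smooth_on_bilinear[OF assms(1) *(2,4,5)]
    by (intro conjI exI[of _ W] exI[of _ "\<lambda>x. B (F x) (G x)"]) auto
qed

lemmas smooth_via_mult = smooth_via_bilinear[OF bounded_bilinear_mult]
lemmas smooth_via_scaleR = smooth_via_bilinear[OF bounded_bilinear_scaleR]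
lemmas smooth_via_inner = smooth_via_bilinear[OF bounded_bilinear_inner]

lemma smooth_via_sum: "p \<in> N \<Longrightarrow> (\<And>i. i \<in> I \<Longrightarrow> smooth_via N \<theta> p (f i)) \<Longrightarrow> smooth_via N \<theta> p (\<lambda>q. \<Sum>i\<in>I. f i q)"
  by (induction I rule: infinite_finite_induct) (auto intro: smooth_via_const smooth_via_add)

lemma smooth_via_minus: "smooth_via N \<theta> p f \<Longrightarrow> smooth_via N \<theta> p (\<lambda>q. - f q)"
  using smooth_via_scaleR[OF smooth_via_const[OF smooth_via_mem[of N \<theta> p f], of \<theta> "- 1"], of f] by simp

lemma smooth_via_diff: "smooth_via N \<theta> p f \<Longrightarrow> smooth_via N \<theta> p g \<Longrightarrow> smooth_via N \<theta> p (\<lambda>q. f q - g q)"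
  using smooth_via_add[of N \<theta> p f "\<lambda>q. - g q"] smooth_via_minus[of N \<theta> p g] by simp

lemma smooth_via_nth:
  fixes f :: "'a \<Rightarrow> 'b::euclidean_space ^ 'n"
  shows "smooth_via N \<theta> p f \<Longrightarrow> smooth_via N \<theta> p (\<lambda>q. f q $ i)"
  by (erule smooth_via_linear) (rule bounded_linear_vec_nth)

lemma smooth_via_vec:
  fixes f :: "'a \<Rightarrow> 'b::euclidean_space ^ 'n"
  assumes "\<And>i. smooth_via N \<theta> p (\<lambda>q. f q $ i)"
  shows "smooth_via N \<theta> p f"
proof -
  have lin: "bounded_linear (\<lambda>x. axis i x :: 'b ^ 'n)" for i
    by (rule linear_conv_bounded_linear[THEN iffD1])
       (auto intro!: linearI simp: vec_eq_iff axis_def)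
  have "smooth_via N \<theta> p (\<lambda>q. \<Sum>i\<in>UNIV. axis i (f q $ i))"
    by (intro smooth_via_sum smooth_via_linear[OF assms lin] smooth_via_mem[OF assms])
  moreover have "(\<Sum>i\<in>UNIV. axis i (x $ i)) = x" for x :: "'b ^ 'n"
    by (simp add: vec_eq_iff axis_def if_distrib cong: if_cong)
  ultimately show ?thesis by simp
qed

lemma smooth_via_fst:
  fixes f :: "'a \<Rightarrow> 'b::euclidean_space \<times> 'c::euclidean_space"
  shows "smooth_via N \<theta> p f \<Longrightarrow> smooth_via N \<theta> p (\<lambda>q. fst (f q))"
  by (erule smooth_via_linear) (rule bounded_linear_fst)

lemma smooth_via_snd:
  fixes f :: "'a \<Rightarrow> 'b::euclidean_space \<times> 'c::euclidean_space"
  shows "smooth_via N \<theta> p f \<Longrightarrow> smooth_via N \<theta> p (\<lambda>q. snd (f q))"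
  by (erule smooth_via_linear) (rule bounded_linear_snd)

lemma smooth_via_Pair:
  fixes f :: "'a \<Rightarrow> 'b::euclidean_space" and g :: "'a \<Rightarrow> 'c::euclidean_space"
  assumes "smooth_via N \<theta> p f" "smooth_via N \<theta> p g"
  shows "smooth_via N \<theta> p (\<lambda>q. (f q, g q))"
proof -
  have "smooth_via N \<theta> p (\<lambda>q. (f q, 0) + (0, g q))"
    by (intro smooth_via_add smooth_via_linear[OF assms(1), where L = "\<lambda>x. (x, 0)"]
        smooth_via_linear[OF assms(2), where L = "\<lambda>x. (0, x)"] bounded_linear_Pair
        bounded_linear_ident bounded_linear_zero)
  then show ?thesis by simp
qed

lemma eventually_param_nhds_sm:
  assumes "smooth_via N \<theta> p f" "open V" "f p \<in> V"
  shows "eventually (\<lambda>q. f q \<in> V) (param_nhds N \<theta> p)"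
proof -
  obtain W G where W: "open W" "\<theta> p \<in> W" "smooth_on W G" "p \<in> N" "\<forall>q\<in>N. \<theta> q \<in> W \<longrightarrow> f q = G (\<theta> q)"
    using assms(1) unfolding smooth_via_def by blast
  show ?thesis
    by (rule eventually_param_nhdsI[OF continuous_open_preimage[OF smooth_on_continuous[OF W(3)] W(1) assms(2)]])
       (use W assms(3) in auto)
qed

section \<open>Tangent vectors as derivations\<close>

abbreviation TS :: "'a set \<Rightarrow> ('a \<Rightarrow> 'e::euclidean_space) \<Rightarrow> 'a \<Rightarrow> 'a tvec set"
  where "TS N \<theta> p \<equiv> tangent_space {(N, \<theta>)} p"

text \<open>Derivations see the charts only through the smooth functions; this moves tangent spaces
  from an atlas to a single parametrisation.\<close>

lemma tangent_space_cong:
  "(\<And>f. smooth_near C p f \<longleftrightarrow> smooth_near C' p f) \<Longrightarrow> tangent_space C p = tangent_space C' p"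
  unfolding tangent_space_def by simp

lemma TS_add: "v \<in> TS N \<theta> p \<Longrightarrow> smooth_via N \<theta> p f \<Longrightarrow> smooth_via N \<theta> p h \<Longrightarrow> v (\<lambda>q. f q + h q) = v f + v h"
  unfolding tangent_space_def smooth_near_single by (auto simp: plus_fun_def)

lemma TS_scale: "v \<in> TS N \<theta> p \<Longrightarrow> smooth_via N \<theta> p f \<Longrightarrow> v (\<lambda>q. r * f q) = r * v f"
  unfolding tangent_space_def smooth_near_single by (auto simp: scaleR_fun_def)

lemma TS_mult: "v \<in> TS N \<theta> p \<Longrightarrow> smooth_via N \<theta> p f \<Longrightarrow> smooth_via N \<theta> p h \<Longrightarrow>
    v (\<lambda>q. f q * h q) = v f * h p + f p * v h"
  unfolding tangent_space_def smooth_near_single by (auto simp: times_fun_def)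

lemma TS_outside: "v \<in> TS N \<theta> p \<Longrightarrow> \<not> smooth_via N \<theta> p f \<Longrightarrow> v f = 0"
  unfolding tangent_space_def smooth_near_single by auto

lemma TS_I:
  assumes "\<And>f h. smooth_via N \<theta> p f \<Longrightarrow> smooth_via N \<theta> p h \<Longrightarrow> v (\<lambda>q. f q + h q) = v f + v h"
    and "\<And>r f. smooth_via N \<theta> p f \<Longrightarrow> v (\<lambda>q. r * f q) = r * v f"
    and "\<And>f h. smooth_via N \<theta> p f \<Longrightarrow> smooth_via N \<theta> p h \<Longrightarrow> v (\<lambda>q. f q * h q) = v f * h p + f p * v h"
    and "\<And>f. \<not> smooth_via N \<theta> p f \<Longrightarrow> v f = 0"
  shows "v \<in> TS N \<theta> p"
proof -
  \<comment> \<open>For nonsmooth \<open>f\<close> both sides vanish: a nonzero multiple of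
    \<open>f\<close> is again nonsmooth, and the zero multiple is a constant.\<close>
  have "v (r *\<^sub>R f) = r * v f" for r f
  proof (cases "smooth_via N \<theta> p f")
    case True
    then show ?thesis using assms(2) by (simp add: scaleR_fun_def)
  next
    case False
    show ?thesis
    proof (cases "r = 0")
      case True
      show ?thesis
      proof (cases "p \<in> N")
        case True
        then have "v (\<lambda>q. 0 * (0::real)) = 0 * v (\<lambda>q. 0)" by (intro assms(2) smooth_via_const)
        then show ?thesis using \<open>r = 0\<close> by (simp add: scaleR_fun_def)
      next
        case False
        then show ?thesis using assms(4) \<open>r = 0\<close> smooth_via_mem by fastforce
      qed
    next
      case False
      have "\<not> smooth_via N \<theta> p (r *\<^sub>R f)"
      proof
        assume "smooth_via N \<theta> p (r *\<^sub>R f)"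
        from smooth_via_scaleR[OF smooth_via_const[OF smooth_via_mem[OF this], where c = "inverse r"] this]
        show False using \<open>\<not> smooth_via N \<theta> p f\<close> False by (simp add: scaleR_fun_def mult.assoc[symmetric])
      qed
      then show ?thesis using assms(4) \<open>\<not> smooth_via N \<theta> p f\<close> by simp
    qed
  qed
  then show ?thesis
    unfolding tangent_space_def smooth_near_single
    using assms by (auto simp: plus_fun_def times_fun_def)
qed

text \<open>The indicator \<open>k\<close> of the set where \<open>f\<close> and \<open>g\<close>
  agree is smooth and idempotent with \<open>k p = 1\<close>, so the product rule gives
  \<open>v k = 0\<close>. The product rule for \<open>k f = k g\<close> then compares the two
  values.\<close>

lemma TS_local:
  assumes "v \<in> TS N \<theta> p" "smooth_via N \<theta> p f" "eventually (\<lambda>q. f q = g q) (param_nhds N \<theta> p)"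
  shows "v f = v g"
proof -
  have pN: "p \<in> N" using assms(2) by (rule smooth_via_mem)
  define k :: "'a \<Rightarrow> real" where "k q = (if f q = g q then 1 else 0)" for q
  have "smooth_via N \<theta> p k"
    by (rule smooth_via_cong[OF smooth_via_const[OF pN, of \<theta> 1]])
       (use assms(3) in eventually_elim, auto simp: k_def)
  moreover have "k p = 1" using eventually_param_nhds_self[OF assms(3) pN] by (simp add: k_def)
  moreover have "(\<lambda>q. k q * k q) = k" by (auto simp: k_def)
  ultimately have "v k = 0" using TS_mult[OF assms(1), of k k] by simp
  have g: "smooth_via N \<theta> p g" using smooth_via_cong[OF assms(2,3)] .
  have "(\<lambda>q. k q * f q) = (\<lambda>q. k q * g q)" by (auto simp: k_def)
  then show ?thesis
    using TS_mult[OF assms(1) \<open>smooth_via N \<theta> p k\<close> assms(2)] TS_mult[OF assms(1) \<open>smooth_via N \<theta> p k\<close> g]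
      \<open>v k = 0\<close> \<open>k p = 1\<close> by simp
qed

lemma TS_const: "v \<in> TS N \<theta> p \<Longrightarrow> p \<in> N \<Longrightarrow> v (\<lambda>q. c) = 0"
  using TS_mult[of v N \<theta> p "\<lambda>q. 1" "\<lambda>q. 1"] TS_scale[of v N \<theta> p "\<lambda>q. 1" c] by (simp add: smooth_via_const)

lemma TS_sum:
  assumes "v \<in> TS N \<theta> p" "p \<in> N" "\<And>i. i \<in> I \<Longrightarrow> smooth_via N \<theta> p (f i)"
  shows "v (\<lambda>q. \<Sum>i\<in>I. f i q) = (\<Sum>i\<in>I. v (f i))"
  using assms(3)
proof (induction I rule: infinite_finite_induct)
  case (insert i I)
  then have "smooth_via N \<theta> p (f i)" "smooth_via N \<theta> p (\<lambda>q. \<Sum>i\<in>I. f i q)"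
    by (auto intro: smooth_via_sum assms(2))
  from TS_add[OF assms(1) this] show ?case using insert by simp
qed (use assms in \<open>simp_all add: TS_const\<close>)

lemma TS_minus: "v \<in> TS N \<theta> p \<Longrightarrow> smooth_via N \<theta> p f \<Longrightarrow> v (\<lambda>q. - f q) = - v f"
  using TS_scale[of v N \<theta> p f "- 1"] by simp

lemma TS_diff: "v \<in> TS N \<theta> p \<Longrightarrow> smooth_via N \<theta> p f \<Longrightarrow> smooth_via N \<theta> p h \<Longrightarrow> v (\<lambda>q. f q - h q) = v f - v h"
  using TS_add[of v N \<theta> p f "\<lambda>q. - h q"] by (simp add: TS_minus smooth_via_minus)

text \<open>Hadamard's lemma writes \<open>H\<close> near \<open>f p\<close> as a constant plus
  products whose first factors vanish at \<open>f p\<close>. The product rule keeps only the values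
  of the second factors there, and these are the partial derivatives.\<close>

lemma TS_chain:
  fixes f :: "'a \<Rightarrow> 'b::euclidean_space"
  assumes v: "v \<in> TS N \<theta> p" and f: "smooth_via N \<theta> p f" and V: "open V" "smooth_on V H" "f p \<in> V"
  shows "v (\<lambda>q. H (f q)) = frechet_derivative H (at (f p)) (\<Sum>b\<in>Basis. v (\<lambda>q. f q \<bullet> b) *\<^sub>R b)"
proof -
  have pN: "p \<in> N" using f by (rule smooth_via_mem)
  obtain r where r: "r > 0" "ball (f p) r \<subseteq> V" using V openE by blast
  have Hr: "smooth_on (ball (f p) r) H" using V(2) r(2) by (rule smooth_on_subset)
  obtain h where h: "\<And>b. smooth_on (ball (f p) r) (h b)"
    "\<And>x. x \<in> ball (f p) r \<Longrightarrow> H x = H (f p) + (\<Sum>b\<in>Basis. (x \<bullet> b - f p \<bullet> b) * h b x)"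
    "\<And>b. h b (f p) = frechet_derivative H (at (f p)) b"
    using smooth_on_hadamard[OF Hr r(1)] by blast
  have fpr: "f p \<in> ball (f p) r" using r by simp
  have smh: "smooth_via N \<theta> p (\<lambda>q. h b (f q))" for b
    by (rule smooth_via_compose[OF f open_ball h(1) fpr])
  have smb: "smooth_via N \<theta> p (\<lambda>q. f q \<bullet> b)" for b
    by (intro smooth_via_inner f smooth_via_const pN)
  have smd: "smooth_via N \<theta> p (\<lambda>q. f q \<bullet> b - f p \<bullet> b)" for b
    by (intro smooth_via_diff smb smooth_via_const pN)
  have "v (\<lambda>q. H (f q)) = v (\<lambda>q. H (f p) + (\<Sum>b\<in>Basis. (f q \<bullet> b - f p \<bullet> b) * h b (f q)))"
  proof (rule TS_local[OF v smooth_via_compose[OF f V]])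
    show "eventually (\<lambda>q. H (f q) = H (f p) + (\<Sum>b\<in>Basis. (f q \<bullet> b - f p \<bullet> b) * h b (f q))) (param_nhds N \<theta> p)"
      using eventually_param_nhds_sm[OF f open_ball fpr] by eventually_elim (rule h(2))
  qed
  also have "\<dots> = (\<Sum>b\<in>Basis. v (\<lambda>q. f q \<bullet> b) * frechet_derivative H (at (f p)) b)"
    by (simp add: TS_add[OF v] TS_sum[OF v] TS_mult[OF v] TS_diff[OF v] TS_const[OF v] pN
        smooth_via_const smooth_via_sum smooth_via_mult smd smh smb h(3))
  also have "\<dots> = (\<Sum>b\<in>Basis. ((\<Sum>c\<in>Basis. v (\<lambda>q. f q \<bullet> c) *\<^sub>R c) \<bullet> b) *\<^sub>R frechet_derivative H (at (f p)) b)"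
    by (simp add: inner_sum_left_Basis)
  also have "\<dots> = frechet_derivative H (at (f p)) (\<Sum>b\<in>Basis. v (\<lambda>q. f q \<bullet> b) *\<^sub>R b)"
  proof (subst frechet_derivative_basis_expansion[symmetric])
    show "H differentiable at (f p)"
      using smooth_on_has_derivative[OF V(2,3)] by (auto simp: differentiable_def)
  qed simp
  finally show ?thesis .
qed

section \<open>Vector fields near a point and their brackets\<close>

text \<open>The condition is imposed near one point because the images of the test fields under
  \<open>Phi\<close> are known to have smooth coefficients only there.\<close>

definition vf_near :: "'a set \<Rightarrow> ('a \<Rightarrow> 'e::euclidean_space) \<Rightarrow> 'a \<Rightarrow> ('a \<Rightarrow> 'a tvec) \<Rightarrow> bool"
  where "vf_near N \<theta> p X \<longleftrightarrow> eventually (\<lambda>q. X q \<in> TS N \<theta> q \<and>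
    (\<forall>f. smooth_via N \<theta> q f \<longrightarrow> smooth_via N \<theta> q (\<lambda>r. X r f))) (param_nhds N \<theta> p)"

lemma vf_nearD:
  assumes "vf_near N \<theta> p X" "p \<in> N"
  shows "X p \<in> TS N \<theta> p" "smooth_via N \<theta> p f \<Longrightarrow> smooth_via N \<theta> p (\<lambda>r. X r f)"
  using eventually_param_nhds_self[OF assms(1)[unfolded vf_near_def] assms(2)] by auto

lemma vf_near_TS: "vf_near N \<theta> p X \<Longrightarrow> eventually (\<lambda>q. X q \<in> TS N \<theta> q) (param_nhds N \<theta> p)"
  unfolding vf_near_def by (erule eventually_mono) auto

lemma vf_near_cong:
  assumes "vf_near N \<theta> p X" "eventually (\<lambda>q. X q = Y q) (param_nhds N \<theta> p)"
  shows "vf_near N \<theta> p Y"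
  using assms(1)[unfolded vf_near_def] assms(2) eventually_param_nhds_nb[OF assms(2)]
  unfolding vf_near_def
proof eventually_elim
  case (elim q)
  have "smooth_via N \<theta> q (\<lambda>r. Y r f)" if "smooth_via N \<theta> q f" for f
    by (rule smooth_via_cong[of _ _ _ "\<lambda>r. X r f"])
       (use elim that in \<open>auto elim: eventually_mono\<close>)
  then show ?case using elim by simp
qed

lemma vf_near_add:
  assumes X: "vf_near N \<theta> p X" and f: "smooth_via N \<theta> p f" "smooth_via N \<theta> p h"
  shows "eventually (\<lambda>q. X q (\<lambda>r. f r + h r) = X q f + X q h) (param_nhds N \<theta> p)"
  using vf_near_TS[OF X] smooth_via_eventually[OF f(1)] smooth_via_eventually[OF f(2)]
  by eventually_elim (rule TS_add)

lemma vf_near_mult: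
  assumes X: "vf_near N \<theta> p X" and f: "smooth_via N \<theta> p f" "smooth_via N \<theta> p h"
  shows "eventually (\<lambda>q. X q (\<lambda>r. f r * h r) = X q f * h q + f q * X q h) (param_nhds N \<theta> p)"
  using vf_near_TS[OF X] smooth_via_eventually[OF f(1)] smooth_via_eventually[OF f(2)]
  by eventually_elim (rule TS_mult)

lemma vf_near_scale:
  assumes X: "vf_near N \<theta> p X" and f: "smooth_via N \<theta> p f"
  shows "eventually (\<lambda>q. X q (\<lambda>r. c * f r) = c * X q f) (param_nhds N \<theta> p)"
  using vf_near_TS[OF X] smooth_via_eventually[OF f]
  by eventually_elim (rule TS_scale)

text \<open>The two mixed terms are symmetric in \<open>v\<close> and the value of the field at
  \<open>p\<close>, so they cancel in a bracket.\<close>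

lemma TS_vf_mult:
  assumes v: "v \<in> TS N \<theta> p" and X: "vf_near N \<theta> p X" and f: "smooth_via N \<theta> p f" "smooth_via N \<theta> p h"
  shows "v (\<lambda>q. X q (\<lambda>r. f r * h r)) = v (\<lambda>q. X q f) * h p + X p f * v h + v f * X p h + f p * v (\<lambda>q. X q h)"
proof -
  have p: "p \<in> N" using f(1) by (rule smooth_via_mem)
  note s = vf_nearD(2)[OF X p f(1)] vf_nearD(2)[OF X p f(2)] f
  have "v (\<lambda>q. X q (\<lambda>r. f r * h r)) = v (\<lambda>q. X q f * h q + f q * X q h)"
    by (rule TS_local[OF v vf_nearD(2)[OF X p] vf_near_mult[OF X f]]) (intro smooth_via_mult f)
  then show ?thesis
    by (simp add: TS_add[OF v] TS_mult[OF v] smooth_via_mult s)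
qed

lemma lie_bracket_TS:
  assumes X: "vf_near N \<theta> p X" and Y: "vf_near N \<theta> p Y" and p: "p \<in> N"
  shows "lie_bracket {(N, \<theta>)} X Y p \<in> TS N \<theta> p"
proof -
  note D = vf_nearD[OF X p] vf_nearD[OF Y p]
  have add: "V p (\<lambda>q. W q (\<lambda>r. f r + h r)) = V p (\<lambda>q. W q f) + V p (\<lambda>q. W q h)"
    if "vf_near N \<theta> p V" "vf_near N \<theta> p W" "smooth_via N \<theta> p f" "smooth_via N \<theta> p h" for V W f h
    using TS_local[OF vf_nearD(1)[OF that(1) p] vf_nearD(2)[OF that(2) p] vf_near_add[OF that(2-4)]]
      TS_add[OF vf_nearD(1)[OF that(1) p] vf_nearD(2)[OF that(2) p that(3)] vf_nearD(2)[OF that(2) p that(4)]]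
    by (simp add: smooth_via_add that)
  have scale: "V p (\<lambda>q. W q (\<lambda>r. c * f r)) = c * V p (\<lambda>q. W q f)"
    if "vf_near N \<theta> p V" "vf_near N \<theta> p W" "smooth_via N \<theta> p f" for V W f c
    using TS_local[OF vf_nearD(1)[OF that(1) p] vf_nearD(2)[OF that(2) p] vf_near_scale[OF that(2-3)]]
      TS_scale[OF vf_nearD(1)[OF that(1) p] vf_nearD(2)[OF that(2) p that(3)]]
    by (simp add: smooth_via_mult smooth_via_const p that)
  show ?thesis
  proof (rule TS_I)
    fix f h :: "'a \<Rightarrow> real" and r
    assume f: "smooth_via N \<theta> p f"
    show "lie_bracket {(N, \<theta>)} X Y p (\<lambda>q. r * f q) = r * lie_bracket {(N, \<theta>)} X Y p f"
      using f by (simp add: lie_bracket_def smooth_near_single scale X Y smooth_via_mult smooth_via_const p algebra_simps)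
    assume h: "smooth_via N \<theta> p h"
    show "lie_bracket {(N, \<theta>)} X Y p (\<lambda>q. f q + h q) =
        lie_bracket {(N, \<theta>)} X Y p f + lie_bracket {(N, \<theta>)} X Y p h"
      using f h by (simp add: lie_bracket_def smooth_near_single add X Y smooth_via_add)
    show "lie_bracket {(N, \<theta>)} X Y p (\<lambda>q. f q * h q) =
        lie_bracket {(N, \<theta>)} X Y p f * h p + f p * lie_bracket {(N, \<theta>)} X Y p h"
      using f h TS_vf_mult[OF D(1) Y f h] TS_vf_mult[OF D(3) X f h]
      by (simp add: lie_bracket_def smooth_near_single smooth_via_mult algebra_simps)
  qed (simp add: lie_bracket_def smooth_near_single)
qed

lemma sum_fun_apply: "(\<Sum>i\<in>I. f i) x = (\<Sum>i\<in>I. f i x)"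
  by (induction I rule: infinite_finite_induct) auto

lemma TS_subspace: "subspace (TS N \<theta> p)"
  unfolding subspace_def
proof (intro conjI ballI allI)
  show "0 \<in> TS N \<theta> p" by (rule TS_I) auto
  show "v + w \<in> TS N \<theta> p" if "v \<in> TS N \<theta> p" "w \<in> TS N \<theta> p" for v w
    by (rule TS_I) (auto simp: TS_add[OF that(1)] TS_add[OF that(2)] TS_scale[OF that(1)] TS_scale[OF that(2)]
        TS_mult[OF that(1)] TS_mult[OF that(2)] TS_outside[OF that(1)] TS_outside[OF that(2)] algebra_simps)
  show "c *\<^sub>R v \<in> TS N \<theta> p" if "v \<in> TS N \<theta> p" for v c
    by (rule TS_I) (auto simp: TS_add[OF that(1)] TS_scale[OF that(1)] scaleR_fun_def
        TS_mult[OF that(1)] TS_outside[OF that(1)] algebra_simps)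
qed

section \<open>Linear algebra in dimension five\<close>

lemma exhaust_5:
  fixes x :: 5
  shows "x = 1 \<or> x = 2 \<or> x = 3 \<or> x = 4 \<or> x = 5"
proof (induct x)
  case (of_int z)
  then have "z = 0 \<or> z = 1 \<or> z = 2 \<or> z = 3 \<or> z = 4" by fastforce
  then show ?case by auto
qed

lemma forall_5: "(\<forall>i::5. P i) \<longleftrightarrow> P 1 \<and> P 2 \<and> P 3 \<and> P 4 \<and> P 5"
  by (metis exhaust_5)

lemma UNIV_5: "UNIV = {1, 2, 3, 4, 5::5}"
  using exhaust_5 by auto

lemma sum_5: "sum f (UNIV::5 set) = f 1 + f 2 + f 3 + f 4 + f 5"
  unfolding UNIV_5 by (simp add: ac_simps)

definition mk5 :: "'a \<Rightarrow> 'a \<Rightarrow> 'a \<Rightarrow> 'a \<Rightarrow> 'a \<Rightarrow> 'a ^ 5"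
  where "mk5 a b c d e = (\<chi> i. if i = 1 then a else if i = 2 then b else if i = 3 then c
    else if i = 4 then d else e)"

lemma mk5_nth [simp]:
  "mk5 a b c d e $ 1 = a" "mk5 a b c d e $ 2 = b" "mk5 a b c d e $ 3 = c"
  "mk5 a b c d e $ 4 = d" "mk5 a b c d e $ 5 = e"
  by (simp_all add: mk5_def)

text \<open>Laplace expansion along the last column, the 4x4 minors being expanded by complementary
  2x2 minors in the columns 1, 2 and 3, 4. The rows are taken cyclically after \<open>j\<close>; a
  5-cycle is even, so all five summands carry the same sign.\<close>

lemma det_5:
  "det (A::real^5^5) =
    (\<Sum>j\<in>UNIV. A$j$5 * ((A $ (j+1) $ 1 * A $ (j+2) $ 2 - A $ (j+2) $ 1 * A $ (j+1) $ 2) * (A $ (j+3) $ 3 * A $ (j+4) $ 4 - A $ (j+4) $ 3 * A $ (j+3) $ 4)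
     - (A $ (j+1) $ 1 * A $ (j+3) $ 2 - A $ (j+3) $ 1 * A $ (j+1) $ 2) * (A $ (j+2) $ 3 * A $ (j+4) $ 4 - A $ (j+4) $ 3 * A $ (j+2) $ 4)
     + (A $ (j+1) $ 1 * A $ (j+4) $ 2 - A $ (j+4) $ 1 * A $ (j+1) $ 2) * (A $ (j+2) $ 3 * A $ (j+3) $ 4 - A $ (j+3) $ 3 * A $ (j+2) $ 4)
     + (A $ (j+2) $ 1 * A $ (j+3) $ 2 - A $ (j+3) $ 1 * A $ (j+2) $ 2) * (A $ (j+1) $ 3 * A $ (j+4) $ 4 - A $ (j+4) $ 3 * A $ (j+1) $ 4)
     - (A $ (j+2) $ 1 * A $ (j+4) $ 2 - A $ (j+4) $ 1 * A $ (j+2) $ 2) * (A $ (j+1) $ 3 * A $ (j+3) $ 4 - A $ (j+3) $ 3 * A $ (j+1) $ 4)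
     + (A $ (j+3) $ 1 * A $ (j+4) $ 2 - A $ (j+4) $ 1 * A $ (j+3) $ 2) * (A $ (j+1) $ 3 * A $ (j+2) $ 4 - A $ (j+2) $ 3 * A $ (j+1) $ 4)))"
proof -
  have f: "finite {2::5, 3, 4, 5}" "1 \<notin> {2::5, 3, 4, 5}" "finite {3::5, 4, 5}" "2 \<notin> {3::5, 4, 5}"
    "finite {4::5, 5}" "3 \<notin> {4::5, 5}" "finite {5::5}" "4 \<notin> {5::5}" by auto
  have n: "(5::5) = 0" "(6::5) = 1" "(7::5) = 2" "(8::5) = 3" "(9::5) = 4" by simp_all
  show ?thesis
    unfolding det_def UNIV_5
    unfolding sum_over_permutations_insert[OF f(1,2)]
    unfolding sum_over_permutations_insert[OF f(3,4)]
    unfolding sum_over_permutations_insert[OF f(5,6)]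
    unfolding sum_over_permutations_insert[OF f(7,8)]
    unfolding permutes_sing
    by (simp add: sign_swap_id permutation_swap_id permutation_compose sign_compose sign_id swap_id_eq n)
       (simp add: algebra_simps)
qed

lemma vec5_eqI: "(\<And>i. i \<in> {1, 2, 3, 4, 5} \<Longrightarrow> x $ i = y $ i) \<Longrightarrow> x = (y :: 'a ^ 5)"
  using exhaust_5 by (auto simp: vec_eq_iff)

lemma numeral_mod_5 [simp]: "(6::5) = 1" "(7::5) = 2" "(8::5) = 3" "(9::5) = 4"
  by simp_all

lemma cyclic_5 [simp]:
  "(1::5) + 1 = 2" "(1::5) + 2 = 3" "(1::5) + 3 = 4" "(1::5) + 4 = 5"
  "(2::5) + 1 = 3" "(2::5) + 2 = 4" "(2::5) + 3 = 5" "(2::5) + 4 = 1"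
  "(3::5) + 1 = 4" "(3::5) + 2 = 5" "(3::5) + 3 = 1" "(3::5) + 4 = 2"
  "(4::5) + 1 = 5" "(4::5) + 2 = 1" "(4::5) + 3 = 2" "(4::5) + 4 = 3"
  "(5::5) + 1 = 1" "(5::5) + 2 = 2" "(5::5) + 3 = 3" "(5::5) + 4 = 4"
  by simp_all

section \<open>The matrix model of the irreducible so(3)\<close>

definition skew5 :: "real \<Rightarrow> real \<Rightarrow> real \<Rightarrow> real \<Rightarrow> real \<Rightarrow> real \<Rightarrow> real \<Rightarrow> real \<Rightarrow> real \<Rightarrow> real \<Rightarrow> real^5^5"
  where "skew5 m12 m13 m14 m15 m23 m24 m25 m34 m35 m45 =
    mk5 (mk5 0 m12 m13 m14 m15) (mk5 (- m12) 0 m23 m24 m25) (mk5 (- m13) (- m23) 0 m34 m35)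
        (mk5 (- m14) (- m24) (- m34) 0 m45) (mk5 (- m15) (- m25) (- m35) (- m45) 0)"

definition skew :: "real^'n^'n \<Rightarrow> bool"
  where "skew M \<longleftrightarrow> (\<forall>i j. M $ i $ j = - M $ j $ i)"

lemma skew_diag: "skew M \<Longrightarrow> M $ i $ i = 0"
  unfolding skew_def by (metis equal_neg_zero)

lemma skew_skew5 [simp]: "skew (skew5 a b c d e f g h i j)"
  unfolding skew_def skew5_def forall_5 by simp

text \<open>The coefficient matrix of \<open>s\<^sub>1 \<kappa>\<^sub>1 + s\<^sub>2 \<kappa>\<^sub>2 + s\<^sub>3 \<kappa>\<^sub>3\<close>.\<close>

definition Kmat :: "real^3 \<Rightarrow> real^5^5"
  where "Kmat s = skew5 0 (sqrt 3 * s$2) 0 (sqrt 3 * s$1) (s$1) (2 * s$3) (s$2) (s$2) (s$3) (s$1)"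

lemma skew_Kmat [simp]: "skew (Kmat s)"
  by (simp add: Kmat_def)

lemma Kmat_nth:
  "Kmat s $ 1 = mk5 0 0 (sqrt 3 * s$2) 0 (sqrt 3 * s$1)"
  "Kmat s $ 2 = mk5 0 0 (s$1) (2 * s$3) (s$2)"
  "Kmat s $ 3 = mk5 (- sqrt 3 * s$2) (- s$1) 0 (s$2) (s$3)"
  "Kmat s $ 4 = mk5 0 (- 2 * s$3) (- s$2) 0 (s$1)"
  "Kmat s $ 5 = mk5 (- sqrt 3 * s$1) (- s$2) (- s$3) (- s$1) 0"
  by (simp_all add: Kmat_def skew5_def)

lemma linear_Kmat: "linear Kmat"
  by (rule linearI; rule vec5_eqI; rule vec5_eqI) (auto simp: Kmat_nth algebra_simps)

lemmas Kmat_linear = linear_add[OF linear_Kmat] linear_cmul[OF linear_Kmat]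
  linear_diff[OF linear_Kmat] linear_0[OF linear_Kmat] linear_neg[OF linear_Kmat]

lemma Kmat_inj: "Kmat s = Kmat t \<Longrightarrow> s = t"
proof -
  assume "Kmat s = Kmat t"
  then have "Kmat s $ 4 $ 5 = Kmat t $ 4 $ 5" "Kmat s $ 2 $ 5 = Kmat t $ 2 $ 5" "Kmat s $ 3 $ 5 = Kmat t $ 3 $ 5"
    by simp_all
  then show ?thesis by (simp add: Kmat_nth vec_eq_iff forall_3)
qed

text \<open>The three generators satisfy the relations of so(3). This expresses \<open>vprod\<close>
  as a commutator, which does not depend on the basis, and turns the action of the connection on
  bivectors into a vector product.\<close>

lemma Kmat_bracket: "Kmat s ** Kmat t - Kmat t ** Kmat s = Kmat (cross3 s t)"
proof (rule vec5_eqI, rule vec5_eqI)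
  have r: "sqrt 3 * (sqrt 3 * x) = 3 * x" for x :: real
    by (simp add: mult.assoc[symmetric])
  fix i j :: 5 assume "i \<in> {1, 2, 3, 4, 5}" "j \<in> {1, 2, 3, 4, 5}"
  then show "(Kmat s ** Kmat t - Kmat t ** Kmat s) $ i $ j = Kmat (cross3 s t) $ i $ j"
    by (auto simp: matrix_matrix_mult_def sum_5 Kmat_nth cross3_def algebra_simps r)
qed

text \<open>The metric on bivectors in components of an orthonormal basis; the half corrects for
  counting each pair of indices twice.\<close>

definition mdot :: "real^'n^'n \<Rightarrow> real^'n^'n \<Rightarrow> real"
  where "mdot M M' = (\<Sum>i\<in>UNIV. \<Sum>j\<in>UNIV. M $ i $ j * M' $ i $ j) / 2"

text \<open>The factor \<open>5\<close> is the squared length of the kappas, so the twistor fibres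
  become unit spheres in the coordinates \<open>s\<close>.\<close>

lemma mdot_Kmat: "mdot (Kmat s) (Kmat t) = 5 * (s \<bullet> t)"
proof -
  have r: "sqrt 3 * (x * (sqrt 3 * y)) = 3 * (x * y)" for x y :: real
    by (simp add: mult.left_commute[of x] mult.assoc[symmetric])
  show ?thesis
    by (simp add: mdot_def sum_5 Kmat_nth inner_vec_def sum_3 algebra_simps r)
qed

text \<open>The polarisation of the cubic form: \<open>upsilon_polar x y\<close> stands for \<open>\<Upsilon> (x, x, y)\<close>.\<close>

definition upsilon_polar :: "real^5 \<Rightarrow> real^5 \<Rightarrow> real"
  where "upsilon_polar x y = (upsilon_cubic (x + y) - upsilon_cubic (x - y) - 2 * upsilon_cubic y) / 6"

lemma upsilon_polar_eq:
  "upsilon_polar x y =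
    (x$2 * x$2 + x$4 * x$4 - x$1 * x$1 - (x$3 * x$3 + x$5 * x$5) / 2) * y$1
    + (2 * x$1 * x$2 + sqrt 3 * x$3 * x$5) * y$2
    + (- x$1 * x$3 - sqrt 3 * x$3 * x$4 + sqrt 3 * x$2 * x$5) * y$3
    + (2 * x$1 * x$4 + sqrt 3 / 2 * (x$5 * x$5 - x$3 * x$3)) * y$4
    + (- x$1 * x$5 + sqrt 3 * x$4 * x$5 + sqrt 3 * x$2 * x$3) * y$5"
  by (simp add: upsilon_polar_def upsilon_cubic_def power2_eq_square field_simps)

text \<open>Infinitesimal invariance: up to a factor, the left side is the derivative of the cubic
  form along the linear flow generated by \<open>Kmat s\<close>.\<close>

lemma upsilon_polar_Kmat: "upsilon_polar x (Kmat s *v x) = 0"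
proof -
  have r: "sqrt 3 * (sqrt 3 * y) = 3 * y" for y :: real
    by (simp add: mult.assoc[symmetric])
  show ?thesis
    by (simp add: upsilon_polar_eq matrix_vector_mult_def sum_5 Kmat_nth field_simps r)
qed

text \<open>The irreducible \<open>so(3)\<close> is the whole stabiliser algebra of the cubic form.\<close>

lemma upsilon_stabilizer:
  assumes M: "skew M" and stab: "\<And>x. upsilon_polar x (M *v x) = 0"
  obtains s where "M = Kmat s"
proof
  have rc: "sqrt 3 * y = sqrt 3 * z \<longleftrightarrow> y = z" for y z :: real by simp
  have sk: "M$2$1 = - M$1$2" "M$3$1 = - M$1$3" "M$4$1 = - M$1$4" "M$5$1 = - M$1$5"
    "M$3$2 = - M$2$3" "M$4$2 = - M$2$4" "M$5$2 = - M$2$5" "M$4$3 = - M$3$4" "M$5$3 = - M$3$5"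
    "M$5$4 = - M$4$5" "M$1$1 = 0" "M$2$2 = 0" "M$3$3 = 0" "M$4$4 = 0" "M$5$5 = 0"
    using M skew_diag[OF M] unfolding skew_def by blast+
  note ev = upsilon_polar_eq matrix_vector_mult_def sum_5 sk
  \<comment> \<open>Each test vector gives one linear equation for the ten entries above the
    diagonal; the seven equations are independent and leave the three parameters of
    \<open>Kmat\<close>.\<close>
  have 1: "M$1$2 = 0" using stab[of "mk5 0 1 0 0 0"] by (simp add: ev)
  have 2: "M$1$4 = 0" using stab[of "mk5 0 0 0 1 0"] by (simp add: ev)
  have 3: "M$1$3 = sqrt 3 * M$3$4" using stab[of "mk5 0 0 1 0 0"] by (simp add: ev)
  have 4: "M$1$5 = sqrt 3 * M$4$5" using stab[of "mk5 0 0 0 0 1"] by (simp add: ev)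
  have "sqrt 3 * (M$2$3 + M$2$5) = sqrt 3 * (M$3$4 + M$4$5)"
    using stab[of "mk5 0 0 1 0 1"] by (simp add: ev 3 4 algebra_simps)
  then have 5: "M$2$3 + M$2$5 = M$3$4 + M$4$5" by (simp only: rc)
  have "sqrt 3 * (M$2$5 - M$2$3) = sqrt 3 * (M$3$4 - M$4$5)"
    using stab[of "mk5 0 0 1 0 (- 1)"] by (simp add: ev 3 4 algebra_simps)
  then have 6: "M$2$5 - M$2$3 = M$3$4 - M$4$5" by (simp only: rc)
  have "sqrt 3 * (M$2$4 + 2 * M$3$4) = sqrt 3 * (2 * M$2$5 + 2 * M$3$5)"
    using stab[of "mk5 0 1 1 0 0"] by (simp add: ev 1 3 field_simps)
  then have 7: "M$2$4 + 2 * M$3$4 = 2 * M$2$5 + 2 * M$3$5" by (simp only: rc)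
  have 8: "M$2$5 = M$3$4" "M$2$3 = M$4$5" "M$2$4 = 2 * M$3$5" using 5 6 7 by linarith+
  show "M = Kmat (vector [M$4$5, M$3$4, M$3$5])"
    by (rule vec5_eqI, rule vec5_eqI) (auto simp: Kmat_nth vector_3 sk 1 2 3 4 8)
qed

text \<open>The vector of Pfaffians: \<open>\<ast>(\<sigma> \<and> \<sigma>) = 2 pfv M\<close> for a bivector \<open>\<sigma>\<close> with matrix \<open>M\<close>.\<close>

definition pfv :: "real^5^5 \<Rightarrow> real^5"
  where "pfv M = (\<chi> k. M $ (k+1) $ (k+2) * M $ (k+3) $ (k+4) - M $ (k+1) $ (k+3) * M $ (k+2) $ (k+4)
    + M $ (k+1) $ (k+4) * M $ (k+2) $ (k+3))"

text \<open>The half is the \<open>1/4\<close> in \<open>xi\<close> times the \<open>2\<close> in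
  the Hodge dual of the square of the bivector.\<close>

definition xi_vec :: "real^3 \<Rightarrow> real^5"
  where "xi_vec s = (1/2) *\<^sub>R pfv (Kmat s)"

text \<open>The components are harmonic quadratic forms: this is the Veronese map, which sends the
  unit sphere of R^3 into the unit sphere of R^5.\<close>

lemma xi_vec_eq: "xi_vec s = mk5
   ((s$1 * s$1 + s$2 * s$2) / 2 - s$3 * s$3)
   (- sqrt 3 * (s$1 * s$2))
   (sqrt 3 * (s$1 * s$3))
   (sqrt 3 / 2 * (s$2 * s$2 - s$1 * s$1))
   (- sqrt 3 * (s$2 * s$3))"
  by (rule vec5_eqI) (auto simp: xi_vec_def pfv_def Kmat_nth algebra_simps)

lemma norm_xi_vec:
  assumes "s \<bullet> s = 1" shows "norm (xi_vec s) = 1"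
proof -
  have r: "sqrt 3 * (sqrt 3 * x) = 3 * x" for x :: real
    by (simp add: mult.assoc[symmetric])
  have "xi_vec s \<bullet> xi_vec s = (s \<bullet> s)\<^sup>2"
    by (simp add: xi_vec_eq inner_vec_def sum_5 sum_3 power2_eq_square field_simps r)
  then show ?thesis using assms by (simp add: norm_eq_sqrt_inner)
qed

text \<open>A skew 5x5 matrix annihilates its vector of Pfaffians. Here this means that the bivector
  lives on the orthogonal complement of xi.\<close>

lemma xi_vec_kernel: "(\<Sum>k\<in>UNIV. xi_vec s $ k * Kmat s $ k $ j) = 0"
proof -
  have r: "sqrt 3 * (sqrt 3 * x) = 3 * x" for x :: real
    by (simp add: mult.assoc[symmetric])
  have "j \<in> {1, 2, 3, 4, 5}" using exhaust_5 by auto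
  then show ?thesis
    by (auto simp: xi_vec_eq Kmat_nth sum_5 field_simps r)
qed

text \<open>Factoring out the rotation leaves an identity matrix with one changed column. So the
  last column of a rotation is the oriented cross product of the other four, which is the Hodge
  operator on 4-vectors.\<close>

lemma rotation_column_5:
  assumes R: "rotation_matrix (R :: real^5^5)"
  shows "det (\<chi> i j. if j = 5 then u $ i else R $ i $ j) = (\<Sum>i\<in>UNIV. R $ i $ 5 * u $ i)"
proof -
  have RR: "R ** transpose R = mat 1" and det: "det R = 1"
    using R by (auto simp: rotation_matrix_def orthogonal_matrix_def)
  define w where "w = transpose R *v u"
  have u: "R *v w = u" by (simp add: w_def matrix_vector_mul_assoc RR del: transpose_matrix_vector)
  let ?N = "\<chi> i j. if j = 5 then w $ i else if i = j then 1 else 0 :: real^5^5"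
  have "(\<chi> i j. if j = 5 then u $ i else R $ i $ j) = R ** ?N"
    unfolding u[symmetric]
    by (simp add: vec_eq_iff forall_5 sum_5 matrix_matrix_mult_def matrix_vector_mult_def)
  moreover have "det ?N = w $ 5"
    by (simp add: det_5 sum_5)
  ultimately show ?thesis
    by (simp add: det_mul det w_def matrix_vector_mult_def transpose_def del: transpose_matrix_vector)
qed

text \<open>The same factorisation with two changed columns, for the Hodge operator on bivectors of
  a 4-space.\<close>

lemma rotation_columns_4_5:
  assumes R: "rotation_matrix (R :: real^5^5)"
  shows "det (\<chi> i j. if j = 4 then u $ i else if j = 5 then w $ i else R $ i $ j) =
    (\<Sum>i\<in>UNIV. R $ i $ 4 * u $ i) * (\<Sum>i\<in>UNIV. R $ i $ 5 * w $ i)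
    - (\<Sum>i\<in>UNIV. R $ i $ 5 * u $ i) * (\<Sum>i\<in>UNIV. R $ i $ 4 * w $ i)"
proof -
  have RR: "R ** transpose R = mat 1" and det: "det R = 1"
    using R by (auto simp: rotation_matrix_def orthogonal_matrix_def)
  define u' w' where "u' = transpose R *v u" "w' = transpose R *v w"
  have u: "R *v u' = u" "R *v w' = w" by (simp_all add: u'_w'_def matrix_vector_mul_assoc RR del: transpose_matrix_vector)
  let ?N = "\<chi> i j. if j = 4 then u' $ i else if j = 5 then w' $ i else if i = j then 1 else 0 :: real^5^5"
  have "(\<chi> i j. if j = 4 then u $ i else if j = 5 then w $ i else R $ i $ j) = R ** ?N"
    unfolding u[symmetric]
    by (simp add: vec_eq_iff forall_5 sum_5 matrix_matrix_mult_def matrix_vector_mult_def)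
  moreover have "det ?N = u' $ 4 * w' $ 5 - u' $ 5 * w' $ 4"
    by (simp add: det_5 sum_5)
  ultimately show ?thesis
    by (simp add: det_mul det u'_w'_def matrix_vector_mult_def transpose_def del: transpose_matrix_vector)
qed

text \<open>The matrix of \<open>\<ast>(x \<and> M)\<close> for a vector \<open>x\<close> and a bivector with matrix \<open>M\<close>.\<close>

definition star :: "real^5 \<Rightarrow> real^5^5 \<Rightarrow> real^5^5"
  where "star x M = (let T = (\<lambda>c d e. x$c * M$d$e - x$d * M$c$e + x$e * M$c$d) in
    skew5 (T 3 4 5) (- T 2 4 5) (T 2 3 5) (- T 2 3 4) (T 1 4 5) (- T 1 3 5) (T 1 3 4) (T 1 2 5)
      (- T 1 2 4) (T 1 2 3))"

lemma skew_star [simp]: "skew (star x M)"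
  by (simp add: star_def Let_def)

lemma star_add: "star x (M + M') = star x M + star x M'"
  by (rule vec5_eqI, rule vec5_eqI) (auto simp: star_def Let_def skew5_def algebra_simps)

lemma star_scaleR: "star x (c *\<^sub>R M) = c *\<^sub>R star x M"
  by (rule vec5_eqI, rule vec5_eqI) (auto simp: star_def Let_def skew5_def algebra_simps)

lemma star_sum: "star x (\<Sum>i\<in>I. M i) = (\<Sum>i\<in>I. star x (M i))"
proof -
  have "linear (star x)" by (rule linearI) (simp_all add: star_add star_scaleR)
  then show ?thesis by (rule linear_sum)
qed

definition wedge_mat :: "real^5 \<Rightarrow> real^5 \<Rightarrow> real^5^5"
  where "wedge_mat x y = (\<chi> i j. x $ i * y $ j - x $ j * y $ i)"

lemma skew_wedge_mat [simp]: "skew (wedge_mat x y)"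
  by (simp add: skew_def wedge_mat_def)

text \<open>A polynomial identity in the first three columns; orthogonality enters only afterwards,
  when the determinant is evaluated for a rotation.\<close>

lemma det_star:
  "\<forall>a b. det (\<chi> i j. if j = 4 then axis a 1 $ i else if j = 5 then axis b 1 $ i else R $ i $ j) =
    star (column 1 R) (wedge_mat (column 2 R) (column 3 R)) $ a $ b"
  unfolding forall_5
  by (intro conjI; simp add: det_5 sum_5 axis_def star_def Let_def skew5_def wedge_mat_def column_def;
      (simp add: algebra_simps)?)

lemma star_rotation:
  assumes R: "rotation_matrix (R :: real^5^5)"
  shows "star (column 1 R) (wedge_mat (column 2 R) (column 3 R)) = wedge_mat (column 4 R) (column 5 R)"
proof (rule vec5_eqI, rule vec5_eqI)
  fix a b :: 5
  have "det (\<chi> i j. if j = 4 then axis a 1 $ i else if j = 5 then axis b 1 $ i else R $ i $ j) =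
      R $ a $ 4 * R $ b $ 5 - R $ a $ 5 * R $ b $ 4"
    unfolding rotation_columns_4_5[OF R] by (simp add: axis_def if_distrib cong: if_cong)
  then have "wedge_mat (column 4 R) (column 5 R) $ a $ b =
      det (\<chi> i j. if j = 4 then axis a 1 $ i else if j = 5 then axis b 1 $ i else R $ i $ j)"
    by (simp add: wedge_mat_def column_def)
  also have "\<dots> = star (column 1 R) (wedge_mat (column 2 R) (column 3 R)) $ a $ b"
    using det_star by blast
  finally show "star (column 1 R) (wedge_mat (column 2 R) (column 3 R)) $ a $ b =
      wedge_mat (column 4 R) (column 5 R) $ a $ b" ..
qed

text \<open>The factor is \<open>2 / (2 + \<epsilon>)\<close> from \<open>phi\<close> times the
  \<open>1/2\<close> of the dual part. Row \<open>i\<close> holds the image of the i-th frame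
  vector, so the endomorphism acts on row vectors.\<close>

definition phi_mat :: "real \<Rightarrow> real^3 \<Rightarrow> real^5^5"
  where "phi_mat \<epsilon> s = (1 / (2 + \<epsilon>)) *\<^sub>R (Kmat s + \<epsilon> *\<^sub>R star (xi_vec s) (Kmat s))"

section \<open>Manifolds with an irreducible SO(3)-structure in an adapted frame\<close>

context oriented_manifold5
begin

lemma chart_open: "(U, x) \<in> A \<Longrightarrow> open U" "(U, x) \<in> A \<Longrightarrow> open (x ` U)"
  using chart by blast+

lemma chart_inj: "(U, x) \<in> A \<Longrightarrow> inj_on x U"
  using chart unfolding homeomorphism_def by (metis inj_on_inverseI)

lemma chart_continuous: "(U, x) \<in> A \<Longrightarrow> continuous_on U x"
  using chart unfolding homeomorphism_def by blast

lemma chart_image_open: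
  assumes "(U, x) \<in> A" "open V" shows "open (x ` (U \<inter> V))"
proof -
  have "openin (top_of_set (x ` U)) (x ` (U \<inter> V))"
    by (rule homeomorphism_imp_open_map[where T = "x ` U"])
       (use chart[OF assms(1)] assms(2) in \<open>auto simp: openin_open\<close>)
  then show ?thesis using chart_open(2)[OF assms(1)] by (simp add: openin_open_eq)
qed

lemma param_nhds_chart:
  assumes "(U, x) \<in> A" "S \<subseteq> U" "open S" "p \<in> S"
  shows "param_nhds S x p = nhds p"
proof (rule filter_eqI)
  fix P
  show "eventually P (param_nhds S x p) \<longleftrightarrow> eventually P (nhds p)"
  proof
    assume "eventually P (param_nhds S x p)"
    then obtain W where W: "open W" "x p \<in> W" "\<forall>q\<in>S. x q \<in> W \<longrightarrow> P q"
      unfolding eventually_param_nhds by blast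
    have "continuous_on S x" using chart_continuous[OF assms(1)] assms(2) by (rule continuous_on_subset)
    then have "open (S \<inter> x -` W)"
      using continuous_open_preimage assms(3) W(1) by blast
    then show "eventually P (nhds p)"
      unfolding eventually_nhds using W assms(4) by (intro exI[of _ "S \<inter> x -` W"]) auto
  next
    assume "eventually P (nhds p)"
    then obtain V where V: "open V" "p \<in> V" "\<forall>q\<in>V. P q" unfolding eventually_nhds by blast
    show "eventually P (param_nhds S x p)"
    proof (rule eventually_param_nhdsI[OF chart_image_open[OF assms(1) V(1)]])
      show "x p \<in> x ` (U \<inter> V)" using V assms by auto
      show "P q" if "q \<in> S" "x q \<in> x ` (U \<inter> V)" for q
        using that V(3) inj_onD[OF chart_inj[OF assms(1)]] assms(2) by blast
    qed
  qed
qed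

text \<open>\<open>smooth_near\<close> lets the chart vary with the function; smooth transition maps
  reduce it to one fixed chart, and injectivity of that chart allows shrinking its domain to
  \<open>S\<close>.\<close>

lemma smooth_near_chart:
  assumes "(U, x) \<in> A" "S \<subseteq> U" "open S" "p \<in> S"
  shows "smooth_near A p f \<longleftrightarrow> smooth_via S x p f"
proof
  assume "smooth_via S x p f"
  then obtain W G where W: "open W" "x p \<in> W" "smooth_on W G" "\<forall>q\<in>S. x q \<in> W \<longrightarrow> f q = G (x q)"
    unfolding smooth_via_def by blast
  \<comment> \<open>By injectivity of \<open>x\<close>, the intersection with the image of
    \<open>S\<close> excludes the points of \<open>U\<close> outside \<open>S\<close>, where nothing
    is known about \<open>f\<close>.\<close>
  let ?W = "W \<inter> x ` (U \<inter> S)"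
  have "open ?W" using W(1) chart_image_open[OF assms(1,3)] by blast
  moreover have "f q = G (x q)" if r: "q \<in> U" "x q \<in> ?W" for q
  proof -
    obtain r where "r \<in> U \<inter> S" "x q = x r" using r(2) by auto
    then have "q \<in> S" using inj_onD[OF chart_inj[OF assms(1)] \<open>x q = x r\<close>] r(1) by blast
    then show ?thesis using W(4) r by blast
  qed
  ultimately show "smooth_near A p f"
    unfolding smooth_near_def
    using assms W by (intro bexI[of _ "(U, x)"]) (auto intro!: exI[of _ ?W] exI[of _ G] smooth_on_subset[of W])
next
  assume "smooth_near A p f"
  then have "\<exists>c\<in>A. smooth_near {c} p f"
    unfolding smooth_near_def by simp
  then obtain V y where V: "(V, y) \<in> A" "smooth_near {(V, y)} p f"
    by (metis prod.exhaust)
  then have f: "smooth_via V y p f" by (simp add: smooth_near_single)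
  then have "p \<in> V" by (rule smooth_via_mem)
  have "smooth_via S x p y"
    unfolding smooth_via_def
  proof (intro conjI exI[of _ "x ` (U \<inter> V)"] exI[of _ "y \<circ> inv_into U x"] ballI impI)
    show "open (x ` (U \<inter> V))" using chart_image_open[OF assms(1)] chart_open(1)[OF V(1)] by blast
    show "smooth_on (x ` (U \<inter> V)) (y \<circ> inv_into U x)"
      by (rule transition_smooth[OF assms(1) V(1)])
    show "y q = (y \<circ> inv_into U x) (x q)" if "q \<in> S" for q
      using that assms(2) chart_inj[OF assms(1)] by (auto simp: inv_into_f_f)
  qed (use assms \<open>p \<in> V\<close> in auto)
  moreover have "eventually (\<lambda>q. q \<in> V) (param_nhds S x p)"
    unfolding param_nhds_chart[OF assms] using chart_open(1)[OF V(1)] \<open>p \<in> V\<close> by (rule eventually_nhds_in_open)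
  ultimately show "smooth_via S x p f"
    using smooth_via_pullback[of V y "\<lambda>q. q" p f S x] f by simp
qed

end

text \<open>All computations take place over an open set \<open>S\<close> that lies in one chart
  domain and carries one adapted frame. The larger domain \<open>U\<close> is kept because the
  transition maps of the atlas are written with \<open>inv_into U x\<close>.\<close>

locale framed = SO3_connection A g \<Upsilon> D
  for A :: "('m::{t2_space, second_countable_topology}, real^5) chart set"
    and g :: "'m \<Rightarrow> 'm tvec \<Rightarrow> 'm tvec \<Rightarrow> real"
    and \<Upsilon> :: "'m \<Rightarrow> 'm tvec \<Rightarrow> 'm tvec \<Rightarrow> 'm tvec \<Rightarrow> real"
    and D :: "'m \<Rightarrow> 'm tvec \<Rightarrow> ('m \<Rightarrow> 'm tvec) \<Rightarrow> 'm tvec" +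
  fixes U S :: "'m set" and x :: "'m \<Rightarrow> real^5" and E :: "'m \<Rightarrow> 5 \<Rightarrow> 'm tvec"
  assumes chart_A: "(U, x) \<in> A"
    and S_open: "open S" and S_sub: "S \<subseteq> U"
    and E_vfield: "vfield_on A S (\<lambda>q. E q i)"
    and E_adapted: "q \<in> S \<Longrightarrow> adapted q (E q)"
begin

lemma smooth_near_iff: "q \<in> S \<Longrightarrow> smooth_near A q f \<longleftrightarrow> smooth_via S x q f"
  by (rule smooth_near_chart[OF chart_A S_sub S_open])

lemma param_nhds_eq: "q \<in> S \<Longrightarrow> param_nhds S x q = nhds q"
  by (rule param_nhds_chart[OF chart_A S_sub S_open])

lemma TM_eq: "q \<in> S \<Longrightarrow> TM q = TS S x q"
  by (rule tangent_space_cong) (simp add: smooth_near_iff smooth_near_single)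

lemma TM_subspace: "q \<in> S \<Longrightarrow> subspace (TM q)"
  using TS_subspace TM_eq by metis

lemmas TM_add = subspace_add[OF TM_subspace] and TM_scale = subspace_scale[OF TM_subspace]
  and TM_sum = subspace_sum[OF TM_subspace] and TM_0 = subspace_0[OF TM_subspace]

section \<open>Tangent vectors of the base in coordinates and frames\<close>

definition coord :: "'m tvec \<Rightarrow> real^5"
  where "coord v = (\<chi> i. v (\<lambda>r. x r $ i))"

lemma coord_scale: "coord (c *\<^sub>R v) = c *\<^sub>R coord v"
  by (simp add: coord_def vec_eq_iff scaleR_fun_def)

lemma coord_sum: "coord (\<Sum>i\<in>I. v i) = (\<Sum>i\<in>I. coord (v i))"
  by (simp add: coord_def vec_eq_iff sum_fun_apply)

lemma coord_basis: "(\<Sum>b\<in>Basis. v (\<lambda>q. x q \<bullet> b) *\<^sub>R b) = coord v"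
proof -
  have "coord v = (\<Sum>b\<in>Basis. (coord v \<bullet> b) *\<^sub>R b)" by (simp add: euclidean_representation)
  also have "\<dots> = (\<Sum>b\<in>Basis. v (\<lambda>q. x q \<bullet> b) *\<^sub>R b)"
    by (intro sum.cong) (auto simp: Basis_vec_def coord_def inner_axis)
  finally show ?thesis by simp
qed

text \<open>The chain rule expresses a derivation through its values on the five coordinate
  functions; on nonsmooth functions all tangent vectors vanish by definition.\<close>

lemma TM_eqI:
  assumes q: "q \<in> S" and v: "v \<in> TM q" "w \<in> TM q" and eq: "coord v = coord w"
  shows "v = w"
proof
  fix f
  show "v f = w f"
  proof (cases "smooth_via S x q f")
    case True
    then obtain W G where W: "open W" "x q \<in> W" "smooth_on W G" "\<forall>r\<in>S. x r \<in> W \<longrightarrow> f r = G (x r)"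
      unfolding smooth_via_def by blast
    have "u f = frechet_derivative G (at (x q)) (coord u)" if u: "u \<in> TM q" for u
    proof -
      have "u f = u (\<lambda>r. G (x r))"
        by (rule TS_local[OF u[unfolded TM_eq[OF q]] True]) (rule eventually_param_nhdsI[of W], use W in auto)
      then show ?thesis
        using TS_chain[where f = x, OF u[unfolded TM_eq[OF q]] smooth_via_param[OF q] W(1,3,2)] by (simp add: coord_basis)
    qed
    then show ?thesis using v eq by metis
  next
    case False
    then show ?thesis using TS_outside v TM_eq[OF q] by metis
  qed
qed

lemma g_sum:
  assumes q: "q \<in> S" and "\<And>i. i \<in> I \<Longrightarrow> v i \<in> TM q" and w: "w \<in> TM q"
  shows "g q (\<Sum>i\<in>I. v i) w = (\<Sum>i\<in>I. g q (v i) w)"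
  using assms(2)
proof (induction I rule: infinite_finite_induct)
  case (insert i I)
  then have "g q (v i + (\<Sum>i\<in>I. v i)) w = g q (v i) w + g q (\<Sum>i\<in>I. v i) w"
    using w q by (intro g_add TM_sum) auto
  also have "g q (\<Sum>i\<in>I. v i) w = (\<Sum>i\<in>I. g q (v i) w)"
    using insert by blast
  finally show ?case by (simp only: sum.insert[OF insert(1,2)])
qed (use g_scale[of 0 q w 0] w TM_0[OF q] in auto)

definition vec_of :: "(5 \<Rightarrow> 'm tvec) \<Rightarrow> real^5 \<Rightarrow> 'm tvec"
  where "vec_of a u = (\<Sum>i\<in>UNIV. u $ i *\<^sub>R a i)"

lemma vec_of_linear: "linear (vec_of a)"
  by (rule linearI) (simp_all add: vec_of_def scaleR_add_left sum.distrib scaleR_sum_right)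

lemmas vec_of_add = linear_add[OF vec_of_linear] and vec_of_scale = linear_cmul[OF vec_of_linear]
  and vec_of_sum = linear_sum[OF vec_of_linear] and vec_of_0 = linear_0[OF vec_of_linear]

lemma vec_of_axis [simp]: "vec_of a (axis i 1) = a i"
  by (simp add: vec_of_def axis_def if_distrib if_distribR cong: if_cong)

lemma vec_of_apply: "vec_of a u f = (\<Sum>i\<in>UNIV. u $ i * a i f)"
  by (simp add: vec_of_def sum_fun_apply scaleR_fun_def)

text \<open>The definition of orientation asks for some chart. Coordinates of tangent vectors
  transform by the Jacobian matrix of the transition map, whose determinant is positive, so the
  fixed chart shows the same sign.\<close>

lemma oriented_det:
  assumes q: "q \<in> S" and a: "\<And>i. a i \<in> TM q"
  shows "positively_oriented q a \<longleftrightarrow> 0 < det (\<chi> i j. coord (a j) $ i)"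
proof
  assume "0 < det (\<chi> i j. coord (a j) $ i)"
  then show "positively_oriented q a"
    unfolding positively_oriented_def
    using chart_A q S_sub by (intro bexI[of _ "(U, x)"]) (auto simp: coord_def)
next
  assume "positively_oriented q a"
  then obtain V y where V: "(V, y) \<in> A" "q \<in> V" "0 < det (\<chi> i j. a j (\<lambda>r. y r $ i))"
    unfolding positively_oriented_def by auto
  let ?H = "y \<circ> inv_into U x" and ?W = "x ` (U \<inter> V)"
  let ?J = "matrix (frechet_derivative ?H (at (x q)))"
  have W: "open ?W" "x q \<in> ?W"
    using chart_image_open[OF chart_A] chart_open(1)[OF V(1)] V(2) q S_sub by auto
  have sH: "smooth_on ?W ?H" by (rule transition_smooth[OF chart_A V(1)])
  have dH: "(?H has_derivative frechet_derivative ?H (at (x q))) (at (x q))"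
    by (rule smooth_on_has_derivative[OF sH W(2)])
  then have lin: "linear (frechet_derivative ?H (at (x q)))"
    using has_derivative_linear by blast
  have "a j (\<lambda>r. y r $ i) = (?J *v coord (a j)) $ i" for i j
  proof -
    have Hi: "smooth_on ?W (\<lambda>u. ?H u $ i)"
    proof (rule smooth_on_compose[OF W(1) open_UNIV _ sH])
      show "smooth_on UNIV (\<lambda>u::real^5. u $ i)"
        by (intro smooth_on_linear bounded_linear_vec_nth) auto
    qed auto
    have eq: "?H (x r) = y r" if "r \<in> S" for r
      using that S_sub chart_inj[OF chart_A] by (auto simp: inv_into_f_f)
    have sy: "smooth_via S x q (\<lambda>r. ?H (x r) $ i)"
      using smooth_via_compose[where f = x, OF smooth_via_param[OF q] W(1) Hi W(2)] .
    have "((\<lambda>u. ?H u $ i) has_derivative (\<lambda>h. frechet_derivative ?H (at (x q)) h $ i)) (at (x q))"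
      by (rule bounded_linear.has_derivative[OF bounded_linear_vec_nth dH])
    then have fd: "frechet_derivative (\<lambda>u. ?H u $ i) (at (x q)) =
        (\<lambda>h. frechet_derivative ?H (at (x q)) h $ i)"
      by (rule frechet_derivative_at[symmetric])
    have "a j (\<lambda>r. y r $ i) = a j (\<lambda>r. ?H (x r) $ i)"
      by (rule TS_local[OF a[unfolded TM_eq[OF q]] sy, symmetric])
         (rule eventually_mono[OF eventually_param_nhds_mem], simp add: eq del: o_apply)
    also have "\<dots> = frechet_derivative ?H (at (x q)) (coord (a j)) $ i"
      using TS_chain[where f = x, OF a[unfolded TM_eq[OF q]] smooth_via_param[OF q] W(1) Hi W(2)] by (simp only: coord_basis fd)
    finally show ?thesis using fun_cong[OF matrix_vector_mul(2)[OF lin]] by simp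
  qed
  then have "(\<chi> i j. a j (\<lambda>r. y r $ i)) = ?J ** (\<chi> i j. coord (a j) $ i)"
    by (simp add: vec_eq_iff matrix_matrix_mult_def matrix_vector_mult_def)
  then have "0 < det ?J * det (\<chi> i j. coord (a j) $ i)" using V(3) by (simp add: det_mul)
  moreover have "0 < det ?J" by (rule transition_oriented[OF chart_A V(1) W(2)])
  ultimately show "0 < det (\<chi> i j. coord (a j) $ i)" by (simp add: zero_less_mult_iff)
qed

context
  fixes q a
  assumes q: "q \<in> S" and onb: "oriented_onb q a"
begin

lemma onb_TM: "a i \<in> TM q"
  and onb_g: "g q (a i) (a j) = (if i = j then 1 else 0)"
  using onb by (auto simp: oriented_onb_def)

lemma onb_det: "0 < det (\<chi> i j. coord (a j) $ i)"
  using onb oriented_det[OF q onb_TM] by (simp add: oriented_onb_def)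

lemma vec_of_TM: "vec_of a u \<in> TM q"
  unfolding vec_of_def by (intro TM_sum TM_scale q onb_TM)

lemma g_ve_onb: "g q (vec_of a u) (a i) = u $ i"
  unfolding vec_of_def
  by (subst g_sum) (auto simp: q onb_TM TM_scale g_scale onb_g if_distrib cong: if_cong)

lemma coord_ve: "coord (vec_of a u) = (\<chi> i j. coord (a j) $ i) *v u"
  by (simp add: vec_of_def coord_sum coord_scale vec_eq_iff matrix_vector_mult_def mult.commute)

text \<open>That the five vectors span comes from the orientation: a positive coordinate determinant
  makes the matrix of coordinates invertible. Orthonormality then identifies the
  coefficients.\<close>

lemma onb_expand:
  assumes v: "v \<in> TM q" shows "vec_of a (\<chi> i. g q v (a i)) = v"
proof -
  let ?A = "\<chi> i j. coord (a j) $ i :: real^5^5"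
  have "invertible ?A" using onb_det by (simp add: invertible_det_nz)
  then obtain B where B: "?A ** B = mat 1" unfolding invertible_def by blast
  have "coord (vec_of a (B *v coord v)) = coord v"
    by (simp add: coord_ve matrix_vector_mul_assoc B)
  then have "v = vec_of a (B *v coord v)"
    using TM_eqI[OF q vec_of_TM v] by metis
  then show ?thesis
    using g_ve_onb by (metis vec_lambda_unique)
qed

lemma TM_ve:
  assumes "v \<in> TM q" obtains u where "v = vec_of a u"
  using onb_expand[OF assms] by metis

lemma g_ve: "g q (vec_of a u) (vec_of a w) = u \<bullet> w"
proof -
  have "g q (vec_of a w) (vec_of a u) = (\<Sum>i\<in>UNIV. w $ i * g q (a i) (vec_of a u))"
    unfolding vec_of_def[of a w] by (subst g_sum) (auto simp: q onb_TM TM_scale g_scale vec_of_TM)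
  also have "\<dots> = (\<Sum>i\<in>UNIV. w $ i * u $ i)"
    by (simp add: g_sym[OF onb_TM vec_of_TM] g_ve_onb)
  finally show ?thesis by (simp add: g_sym[OF vec_of_TM vec_of_TM, of u w] inner_vec_def mult.commute)
qed

lemma vec_of_inj: "vec_of a u = vec_of a w \<Longrightarrow> u = w"
  using g_ve_onb by (metis vec_eq_iff)

text \<open>The functions are linear in the chart coordinates, with coefficients from the inverse
  coordinate matrix. Vectors and multivectors are functionals here, so their components are read off
  by evaluation on these functions.\<close>

lemma onb_dual:
  obtains f where "\<And>i. smooth_via S x q (f i)" "\<And>u i. vec_of a u (f i) = u $ i"
proof -
  let ?A = "\<chi> i j. coord (a j) $ i :: real^5^5"
  have "invertible ?A" using onb_det by (simp add: invertible_det_nz)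
  then obtain B where B: "B ** ?A = mat 1" unfolding invertible_def by blast
  define f where "f i r = (\<Sum>k\<in>UNIV. B $ i $ k * x r $ k)" for i r
  have smooth_via: "smooth_via S x q (\<lambda>r. x r $ k)" for k by (intro smooth_via_nth smooth_via_param q)
  show ?thesis
  proof
    show "smooth_via S x q (f i)" for i
      unfolding f_def by (intro smooth_via_sum smooth_via_mult smooth_via_const smooth_via q)
    fix u i
    note T = vec_of_TM[of u, unfolded TM_eq[OF q]]
    have "vec_of a u (f i) = (\<Sum>k\<in>UNIV. B $ i $ k * coord (vec_of a u) $ k)"
      unfolding f_def
      by (subst TS_sum[OF T q]) (auto simp: TS_scale[OF T smooth_via] coord_def intro!: smooth_via_mult smooth_via_const smooth_via q)
    also have "\<dots> = (B *v (?A *v u)) $ i"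
      by (simp add: coord_ve matrix_vector_mult_def)
    also have "\<dots> = u $ i" by (simp add: matrix_vector_mul_assoc B)
    finally show "vec_of a u (f i) = u $ i" .
  qed
qed

end

section \<open>Bivectors as skew matrices\<close>

text \<open>With the half, an entry of a skew matrix above the diagonal is the coefficient of the
  corresponding wedge product; on skew matrices the representation is faithful.\<close>

definition bivec_of :: "(5 \<Rightarrow> 'm tvec) \<Rightarrow> real^5^5 \<Rightarrow> 'm bivec"
  where "bivec_of a M = (1/2) *\<^sub>R (\<Sum>i\<in>UNIV. \<Sum>j\<in>UNIV. M $ i $ j *\<^sub>R (a i \<and>\<^sub>1 a j))"

lemma bivec_of_linear: "linear (bivec_of a)"
  by (rule linearI) (simp_all add: bivec_of_def scaleR_add_left scaleR_add_right sum.distrib scaleR_sum_right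
      scaleR_left_commute)

lemmas bivec_of_add = linear_add[OF bivec_of_linear] and bivec_of_scale = linear_cmul[OF bivec_of_linear]
  and bivec_of_sum = linear_sum[OF bivec_of_linear] and bivec_of_0 = linear_0[OF bivec_of_linear]

lemma bivec_of_apply: "bivec_of a M f h = (\<Sum>i\<in>UNIV. \<Sum>j\<in>UNIV. M $ i $ j * (a i f * a j h - a i h * a j f)) / 2"
  by (simp add: bivec_of_def sum_fun_apply scaleR_fun_def wedge_def)

lemma bivec_of_apply_skew:
  assumes "skew M"
  shows "bivec_of a M f h = (\<Sum>i\<in>UNIV. \<Sum>j\<in>UNIV. M $ i $ j * (a i f * a j h))"
proof -
  have "(\<Sum>i\<in>UNIV. \<Sum>j\<in>UNIV. M $ i $ j * (a i h * a j f)) = (\<Sum>j\<in>UNIV. \<Sum>i\<in>UNIV. M $ i $ j * (a i h * a j f))"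
    by (rule sum.swap)
  also have "\<dots> = (\<Sum>i\<in>UNIV. \<Sum>j\<in>UNIV. - (M $ i $ j * (a i f * a j h)))"
    using assms unfolding skew_def
    by (intro sum.cong refl) (metis mult.commute mult_minus_left)
  finally show ?thesis
    by (simp add: bivec_of_apply right_diff_distrib sum_subtractf sum_negf)
qed

lemma bivec_of_dual:
  assumes "skew M" "\<And>i j. a i (f j) = (if i = j then 1 else 0)"
  shows "bivec_of a M (f i) (f j) = M $ i $ j"
  using exhaust_5[of i] exhaust_5[of j] by (auto simp: bivec_of_apply_skew[OF assms(1)] assms(2) sum_5)

lemma wedge_ve: "vec_of a u \<and>\<^sub>1 vec_of a w = bivec_of a (wedge_mat u w)"
proof (intro ext)
  fix f h
  have "(vec_of a u \<and>\<^sub>1 vec_of a w) f h = (\<Sum>i\<in>UNIV. \<Sum>j\<in>UNIV. u $ i * w $ j * (a i f * a j h))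
      - (\<Sum>i\<in>UNIV. \<Sum>j\<in>UNIV. u $ i * w $ j * (a i h * a j f))"
    by (simp add: wedge_def vec_of_apply sum_product algebra_simps)
  also have "(\<Sum>i\<in>UNIV. \<Sum>j\<in>UNIV. u $ i * w $ j * (a i h * a j f)) =
      (\<Sum>i\<in>UNIV. \<Sum>j\<in>UNIV. u $ j * w $ i * (a i f * a j h))"
    by (subst sum.swap) (simp add: algebra_simps)
  finally show "(vec_of a u \<and>\<^sub>1 vec_of a w) f h = bivec_of a (wedge_mat u w) f h"
    by (simp add: bivec_of_apply_skew sum_subtractf[symmetric]) (simp add: wedge_mat_def algebra_simps)
qed

lemma kappa_comb_eq: "kappa_comb a s = bivec_of a (Kmat s)"
  by (intro ext) (simp add: kappa_comb_def kappa1_def kappa2_def kappa3_def bivec_of_apply sum_5 Kmat_nth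
      wedge_def scaleR_fun_def algebra_simps)

end

lemma mdot_wedge_mat: "mdot (wedge_mat a b) (wedge_mat c d) = (a \<bullet> c) * (b \<bullet> d) - (a \<bullet> d) * (b \<bullet> c)"
proof -
  have 1: "(\<Sum>i\<in>UNIV. \<Sum>j\<in>UNIV. u $ i * v $ j * (w $ i * z $ j)) = (u \<bullet> w) * (v \<bullet> z)" for u v w z :: "real^5"
    by (simp add: inner_vec_def sum_product mult_ac)
  have 2: "(\<Sum>i\<in>UNIV. \<Sum>j\<in>UNIV. u $ j * v $ i * (w $ i * z $ j)) = (u \<bullet> z) * (v \<bullet> w)" for u v w z :: "real^5"
    by (subst sum.swap) (simp add: inner_vec_def sum_product mult_ac)
  have 3: "(\<Sum>i\<in>UNIV. \<Sum>j\<in>UNIV. u $ i * v $ j * (w $ j * z $ i)) = (u \<bullet> z) * (v \<bullet> w)" for u v w z :: "real^5"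
    by (simp add: inner_vec_def sum_product mult_ac)
  have 4: "(\<Sum>i\<in>UNIV. \<Sum>j\<in>UNIV. u $ j * v $ i * (w $ j * z $ i)) = (u \<bullet> w) * (v \<bullet> z)" for u v w z :: "real^5"
    by (subst sum.swap) (simp add: inner_vec_def sum_product mult_ac)
  show ?thesis
    by (simp add: mdot_def wedge_mat_def left_diff_distrib right_diff_distrib sum_subtractf 1 2 3 4 inner_commute)
qed

lemma mdot_wedge_mat_right:
  assumes "skew M" shows "mdot M (wedge_mat u w) = (\<Sum>i\<in>UNIV. \<Sum>j\<in>UNIV. M $ i $ j * u $ i * w $ j)"
proof -
  have "(\<Sum>i\<in>UNIV. \<Sum>j\<in>UNIV. M $ i $ j * (u $ j * w $ i)) = (\<Sum>j\<in>UNIV. \<Sum>i\<in>UNIV. M $ i $ j * (u $ j * w $ i))"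
    by (rule sum.swap)
  also have "\<dots> = (\<Sum>j\<in>UNIV. \<Sum>i\<in>UNIV. - (M $ j $ i * u $ j * w $ i))"
    using assms unfolding skew_def by (intro sum.cong refl) (metis mult.assoc mult_minus_left)
  finally show ?thesis
    by (simp add: mdot_def wedge_mat_def right_diff_distrib sum_subtractf sum_negf mult.assoc)
qed

lemma mdot_sum:
  "mdot (\<Sum>k\<in>I. M k) M' = (\<Sum>k\<in>I. mdot (M k) M')" "mdot M' (\<Sum>k\<in>I. M k) = (\<Sum>k\<in>I. mdot M' (M k))"
proof -
  have "linear (\<lambda>M. mdot M M')" "linear (mdot M')"
    by (auto intro!: linearI simp: mdot_def sum.distrib distrib_left distrib_right add_divide_distrib
        sum_distrib_left mult_ac)
  then show "mdot (\<Sum>k\<in>I. M k) M' = (\<Sum>k\<in>I. mdot (M k) M')" "mdot M' (\<Sum>k\<in>I. M k) = (\<Sum>k\<in>I. mdot M' (M k))"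
    using linear_sum by blast+
qed

lemma skewD: "skew M \<Longrightarrow> M $ i $ j = - M $ j $ i"
  unfolding skew_def by blast

lemma skew_sum: "(\<And>i. i \<in> I \<Longrightarrow> skew (M i)) \<Longrightarrow> skew (\<Sum>i\<in>I. M i)"
proof (unfold skew_def[of "sum M I"], intro allI)
  fix a b assume "\<And>i. i \<in> I \<Longrightarrow> skew (M i)"
  then have "(\<Sum>i\<in>I. M i $ a $ b) = (\<Sum>i\<in>I. - M i $ b $ a)"
    by (intro sum.cong refl skewD)
  then show "(\<Sum>i\<in>I. M i) $ a $ b = - (\<Sum>i\<in>I. M i) $ b $ a"
    by (simp add: sum_negf)
qed

lemma skew_add: "skew M \<Longrightarrow> skew M' \<Longrightarrow> skew (M + M')"
proof (unfold skew_def, intro allI)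
  fix i j assume "\<forall>i j. M $ i $ j = - M $ j $ i" "\<forall>i j. M' $ i $ j = - M' $ j $ i"
  then have "M $ i $ j = - M $ j $ i" "M' $ i $ j = - M' $ j $ i" by blast+
  then show "(M + M') $ i $ j = - (M + M') $ j $ i" by simp
qed

lemma skew_scaleR: "skew M \<Longrightarrow> skew (c *\<^sub>R M)"
proof (unfold skew_def, intro allI)
  fix i j assume "\<forall>i j. M $ i $ j = - M $ j $ i"
  then have "M $ i $ j = - M $ j $ i" by blast
  then show "(c *\<^sub>R M) $ i $ j = - (c *\<^sub>R M) $ j $ i" by simp
qed

lemma skew_conj: "skew M \<Longrightarrow> skew (R ** M ** transpose R)"
  unfolding skew_def
proof (intro allI)
  fix i j assume M: "\<forall>i j. M $ i $ j = - M $ j $ i"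
  have "(R ** M ** transpose R) $ i $ j = (\<Sum>l\<in>UNIV. \<Sum>k\<in>UNIV. R $ i $ k * M $ k $ l * R $ j $ l)"
    by (simp add: matrix_matrix_mult_def transpose_def sum_distrib_right)
  also have "\<dots> = (\<Sum>k\<in>UNIV. \<Sum>l\<in>UNIV. R $ i $ k * M $ k $ l * R $ j $ l)"
    by (rule sum.swap)
  also have "\<dots> = (\<Sum>k\<in>UNIV. \<Sum>l\<in>UNIV. - (R $ j $ l * M $ l $ k * R $ i $ k))"
    by (intro sum.cong refl) (metis (no_types, lifting) M mult.commute mult.assoc mult_minus_left mult_minus_right)
  also have "\<dots> = - (R ** M ** transpose R) $ j $ i"
    by (simp add: matrix_matrix_mult_def transpose_def sum_distrib_right sum_negf)
  finally show "(R ** M ** transpose R) $ i $ j = - (R ** M ** transpose R) $ j $ i" .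
qed

lemma conj_wedge_mat:
  assumes "skew M"
  shows "(1/2) *\<^sub>R (\<Sum>i\<in>UNIV. \<Sum>j\<in>UNIV. M $ i $ j *\<^sub>R wedge_mat (column i R) (column j R)) =
    R ** M ** transpose R"
proof -
  have "((1/2) *\<^sub>R (\<Sum>i\<in>UNIV. \<Sum>j\<in>UNIV. M $ i $ j *\<^sub>R wedge_mat (column i R) (column j R))) $ a $ b =
      (R ** M ** transpose R) $ a $ b" for a b
  proof -
    have "(\<Sum>i\<in>UNIV. \<Sum>j\<in>UNIV. M $ i $ j * (R $ b $ i * R $ a $ j)) =
        (\<Sum>j\<in>UNIV. \<Sum>i\<in>UNIV. M $ i $ j * (R $ b $ i * R $ a $ j))"
      by (rule sum.swap)
    also have "\<dots> = (\<Sum>j\<in>UNIV. \<Sum>i\<in>UNIV. - (M $ j $ i * (R $ a $ j * R $ b $ i)))"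
      using assms unfolding skew_def
      by (intro sum.cong refl) (metis mult.commute mult_minus_left)
    moreover have "(R ** M ** transpose R) $ a $ b = (\<Sum>i\<in>UNIV. \<Sum>j\<in>UNIV. M $ i $ j * (R $ a $ i * R $ b $ j))"
      by (subst sum.swap) (simp add: matrix_matrix_mult_def transpose_def sum_distrib_left mult_ac)
    ultimately show ?thesis
      by (simp add: wedge_mat_def column_def right_diff_distrib sum_subtractf sum_negf)
  qed
  then show ?thesis by (simp add: vec_eq_iff)
qed

definition perm_mat :: "('n \<Rightarrow> 'n) \<Rightarrow> real^'n^'n"
  where "perm_mat \<pi> = (\<chi> i j. if i = \<pi> j then 1 else 0)"

lemma column_perm_mat: "column j (perm_mat \<pi>) = axis (\<pi> j) 1"
  by (simp add: perm_mat_def column_def axis_def)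

lemma orthogonal_perm_mat: "inj \<pi> \<Longrightarrow> transpose (perm_mat \<pi>) ** perm_mat \<pi> = mat 1"
proof -
  assume "inj \<pi>"
  have "(if k = \<pi> i then 1 else 0) * (if k = \<pi> j then 1 else 0) =
      (if k = \<pi> i then if i = j then 1 else 0 else 0 :: real)" for i j k
    using \<open>inj \<pi>\<close> by (auto dest: injD)
  then show ?thesis
    by (simp add: vec_eq_iff matrix_matrix_mult_def transpose_def mat_def perm_mat_def)
qed

text \<open>The Hodge operators are defined through oriented bases, so only even permutations
  qualify. The first six fix the index 1 and bring each of the six pairs from 2, ..., 5 to the
  places 2 and 3; the last one moves the index 1 to the fifth place.\<close>

lemma rotation_perm_mat:
  assumes "\<pi> \<in> {($) (mk5 1 2 3 4 5), ($) (mk5 1 2 4 5 3), ($) (mk5 1 2 5 3 4), ($) (mk5 1 3 4 2 5),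
     ($) (mk5 1 3 5 4 2), ($) (mk5 1 4 5 2 3), ($) (mk5 2 3 4 5 (1::5))}"
  shows "rotation_matrix (perm_mat \<pi>)"
proof -
  have "inj \<pi>"
    using assms by (elim insertE emptyE; simp add: inj_def forall_5)
  moreover have "det (perm_mat \<pi>) = 1"
    using assms by (elim insertE emptyE; simp add: det_5 sum_5 perm_mat_def)
  ultimately show ?thesis
    by (simp add: rotation_matrix_def orthogonal_matrix orthogonal_perm_mat)
qed

text \<open>In cyclic indices the cofactor of the last column is a component of the 4-vector formed
  by the first four columns.\<close>

lemma det_column_5:
  fixes R :: "real^5^5"
  shows "det (\<chi> i j. if j = 5 then axis k 1 $ i else R $ i $ j) =
    (R $ (k+1) $ 1 * R $ (k+2) $ 2 - R $ (k+2) $ 1 * R $ (k+1) $ 2) * (R $ (k+3) $ 3 * R $ (k+4) $ 4 - R $ (k+4) $ 3 * R $ (k+3) $ 4)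
    - (R $ (k+1) $ 1 * R $ (k+3) $ 2 - R $ (k+3) $ 1 * R $ (k+1) $ 2) * (R $ (k+2) $ 3 * R $ (k+4) $ 4 - R $ (k+4) $ 3 * R $ (k+2) $ 4)
    + (R $ (k+1) $ 1 * R $ (k+4) $ 2 - R $ (k+4) $ 1 * R $ (k+1) $ 2) * (R $ (k+2) $ 3 * R $ (k+3) $ 4 - R $ (k+3) $ 3 * R $ (k+2) $ 4)
    + (R $ (k+2) $ 1 * R $ (k+3) $ 2 - R $ (k+3) $ 1 * R $ (k+2) $ 2) * (R $ (k+1) $ 3 * R $ (k+4) $ 4 - R $ (k+4) $ 3 * R $ (k+1) $ 4)
    - (R $ (k+2) $ 1 * R $ (k+4) $ 2 - R $ (k+4) $ 1 * R $ (k+2) $ 2) * (R $ (k+1) $ 3 * R $ (k+3) $ 4 - R $ (k+3) $ 3 * R $ (k+1) $ 4)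
    + (R $ (k+3) $ 1 * R $ (k+4) $ 2 - R $ (k+4) $ 1 * R $ (k+3) $ 2) * (R $ (k+1) $ 3 * R $ (k+2) $ 4 - R $ (k+2) $ 3 * R $ (k+1) $ 4)"
    (is "?l k = ?r k")
proof -
  have "\<forall>k. ?l k = ?r k"
    unfolding forall_5 by (intro conjI; simp add: det_5 sum_5 axis_def)
  then show ?thesis by blast
qed

context framed
begin

lemma E_onb: "q \<in> S \<Longrightarrow> oriented_onb q (E q)"
  using E_adapted by (simp add: adapted_def)

text \<open>Duality to the frame holds at \<open>q\<close> alone; at other points these are just
  smooth functions, which is enough for reading off components at \<open>q\<close>.\<close>

definition dual_fun :: "'m \<Rightarrow> 5 \<Rightarrow> 'm \<Rightarrow> real"
  where "dual_fun q = (SOME f. \<forall>i. smooth_via S x q (f i) \<and> (\<forall>u. vec_of (E q) u (f i) = u $ i))"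

lemma dual_fun:
  assumes "q \<in> S"
  shows "smooth_via S x q (dual_fun q i)" "vec_of (E q) u (dual_fun q i) = u $ i"
proof -
  have "\<exists>f. \<forall>i. smooth_via S x q (f i) \<and> (\<forall>u. vec_of (E q) u (f i) = u $ i)"
    by (rule onb_dual[OF assms E_onb[OF assms]]) blast
  from someI_ex[OF this] show "smooth_via S x q (dual_fun q i)" "vec_of (E q) u (dual_fun q i) = u $ i"
    unfolding dual_fun_def by blast+
qed

lemma E_dual_fun: "q \<in> S \<Longrightarrow> E q i (dual_fun q j) = (if i = j then 1 else 0)"
  using dual_fun(2)[of q "axis i 1" j] unfolding vec_of_axis by (auto simp: axis_def)

lemma bivec_of_dual_fun: "q \<in> S \<Longrightarrow> skew M \<Longrightarrow> bivec_of (E q) M (dual_fun q i) (dual_fun q j) = M $ i $ j"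
  by (rule bivec_of_dual) (auto simp: E_dual_fun)

lemma bivec_of_inj:
  assumes "q \<in> S" "bivec_of (E q) M = bivec_of (E q) M'" "skew M" "skew M'"
  shows "M = M'"
proof -
  have "M $ i $ j = M' $ i $ j" for i j
    using bivec_of_dual_fun[OF assms(1,3)] bivec_of_dual_fun[OF assms(1,4)] assms(2) by metis
  then show ?thesis by (simp add: vec_eq_iff)
qed

abbreviation comps :: "'m \<Rightarrow> 'm tvec \<Rightarrow> real^5"
  where "comps q v \<equiv> (\<chi> i. g q v (E q i))"

lemma vec_of_comps: "q \<in> S \<Longrightarrow> v \<in> TM q \<Longrightarrow> vec_of (E q) (comps q v) = v"
  using onb_expand[OF _ E_onb] by blast

lemma wedge_comps: "q \<in> S \<Longrightarrow> v \<in> TM q \<Longrightarrow> w \<in> TM q \<Longrightarrow>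
    v \<and>\<^sub>1 w = bivec_of (E q) (wedge_mat (comps q v) (comps q w))"
  using wedge_ve[of "E q" "comps q v" "comps q w"] by (simp add: vec_of_comps)

lemma sum_wedge_comps:
  assumes "q \<in> S" "\<forall>k<n. X k \<in> TM q \<and> Y k \<in> TM q"
  shows "(\<Sum>k<(n::nat). X k \<and>\<^sub>1 Y k) = bivec_of (E q) (\<Sum>k<n. wedge_mat (comps q (X k)) (comps q (Y k)))"
  unfolding bivec_of_sum using assms by (intro sum.cong refl wedge_comps) auto

text \<open>The definitions index sums by natural numbers, the frames by the type \<open>5\<close>;
  \<open>of_nat\<close> matches 0, ..., 4 with the five indices, 0 going to the fifth.\<close>

lemma sum_lessThan_5: "(\<Sum>k<(5::nat). h (of_nat k :: 5)) = sum h UNIV"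
proof -
  have "h 5 = h 0" by (rule arg_cong[of _ _ h]) simp
  then show ?thesis by (simp add: eval_nat_numeral sum_5 ac_simps)
qed

text \<open>Pairing each frame vector with half of the corresponding row gives five simple
  bivectors. They are the witnesses for definite descriptions that speak of decompositions.\<close>

lemma bivec_of_representable:
  assumes "skew M"
  shows "bivec_of (E q) M = (\<Sum>k<(5::nat). E q (of_nat k) \<and>\<^sub>1 vec_of (E q) (\<chi> j. M $ (of_nat k) $ j / 2))"
proof -
  have "bivec_of (E q) M f h = (\<Sum>i\<in>UNIV. (E q i \<and>\<^sub>1 vec_of (E q) (\<chi> j. M $ i $ j / 2)) f h)" for f h
    by (simp add: bivec_of_apply wedge_def vec_of_apply sum_distrib_left sum_subtractf[symmetric] sum_divide_distrib field_simps)
  then show ?thesis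
    using sum_lessThan_5[of "\<lambda>i. E q i \<and>\<^sub>1 vec_of (E q) (\<chi> j. M $ i $ j / 2)"]
    by (simp add: fun_eq_iff sum_fun_apply)
qed

text \<open>Every decomposition into simple bivectors has the same skew matrix, so the double sum in
  the definition depends only on the two matrices.\<close>

lemma biv_inner_bv:
  assumes q: "q \<in> S" and M: "skew M" "skew M'"
  shows "biv_inner q (bivec_of (E q) M) (bivec_of (E q) M') = mdot M M'"
  unfolding biv_inner_def
proof (rule the_equality)
  have eq: "(\<Sum>k<n. \<Sum>l<m. g q (x k) (u l) * g q (y k) (v l) - g q (x k) (v l) * g q (y k) (u l)) = mdot M M'"
    if "\<forall>k<n. x k \<in> TM q \<and> y k \<in> TM q" "\<forall>l<m. u l \<in> TM q \<and> v l \<in> TM q"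
      "bivec_of (E q) M = (\<Sum>k<n. x k \<and>\<^sub>1 y k)" "bivec_of (E q) M' = (\<Sum>l<m. u l \<and>\<^sub>1 v l)"
    for n m :: nat and x y u v
  proof -
    have "M = (\<Sum>k<n. wedge_mat (comps q (x k)) (comps q (y k)))"
      using sum_wedge_comps[OF q that(1)] that(3) M by (intro bivec_of_inj[OF q]) (auto intro: skew_sum)
    moreover have "M' = (\<Sum>l<m. wedge_mat (comps q (u l)) (comps q (v l)))"
      using sum_wedge_comps[OF q that(2)] that(4) M by (intro bivec_of_inj[OF q]) (auto intro: skew_sum)
    moreover have "g q a b = comps q a \<bullet> comps q b" if "a \<in> TM q" "b \<in> TM q" for a b
      using g_ve[OF q E_onb[OF q], of "comps q a" "comps q b"] that by (simp add: vec_of_comps q)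
    ultimately show ?thesis
      using that(1,2) by (simp add: mdot_sum mdot_wedge_mat) (rule sum.swap)
  qed
  note T = onb_TM[OF q E_onb[OF q]] vec_of_TM[OF q E_onb[OF q]]
  show "\<exists>(n::nat) (m::nat) x y u v.
    (\<forall>k<n. x k \<in> TM q \<and> y k \<in> TM q) \<and> (\<forall>l<m. u l \<in> TM q \<and> v l \<in> TM q) \<and>
    bivec_of (E q) M = (\<Sum>k<n. x k \<and>\<^sub>1 y k) \<and> bivec_of (E q) M' = (\<Sum>l<m. u l \<and>\<^sub>1 v l) \<and>
    mdot M M' = (\<Sum>k<n. \<Sum>l<m. g q (x k) (u l) * g q (y k) (v l) - g q (x k) (v l) * g q (y k) (u l))"
    using bivec_of_representable[OF M(1), of q] bivec_of_representable[OF M(2), of q]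
    by (intro exI[of _ 5] exI conjI eq[symmetric]) (auto simp: T q)
  show "r = mdot M M'" if "\<exists>(n::nat) (m::nat) x y u v.
    (\<forall>k<n. x k \<in> TM q \<and> y k \<in> TM q) \<and> (\<forall>l<m. u l \<in> TM q \<and> v l \<in> TM q) \<and>
    bivec_of (E q) M = (\<Sum>k<n. x k \<and>\<^sub>1 y k) \<and> bivec_of (E q) M' = (\<Sum>l<m. u l \<and>\<^sub>1 v l) \<and>
    r = (\<Sum>k<n. \<Sum>l<m. g q (x k) (u l) * g q (y k) (v l) - g q (x k) (v l) * g q (y k) (u l))" for r
    using that by (elim exE conjE) (simp only: eq)
qed

subsection \<open>Change of frame\<close>

definition rotated_frame :: "'m \<Rightarrow> real^5^5 \<Rightarrow> 5 \<Rightarrow> 'm tvec"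
  where "rotated_frame q R j = vec_of (E q) (column j R)"

lemma vec_of_fr: "vec_of (rotated_frame q R) u = vec_of (E q) (R *v u)"
proof -
  have "vec_of (rotated_frame q R) u = vec_of (E q) (\<Sum>j\<in>UNIV. u $ j *\<^sub>R column j R)"
    by (simp add: vec_of_def[of "rotated_frame q R"] rotated_frame_def vec_of_sum vec_of_scale)
  also have "(\<Sum>j\<in>UNIV. u $ j *\<^sub>R column j R) = R *v u"
    by (simp add: vec_eq_iff matrix_vector_mult_def column_def mult.commute)
  finally show ?thesis .
qed

lemma bivec_of_fr:
  assumes "skew M" shows "bivec_of (rotated_frame q R) M = bivec_of (E q) (R ** M ** transpose R)"
  by (simp add: bivec_of_def[of "rotated_frame q R"] rotated_frame_def wedge_ve flip: conj_wedge_mat[OF assms])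
     (simp add: bivec_of_scale bivec_of_sum)

lemma rotated_frame_mult: "rotated_frame q (R ** P) j = vec_of (rotated_frame q R) (column j P)"
  by (simp add: vec_of_fr rotated_frame_def) (rule arg_cong[of _ _ "vec_of (E q)"],
    simp add: vec_eq_iff column_def matrix_matrix_mult_def matrix_vector_mult_def)

lemma rotated_frame_perm: "rotated_frame q (R ** perm_mat \<pi>) = (\<lambda>j. rotated_frame q R (\<pi> j))"
  by (rule ext) (simp add: rotated_frame_mult column_perm_mat)

lemma rotation_mult:
  fixes R P :: "real^'n^'n"
  shows "rotation_matrix R \<Longrightarrow> rotation_matrix P \<Longrightarrow> rotation_matrix (R ** P)"
  unfolding rotation_matrix_def by (simp add: orthogonal_matrix_mul(1) det_mul)

lemma coord_fr_det:
  assumes "q \<in> S"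
  shows "det (\<chi> i j. coord (rotated_frame q R j) $ i) = det (\<chi> i j. coord (E q j) $ i) * det R"
proof -
  have "(\<chi> i j. coord (rotated_frame q R j) $ i) = (\<chi> i j. coord (E q j) $ i) ** R"
    by (simp add: vec_eq_iff rotated_frame_def coord_ve[OF assms E_onb[OF assms]] matrix_vector_mult_def
        matrix_matrix_mult_def column_def)
  then show ?thesis by (simp add: det_mul)
qed

lemma g_fr: "q \<in> S \<Longrightarrow> g q (rotated_frame q R i) (rotated_frame q R j) = (transpose R ** R) $ i $ j"
  by (simp add: rotated_frame_def g_ve E_onb inner_vec_def column_def matrix_matrix_mult_def transpose_def)

lemma rotated_frame_onb:
  assumes q: "q \<in> S" and R: "rotation_matrix R"
  shows "oriented_onb q (rotated_frame q R)"
proof -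
  have T: "rotated_frame q R j \<in> TM q" for j unfolding rotated_frame_def by (rule vec_of_TM[OF q E_onb[OF q]])
  have "g q (rotated_frame q R i) (rotated_frame q R j) = (if i = j then 1 else 0)" for i j
    using R g_fr[OF q] by (simp add: rotation_matrix_def orthogonal_matrix mat_def)
  moreover have "positively_oriented q (rotated_frame q R)"
    using R onb_det[OF q E_onb[OF q]]
    by (simp add: oriented_det[OF q T] coord_fr_det[OF q] rotation_matrix_def)
  ultimately show ?thesis using T by (simp add: oriented_onb_def)
qed

text \<open>The columns of \<open>R\<close> are the components of the new basis. Orthonormality
  makes \<open>R\<close> orthogonal, and comparing the two positive coordinate determinants fixes
  the sign of its determinant.\<close>

lemma onb_fr:
  assumes q: "q \<in> S" and b: "oriented_onb q b"
  obtains R where "rotation_matrix R" "b = rotated_frame q R"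
proof -
  define R where "R = (\<chi> i j. g q (b j) (E q i))"
  have "rotated_frame q R j = vec_of (E q) (comps q (b j))" for j
    by (simp add: rotated_frame_def R_def column_def)
  then have bR: "b = rotated_frame q R" using vec_of_comps[OF q onb_TM[OF q b]] by auto
  have "transpose R ** R = mat 1"
    using onb_g[OF q b] g_fr[OF q, of R] bR by (simp add: vec_eq_iff mat_def)
  then have orth: "orthogonal_matrix R" by (simp add: orthogonal_matrix)
  have "0 < det (\<chi> i j. coord (E q j) $ i) * det R"
    using onb_det[OF q b] coord_fr_det[OF q, of R] bR by simp
  then have "0 < det R" using onb_det[OF q E_onb[OF q]] by (simp add: zero_less_mult_iff)
  then have "rotation_matrix R"
    using orth det_orthogonal_matrix[OF orth] by (auto simp: rotation_matrix_def)
  then show ?thesis using that bR by blast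
qed

lemma rotated_frame_dual_fun: "q \<in> S \<Longrightarrow> rotated_frame q R j (dual_fun q i) = R $ i $ j"
  by (simp add: rotated_frame_def dual_fun(2) column_def)

section \<open>The Hodge operators and the vector xi\<close>

text \<open>The cross product property of rotations recovers the fifth vector from the 4-vector of
  the others, by an expression that is linear in this 4-vector; linearity is what makes
  \<open>hodge4\<close> well defined.\<close>

lemma fourvec_5:
  assumes q: "q \<in> S" and b: "oriented_onb q b"
  shows "b 5 = vec_of (E q) (\<chi> k. ((b 1 \<and>\<^sub>1 b 2) \<and>\<^sub>2 (b 3 \<and>\<^sub>1 b 4)) (dual_fun q (k+1)) (dual_fun q (k+2)) (dual_fun q (k+3)) (dual_fun q (k+4)))"
proof -
  obtain R where R: "rotation_matrix R" "b = rotated_frame q R" using onb_fr[OF q b] .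
  have "R $ k $ 5 = ((b 1 \<and>\<^sub>1 b 2) \<and>\<^sub>2 (b 3 \<and>\<^sub>1 b 4)) (dual_fun q (k+1)) (dual_fun q (k+2)) (dual_fun q (k+3)) (dual_fun q (k+4))" for k
  proof -
    have "R $ k $ 5 = det (\<chi> i j. if j = 5 then axis k 1 $ i else R $ i $ j)"
      unfolding rotation_column_5[OF R(1)] by (simp add: axis_def if_distrib cong: if_cong)
    also have "\<dots> = ((b 1 \<and>\<^sub>1 b 2) \<and>\<^sub>2 (b 3 \<and>\<^sub>1 b 4)) (dual_fun q (k+1)) (dual_fun q (k+2)) (dual_fun q (k+3)) (dual_fun q (k+4))"
      by (simp add: det_column_5 wedge2_def wedge_def R(2) rotated_frame_dual_fun[OF q])
    finally show ?thesis .
  qed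
  then have "column 5 R = (\<chi> k. ((b 1 \<and>\<^sub>1 b 2) \<and>\<^sub>2 (b 3 \<and>\<^sub>1 b 4)) (dual_fun q (k+1)) (dual_fun q (k+2)) (dual_fun q (k+3)) (dual_fun q (k+4)))"
    by (simp add: vec_eq_iff column_def)
  then show ?thesis using R(2) by (simp add: rotated_frame_def)
qed

text \<open>Uniqueness follows from linearity of the right side in \<open>\<omega>\<close>. The
  assumed decomposable form is the witness for existence, and squares of twistors have this
  form.\<close>

lemma hodge4_eq:
  assumes q: "q \<in> S" and a: "oriented_onb q a"
    and \<omega>: "\<omega> = c *\<^sub>R ((a 1 \<and>\<^sub>1 a 2) \<and>\<^sub>2 (a 3 \<and>\<^sub>1 a 4))"
  shows "hodge4 q \<omega> = vec_of (E q) (\<chi> k. \<omega> (dual_fun q (k+1)) (dual_fun q (k+2)) (dual_fun q (k+3)) (dual_fun q (k+4)))"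
    (is "_ = ?v")
  unfolding hodge4_def
proof (rule the_equality)
  have eq: "v = ?v" if "\<forall>k<n. oriented_onb q (a k)"
    "\<omega> = (\<Sum>k<n. c k *\<^sub>R ((a k 1 \<and>\<^sub>1 a k 2) \<and>\<^sub>2 (a k 3 \<and>\<^sub>1 a k 4)))" "v = (\<Sum>k<n. c k *\<^sub>R a k 5)"
    for v and n :: nat and c :: "nat \<Rightarrow> real" and a :: "nat \<Rightarrow> 5 \<Rightarrow> 'm tvec"
  proof -
    have "v = (\<Sum>k<n. c k *\<^sub>R vec_of (E q) (\<chi> l. ((a k 1 \<and>\<^sub>1 a k 2) \<and>\<^sub>2 (a k 3 \<and>\<^sub>1 a k 4))
        (dual_fun q (l+1)) (dual_fun q (l+2)) (dual_fun q (l+3)) (dual_fun q (l+4))))"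
      unfolding that(3)
    proof (intro sum.cong refl)
      fix k assume "k \<in> {..<n}"
      then have "oriented_onb q (a k)" using that(1) by simp
      from fourvec_5[OF q this]
      show "c k *\<^sub>R a k 5 = c k *\<^sub>R vec_of (E q) (\<chi> l. ((a k 1 \<and>\<^sub>1 a k 2) \<and>\<^sub>2 (a k 3 \<and>\<^sub>1 a k 4))
          (dual_fun q (l+1)) (dual_fun q (l+2)) (dual_fun q (l+3)) (dual_fun q (l+4)))"
        by (rule arg_cong)
    qed
    also have "\<dots> = vec_of (E q) (\<Sum>k<n. c k *\<^sub>R (\<chi> l. ((a k 1 \<and>\<^sub>1 a k 2) \<and>\<^sub>2 (a k 3 \<and>\<^sub>1 a k 4))
        (dual_fun q (l+1)) (dual_fun q (l+2)) (dual_fun q (l+3)) (dual_fun q (l+4))))"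
      by (simp add: vec_of_sum vec_of_scale)
    also have "\<dots> = ?v"
      by (rule arg_cong[of _ _ "vec_of (E q)"]) (simp add: vec_eq_iff that(2) sum_fun_apply scaleR_fun_def)
    finally show ?thesis .
  qed
  show "\<exists>(n::nat) (c :: nat \<Rightarrow> real) (a :: nat \<Rightarrow> 5 \<Rightarrow> 'm tvec).
    (\<forall>k<n. oriented_onb q (a k)) \<and>
    \<omega> = (\<Sum>k<n. c k *\<^sub>R ((a k 1 \<and>\<^sub>1 a k 2) \<and>\<^sub>2 (a k 3 \<and>\<^sub>1 a k 4))) \<and>
    ?v = (\<Sum>k<n. c k *\<^sub>R a k 5)"
  proof (rule exI[of _ 1], rule exI[of _ "\<lambda>_. c"], rule exI[of _ "\<lambda>_. a"])
    have "c *\<^sub>R a 5 = ?v"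
      by (rule eq[of 1 "\<lambda>_. a" "\<lambda>_. c"]) (use a \<omega> in auto)
    then show "(\<forall>k<1. oriented_onb q a) \<and>
        \<omega> = (\<Sum>k<(1::nat). c *\<^sub>R ((a 1 \<and>\<^sub>1 a 2) \<and>\<^sub>2 (a 3 \<and>\<^sub>1 a 4))) \<and>
        ?v = (\<Sum>k<(1::nat). c *\<^sub>R a 5)"
      using a \<omega> by simp
  qed
  show "v = ?v" if "\<exists>(n::nat) (c :: nat \<Rightarrow> real) (a :: nat \<Rightarrow> 5 \<Rightarrow> 'm tvec).
    (\<forall>k<n. oriented_onb q (a k)) \<and>
    \<omega> = (\<Sum>k<n. c k *\<^sub>R ((a k 1 \<and>\<^sub>1 a k 2) \<and>\<^sub>2 (a k 3 \<and>\<^sub>1 a k 4))) \<and>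
    v = (\<Sum>k<n. c k *\<^sub>R a k 5)" for v
    using that by (elim exE conjE) (rule eq)
qed

text \<open>Since xi is in the kernel, a rotation taking the first basis vector to xi leaves a
  matrix with vanishing first row: the bivector then involves only four vectors.\<close>

lemma normal_form:
  assumes "s \<bullet> s = 1"
  obtains R M where "rotation_matrix R" "column 1 R = xi_vec s" "skew M" "\<forall>j. M $ 1 $ j = 0"
    "Kmat s = R ** M ** transpose R"
proof -
  obtain R :: "real^5^5" where R: "rotation_matrix R" "R *v axis 1 1 = xi_vec s"
    by (rule rotation_matrix_exists_basis[where a = "xi_vec s" and k = 1])
       (auto simp: norm_xi_vec[OF assms])
  then have c: "column 1 R = xi_vec s" by (simp add: matrix_vector_mult_basis)
  have RR: "R ** transpose R = mat 1" using R(1) by (simp add: rotation_matrix_def orthogonal_matrix_def)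
  define M where "M = transpose R ** Kmat s ** R"
  have "skew M" using skew_conj[OF skew_Kmat, of "transpose R" s] by (simp add: M_def transpose_transpose)
  moreover have "M $ 1 $ j = 0" for j
  proof -
    have "R $ k $ 1 = xi_vec s $ k" for k using c by (simp add: vec_eq_iff column_def)
    then show ?thesis
      using xi_vec_kernel[of s] by (simp add: M_def matrix_matrix_mult_def transpose_def)
  qed
  moreover have "Kmat s = R ** M ** transpose R"
    unfolding M_def by (simp add: matrix_mul_assoc RR) (simp add: RR flip: matrix_mul_assoc)
  ultimately show ?thesis using that R(1) c by blast
qed

lemma bivec_of_six:
  assumes "skew M" "\<forall>j. M $ 1 $ j = 0"
  shows "bivec_of h M = M$2$3 *\<^sub>R (h 2 \<and>\<^sub>1 h 3) + M$2$4 *\<^sub>R (h 2 \<and>\<^sub>1 h 4) + M$2$5 *\<^sub>R (h 2 \<and>\<^sub>1 h 5)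
    + M$3$4 *\<^sub>R (h 3 \<and>\<^sub>1 h 4) + M$3$5 *\<^sub>R (h 3 \<and>\<^sub>1 h 5) + M$4$5 *\<^sub>R (h 4 \<and>\<^sub>1 h 5)"
proof -
  have sk: "M$3$2 = - M$2$3" "M$4$2 = - M$2$4" "M$5$2 = - M$2$5" "M$4$3 = - M$3$4" "M$5$3 = - M$3$5"
    "M$5$4 = - M$4$5" "M$2$2 = 0" "M$3$3 = 0" "M$4$4 = 0" "M$5$5 = 0"
    using skewD[OF assms(1)] skew_diag[OF assms(1)] by blast+
  have "M $ i $ 1 = 0" for i using skewD[OF assms(1), of i 1] assms(2) by simp
  moreover have "M $ 1 $ j = 0" for j using assms(2) by blast
  ultimately show ?thesis
    by (intro ext) (simp add: bivec_of_apply sum_5 sk wedge_def scaleR_fun_def field_simps)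
qed

lemma wedge2_add: "(\<sigma> + \<sigma>') \<and>\<^sub>2 \<tau> = \<sigma> \<and>\<^sub>2 \<tau> + \<sigma>' \<and>\<^sub>2 \<tau>" "\<tau> \<and>\<^sub>2 (\<sigma> + \<sigma>') = \<tau> \<and>\<^sub>2 \<sigma> + \<tau> \<and>\<^sub>2 \<sigma>'"
  and wedge2_scale: "(c *\<^sub>R \<sigma>) \<and>\<^sub>2 \<tau> = c *\<^sub>R (\<sigma> \<and>\<^sub>2 \<tau>)" "\<tau> \<and>\<^sub>2 (c *\<^sub>R \<sigma>) = c *\<^sub>R (\<tau> \<and>\<^sub>2 \<sigma>)"
  by (intro ext, simp add: wedge2_def scaleR_fun_def algebra_simps)+

lemma wedge2_wedge:
  "(a \<and>\<^sub>1 b) \<and>\<^sub>2 (a \<and>\<^sub>1 c) = 0" "(a \<and>\<^sub>1 b) \<and>\<^sub>2 (c \<and>\<^sub>1 a) = 0" "(b \<and>\<^sub>1 a) \<and>\<^sub>2 (a \<and>\<^sub>1 c) = 0" "(b \<and>\<^sub>1 a) \<and>\<^sub>2 (c \<and>\<^sub>1 a) = 0"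
  "(c \<and>\<^sub>1 d) \<and>\<^sub>2 (a \<and>\<^sub>1 b) = (a \<and>\<^sub>1 b) \<and>\<^sub>2 (c \<and>\<^sub>1 d)"
  "(a \<and>\<^sub>1 c) \<and>\<^sub>2 (b \<and>\<^sub>1 d) = (- 1) *\<^sub>R ((a \<and>\<^sub>1 b) \<and>\<^sub>2 (c \<and>\<^sub>1 d))" "(a \<and>\<^sub>1 d) \<and>\<^sub>2 (b \<and>\<^sub>1 c) = (a \<and>\<^sub>1 b) \<and>\<^sub>2 (c \<and>\<^sub>1 d)"
  by (intro ext, simp add: wedge2_def wedge_def scaleR_fun_def algebra_simps)+

text \<open>In a 4-space the square of a bivector is twice its Pfaffian times the volume 4-vector.
  This supplies the decomposable form that \<open>hodge4_eq\<close> asks for.\<close>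

lemma wedge2_six:
  "(m1 *\<^sub>R (a \<and>\<^sub>1 b) + m2 *\<^sub>R (a \<and>\<^sub>1 c) + m3 *\<^sub>R (a \<and>\<^sub>1 d) + m4 *\<^sub>R (b \<and>\<^sub>1 c) + m5 *\<^sub>R (b \<and>\<^sub>1 d) + m6 *\<^sub>R (c \<and>\<^sub>1 d)) \<and>\<^sub>2
   (m1 *\<^sub>R (a \<and>\<^sub>1 b) + m2 *\<^sub>R (a \<and>\<^sub>1 c) + m3 *\<^sub>R (a \<and>\<^sub>1 d) + m4 *\<^sub>R (b \<and>\<^sub>1 c) + m5 *\<^sub>R (b \<and>\<^sub>1 d) + m6 *\<^sub>R (c \<and>\<^sub>1 d)) =
   (2 * (m1 * m6 - m2 * m5 + m3 * m4)) *\<^sub>R ((a \<and>\<^sub>1 b) \<and>\<^sub>2 (c \<and>\<^sub>1 d))"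
proof -
  have same: "(u \<and>\<^sub>1 v) \<and>\<^sub>2 (u \<and>\<^sub>1 v) = 0" for u v :: "'b tvec" by (rule wedge2_wedge(1))
  note z = wedge2_wedge(1)[where a = a] wedge2_wedge(1)[where a = b] wedge2_wedge(1)[where a = c]
    wedge2_wedge(2)[where a = b] wedge2_wedge(2)[where a = c]
    wedge2_wedge(3)[where a = b] wedge2_wedge(3)[where a = c]
    wedge2_wedge(4)[where a = b] wedge2_wedge(4)[where a = c] wedge2_wedge(4)[where a = d]
    wedge2_wedge(5)[of c d a b] wedge2_wedge(6)[of a c b d] wedge2_wedge(7)[of a d b c]
    wedge2_wedge(5)[of b d a c] wedge2_wedge(5)[of b c a d]
  show ?thesis
    by (simp only: wedge2_add wedge2_scale same z scaleR_zero_right add_0_left add_0_right)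
       (intro ext, simp add: scaleR_fun_def algebra_simps)
qed

lemma xi_eq:
  assumes q: "q \<in> S" and s: "s \<bullet> s = 1"
  shows "xi (q, bivec_of (E q) (Kmat s)) = vec_of (E q) (xi_vec s)"
proof -
  let ?\<sigma> = "bivec_of (E q) (Kmat s)"
  obtain R M where R: "rotation_matrix R" "column 1 R = xi_vec s" "skew M" "\<forall>j. M $ 1 $ j = 0"
    "Kmat s = R ** M ** transpose R" using normal_form[OF s] .
  have \<sigma>: "?\<sigma> = bivec_of (rotated_frame q R) M" using bivec_of_fr[OF R(3)] R(5) by simp
  have "hodge4 q (?\<sigma> \<and>\<^sub>2 ?\<sigma>) = vec_of (E q) (\<chi> k. (?\<sigma> \<and>\<^sub>2 ?\<sigma>) (dual_fun q (k+1)) (dual_fun q (k+2)) (dual_fun q (k+3)) (dual_fun q (k+4)))"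
  proof (rule hodge4_eq[OF q])
    \<comment> \<open>The cyclic permutation puts xi, the first vector of the rotated frame, into
      the fifth place, where \<open>hodge4\<close> takes its value from.\<close>
    show "oriented_onb q (rotated_frame q (R ** perm_mat (($) (mk5 2 3 4 5 1))))"
      by (intro rotated_frame_onb rotation_mult rotation_perm_mat R q) simp
    show "?\<sigma> \<and>\<^sub>2 ?\<sigma> = (2 * (M$2$3 * M$4$5 - M$2$4 * M$3$5 + M$2$5 * M$3$4)) *\<^sub>R
      ((rotated_frame q (R ** perm_mat (($) (mk5 2 3 4 5 1))) 1 \<and>\<^sub>1 rotated_frame q (R ** perm_mat (($) (mk5 2 3 4 5 1))) 2) \<and>\<^sub>2
       (rotated_frame q (R ** perm_mat (($) (mk5 2 3 4 5 1))) 3 \<and>\<^sub>1 rotated_frame q (R ** perm_mat (($) (mk5 2 3 4 5 1))) 4))"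
      unfolding \<sigma> bivec_of_six[OF R(3,4)] wedge2_six by (simp add: rotated_frame_perm)
  qed
  also have "(\<chi> k. (?\<sigma> \<and>\<^sub>2 ?\<sigma>) (dual_fun q (k+1)) (dual_fun q (k+2)) (dual_fun q (k+3)) (dual_fun q (k+4))) = 2 *\<^sub>R pfv (Kmat s)"
    by (simp add: vec_eq_iff wedge2_def bivec_of_dual_fun[OF q] pfv_def algebra_simps)
  finally show ?thesis by (simp add: xi_def vec_of_scale xi_vec_def)
qed

lemma star_fr:
  assumes q: "q \<in> S" and h: "oriented_onb q h" "h 1 = vec_of (E q) u"
  shows "h 4 \<and>\<^sub>1 h 5 = bivec_of (E q) (star u (\<chi> i j. (h 2 \<and>\<^sub>1 h 3) (dual_fun q i) (dual_fun q j)))"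
proof -
  obtain R where R: "rotation_matrix R" "h = rotated_frame q R" using onb_fr[OF q h(1)] .
  have u: "column 1 R = u" using h(2) R(2) vec_of_inj[OF q E_onb[OF q]] by (simp add: rotated_frame_def)
  have "(\<chi> i j. (h 2 \<and>\<^sub>1 h 3) (dual_fun q i) (dual_fun q j)) = wedge_mat (column 2 R) (column 3 R)"
    unfolding R(2) rotated_frame_def wedge_ve by (simp add: vec_eq_iff bivec_of_dual_fun[OF q])
  then show ?thesis
    using star_rotation[OF R(1)] u by (simp add: R(2) rotated_frame_def wedge_ve)
qed

text \<open>By \<open>star_fr\<close> each simple term is sent to its dual by an operation that is
  linear in the bivector, so all decompositions give the same result; the normal form provides
  one.\<close>

lemma hodgeH_eq:
  assumes q: "q \<in> S" and s: "s \<bullet> s = 1"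
  shows "hodgeH (q, bivec_of (E q) (Kmat s)) (bivec_of (E q) (Kmat s)) = bivec_of (E q) (star (xi_vec s) (Kmat s))"
    (is "hodgeH ?z ?\<sigma> = ?\<tau>")
  unfolding hodgeH_def
proof (rule the_equality)
  have eq: "\<tau> = ?\<tau>" if h: "\<forall>k<n. oriented_onb (fst ?z) (h k) \<and> h k 1 = xi ?z"
    "?\<sigma> = (\<Sum>k<n. c k *\<^sub>R (h k 2 \<and>\<^sub>1 h k 3))" "\<tau> = (\<Sum>k<n. c k *\<^sub>R (h k 4 \<and>\<^sub>1 h k 5))"
    for \<tau> and n :: nat and c :: "nat \<Rightarrow> real" and h :: "nat \<Rightarrow> 5 \<Rightarrow> 'm tvec"
  proof -
    have "\<tau> = (\<Sum>k<n. c k *\<^sub>R bivec_of (E q) (star (xi_vec s) (\<chi> i j. (h k 2 \<and>\<^sub>1 h k 3) (dual_fun q i) (dual_fun q j))))"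
      unfolding h(3)
    proof (intro sum.cong refl)
      fix k assume "k \<in> {..<n}"
      then have "oriented_onb q (h k)" "h k 1 = vec_of (E q) (xi_vec s)"
        using h(1) xi_eq[OF q s] by auto
      from star_fr[OF q this]
      show "c k *\<^sub>R (h k 4 \<and>\<^sub>1 h k 5) =
          c k *\<^sub>R bivec_of (E q) (star (xi_vec s) (\<chi> i j. (h k 2 \<and>\<^sub>1 h k 3) (dual_fun q i) (dual_fun q j)))"
        by (rule arg_cong)
    qed
    also have "\<dots> = bivec_of (E q) (star (xi_vec s) (\<Sum>k<n. c k *\<^sub>R (\<chi> i j. (h k 2 \<and>\<^sub>1 h k 3) (dual_fun q i) (dual_fun q j))))"
      by (simp add: star_sum star_scaleR bivec_of_sum bivec_of_scale)
    also have "(\<Sum>k<n. c k *\<^sub>R (\<chi> i j. (h k 2 \<and>\<^sub>1 h k 3) (dual_fun q i) (dual_fun q j))) = (\<chi> i j. ?\<sigma> (dual_fun q i) (dual_fun q j))"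
      by (simp add: vec_eq_iff h(2) sum_fun_apply scaleR_fun_def)
    also have "\<dots> = Kmat s" by (simp add: vec_eq_iff bivec_of_dual_fun[OF q])
    finally show ?thesis .
  qed
  obtain R M where R: "rotation_matrix R" "column 1 R = xi_vec s" "skew M" "\<forall>j. M $ 1 $ j = 0"
    "Kmat s = R ** M ** transpose R" using normal_form[OF s] .
  have \<sigma>: "?\<sigma> = bivec_of (rotated_frame q R) M" using bivec_of_fr[OF R(3)] R(5) by simp
  \<comment> \<open>One even permutation fixing 1 for each of the six coordinate planes orthogonal
    to xi, in the same order as the coefficients below.\<close>
  let ?p = "\<lambda>k::nat. [mk5 1 2 3 4 5, mk5 1 2 4 5 3, mk5 1 2 5 3 4, mk5 1 3 4 2 5, mk5 1 3 5 4 2, mk5 1 4 5 2 (3::5)] ! k"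
  let ?c = "\<lambda>k::nat. [M$2$3, M$2$4, M$2$5, M$3$4, M$3$5, M$4$5] ! k"
  let ?h = "\<lambda>k. rotated_frame q (R ** perm_mat (($) (?p k)))"
  have k6: "k \<in> {0, 1, 2, 3, 4, 5}" if "k < 6" for k :: nat using that by auto
  have h1: "\<forall>k<6. oriented_onb (fst ?z) (?h k) \<and> ?h k 1 = xi ?z"
  proof (intro allI impI conjI)
    fix k :: nat assume "k < 6"
    then have k: "k \<in> {0, 1, 2, 3, 4, 5}" by (rule k6)
    have "($) (?p k) \<in> {($) (mk5 1 2 3 4 5), ($) (mk5 1 2 4 5 3), ($) (mk5 1 2 5 3 4), ($) (mk5 1 3 4 2 5),
     ($) (mk5 1 3 5 4 2), ($) (mk5 1 4 5 2 3), ($) (mk5 2 3 4 5 (1::5))}"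
      using k by (elim insertE emptyE) simp_all
    then show "oriented_onb (fst ?z) (?h k)"
      by (simp only: fst_conv) (intro rotated_frame_onb rotation_mult rotation_perm_mat R q)
    have "?p k $ 1 = 1" using k by (elim insertE emptyE) simp_all
    then have "?h k 1 = rotated_frame q R 1" by (simp only: rotated_frame_perm)
    then show "?h k 1 = xi ?z" by (simp add: rotated_frame_def R(2) xi_eq[OF q s])
  qed
  have h2: "?\<sigma> = (\<Sum>k<6. ?c k *\<^sub>R (?h k 2 \<and>\<^sub>1 ?h k 3))"
    unfolding \<sigma> bivec_of_six[OF R(3,4)] by (simp add: eval_nat_numeral rotated_frame_perm)
  \<comment> \<open>The dual need not be computed term by term: the uniqueness part, applied to this
    decomposition, already identifies it.\<close>
  have h3: "?\<tau> = (\<Sum>k<6. ?c k *\<^sub>R (?h k 4 \<and>\<^sub>1 ?h k 5))"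
    by (rule eq[OF h1 h2 refl, symmetric])
  show "\<exists>(n::nat) (c :: nat \<Rightarrow> real) (h :: nat \<Rightarrow> 5 \<Rightarrow> 'm tvec).
    (\<forall>k<n. oriented_onb (fst ?z) (h k) \<and> h k 1 = xi ?z) \<and>
    ?\<sigma> = (\<Sum>k<n. c k *\<^sub>R (h k 2 \<and>\<^sub>1 h k 3)) \<and> ?\<tau> = (\<Sum>k<n. c k *\<^sub>R (h k 4 \<and>\<^sub>1 h k 5))"
    by (rule exI[of _ 6], rule exI[of _ ?c], rule exI[of _ ?h], intro conjI h1 h2 h3)
  show "\<tau> = ?\<tau>" if "\<exists>(n::nat) (c :: nat \<Rightarrow> real) (h :: nat \<Rightarrow> 5 \<Rightarrow> 'm tvec).
    (\<forall>k<n. oriented_onb (fst ?z) (h k) \<and> h k 1 = xi ?z) \<and>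
    ?\<sigma> = (\<Sum>k<n. c k *\<^sub>R (h k 2 \<and>\<^sub>1 h k 3)) \<and> \<tau> = (\<Sum>k<n. c k *\<^sub>R (h k 4 \<and>\<^sub>1 h k 5))" for \<tau>
    using that by (elim exE conjE) (rule eq)
qed

lemma dual_part_eq:
  assumes "q \<in> S" "s \<bullet> s = 1"
  shows "dual_part \<epsilon> (q, bivec_of (E q) (Kmat s)) = bivec_of (E q) ((1/2) *\<^sub>R (Kmat s + \<epsilon> *\<^sub>R star (xi_vec s) (Kmat s)))"
  by (simp add: dual_part_def hodgeH_eq[OF assms] bivec_of_scale bivec_of_add)

text \<open>In components the defining pairing is a bilinear form with matrix
  \<open>phi_mat\<close>; nondegeneracy of the metric makes the solution unique.\<close>

lemma phi_eq:
  assumes q: "q \<in> S" and s: "s \<bullet> s = 1"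
  shows "phi \<epsilon> (q, bivec_of (E q) (Kmat s)) (vec_of (E q) u) = vec_of (E q) (\<chi> j. \<Sum>i\<in>UNIV. u $ i * phi_mat \<epsilon> s $ i $ j)"
    (is "_ = vec_of (E q) ?w")
  unfolding phi_def fst_conv
proof (rule the_equality)
  note T = vec_of_TM[OF q E_onb[OF q]] and G = g_ve[OF q E_onb[OF q]]
  let ?M = "(1/2) *\<^sub>R (Kmat s + \<epsilon> *\<^sub>R star (xi_vec s) (Kmat s))"
  have M: "skew ?M" by (intro skew_scaleR skew_add) simp_all
  have key: "2 / (2 + \<epsilon>) * biv_inner q (dual_part \<epsilon> (q, bivec_of (E q) (Kmat s))) (vec_of (E q) u \<and>\<^sub>1 vec_of (E q) y) = ?w \<bullet> y" for y
  proof -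
    have "2 / (2 + \<epsilon>) * biv_inner q (dual_part \<epsilon> (q, bivec_of (E q) (Kmat s))) (vec_of (E q) u \<and>\<^sub>1 vec_of (E q) y) =
       2 / (2 + \<epsilon>) * (\<Sum>i\<in>UNIV. \<Sum>j\<in>UNIV. ?M $ i $ j * u $ i * y $ j)"
      unfolding dual_part_eq[OF q s] wedge_ve biv_inner_bv[OF q M skew_wedge_mat] mdot_wedge_mat_right[OF M] ..
    also have "\<dots> = (\<Sum>i\<in>UNIV. \<Sum>j\<in>UNIV. u $ i * phi_mat \<epsilon> s $ i $ j * y $ j)"
    proof -
      have "2 / d * (1 / 2 * a * b * c) = b * (1 / d * a) * c" for a b c d :: real by simp
      then show ?thesis
        unfolding sum_distrib_left phi_mat_def
        by (intro sum.cong refl) (simp only: vector_scaleR_component vector_add_component real_scaleR_def)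
    qed
    also have "\<dots> = ?w \<bullet> y"
      by (subst sum.swap) (simp add: inner_vec_def sum_distrib_right)
    finally show ?thesis .
  qed
  show "vec_of (E q) ?w \<in> TM q \<and> (\<forall>Y\<in>TM q. g q (vec_of (E q) ?w) Y =
      2 / (2 + \<epsilon>) * biv_inner q (dual_part \<epsilon> (q, bivec_of (E q) (Kmat s))) (vec_of (E q) u \<and>\<^sub>1 Y))"
  proof (intro conjI ballI T)
    fix Y assume "Y \<in> TM q"
    then obtain y where "Y = vec_of (E q) y" using TM_ve[OF q E_onb[OF q]] by blast
    then show "g q (vec_of (E q) ?w) Y =
        2 / (2 + \<epsilon>) * biv_inner q (dual_part \<epsilon> (q, bivec_of (E q) (Kmat s))) (vec_of (E q) u \<and>\<^sub>1 Y)"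
      by (simp only: key G)
  qed
  fix W assume W: "W \<in> TM q \<and> (\<forall>Y\<in>TM q. g q W Y =
      2 / (2 + \<epsilon>) * biv_inner q (dual_part \<epsilon> (q, bivec_of (E q) (Kmat s))) (vec_of (E q) u \<and>\<^sub>1 Y))"
  then obtain w where w: "W = vec_of (E q) w" using TM_ve[OF q E_onb[OF q]] by blast
  have "w \<bullet> y = ?w \<bullet> y" for y
  proof -
    have "g q W (vec_of (E q) y) =
        2 / (2 + \<epsilon>) * biv_inner q (dual_part \<epsilon> (q, bivec_of (E q) (Kmat s))) (vec_of (E q) u \<and>\<^sub>1 vec_of (E q) y)"
      using conjunct2[OF W] T[of y] by (rule bspec)
    then show ?thesis by (simp only: w key G)
  qed
  then have "w = ?w" using vector_eq_rdot[of w ?w] by simp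
  then show "W = vec_of (E q) ?w" using w by simp
qed

lemma conj_diff: "R ** (P - Q) ** C = R ** P ** C - R ** Q ** (C :: real^5^5)"
  by (simp add: vec_eq_iff matrix_matrix_mult_def left_diff_distrib right_diff_distrib sum_subtractf)

section \<open>Independence of the adapted basis\<close>

lemma Upsilon_cubic:
  assumes "q \<in> S" "adapted q b"
  shows "\<Upsilon> q (vec_of b u) (vec_of b u) (vec_of b u) = upsilon_cubic u"
  using assms(2) by (simp add: adapted_def vec_of_def Let_def)

lemma Upsilon_right:
  assumes "u \<in> TM q" "v \<in> TM q" "w \<in> TM q" "w' \<in> TM q" "q \<in> S"
  shows "\<Upsilon> q u v (w + w') = \<Upsilon> q u v w + \<Upsilon> q u v w'"
    and "\<Upsilon> q u (v + w) w' = \<Upsilon> q u v w' + \<Upsilon> q u w w'"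
    and "\<Upsilon> q u v (c *\<^sub>R w) = c * \<Upsilon> q u v w"
    and "\<Upsilon> q u (c *\<^sub>R v) w = c * \<Upsilon> q u v w"
proof -
  have sw: "\<Upsilon> q a b c = \<Upsilon> q c b a" "\<Upsilon> q a b c = \<Upsilon> q b a c" if "a \<in> TM q" "b \<in> TM q" "c \<in> TM q" for a b c
  proof -
    note s = Upsilon_sym[OF that(1,2,3)] Upsilon_sym[OF that(2,1,3)] Upsilon_sym[OF that(2,3,1)]
    show "\<Upsilon> q a b c = \<Upsilon> q b a c" by (rule conjunct1[OF s(1)])
    also have "\<dots> = \<Upsilon> q b c a" by (rule conjunct2[OF s(2)])
    also have "\<dots> = \<Upsilon> q c b a" by (rule conjunct1[OF s(3)])
    finally show "\<Upsilon> q a b c = \<Upsilon> q c b a" .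
  qed
  note T = TM_add[OF assms(5)] TM_scale[OF assms(5)]
  show "\<Upsilon> q u v (w + w') = \<Upsilon> q u v w + \<Upsilon> q u v w'"
    using sw(1)[of u v "w + w'"] sw(1)[of u v w] sw(1)[of u v w'] Upsilon_add[of w q w' v u] assms
    by (simp only: T)
  show "\<Upsilon> q u (v + w) w' = \<Upsilon> q u v w' + \<Upsilon> q u w w'"
    using sw(2)[of u "v + w" w'] sw(2)[of u v w'] sw(2)[of u w w'] Upsilon_add[of v q w u w'] assms
    by (simp only: T)
  show "\<Upsilon> q u v (c *\<^sub>R w) = c * \<Upsilon> q u v w"
    using sw(1)[of u v "c *\<^sub>R w"] sw(1)[of u v w] Upsilon_scale[of w q v u c] assms
    by (simp only: T)
  show "\<Upsilon> q u (c *\<^sub>R v) w = c * \<Upsilon> q u v w"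
    using sw(2)[of u "c *\<^sub>R v" w] sw(2)[of u v w] Upsilon_scale[of v q u w c] assms
    by (simp only: T)
qed

lemma Upsilon_cube_add:
  assumes q: "q \<in> S" and u: "u \<in> TM q" "v \<in> TM q"
  shows "\<Upsilon> q (u + v) (u + v) (u + v) = \<Upsilon> q u u u + 3 * \<Upsilon> q u u v + 3 * \<Upsilon> q u v v + \<Upsilon> q v v v"
proof -
  note T = TM_add[OF q u]
  have sw: "\<Upsilon> q u v u = \<Upsilon> q u u v" "\<Upsilon> q v u u = \<Upsilon> q u u v" "\<Upsilon> q v u v = \<Upsilon> q u v v" "\<Upsilon> q v v u = \<Upsilon> q u v v"
    using Upsilon_sym[OF u(1) u(2) u(1)] Upsilon_sym[OF u(1) u(1) u(2)] Upsilon_sym[OF u(2) u(1) u(2)]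
      Upsilon_sym[OF u(2) u(2) u(1)] Upsilon_sym[OF u(2) u(1) u(1)] by simp_all
  have "\<Upsilon> q (u + v) (u + v) (u + v) = \<Upsilon> q u (u + v) (u + v) + \<Upsilon> q v (u + v) (u + v)"
    by (rule Upsilon_add[OF u T T])
  also have "\<dots> = (\<Upsilon> q u u (u + v) + \<Upsilon> q u v (u + v)) + (\<Upsilon> q v u (u + v) + \<Upsilon> q v v (u + v))"
    by (simp only: Upsilon_right(2)[OF u(1) u T q] Upsilon_right(2)[OF u(2) u T q])
  also have "\<dots> = \<Upsilon> q u u u + 3 * \<Upsilon> q u u v + 3 * \<Upsilon> q u v v + \<Upsilon> q v v v"
    by (simp only: Upsilon_right(1)[OF u(1) u(1) u q] Upsilon_right(1)[OF u(1) u(2) u q]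
        Upsilon_right(1)[OF u(2) u(1) u q] Upsilon_right(1)[OF u(2) u(2) u q] sw)
  finally show ?thesis .
qed

text \<open>Expanding the cubes of u + w and u - w, the difference is six times the mixed value plus
  twice the cube of \<open>w\<close>; the definition of \<open>upsilon_polar\<close> subtracts the
  latter.\<close>

lemma Upsilon_polar:
  assumes q: "q \<in> S"
  shows "\<Upsilon> q (vec_of (E q) u) (vec_of (E q) u) (vec_of (E q) w) = upsilon_polar u w"
proof -
  let ?u = "vec_of (E q) u" and ?w = "vec_of (E q) w"
  note T = vec_of_TM[OF q E_onb[OF q]] and C = Upsilon_cubic[OF q E_adapted[OF q]]
  have nT: "(- 1) *\<^sub>R ?w \<in> TM q" by (rule TM_scale[OF q T])
  have m: "vec_of (E q) (u - w) = ?u + (- 1) *\<^sub>R ?w" by (simp add: vec_of_linear linear_diff)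
  have "upsilon_cubic (u + w) = \<Upsilon> q (?u + ?w) (?u + ?w) (?u + ?w)" by (simp only: C[symmetric] vec_of_add)
  moreover have "upsilon_cubic (u - w) = \<Upsilon> q (?u + (- 1) *\<^sub>R ?w) (?u + (- 1) *\<^sub>R ?w) (?u + (- 1) *\<^sub>R ?w)"
    by (simp only: C[symmetric] m)
  ultimately have "upsilon_cubic (u + w) - upsilon_cubic (u - w) = 6 * \<Upsilon> q ?u ?u ?w + 2 * upsilon_cubic w"
    by (simp only: Upsilon_cube_add[OF q T T] Upsilon_cube_add[OF q T nT] Upsilon_right(3,4)[OF T T T T q]
        Upsilon_right(3,4)[OF T T nT T q] Upsilon_right(3,4)[OF T nT T T q] Upsilon_right(4)[OF nT T nT T q]
        Upsilon_right(3)[OF nT nT T T q] Upsilon_right(3)[OF T nT T T q] Upsilon_right(4)[OF nT T T T q]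
        Upsilon_scale[OF T T T] Upsilon_scale[OF T T nT] Upsilon_scale[OF T nT nT] C)
  then show ?thesis by (simp add: upsilon_polar_def)
qed

text \<open>\<open>R\<close> carries one adapted basis to another, so it preserves the cubic form
  and its polarisation. Conjugation by \<open>R\<close> therefore preserves the stabiliser algebra,
  which is the range of \<open>Kmat\<close>.\<close>

lemma adapted_fr_kappa:
  assumes q: "q \<in> S" and b: "adapted q b"
  obtains R where "orthogonal_matrix R" "b = rotated_frame q R" "\<And>s. \<exists>s'. R ** Kmat s ** transpose R = Kmat s'"
proof -
  have "oriented_onb q b" using b by (simp add: adapted_def)
  then obtain R where R: "rotation_matrix R" "b = rotated_frame q R" using onb_fr[OF q] by blast
  have orth: "orthogonal_matrix R" using R(1) by (simp add: rotation_matrix_def)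
  then have RR: "transpose R ** R = mat 1" "R ** transpose R = mat 1" by (simp_all add: orthogonal_matrix_def)
  have cub: "upsilon_cubic (R *v u) = upsilon_cubic u" for u
    using Upsilon_cubic[OF q b, of u] Upsilon_cubic[OF q E_adapted[OF q], of "R *v u"]
    by (simp add: R(2) vec_of_fr)
  have pol: "upsilon_polar (R *v u) (R *v w) = upsilon_polar u w" for u w
    by (simp add: upsilon_polar_def cub flip: matrix_vector_right_distrib matrix_vector_mult_diff_distrib)
  have "\<exists>s'. R ** Kmat s ** transpose R = Kmat s'" for s
  proof -
    have "upsilon_polar u ((R ** Kmat s ** transpose R) *v u) = 0" for u
    proof -
      define w where "w = transpose R *v u"
      have u: "u = R *v w" by (simp add: w_def matrix_vector_mul_assoc RR del: transpose_matrix_vector)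
      have "(R ** Kmat s ** transpose R) *v u = R *v (Kmat s *v w)"
        by (simp add: w_def matrix_vector_mul_assoc matrix_mul_assoc del: transpose_matrix_vector)
      then show ?thesis by (simp add: u pol upsilon_polar_Kmat)
    qed
    then show ?thesis
      using upsilon_stabilizer[of "R ** Kmat s ** transpose R"] skew_conj[OF skew_Kmat] by metis
  qed
  then show ?thesis using that orth R(2) by blast
qed

lemma kappa_comb_adapted:
  assumes "q \<in> S" "adapted q b" obtains s' where "kappa_comb b s = bivec_of (E q) (Kmat s')"
proof -
  obtain R where "b = rotated_frame q R" "\<And>s. \<exists>s'. R ** Kmat s ** transpose R = Kmat s'"
    using adapted_fr_kappa[OF assms] by blast
  then show ?thesis using that by (metis bivec_of_fr kappa_comb_eq skew_Kmat)
qed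

text \<open>The definition is a union over all adapted bases; all of them have the same span as the
  frame \<open>E\<close>.\<close>

lemma Lambda23_eq:
  assumes q: "q \<in> S" shows "Lambda23 q = range (\<lambda>s. bivec_of (E q) (Kmat s))"
proof
  have sp: "span {kappa1 a, kappa2 a, kappa3 a} = range (kappa_comb a)" for a :: "5 \<Rightarrow> 'm tvec"
  proof
    have "subspace (range (kappa_comb a))"
      by (rule linear_subspace_image[OF _ subspace_UNIV])
         (auto intro!: linearI simp: kappa_comb_eq Kmat_linear bivec_of_add bivec_of_scale)
    moreover have "kappa1 a = kappa_comb a (axis 1 1)" "kappa2 a = kappa_comb a (axis 2 1)"
      "kappa3 a = kappa_comb a (axis 3 1)"
      by (simp_all add: kappa_comb_def axis_def)
    then have "{kappa1 a, kappa2 a, kappa3 a} \<subseteq> range (kappa_comb a)" by (metis empty_subsetI insert_subsetI rangeI)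
    ultimately show "span {kappa1 a, kappa2 a, kappa3 a} \<subseteq> range (kappa_comb a)"
      by (intro span_minimal)
    show "range (kappa_comb a) \<subseteq> span {kappa1 a, kappa2 a, kappa3 a}"
      unfolding kappa_comb_def by (intro image_subsetI span_add span_scale span_base) auto
  qed
  show "Lambda23 q \<subseteq> range (\<lambda>s. bivec_of (E q) (Kmat s))"
  proof
    fix \<sigma> assume "\<sigma> \<in> Lambda23 q"
    then obtain a s where "adapted q a" "\<sigma> = kappa_comb a s" unfolding Lambda23_def sp by blast
    then show "\<sigma> \<in> range (\<lambda>s. bivec_of (E q) (Kmat s))" using kappa_comb_adapted[OF q] by (metis rangeI)
  qed
  show "range (\<lambda>s. bivec_of (E q) (Kmat s)) \<subseteq> Lambda23 q"
    unfolding Lambda23_def sp using E_adapted[OF q] by (auto simp: kappa_comb_eq)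
qed

lemma biv_inner_kappa: "q \<in> S \<Longrightarrow> biv_inner q (bivec_of (E q) (Kmat s)) (bivec_of (E q) (Kmat t)) = 5 * (s \<bullet> t)"
  by (simp add: biv_inner_bv mdot_Kmat)

lemma kappa_inj: "q \<in> S \<Longrightarrow> bivec_of (E q) (Kmat s) = bivec_of (E q) (Kmat t) \<Longrightarrow> s = t"
  using bivec_of_inj[of q "Kmat s" "Kmat t"] Kmat_inj by simp

lemma twistor_iff: "q \<in> S \<Longrightarrow> (q, \<sigma>) \<in> twistor_space \<longleftrightarrow> (\<exists>s. \<sigma> = bivec_of (E q) (Kmat s) \<and> s \<bullet> s = 1)"
  unfolding twistor_space_def by (auto simp: Lambda23_eq biv_inner_kappa)

lemma vertical_iff: "q \<in> S \<Longrightarrow> V \<in> vertical (q, bivec_of (E q) (Kmat s)) \<longleftrightarrow>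
    (\<exists>v. V = bivec_of (E q) (Kmat v) \<and> v \<bullet> s = 0)"
  unfolding vertical_def by (auto simp: Lambda23_eq biv_inner_kappa)

text \<open>Existence is witnessed by the frame itself. In another adapted basis the vector product
  is again a commutator of coefficient matrices, and commutators are compatible with the conjugation
  that relates the bases.\<close>

lemma vprod_eq:
  assumes q: "q \<in> S"
  shows "vprod q (bivec_of (E q) (Kmat s)) (bivec_of (E q) (Kmat t)) = bivec_of (E q) (Kmat (cross3 s t))"
  unfolding vprod_def
proof (rule the_equality)
  show "\<exists>a s' t'. adapted q a \<and> bivec_of (E q) (Kmat s) = kappa_comb a s' \<and> bivec_of (E q) (Kmat t) = kappa_comb a t' \<and>
      bivec_of (E q) (Kmat (cross3 s t)) = kappa_comb a (cross3 s' t')"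
    using E_adapted[OF q] by (auto simp: kappa_comb_eq)
  fix \<rho> assume "\<exists>a s' t'. adapted q a \<and> bivec_of (E q) (Kmat s) = kappa_comb a s' \<and>
      bivec_of (E q) (Kmat t) = kappa_comb a t' \<and> \<rho> = kappa_comb a (cross3 s' t')"
  then obtain a s' t' where a: "adapted q a" "bivec_of (E q) (Kmat s) = kappa_comb a s'"
    "bivec_of (E q) (Kmat t) = kappa_comb a t'" "\<rho> = kappa_comb a (cross3 s' t')" by blast
  obtain R where R: "orthogonal_matrix R" "a = rotated_frame q R" using adapted_fr_kappa[OF q a(1)] by blast
  have RR: "transpose R ** R = mat 1" using R(1) by (simp add: orthogonal_matrix_def)
  have conj: "(R ** P ** transpose R) ** (R ** Q ** transpose R) = R ** (P ** Q) ** transpose R" for P Q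
  proof -
    have "(R ** P ** transpose R) ** (R ** Q ** transpose R) = R ** P ** (transpose R ** R) ** Q ** transpose R"
      by (simp only: matrix_mul_assoc)
    then show ?thesis by (simp add: RR matrix_mul_assoc)
  qed
  have k: "kappa_comb a r = bivec_of (E q) (R ** Kmat r ** transpose R)" for r
    by (simp add: kappa_comb_eq R(2) bivec_of_fr)
  have s: "Kmat s = R ** Kmat s' ** transpose R" and t: "Kmat t = R ** Kmat t' ** transpose R"
    using a(2,3) unfolding k by (auto intro!: bivec_of_inj[OF q] skew_conj)
  have "R ** Kmat (cross3 s' t') ** transpose R = Kmat (cross3 s t)"
    unfolding Kmat_bracket[symmetric] s t conj by (rule conj_diff)
  then show "\<rho> = bivec_of (E q) (Kmat (cross3 s t))" using a(4) by (simp add: k)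
qed

end

lemma Kmat_expand: "Kmat s $ i $ j = (\<Sum>c\<in>UNIV. s $ c * Kmat (axis c 1) $ i $ j)"
proof -
  have "Kmat s = Kmat (\<Sum>c\<in>UNIV. s $ c *\<^sub>R axis c 1)"
    by (rule arg_cong[of _ _ Kmat]) (simp add: vec_eq_iff axis_def if_distrib cong: if_cong)
  also have "\<dots> = (\<Sum>c\<in>UNIV. s $ c *\<^sub>R Kmat (axis c 1))"
    by (simp add: linear_sum[OF linear_Kmat] Kmat_linear)
  finally show ?thesis by simp
qed

context framed
begin

section \<open>The connection in an adapted frame\<close>

lemma vfield_onD:
  assumes "vfield_on A V X" "r \<in> V"
  shows "X r \<in> TM r" "r \<in> S \<Longrightarrow> smooth_via S x r f \<Longrightarrow> smooth_via S x r (\<lambda>q. X q f)"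
  using assms smooth_near_iff unfolding vfield_on_def by auto

lemma vfield_onI:
  assumes "V \<subseteq> S" "\<And>r. r \<in> V \<Longrightarrow> X r \<in> TM r"
    and "\<And>r f. r \<in> V \<Longrightarrow> smooth_via S x r f \<Longrightarrow> smooth_via S x r (\<lambda>q. X q f)"
  shows "vfield_on A V X"
  using assms smooth_near_iff unfolding vfield_on_def by blast

lemma vfield_on_subset: "vfield_on A V X \<Longrightarrow> W \<subseteq> V \<Longrightarrow> vfield_on A W X"
  unfolding vfield_on_def by blast

lemma E_TM: "q \<in> S \<Longrightarrow> E q i \<in> TM q"
  using vfield_onD(1)[OF E_vfield] .

lemma E_sm: "q \<in> S \<Longrightarrow> smooth_via S x q f \<Longrightarrow> smooth_via S x q (\<lambda>r. E r i f)"
  using vfield_onD(2)[OF E_vfield] .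

lemma g_sm:
  assumes "open V" "V \<subseteq> S" "vfield_on A V X" "vfield_on A V Y" "r \<in> V"
  shows "smooth_via S x r (\<lambda>q. g q (X q) (Y q))"
  using g_smooth[OF assms(1,3,4,5)] smooth_near_iff assms by blast

lemma vfield_on_ve:
  assumes V: "V \<subseteq> S" and c: "\<And>r i. r \<in> V \<Longrightarrow> smooth_via S x r (\<lambda>q. c q $ i)"
  shows "vfield_on A V (\<lambda>q. vec_of (E q) (c q))"
proof (rule vfield_onI[OF V])
  fix r assume r: "r \<in> V"
  then have rS: "r \<in> S" using V by blast
  show "vec_of (E r) (c r) \<in> TM r" by (rule vec_of_TM[OF rS E_onb[OF rS]])
  show "smooth_via S x r (\<lambda>q. vec_of (E q) (c q) f)" if "smooth_via S x r f" for f
    unfolding vec_of_apply by (intro smooth_via_sum smooth_via_mult c[OF r] E_sm[OF rS that] rS)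
qed

text \<open>The product rule makes \<open>D\<close> local, as the indicator function of an open set is smooth
  near its points.\<close>

lemma D_local:
  assumes V: "open V" "p \<in> V" "vfield_on A V Y" "vfield_on A V Y'" and v: "v \<in> TM p" and p: "p \<in> S"
    and eq: "\<And>q. q \<in> V \<Longrightarrow> Y q = Y' q"
  shows "D p v Y = D p v Y'"
proof -
  define k :: "'m \<Rightarrow> real" where "k q = (if q \<in> V then 1 else 0)" for q
  have ev: "eventually (\<lambda>q. 1 = k q) (param_nhds S x p)"
    unfolding param_nhds_eq[OF p] using eventually_nhds_in_open[OF V(1,2)] by (rule eventually_mono) (simp add: k_def)
  have k: "smooth_via S x p k" by (rule smooth_via_cong[OF smooth_via_const[OF p] ev])
  have vT: "v \<in> TS S x p" using v TM_eq[OF p] by simp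
  have vk: "v k = 0"
    using TS_local[OF vT smooth_via_const[OF p] ev] TS_const[OF vT p, of 1] by simp
  have kA: "smooth_near A p k" using smooth_near_iff[OF p] k by blast
  have kp: "k p = 1" using V by (simp add: k_def)
  have "(\<lambda>q. k q *\<^sub>R Y q) = (\<lambda>q. k q *\<^sub>R Y' q)" using eq by (auto simp: k_def)
  then show ?thesis
    using D_Leibniz[OF V(1,2,3) v kA] D_Leibniz[OF V(1,2,4) v kA] by (simp add: vk kp)
qed

text \<open>The zero field is zero times a frame field, so the product rule applies.\<close>

lemma D_zero:
  assumes "open V" "p \<in> V" "V \<subseteq> S" "v \<in> TM p"
  shows "D p v (\<lambda>q. 0) = 0"
proof -
  have p: "p \<in> S" using assms by blast
  have "D p v (\<lambda>q. (0::real) *\<^sub>R E q 1) = v (\<lambda>q. 0) *\<^sub>R E p 1 + 0 *\<^sub>R D p v (\<lambda>q. E q 1)"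
    by (rule D_Leibniz[OF assms(1,2) vfield_on_subset[OF E_vfield assms(3)] assms(4)])
       (simp add: smooth_near_iff p smooth_via_const)
  moreover have "v (\<lambda>q. 0) = 0" using TS_const[of v S x p 0] assms(4) p TM_eq by blast
  ultimately have "D p v (\<lambda>q. (0::real) *\<^sub>R E q 1) = 0"
    by (simp only: scaleR_zero_left add_0_left)
  then show ?thesis by (simp only: scaleR_zero_left)
qed

lemma vfield_on_sum:
  assumes "V \<subseteq> S" "\<And>i. i \<in> I \<Longrightarrow> vfield_on A V (Y i)"
  shows "vfield_on A V (\<lambda>q. \<Sum>i\<in>I. Y i q)"
proof (rule vfield_onI[OF assms(1)])
  fix r assume r: "r \<in> V"
  then have rS: "r \<in> S" using assms by blast
  show "(\<Sum>i\<in>I. Y i r) \<in> TM r" by (rule TM_sum[OF rS]) (rule vfield_onD(1)[OF assms(2) r])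
  show "smooth_via S x r (\<lambda>q. (\<Sum>i\<in>I. Y i q) f)" if "smooth_via S x r f" for f
    unfolding sum_fun_apply by (rule smooth_via_sum[OF rS]) (rule vfield_onD(2)[OF assms(2) r rS that])
qed

lemma vfield_on_scale:
  assumes "V \<subseteq> S" "vfield_on A V Y" "\<And>r. r \<in> V \<Longrightarrow> smooth_via S x r c"
  shows "vfield_on A V (\<lambda>q. c q *\<^sub>R Y q)"
proof (rule vfield_onI[OF assms(1)])
  fix r assume r: "r \<in> V"
  then have rS: "r \<in> S" using assms by blast
  show "c r *\<^sub>R Y r \<in> TM r" by (rule TM_scale[OF rS vfield_onD(1)[OF assms(2) r]])
  show "smooth_via S x r (\<lambda>q. (c q *\<^sub>R Y q) f)" if "smooth_via S x r f" for f
    unfolding scaleR_fun_def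
    using smooth_via_mult[OF assms(3)[OF r] vfield_onD(2)[OF assms(2) r rS that]] by simp
qed

lemma D_sum:
  assumes V: "open V" "p \<in> V" "V \<subseteq> S" and v: "v \<in> TM p" and "finite I"
    and "\<And>i. i \<in> I \<Longrightarrow> vfield_on A V (Y i)"
  shows "D p v (\<lambda>q. \<Sum>i\<in>I. Y i q) = (\<Sum>i\<in>I. D p v (Y i))"
  using assms(5,6)
proof (induction I)
  case empty
  show ?case by (simp only: sum.empty D_zero[OF V v])
next
  case (insert i I)
  have "D p v (\<lambda>q. Y i q + (\<Sum>i\<in>I. Y i q)) = D p v (Y i) + D p v (\<lambda>q. \<Sum>i\<in>I. Y i q)"
  proof (rule D_add_right[OF V(1,2) _ _ v])
    show "vfield_on A V (Y i)" by (rule insert.prems) simp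
    show "vfield_on A V (\<lambda>q. \<Sum>i\<in>I. Y i q)" by (rule vfield_on_sum[OF V(3)]) (rule insert.prems, simp)
  qed
  also have "D p v (\<lambda>q. \<Sum>i\<in>I. Y i q) = (\<Sum>i\<in>I. D p v (Y i))" using insert by blast
  finally show ?case by (simp only: sum.insert[OF insert(1,2)])
qed

definition conn_mat :: "'m \<Rightarrow> 'm tvec \<Rightarrow> real^5^5"
  where "conn_mat p v = (\<chi> i j. g p (D p v (\<lambda>r. E r j)) (E p i))"

lemma D_frame: "p \<in> S \<Longrightarrow> v \<in> TM p \<Longrightarrow> D p v (\<lambda>r. E r j) = vec_of (E p) (column j (conn_mat p v))"
  using vec_of_comps[of p "D p v (\<lambda>r. E r j)"] D_tangent[OF S_open _ E_vfield]
  by (simp add: conn_mat_def column_def)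

lemma D_ve:
  assumes V: "open V" "p \<in> V" "V \<subseteq> S" and v: "v \<in> TM p"
    and c: "\<And>r i. r \<in> V \<Longrightarrow> smooth_via S x r (\<lambda>q. c q $ i)"
  shows "D p v (\<lambda>q. vec_of (E q) (c q)) = vec_of (E p) ((\<chi> i. v (\<lambda>q. c q $ i)) + conn_mat p v *v c p)"
proof -
  have p: "p \<in> S" using V by blast
  have EV: "vfield_on A V (\<lambda>q. E q i)" for i by (rule vfield_on_subset[OF E_vfield V(3)])
  have "D p v (\<lambda>q. vec_of (E q) (c q)) = (\<Sum>i\<in>UNIV. D p v (\<lambda>q. c q $ i *\<^sub>R E q i))"
    unfolding vec_of_def by (rule D_sum[OF V v]) (auto intro!: vfield_on_scale V EV c)
  also have "\<dots> = (\<Sum>i\<in>UNIV. v (\<lambda>q. c q $ i) *\<^sub>R E p i + c p $ i *\<^sub>R vec_of (E p) (column i (conn_mat p v)))"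
    by (intro sum.cong refl, subst D_Leibniz[OF V(1,2) EV v])
       (use c V p in \<open>auto simp: smooth_near_iff D_frame v\<close>)
  also have "\<dots> = vec_of (E p) (\<chi> i. v (\<lambda>q. c q $ i)) + vec_of (E p) (\<Sum>i\<in>UNIV. c p $ i *\<^sub>R column i (conn_mat p v))"
    by (simp add: sum.distrib vec_of_sum vec_of_scale) (simp add: vec_of_def)
  also have "(\<Sum>i\<in>UNIV. c p $ i *\<^sub>R column i (conn_mat p v)) = conn_mat p v *v c p"
    by (simp add: vec_eq_iff matrix_vector_mult_def column_def mult.commute)
  finally show ?thesis by (simp only: vec_of_add)
qed

lemma comps_sm:
  assumes "open V" "V \<subseteq> S" "vfield_on A V Y" "r \<in> V"
  shows "smooth_via S x r (\<lambda>q. comps q (Y q) $ i)"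
  using g_sm[OF assms(1-3) vfield_on_subset[OF E_vfield assms(2)] assms(4)] by simp

lemma D_eq:
  assumes V: "open V" "p \<in> V" "V \<subseteq> S" and v: "v \<in> TM p" and Y: "vfield_on A V Y"
  shows "D p v Y = vec_of (E p) ((\<chi> i. v (\<lambda>q. comps q (Y q) $ i)) + conn_mat p v *v comps p (Y p))"
proof -
  have p: "p \<in> S" using V by blast
  \<comment> \<open>The field is known to equal its frame expansion only on \<open>V\<close>, hence
    the appeal to locality.\<close>
  have "D p v Y = D p v (\<lambda>q. vec_of (E q) (comps q (Y q)))"
    by (rule D_local[OF V(1,2) Y vfield_on_ve[OF V(3) comps_sm[OF V(1,3) Y]] v p])
       (use vec_of_comps vfield_onD(1)[OF Y] V(3) in auto)
  then show ?thesis
    using D_ve[OF V v comps_sm[OF V(1,3) Y]] by simp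
qed

text \<open>Differentiate the constant inner products of the frame fields.\<close>

lemma conn_mat_skew:
  assumes p: "p \<in> S" and v: "v \<in> TM p"
  shows "skew (conn_mat p v)"
  unfolding skew_def
proof (intro allI)
  fix i j
  have vT: "v \<in> TS S x p" using v TM_eq[OF p] by simp
  have DT: "D p v (\<lambda>r. E r k) \<in> TM p" for k by (rule D_tangent[OF S_open p E_vfield v])
  have "v (\<lambda>q. g q (E q i) (E q j)) = v (\<lambda>q. if i = j then 1 else 0)"
  proof (rule TS_local[OF vT g_sm[OF S_open order_refl E_vfield E_vfield p]])
    show "eventually (\<lambda>q. g q (E q i) (E q j) = (if i = j then 1 else 0)) (param_nhds S x p)"
      using eventually_param_nhds_mem by eventually_elim (auto simp: onb_g[OF _ E_onb])
  qed
  then have "g p (D p v (\<lambda>r. E r i)) (E p j) + g p (E p i) (D p v (\<lambda>r. E r j)) = 0"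
    using D_metric[OF S_open p E_vfield E_vfield v] TS_const[OF vT p] by simp
  then show "conn_mat p v $ i $ j = - conn_mat p v $ j $ i"
    using g_sym[OF E_TM[OF p] DT, of i j] by (simp add: conn_mat_def)
qed

text \<open>On a field with constant components in an adapted frame the cubic form is constant. Its
  derivative consists of three terms, equal by symmetry, so each of them vanishes: the connection
  matrix stabilises the cubic form.\<close>

lemma conn_mat_Kmat:
  assumes p: "p \<in> S" and v: "v \<in> TM p"
  obtains w where "conn_mat p v = Kmat w"
proof -
  have vT: "v \<in> TS S x p" using v TM_eq[OF p] by simp
  note T = vec_of_TM[OF p E_onb[OF p]]
  have "upsilon_polar u (conn_mat p v *v u) = 0" for u
  proof -
    let ?Y = "\<lambda>q. vec_of (E q) u"
    have Y: "vfield_on A S ?Y"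
      by (rule vfield_on_ve[OF order_refl]) (rule smooth_via_const)
    have z: "v (\<lambda>q. c) = 0" for c by (rule TS_const[OF vT p])
    have "D p v ?Y = vec_of (E p) ((\<chi> i. v (\<lambda>q. u $ i)) + conn_mat p v *v u)"
      by (rule D_ve[OF S_open p order_refl v]) (rule smooth_via_const)
    then have DY: "D p v ?Y = vec_of (E p) (conn_mat p v *v u)"
      by (simp add: z zero_vec_def[symmetric])
    have "v (\<lambda>q. \<Upsilon> q (?Y q) (?Y q) (?Y q)) = v (\<lambda>q. upsilon_cubic u)"
    proof (rule TS_local[OF vT])
      show "smooth_via S x p (\<lambda>q. \<Upsilon> q (?Y q) (?Y q) (?Y q))"
        using Upsilon_smooth[OF S_open Y Y Y p] smooth_near_iff[OF p] by blast
      show "eventually (\<lambda>q. \<Upsilon> q (?Y q) (?Y q) (?Y q) = upsilon_cubic u) (param_nhds S x p)"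
        using eventually_param_nhds_mem by eventually_elim (rule Upsilon_cubic[OF _ E_adapted])
    qed
    then have "\<Upsilon> p (D p v ?Y) (?Y p) (?Y p) + \<Upsilon> p (?Y p) (D p v ?Y) (?Y p) + \<Upsilon> p (?Y p) (?Y p) (D p v ?Y) = 0"
      using D_Upsilon[OF S_open p Y Y Y v] by (simp add: z)
    moreover have "\<Upsilon> p (?Y p) (D p v ?Y) (?Y p) = \<Upsilon> p (?Y p) (?Y p) (D p v ?Y)"
      unfolding DY using Upsilon_sym[OF T T T] by blast
    moreover have "\<Upsilon> p (D p v ?Y) (?Y p) (?Y p) = \<Upsilon> p (?Y p) (D p v ?Y) (?Y p)"
      unfolding DY using Upsilon_sym[OF T T T] by blast
    ultimately have "\<Upsilon> p (?Y p) (?Y p) (D p v ?Y) = 0" by linarith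
    then show ?thesis unfolding DY by (simp only: Upsilon_polar[OF p])
  qed
  then show ?thesis using upsilon_stabilizer[OF conn_mat_skew[OF p v]] that by blast
qed

text \<open>As the connection preserves \<open>\<Upsilon>\<close>, its matrix is of the form \<open>Kmat w\<close>; the vector \<open>w\<close> is read off three entries.\<close>

definition conn_vec :: "'m \<Rightarrow> 'm tvec \<Rightarrow> real^3"
  where "conn_vec p v = vector [conn_mat p v $ 4 $ 5, conn_mat p v $ 3 $ 4, conn_mat p v $ 3 $ 5]"

lemma conn_mat_eq: "p \<in> S \<Longrightarrow> v \<in> TM p \<Longrightarrow> conn_mat p v = Kmat (conn_vec p v)"
proof -
  assume "p \<in> S" "v \<in> TM p"
  then obtain w where w: "conn_mat p v = Kmat w" by (rule conn_mat_Kmat)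
  moreover have "conn_vec p v = w" by (simp add: conn_vec_def w Kmat_nth vec_eq_iff forall_3 vector_3)
  ultimately show ?thesis by simp
qed

lemma conn_mat_linear:
  assumes "p \<in> S" "v \<in> TM p" "w \<in> TM p"
  shows "conn_mat p (v + w) = conn_mat p v + conn_mat p w" "conn_mat p (c *\<^sub>R v) = c *\<^sub>R conn_mat p v"
proof -
  have T: "D p v (\<lambda>r. E r j) \<in> TM p" "D p w (\<lambda>r. E r j) \<in> TM p" for j
    using D_tangent[OF S_open assms(1) E_vfield] assms by auto
  show "conn_mat p (v + w) = conn_mat p v + conn_mat p w"
    by (simp add: conn_mat_def vec_eq_iff D_add_left[OF S_open assms(1) E_vfield assms(2,3)] g_add T E_TM assms)
  show "conn_mat p (c *\<^sub>R v) = c *\<^sub>R conn_mat p v"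
    by (simp add: conn_mat_def vec_eq_iff D_scale_left[OF S_open assms(1) E_vfield assms(2)] g_scale T E_TM assms)
qed

lemma conn_vec_ve:
  assumes p: "p \<in> S"
  shows "conn_vec p (vec_of (E p) u) = (\<Sum>i\<in>UNIV. u $ i *\<^sub>R conn_vec p (E p i))"
proof -
  note T = E_TM[OF p] TM_scale[OF p E_TM[OF p]]
  have z: "conn_mat p 0 = 0"
    using conn_mat_linear(2)[OF p T(1) T(1), of 0] by (simp only: scaleR_zero_left)
  have lin: "conn_mat p (\<Sum>i\<in>I. u $ i *\<^sub>R E p i) = (\<Sum>i\<in>I. u $ i *\<^sub>R conn_mat p (E p i))" if "finite I" for I
    using that
  proof (induction I)
    case empty
    show ?case by (simp only: sum.empty z)
  next
    case (insert i I)
    have "conn_mat p (u $ i *\<^sub>R E p i + (\<Sum>i\<in>I. u $ i *\<^sub>R E p i)) = u $ i *\<^sub>R conn_mat p (E p i) + conn_mat p (\<Sum>i\<in>I. u $ i *\<^sub>R E p i)"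
      by (simp only: conn_mat_linear(1)[OF p T(2) TM_sum[OF p T(2)]] conn_mat_linear(2)[OF p T(1) T(1)])
    then show ?case using insert by (simp only: sum.insert[OF insert(1,2)])
  qed
  show ?thesis
    by (simp add: conn_vec_def vec_of_def lin vec_eq_iff forall_3 vector_3)
qed

lemma conn_vec_sm:
  assumes "p \<in> S" shows "smooth_via S x p (\<lambda>q. conn_vec q (E q i) $ c)"
proof -
  have "smooth_via S x p (\<lambda>q. conn_mat q (E q i) $ a $ b)" for a b
    using g_sm[OF S_open order_refl D_smooth[OF S_open E_vfield E_vfield] E_vfield assms]
    by (simp add: conn_mat_def)
  then have "\<forall>c. smooth_via S x p (\<lambda>q. conn_vec q (E q i) $ c)"
    unfolding forall_3 conn_vec_def vector_3 by blast
  then show ?thesis by blast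
qed

section \<open>The induced connection on bivectors\<close>

text \<open>The extension of \<open>\<Omega>\<close> to bivectors as a derivation multiplies by
  \<open>\<Omega>\<close> on the left and by its transpose on the right, and the transpose is the
  negative.\<close>

lemma wedge_mat_Om:
  assumes "skew \<Omega>"
  shows "wedge_mat (\<Omega> *v y) z + wedge_mat y (\<Omega> *v z) = \<Omega> ** wedge_mat y z - wedge_mat y z ** \<Omega>"
proof -
  have "(wedge_mat (\<Omega> *v y) z + wedge_mat y (\<Omega> *v z)) $ i $ j =
      (\<Omega> ** wedge_mat y z - wedge_mat y z ** \<Omega>) $ i $ j" for i j
  proof -
    have "(\<Sum>k\<in>UNIV. (y $ i * z $ k - y $ k * z $ i) * \<Omega> $ k $ j) =
        (\<Sum>k\<in>UNIV. - (\<Omega> $ j $ k * (y $ i * z $ k - y $ k * z $ i)))"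
      by (intro sum.cong refl) (simp add: skewD[OF assms, of _ j] algebra_simps)
    then show ?thesis
      by (simp add: wedge_mat_def matrix_vector_mult_def matrix_matrix_mult_def sum_negf)
         (simp add: sum_distrib_left sum_distrib_right sum_subtractf[symmetric] sum.distrib[symmetric] algebra_simps)
  qed
  then show ?thesis by (simp add: vec_eq_iff)
qed

text \<open>The right side involves the decomposition only through the matrix of the bivector field;
  this makes \<open>D_biv\<close> well defined.\<close>

lemma D_biv_rep:
  assumes V: "open V" "p \<in> V" "V \<subseteq> S" and v: "v \<in> TM p"
    and YZ: "\<And>k. k < n \<Longrightarrow> vfield_on A V (Y k) \<and> vfield_on A V (Z k)"
    and M: "\<And>q. q \<in> V \<Longrightarrow> skew (M q)" "\<And>q. q \<in> V \<Longrightarrow> bivec_of (E q) (M q) = (\<Sum>k<(n::nat). Y k q \<and>\<^sub>1 Z k q)"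
  shows "(\<Sum>k<n. D p v (Y k) \<and>\<^sub>1 Z k p + Y k p \<and>\<^sub>1 D p v (Z k)) =
    bivec_of (E p) ((\<chi> i j. v (\<lambda>q. M q $ i $ j)) + (conn_mat p v ** M p - M p ** conn_mat p v))"
proof -
  have p: "p \<in> S" using V by blast
  have vT: "v \<in> TS S x p" using v TM_eq[OF p] by simp
  define y z where "y k q = comps q (Y k q)" and "z k q = comps q (Z k q)" for k q
  have YZT: "Y k q \<in> TM q" "Z k q \<in> TM q" if "k < n" "q \<in> V" for k q
    using YZ[OF that(1)] vfield_onD(1) that(2) by blast+
  have vec_of: "Y k q = vec_of (E q) (y k q)" "Z k q = vec_of (E q) (z k q)" if "k < n" "q \<in> V" for k q
    unfolding y_def z_def using vec_of_comps YZT[OF that] V(3) that(2) by auto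
  have yz: "smooth_via S x q (\<lambda>q. y k q $ i)" "smooth_via S x q (\<lambda>q. z k q $ i)" if "k < n" "q \<in> V" for k q i
    unfolding y_def z_def using comps_sm[OF V(1,3)] YZ[OF that(1)] that(2) by blast+
  have Mq: "M q = (\<Sum>k<n. wedge_mat (y k q) (z k q))" if "q \<in> V" for q
    using M[OF that] sum_wedge_comps[of q n "\<lambda>k. Y k q" "\<lambda>k. Z k q"] YZT[OF _ that] V(3) that
    by (intro bivec_of_inj[of q]) (auto simp: y_def z_def intro: skew_sum)
  define y' z' where "y' k = (\<chi> i. v (\<lambda>q. y k q $ i))" and "z' k = (\<chi> i. v (\<lambda>q. z k q $ i))" for k
  have "(\<Sum>k<n. D p v (Y k) \<and>\<^sub>1 Z k p + Y k p \<and>\<^sub>1 D p v (Z k)) =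
      (\<Sum>k<n. bivec_of (E p) (wedge_mat (y' k + conn_mat p v *v y k p) (z k p) + wedge_mat (y k p) (z' k + conn_mat p v *v z k p)))"
  proof (intro sum.cong refl)
    fix k assume "k \<in> {..<n}"
    then have k: "k < n" by simp
    have "D p v (Y k) = vec_of (E p) (y' k + conn_mat p v *v y k p)" "D p v (Z k) = vec_of (E p) (z' k + conn_mat p v *v z k p)"
      unfolding y'_def z'_def y_def z_def
      using D_eq[OF V v conjunct1[OF YZ[OF k]]] D_eq[OF V v conjunct2[OF YZ[OF k]]] by auto
    then show "D p v (Y k) \<and>\<^sub>1 Z k p + Y k p \<and>\<^sub>1 D p v (Z k) =
        bivec_of (E p) (wedge_mat (y' k + conn_mat p v *v y k p) (z k p) + wedge_mat (y k p) (z' k + conn_mat p v *v z k p))"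
      by (simp only: vec_of[OF k V(2)] wedge_ve bivec_of_add)
  qed
  also have "\<dots> = bivec_of (E p) (\<Sum>k<n. (wedge_mat (y' k) (z k p) + wedge_mat (y k p) (z' k))
      + (conn_mat p v ** wedge_mat (y k p) (z k p) - wedge_mat (y k p) (z k p) ** conn_mat p v))"
    unfolding bivec_of_sum
  proof (intro sum.cong refl)
    fix k
    have "wedge_mat (y' k + conn_mat p v *v y k p) (z k p) + wedge_mat (y k p) (z' k + conn_mat p v *v z k p) =
      (wedge_mat (y' k) (z k p) + wedge_mat (y k p) (z' k))
      + (wedge_mat (conn_mat p v *v y k p) (z k p) + wedge_mat (y k p) (conn_mat p v *v z k p))"
      by (simp add: vec_eq_iff wedge_mat_def algebra_simps)
    then show "bivec_of (E p) (wedge_mat (y' k + conn_mat p v *v y k p) (z k p) + wedge_mat (y k p) (z' k + conn_mat p v *v z k p)) =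
      bivec_of (E p) ((wedge_mat (y' k) (z k p) + wedge_mat (y k p) (z' k))
      + (conn_mat p v ** wedge_mat (y k p) (z k p) - wedge_mat (y k p) (z k p) ** conn_mat p v))"
      by (simp only: wedge_mat_Om[OF conn_mat_skew[OF p v]])
  qed
  also have "(\<Sum>k<n. (wedge_mat (y' k) (z k p) + wedge_mat (y k p) (z' k))
      + (conn_mat p v ** wedge_mat (y k p) (z k p) - wedge_mat (y k p) (z k p) ** conn_mat p v)) =
      (\<Sum>k<n. wedge_mat (y' k) (z k p) + wedge_mat (y k p) (z' k)) + (conn_mat p v ** M p - M p ** conn_mat p v)"
  proof -
    have "linear (\<lambda>W. conn_mat p v ** W - W ** conn_mat p v)"
      by (rule linearI) (simp_all add: vec_eq_iff matrix_matrix_mult_def sum.distrib distrib_left distrib_right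
          sum_distrib_left right_diff_distrib mult_ac)
    from linear_sum[OF this, of "\<lambda>k. wedge_mat (y k p) (z k p)" "{..<n}"]
    show ?thesis by (simp add: sum.distrib Mq[OF V(2)])
  qed
  also have "(\<Sum>k<n. wedge_mat (y' k) (z k p) + wedge_mat (y k p) (z' k)) = (\<chi> i j. v (\<lambda>q. M q $ i $ j))"
  proof -
    have "v (\<lambda>q. M q $ i $ j) = (\<Sum>k<n. wedge_mat (y' k) (z k p) + wedge_mat (y k p) (z' k)) $ i $ j" for i j
    proof -
      have s: "smooth_via S x p (\<lambda>q. wedge_mat (y k q) (z k q) $ i $ j)" if "k < n" for k
        unfolding wedge_mat_def using yz[OF that V(2)] by (auto intro!: smooth_via_diff smooth_via_mult)
      have "v (\<lambda>q. M q $ i $ j) = v (\<lambda>q. \<Sum>k<n. wedge_mat (y k q) (z k q) $ i $ j)"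
      proof (rule TS_local[OF vT, symmetric])
        show "smooth_via S x p (\<lambda>q. \<Sum>k<n. wedge_mat (y k q) (z k q) $ i $ j)" using s by (auto intro!: smooth_via_sum p)
        show "eventually (\<lambda>q. (\<Sum>k<n. wedge_mat (y k q) (z k q) $ i $ j) = M q $ i $ j) (param_nhds S x p)"
          unfolding param_nhds_eq[OF p] using eventually_nhds_in_open[OF V(1,2)]
          by eventually_elim (simp add: Mq)
      qed
      also have "\<dots> = (\<Sum>k<n. v (\<lambda>q. wedge_mat (y k q) (z k q) $ i $ j))"
        by (rule TS_sum[OF vT p]) (simp add: s)
      also have "\<dots> = (\<Sum>k<n. (wedge_mat (y' k) (z k p) + wedge_mat (y k p) (z' k)) $ i $ j)"
      proof (intro sum.cong refl)
        fix k assume "k \<in> {..<n}"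
        then have k: "k < n" by simp
        note t = yz[OF k V(2)]
        show "v (\<lambda>q. wedge_mat (y k q) (z k q) $ i $ j) =
            (wedge_mat (y' k) (z k p) + wedge_mat (y k p) (z' k)) $ i $ j"
          by (simp add: wedge_mat_def TS_diff[OF vT] TS_mult[OF vT] t smooth_via_mult y'_def z'_def)
      qed
      finally show ?thesis by simp
    qed
    then show ?thesis by (simp add: vec_eq_iff)
  qed
  finally show ?thesis .
qed

lemma D_biv_eq:
  assumes V: "open V" "p \<in> V" "V \<subseteq> S" and v: "v \<in> TM p"
    and M: "\<And>q. q \<in> V \<Longrightarrow> skew (M q)" "\<And>q. q \<in> V \<Longrightarrow> s q = bivec_of (E q) (M q)"
    and sM: "\<And>q i j. q \<in> V \<Longrightarrow> smooth_via S x q (\<lambda>q. M q $ i $ j)"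
  shows "D_biv p v s = bivec_of (E p) ((\<chi> i j. v (\<lambda>q. M q $ i $ j)) + (conn_mat p v ** M p - M p ** conn_mat p v))"
    (is "_ = ?\<tau>")
  unfolding D_biv_def
proof (rule the_equality)
  let ?Y = "\<lambda>k q. E q (of_nat k)" and ?Z = "\<lambda>k q. vec_of (E q) (\<chi> j. M q $ (of_nat k) $ j / 2)"
  have s2: "smooth_via S x q (\<lambda>q. M q $ i $ j / 2)" if "q \<in> V" for q i j
    using smooth_via_mult[OF sM[OF that] smooth_via_const[of q S x "1/2"]] V(3) that by auto
  have YZ: "vfield_on A V (?Y k) \<and> vfield_on A V (?Z k)" for k
    using vfield_on_subset[OF E_vfield V(3)] vfield_on_ve[OF V(3), of "\<lambda>q. \<chi> j. M q $ (of_nat k) $ j / 2"]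
    by (simp add: s2)
  have rep: "bivec_of (E q) (M q) = (\<Sum>k<(5::nat). ?Y k q \<and>\<^sub>1 ?Z k q)" if "q \<in> V" for q
    by (rule bivec_of_representable[OF M(1)[OF that]])
  show "\<exists>U (n::nat) Y Z. open U \<and> p \<in> U \<and> (\<forall>k<n. vfield_on A U (Y k) \<and> vfield_on A U (Z k)) \<and>
    (\<forall>q\<in>U. s q = (\<Sum>k<n. Y k q \<and>\<^sub>1 Z k q)) \<and>
    ?\<tau> = (\<Sum>k<n. D p v (Y k) \<and>\<^sub>1 Z k p + Y k p \<and>\<^sub>1 D p v (Z k))"
  proof (rule exI[of _ V], rule exI[of _ 5], rule exI[of _ ?Y], rule exI[of _ ?Z], intro conjI)
    show "?\<tau> = (\<Sum>k<5. D p v (?Y k) \<and>\<^sub>1 ?Z k p + ?Y k p \<and>\<^sub>1 D p v (?Z k))"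
      by (rule D_biv_rep[OF V v YZ M(1) rep, symmetric])
    show "\<forall>q\<in>V. s q = (\<Sum>k<5. ?Y k q \<and>\<^sub>1 ?Z k q)" using rep M(2) by simp
  qed (use V YZ in auto)
  fix \<tau> assume "\<exists>U (n::nat) Y Z. open U \<and> p \<in> U \<and> (\<forall>k<n. vfield_on A U (Y k) \<and> vfield_on A U (Z k)) \<and>
    (\<forall>q\<in>U. s q = (\<Sum>k<n. Y k q \<and>\<^sub>1 Z k q)) \<and>
    \<tau> = (\<Sum>k<n. D p v (Y k) \<and>\<^sub>1 Z k p + Y k p \<and>\<^sub>1 D p v (Z k))"
  then obtain U' and n :: nat and Y Z where *: "open U'" "p \<in> U'" "\<forall>k<n. vfield_on A U' (Y k) \<and> vfield_on A U' (Z k)"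
    "\<forall>q\<in>U'. s q = (\<Sum>k<n. Y k q \<and>\<^sub>1 Z k q)"
    "\<tau> = (\<Sum>k<n. D p v (Y k) \<and>\<^sub>1 Z k p + Y k p \<and>\<^sub>1 D p v (Z k))"
    by (elim exE conjE) (rule that, assumption+)
  show "\<tau> = ?\<tau>"
    unfolding *(5)
  \<comment> \<open>The competing decomposition comes with its own neighbourhood \<open>U'\<close>;
    the two are compared on the intersection.\<close>
  proof (rule D_biv_rep[where V = "V \<inter> U'"])
    show "vfield_on A (V \<inter> U') (Y k) \<and> vfield_on A (V \<inter> U') (Z k)" if "k < n" for k
      using *(3) that vfield_on_subset by (metis inf_le2)
    show "bivec_of (E q) (M q) = (\<Sum>k<n. Y k q \<and>\<^sub>1 Z k q)" if "q \<in> V \<inter> U'" for q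
      using *(4) M(2) that by auto
  qed (use V v M(1) * in auto)
qed

text \<open>As the connection matrix lies in the range of \<open>Kmat\<close>, its commutator with
  the section is a vector product, so the covariant derivative can be written in the three fibre
  coordinates.\<close>

lemma D_biv_kappa:
  assumes V: "open V" "p \<in> V" "V \<subseteq> S" and v: "v \<in> TM p"
    and s: "\<And>q. q \<in> V \<Longrightarrow> s q = bivec_of (E q) (Kmat (\<sigma> q))"
    and smooth_via: "\<And>q c. q \<in> V \<Longrightarrow> smooth_via S x q (\<lambda>q. \<sigma> q $ c)"
  shows "D_biv p v s = bivec_of (E p) (Kmat ((\<chi> c. v (\<lambda>q. \<sigma> q $ c)) + cross3 (conn_vec p v) (\<sigma> p)))"
proof -
  have p: "p \<in> S" using V by blast
  have vT: "v \<in> TS S x p" using v TM_eq[OF p] by simp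
  have sK: "smooth_via S x q (\<lambda>q. Kmat (\<sigma> q) $ i $ j)" if q: "q \<in> V" for q i j
  proof -
    have "q \<in> S" using V q by blast
    then show ?thesis
      unfolding Kmat_expand[of "\<sigma> _"] by (intro smooth_via_sum smooth_via_mult smooth_via[OF q] smooth_via_const)
  qed
  have "v (\<lambda>q. Kmat (\<sigma> q) $ i $ j) = Kmat (\<chi> c. v (\<lambda>q. \<sigma> q $ c)) $ i $ j" for i j
  proof -
    have c: "smooth_via S x p (\<lambda>q. Kmat (axis c 1) $ i $ j)" for c by (rule smooth_via_const[OF p])
    show ?thesis
      unfolding Kmat_expand[of "\<sigma> _"] Kmat_expand[of "\<chi> c. v (\<lambda>q. \<sigma> q $ c)"]
      by (subst TS_sum[OF vT p])
         (auto intro!: smooth_via_mult smooth_via V c simp: TS_mult[OF vT smooth_via[OF V(2)] c] TS_const[OF vT p])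
  qed
  then have "(\<chi> i j. v (\<lambda>q. Kmat (\<sigma> q) $ i $ j)) = Kmat (\<chi> c. v (\<lambda>q. \<sigma> q $ c))"
    by (simp add: vec_eq_iff)
  then show ?thesis
    using D_biv_eq[OF V v skew_Kmat s sK]
    by (simp add: conn_mat_eq[OF p v] Kmat_bracket Kmat_linear)
qed

end

lemma sum_Basis_vec:
  fixes c :: "real^'n \<Rightarrow> real"
  shows "(\<Sum>b\<in>Basis. c b *\<^sub>R b) = (\<chi> i. c (axis i 1))"
proof -
  have "(\<chi> i. c (axis i 1)) = (\<Sum>b\<in>Basis. ((\<chi> i. c (axis i 1)) \<bullet> b) *\<^sub>R b)"
    by (simp add: euclidean_representation)
  also have "\<dots> = (\<Sum>b\<in>Basis. c b *\<^sub>R b)"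
    by (intro sum.cong) (auto simp: Basis_vec_def inner_axis)
  finally show ?thesis by simp
qed

lemma sum_Basis_prod:
  fixes c :: "'a::euclidean_space \<times> 'b::euclidean_space \<Rightarrow> real"
  shows "(\<Sum>b\<in>Basis. c b *\<^sub>R b) = (\<Sum>b\<in>Basis. c (b, 0) *\<^sub>R b, \<Sum>b\<in>Basis. c (0, b) *\<^sub>R b)"
proof -
  have "(\<Sum>b\<in>Basis. c b *\<^sub>R b) =
      (\<Sum>b\<in>(\<lambda>u. (u, 0)) ` Basis. c b *\<^sub>R b) + (\<Sum>b\<in>(\<lambda>u. (0, u)) ` Basis. c b *\<^sub>R b)"
    unfolding Basis_prod_def by (rule sum.union_disjoint) auto
  also have "\<dots> = (\<Sum>b\<in>Basis. c (b, 0) *\<^sub>R (b, 0)) + (\<Sum>b\<in>Basis. c (0, b) *\<^sub>R (0, b))"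
    by (simp add: sum.reindex inj_on_def)
  also have "\<dots> = (\<Sum>b\<in>Basis. c (b, 0) *\<^sub>R b, \<Sum>b\<in>Basis. c (0, b) *\<^sub>R b)"
    by (simp add: prod_eq_iff fst_sum snd_sum)
  finally show ?thesis .
qed

context framed
begin

subsection \<open>Coordinate vector fields\<close>

definition coord_field :: "5 \<Rightarrow> 'm \<Rightarrow> 'm tvec"
  where "coord_field i q f = (if smooth_via S x q f
    then frechet_derivative (\<lambda>u. f (inv_into U x u)) (at (x q)) (axis i 1) else 0)"

lemma x_image_open: "open (x ` S)"
  using chart_image_open[OF chart_A S_open] S_sub by (simp add: Int_absorb1)

lemma coord_field_eq:
  assumes q: "q \<in> S" and G: "open W" "x q \<in> W" "smooth_on W G" "\<forall>r\<in>S. x r \<in> W \<longrightarrow> f r = G (x r)"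
  shows "coord_field i q f = frechet_derivative G (at (x q)) (axis i 1)"
proof -
  have inv: "inv_into U x (x r) = r" if "r \<in> S" for r
    using that S_sub chart_inj[OF chart_A] by (auto simp: inv_into_f_f)
  have "((\<lambda>u. f (inv_into U x u)) has_derivative frechet_derivative G (at (x q))) (at (x q))"
    by (rule has_derivative_transform_within_open[of G _ "x q" UNIV "W \<inter> x ` S", OF smooth_on_has_derivative[OF G(3,2)]])
       (use G q x_image_open inv in auto)
  then have "frechet_derivative (\<lambda>u. f (inv_into U x u)) (at (x q)) = frechet_derivative G (at (x q))"
    by (rule frechet_derivative_at[symmetric])
  moreover have "smooth_via S x q f" unfolding smooth_via_def using G q by blast
  ultimately show ?thesis by (simp add: coord_field_def)
qed

lemma coord_field_TM:
  assumes q: "q \<in> S" shows "coord_field i q \<in> TM q"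
  unfolding TM_eq[OF q]
proof (rule TS_I)
  fix f h :: "'m \<Rightarrow> real" and c
  assume f: "smooth_via S x q f"
  show "coord_field i q (\<lambda>r. c * f r) = c * coord_field i q f"
  proof -
    obtain W G where W: "open W" "x q \<in> W" "smooth_on W G" "\<forall>r\<in>S. x r \<in> W \<longrightarrow> f r = G (x r)"
      using f unfolding smooth_via_def by blast
    have d: "((\<lambda>u. c * G u) has_derivative (\<lambda>h. c * frechet_derivative G (at (x q)) h)) (at (x q))"
      by (rule has_derivative_mult_right[OF smooth_on_has_derivative[OF W(3,2)]])
    have fibre_coord: "smooth_on W (\<lambda>u. c * G u)"
      by (rule smooth_on_bilinear[OF bounded_bilinear_mult W(1) smooth_on_const[OF W(1)] W(3)])
    have "coord_field i q (\<lambda>r. c * f r) = frechet_derivative (\<lambda>u. c * G u) (at (x q)) (axis i 1)"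
      by (rule coord_field_eq[OF q W(1,2) fibre_coord]) (use W in auto)
    then show ?thesis by (simp only: coord_field_eq[OF q W] frechet_derivative_at[OF d, symmetric])
  qed
  assume h: "smooth_via S x q h"
  obtain W F G where W0: "q \<in> S" and W: "open W" "x q \<in> W" "smooth_on W F" "smooth_on W G"
    "\<forall>r\<in>S. x r \<in> W \<longrightarrow> f r = F (x r) \<and> h r = G (x r)"
    using smooth_via_common[OF f h] .
  then have f': "coord_field i q f = frechet_derivative F (at (x q)) (axis i 1)"
    and h': "coord_field i q h = frechet_derivative G (at (x q)) (axis i 1)"
    by (auto intro!: coord_field_eq[OF q W(1,2)])
  have fq: "f q = F (x q)" "h q = G (x q)" using W q by auto
  note dF = smooth_on_has_derivative[OF W(3,2)] and dG = smooth_on_has_derivative[OF W(4,2)]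
  have "coord_field i q (\<lambda>r. f r + h r) = frechet_derivative (\<lambda>u. F u + G u) (at (x q)) (axis i 1)"
    by (rule coord_field_eq[OF q W(1,2) smooth_on_add[OF W(1,3,4)]]) (use W in auto)
  then show "coord_field i q (\<lambda>r. f r + h r) = coord_field i q f + coord_field i q h"
    by (simp only: f' h' frechet_derivative_at[OF has_derivative_add[OF dF dG], symmetric])
  have "coord_field i q (\<lambda>r. f r * h r) = frechet_derivative (\<lambda>u. F u * G u) (at (x q)) (axis i 1)"
    by (rule coord_field_eq[OF q W(1,2) smooth_on_bilinear[OF bounded_bilinear_mult W(1,3,4)]]) (use W in auto)
  also have "\<dots> = F (x q) * coord_field i q h + coord_field i q f * G (x q)"
    by (simp only: f' h' frechet_derivative_at[OF has_derivative_mult[OF dF dG], symmetric])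
  finally show "coord_field i q (\<lambda>r. f r * h r) = coord_field i q f * h q + f q * coord_field i q h" by (simp add: fq)
qed (simp add: coord_field_def)

lemma coord_field_vfield: "vfield_on A S (coord_field i)"
proof (rule vfield_onI[OF order_refl])
  fix q and f :: "'m \<Rightarrow> real" assume q: "q \<in> S" and "smooth_via S x q f"
  then obtain W G where W: "open W" "x q \<in> W" "smooth_on W G" "\<forall>r\<in>S. x r \<in> W \<longrightarrow> f r = G (x r)"
    unfolding smooth_via_def by blast
  show "smooth_via S x q (\<lambda>r. coord_field i r f)"
    unfolding smooth_via_def using q W smooth_on_frechet_derivative[OF W(3), of "axis i 1"] coord_field_eq[OF _ W(1) _ W(3,4)]
    by (intro conjI exI[of _ W] exI[of _ "\<lambda>u. frechet_derivative G (at u) (axis i 1)"]) auto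
qed (rule coord_field_TM)

lemma coord_pd: "q \<in> S \<Longrightarrow> coord (coord_field i q) = axis i 1"
proof -
  assume q: "q \<in> S"
  have "coord_field i q (\<lambda>r. x r $ j) = axis i 1 $ j" for j
  proof -
    have "((\<lambda>u::real^5. u $ j) has_derivative (\<lambda>u. u $ j)) (at (x q))"
      by (rule bounded_linear_imp_has_derivative[OF bounded_linear_vec_nth])
    then have "frechet_derivative (\<lambda>u::real^5. u $ j) (at (x q)) = (\<lambda>u. u $ j)"
      by (rule frechet_derivative_at[symmetric])
    moreover have "coord_field i q (\<lambda>r. x r $ j) = frechet_derivative (\<lambda>u. u $ j) (at (x q)) (axis i 1)"
      by (rule coord_field_eq[OF q open_UNIV]) (auto intro: smooth_on_linear bounded_linear_vec_nth)
    ultimately show ?thesis by simp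
  qed
  then show ?thesis by (simp add: coord_def vec_eq_iff)
qed

text \<open>The matrix inverse to the coordinate matrix of the frame. As metric products of smooth
  fields its entries are smooth, so no matrix of functions has to be inverted.\<close>

definition coframe :: "'m \<Rightarrow> 5 \<Rightarrow> 5 \<Rightarrow> real"
  where "coframe q a i = g q (coord_field i q) (E q a)"

lemma coframe_sm: "q \<in> S \<Longrightarrow> smooth_via S x q (\<lambda>r. coframe r a i)"
  unfolding coframe_def by (rule g_sm[OF S_open order_refl coord_field_vfield E_vfield])

lemma coframe_coord:
  assumes q: "q \<in> S" shows "(\<Sum>i\<in>UNIV. coframe q a i * coord (vec_of (E q) u) $ i) = u $ a"
proof -
  let ?v = "vec_of (E q) u"
  note T = vec_of_TM[OF q E_onb[OF q]] coord_field_TM[OF q]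
  have "coord (\<Sum>i\<in>UNIV. coord ?v $ i *\<^sub>R coord_field i q) = coord ?v"
    by (simp add: coord_sum coord_scale coord_pd[OF q]) (simp add: vec_eq_iff axis_def if_distrib cong: if_cong)
  then have "(\<Sum>i\<in>UNIV. coord ?v $ i *\<^sub>R coord_field i q) = ?v"
    by (intro TM_eqI[OF q] TM_sum[OF q] TM_scale[OF q] T)
  then have "g q ?v (E q a) = g q (\<Sum>i\<in>UNIV. coord ?v $ i *\<^sub>R coord_field i q) (E q a)" by simp
  also have "\<dots> = (\<Sum>i\<in>UNIV. coord ?v $ i * coframe q a i)"
    by (subst g_sum[OF q]) (auto simp: TM_scale[OF q] T E_TM[OF q] g_scale coframe_def)
  finally show ?thesis by (simp add: g_ve_onb[OF q E_onb[OF q]] mult.commute)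
qed

subsection \<open>The twistor space over a framed domain\<close>

definition tw_restr :: "('m \<times> 'm bivec) set"
  where "tw_restr = {z \<in> twistor_space. fst z \<in> S}"

definition tw_point :: "'m \<Rightarrow> real^3 \<Rightarrow> 'm \<times> 'm bivec"
  where "tw_point q s = (q, bivec_of (E q) (Kmat s))"

definition fibre_coord :: "'m \<times> 'm bivec \<Rightarrow> real^3"
  where "fibre_coord z = (THE s. snd z = bivec_of (E (fst z)) (Kmat s))"

definition tw_coord :: "'m \<times> 'm bivec \<Rightarrow> (real^5) \<times> (real^3)"
  where "tw_coord z = (x (fst z), fibre_coord z)"

lemma fst_pt [simp]: "fst (tw_point q s) = q"
  by (simp add: tw_point_def)

lemma fibre_coord_pt: "q \<in> S \<Longrightarrow> fibre_coord (tw_point q s) = s"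
  unfolding fibre_coord_def tw_point_def by (auto intro!: the_equality dest: kappa_inj)

lemma tw_coord_pt: "q \<in> S \<Longrightarrow> tw_coord (tw_point q s) = (x q, s)"
  by (simp add: tw_coord_def fibre_coord_pt)

lemma tw_point_N: "q \<in> S \<Longrightarrow> s \<bullet> s = 1 \<Longrightarrow> tw_point q s \<in> tw_restr"
  by (auto simp: tw_restr_def tw_point_def twistor_iff)

lemma tw_restr_point:
  assumes "z \<in> tw_restr" shows "fst z \<in> S" "z = tw_point (fst z) (fibre_coord z)" "fibre_coord z \<bullet> fibre_coord z = 1"
proof -
  show q: "fst z \<in> S" using assms by (simp add: tw_restr_def)
  obtain s where s: "z = tw_point (fst z) s" "s \<bullet> s = 1"
    using assms twistor_iff[OF q, of "snd z"] by (cases z) (auto simp: tw_restr_def tw_point_def)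
  then have "fibre_coord z = s" using fibre_coord_pt[OF q] by metis
  then show "z = tw_point (fst z) (fibre_coord z)" "fibre_coord z \<bullet> fibre_coord z = 1" using s by auto
qed

lemma smooth_via_fst_th: "z \<in> tw_restr \<Longrightarrow> smooth_via tw_restr tw_coord z (\<lambda>z. x (fst z))"
  using smooth_via_fst[OF smooth_via_param[of z tw_restr tw_coord]] by (simp add: tw_coord_def)

lemma smooth_via_sc: "z \<in> tw_restr \<Longrightarrow> smooth_via tw_restr tw_coord z fibre_coord"
  using smooth_via_snd[OF smooth_via_param[of z tw_restr tw_coord]] by (simp add: tw_coord_def)

lemma smooth_via_base:
  assumes "z \<in> tw_restr" "smooth_via S x (fst z) f" shows "smooth_via tw_restr tw_coord z (\<lambda>z. f (fst z))"
proof (rule smooth_via_pullback[OF assms(2) smooth_via_fst_th[OF assms(1)]])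
  show "eventually (\<lambda>z. fst z \<in> S) (param_nhds tw_restr tw_coord z)"
    using eventually_param_nhds_mem by (rule eventually_mono) (rule tw_restr_point(1))
qed

abbreviation tw_dom :: "'m set \<Rightarrow> ('m \<times> 'm bivec) set"
  where "tw_dom V \<equiv> {(p, \<sigma>) \<in> twistor_space. p \<in> V}"

abbreviation tw :: "('m \<Rightarrow> real^5) \<Rightarrow> 'm \<times> 'm bivec \<Rightarrow> (real^5) \<times> (real^5^5)"
  where "tw y \<equiv> (\<lambda>(p, \<sigma>). (y p, \<chi> i j. \<sigma> (\<lambda>q. y q $ i) (\<lambda>q. y q $ j)))"

lemma smooth_near_tw: "smooth_near twistor_charts z F \<longleftrightarrow> (\<exists>(V, y)\<in>A. smooth_via (tw_dom V) (tw y) z F)"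
  unfolding twistor_charts_def smooth_near_def smooth_via_def by (auto simp: split_beta)

lemma mult_delta: "c * ((if a = k then 1 else 0) * (if b = l then 1 else 0)) =
    (if l = b then if k = a then c else 0 else (0::real))"
  by auto

text \<open>Contracting the ambient coordinates of a bivector with the coframe gives its matrix in
  the frame, and \<open>s\<close> sits in the entries 45, 34 and 35 of \<open>Kmat s\<close>. This
  shows that \<open>fibre_coord\<close> is smooth in the charts of the twistor space.\<close>

lemma fibre_coord_formula:
  assumes z: "z \<in> tw_restr"
  defines "m \<equiv> (\<lambda>a b. \<Sum>i\<in>UNIV. \<Sum>j\<in>UNIV. coframe (fst z) a i * coframe (fst z) b j * snd (tw x z) $ i $ j)"
  shows "fibre_coord z = vector [m 4 5, m 3 4, m 3 5]"
proof -
  define q s where "q = fst z" and "s = fibre_coord z"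
  have q: "q \<in> S" and zq: "z = tw_point q s" using tw_restr_point[OF z] by (auto simp: q_def s_def)
  have tw: "snd (tw x z) $ i $ j = (\<Sum>k\<in>UNIV. \<Sum>l\<in>UNIV. Kmat s $ k $ l * (coord (E q k) $ i * coord (E q l) $ j))" for i j
    by (simp add: zq tw_point_def bivec_of_apply_skew coord_def)
  have c: "(\<Sum>i\<in>UNIV. coframe q a i * coord (E q k) $ i) = (if a = k then 1 else 0)" for a k
    using coframe_coord[OF q, of a "axis k 1"] unfolding vec_of_axis by (simp add: axis_def)
  have "m a b = Kmat s $ a $ b" for a b
  proof -
    have "m a b = (\<Sum>i\<in>UNIV. \<Sum>j\<in>UNIV. \<Sum>k\<in>UNIV. \<Sum>l\<in>UNIV.
        Kmat s $ k $ l * ((coframe q a i * coord (E q k) $ i) * (coframe q b j * coord (E q l) $ j)))"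
      unfolding m_def tw q_def[symmetric] by (simp add: sum_distrib_left mult_ac)
    \<comment> \<open>The sums are reordered until each contraction of coframe and frame stands
      alone and becomes a Kronecker delta.\<close>
    also have "\<dots> = (\<Sum>i\<in>UNIV. \<Sum>k\<in>UNIV. \<Sum>j\<in>UNIV. \<Sum>l\<in>UNIV.
        Kmat s $ k $ l * ((coframe q a i * coord (E q k) $ i) * (coframe q b j * coord (E q l) $ j)))"
      by (rule sum.cong[OF refl], rule sum.swap)
    also have "\<dots> = (\<Sum>k\<in>UNIV. \<Sum>i\<in>UNIV. \<Sum>l\<in>UNIV. \<Sum>j\<in>UNIV.
        Kmat s $ k $ l * ((coframe q a i * coord (E q k) $ i) * (coframe q b j * coord (E q l) $ j)))"
      by (subst sum.swap, rule sum.cong[OF refl], rule sum.cong[OF refl], rule sum.swap)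
    also have "\<dots> = (\<Sum>k\<in>UNIV. \<Sum>l\<in>UNIV. \<Sum>i\<in>UNIV. \<Sum>j\<in>UNIV.
        Kmat s $ k $ l * ((coframe q a i * coord (E q k) $ i) * (coframe q b j * coord (E q l) $ j)))"
      by (rule sum.cong[OF refl], rule sum.swap)
    also have "\<dots> = (\<Sum>k\<in>UNIV. \<Sum>l\<in>UNIV. Kmat s $ k $ l * ((if a = k then 1 else 0) * (if b = l then 1 else 0)))"
      by (simp only: c[symmetric] sum_product) (simp only: sum_distrib_left)
    also have "\<dots> = Kmat s $ a $ b"
      by (simp add: mult_delta)
    finally show ?thesis .
  qed
  then show ?thesis by (simp add: s_def[symmetric] Kmat_nth vec_eq_iff forall_3 vector_3)
qed

text \<open>The two parametrisations are smooth in each other: base point and unit vector in the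
  ambient coordinates through the coframe, the ambient coordinates in base point and unit vector
  through the frame.\<close>

lemma smooth_near_T:
  assumes z: "z \<in> tw_restr"
  shows "smooth_near twistor_charts z F \<longleftrightarrow> smooth_via tw_restr tw_coord z F"
proof
  note q = tw_restr_point(1)[OF z]
  assume F: "smooth_via tw_restr tw_coord z F"
  have zU: "z \<in> tw_dom U" using z S_sub by (auto simp: tw_restr_def)
  have tw1: "smooth_via (tw_dom U) (tw x) z (\<lambda>z. x (fst z))"
    using smooth_via_fst[OF smooth_via_param[OF zU, of "tw x"]] by (simp add: split_beta)
  have tw2: "smooth_via (tw_dom U) (tw x) z (\<lambda>z. snd (tw x z))"
    by (rule smooth_via_snd[OF smooth_via_param[OF zU]])
  have evS: "eventually (\<lambda>z. z \<in> tw_restr) (param_nhds (tw_dom U) (tw x) z)"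
  proof (rule eventually_param_nhdsI[where W = "x ` S \<times> UNIV"])
    show "z' \<in> tw_restr" if "z' \<in> tw_dom U" "tw x z' \<in> x ` S \<times> UNIV" for z'
      using that inj_onD[OF chart_inj[OF chart_A]] S_sub by (auto simp: tw_restr_def split_beta)
  qed (use q x_image_open in \<open>auto simp: split_beta intro: open_Times\<close>)
  have base: "smooth_via (tw_dom U) (tw x) z (\<lambda>z. f (fst z))" if "smooth_via S x (fst z) f" for f :: "'m \<Rightarrow> real"
    by (rule smooth_via_pullback[OF that tw1]) (use evS in eventually_elim, auto simp: tw_restr_def)
  let ?m = "\<lambda>z a b. \<Sum>i\<in>UNIV. \<Sum>j\<in>UNIV. coframe (fst z) a i * coframe (fst z) b j * snd (tw x z) $ i $ j"
  have m: "smooth_via (tw_dom U) (tw x) z (\<lambda>z. ?m z a b)" for a b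
    by (intro smooth_via_sum smooth_via_mult base coframe_sm[OF q] smooth_via_nth tw2 zU)
  have "\<forall>c. smooth_via (tw_dom U) (tw x) z (\<lambda>z. (vector [?m z 4 5, ?m z 3 4, ?m z 3 5] :: real^3) $ c)"
    unfolding forall_3 vector_3 by (intro conjI m)
  then have "smooth_via (tw_dom U) (tw x) z (\<lambda>z. vector [?m z 4 5, ?m z 3 4, ?m z 3 5] :: real^3)"
    by (intro smooth_via_vec) blast
  then have "smooth_via (tw_dom U) (tw x) z fibre_coord"
    by (rule smooth_via_cong) (use evS in eventually_elim, rule fibre_coord_formula[symmetric])
  then have "smooth_via (tw_dom U) (tw x) z tw_coord"
    using smooth_via_Pair[OF tw1] by (simp add: tw_coord_def[abs_def])
  then have "smooth_via (tw_dom U) (tw x) z F"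
    using smooth_via_pullback[of tw_restr tw_coord "\<lambda>z. z" z F] F evS by simp
  then show "smooth_near twistor_charts z F"
    unfolding smooth_near_tw using chart_A by blast
next
  note q = tw_restr_point(1)[OF z]
  assume "smooth_near twistor_charts z F"
  then obtain V y where V: "(V, y) \<in> A" "smooth_via (tw_dom V) (tw y) z F" unfolding smooth_near_tw by blast
  have qV: "fst z \<in> V" using smooth_via_mem[OF V(2)] by auto
  have yi: "smooth_via S x (fst z) (\<lambda>r. y r $ i)" if "fst z \<in> V" "fst z \<in> S" for i and z :: "'m \<times> 'm bivec"
    using smooth_near_chart[OF V(1) order_refl chart_open(1)[OF V(1)] that(1)] smooth_near_iff[OF that(2)]
      smooth_via_nth[OF smooth_via_param[OF that(1), of y]] by blast
  have evV: "eventually (\<lambda>z. z \<in> tw_dom V) (param_nhds tw_restr tw_coord z)"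
  proof -
    have "eventually (\<lambda>r. r \<in> V) (param_nhds S x (fst z))"
      unfolding param_nhds_eq[OF q] using chart_open(1)[OF V(1)] qV by (rule eventually_nhds_in_open)
    then obtain W where W: "open W" "x (fst z) \<in> W" "\<forall>r\<in>S. x r \<in> W \<longrightarrow> r \<in> V"
      unfolding eventually_param_nhds by blast
    show ?thesis
    proof (rule eventually_param_nhdsI[where W = "W \<times> UNIV"])
      show "z' \<in> tw_dom V" if "z' \<in> tw_restr" "tw_coord z' \<in> W \<times> UNIV" for z'
        using that W(3) by (auto simp: tw_restr_def tw_coord_def)
    qed (use W in \<open>auto simp: tw_coord_def intro: open_Times\<close>)
  qed
  let ?K = "\<lambda>z i j. \<Sum>k\<in>UNIV. \<Sum>l\<in>UNIV. Kmat (fibre_coord z) $ k $ l *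
      (E (fst z) k (\<lambda>r. y r $ i) * E (fst z) l (\<lambda>r. y r $ j))"
  have K: "smooth_via tw_restr tw_coord z (\<lambda>z. ?K z i j)" for i j
    unfolding Kmat_expand[of "fibre_coord _"]
    by (intro smooth_via_sum smooth_via_mult smooth_via_base[OF z] E_sm[OF q] yi q qV z smooth_via_nth[OF smooth_via_sc[OF z]] smooth_via_const)
  have "smooth_via tw_restr tw_coord z (\<lambda>z. (y (fst z), \<chi> i j. ?K z i j))"
  proof (intro smooth_via_Pair smooth_via_vec)
    show "smooth_via tw_restr tw_coord z (\<lambda>z. y (fst z) $ i)" for i
      by (rule smooth_via_base[OF z yi[OF qV q]])
    show "smooth_via tw_restr tw_coord z (\<lambda>z. (\<chi> i j. ?K z i j) $ i $ j)" for i j using K by simp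
  qed
  then have "smooth_via tw_restr tw_coord z (tw y)"
  proof (rule smooth_via_cong)
    show "eventually (\<lambda>z. (y (fst z), \<chi> i j. ?K z i j) = tw y z) (param_nhds tw_restr tw_coord z)"
      using eventually_param_nhds_mem
    proof eventually_elim
      case (elim z)
      have "tw y z = tw y (tw_point (fst z) (fibre_coord z))" using tw_restr_point(2)[OF elim] by (rule arg_cong)
      then show ?case by (simp add: tw_point_def bivec_of_apply_skew vec_eq_iff)
    qed
  qed
  then show "smooth_via tw_restr tw_coord z F"
    using smooth_via_pullback[of "tw_dom V" "tw y" "\<lambda>z. z" z F] V(2) evV by simp
qed

lemma TT_eq: "z \<in> tw_restr \<Longrightarrow> tangent_space twistor_charts z = TS tw_restr tw_coord z"
  by (rule tangent_space_cong) (simp add: smooth_near_T smooth_near_single)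

section \<open>Vertical vectors and horizontal lifts\<close>

text \<open>\<open>G\<close> extends \<open>F\<close> to an open set of R^5 x R^3, so beyond the
  unit sphere in the second factor. Its derivatives normal to the sphere depend on the choice, and
  tangent vectors do not use them.\<close>

definition local_rep :: "('m \<times> 'm bivec \<Rightarrow> real) \<Rightarrow> 'm \<times> 'm bivec \<Rightarrow> ((real^5) \<times> (real^3)) set \<Rightarrow>
    ((real^5) \<times> (real^3) \<Rightarrow> real) \<Rightarrow> bool"
  where "local_rep F z W G \<longleftrightarrow> open W \<and> tw_coord z \<in> W \<and> smooth_on W G \<and> (\<forall>z'\<in>tw_restr. tw_coord z' \<in> W \<longrightarrow> F z' = G (tw_coord z'))"

lemma smooth_via_rp: "smooth_via tw_restr tw_coord z F \<Longrightarrow> \<exists>W G. local_rep F z W G"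
  unfolding smooth_via_def local_rep_def by blast

lemma local_rep_sm: "z \<in> tw_restr \<Longrightarrow> local_rep F z W G \<Longrightarrow> smooth_via tw_restr tw_coord z F"
  unfolding smooth_via_def local_rep_def by blast

lemma local_rep_has_derivative: "local_rep F z W G \<Longrightarrow> (G has_derivative frechet_derivative G (at (tw_coord z))) (at (tw_coord z))"
  unfolding local_rep_def by (blast intro: smooth_on_has_derivative)

lemma local_rep_linear: "local_rep F z W G \<Longrightarrow> linear (frechet_derivative G (at (tw_coord z)))"
  using local_rep_has_derivative has_derivative_linear by blast

text \<open>As \<open>v\<close> is orthogonal to \<open>s\<close>, the squared length of
  \<open>s + \<tau> v\<close> is 1 + \<tau>^2 |v|^2; normalising changes the curve only to second
  order and keeps its velocity.\<close>

lemma has_derivative_normalized: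
  fixes s v :: "real^3"
  assumes "s \<bullet> s = 1" "v \<bullet> s = 0"
  shows "((\<lambda>\<tau>. (1 / sqrt (1 + \<tau>\<^sup>2 * (v \<bullet> v))) *\<^sub>R (s + \<tau> *\<^sub>R v)) has_derivative (\<lambda>\<tau>. \<tau> *\<^sub>R v)) (at 0)"
proof -
  have "((\<lambda>\<tau>. 1 / sqrt (1 + \<tau>\<^sup>2 * (v \<bullet> v))) has_real_derivative 0) (at 0)"
    by (auto intro!: derivative_eq_intros)
  then have "((\<lambda>\<tau>. 1 / sqrt (1 + \<tau>\<^sup>2 * (v \<bullet> v))) has_derivative (\<lambda>h. 0)) (at 0)"
    by (simp add: has_field_derivative_def mult_zero_left[abs_def])
  moreover have "((\<lambda>\<tau>. s + \<tau> *\<^sub>R v) has_derivative (\<lambda>\<tau>. \<tau> *\<^sub>R v)) (at 0)"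
    by (auto intro!: derivative_eq_intros)
  ultimately have "((\<lambda>\<tau>. (1 / sqrt (1 + \<tau>\<^sup>2 * (v \<bullet> v))) *\<^sub>R (s + \<tau> *\<^sub>R v)) has_derivative
      (\<lambda>\<tau>. (1 / sqrt (1 + 0\<^sup>2 * (v \<bullet> v))) *\<^sub>R (\<tau> *\<^sub>R v) + 0 *\<^sub>R (s + 0 *\<^sub>R v))) (at 0)"
    by (rule has_derivative_scaleR)
  then show ?thesis by simp
qed

text \<open>Rescaling to squared length \<open>5\<close> in the definition of \<open>vert\<close> is
  normalisation to unit length in the coordinates \<open>s\<close>; the rest is the chain rule for a
  local extension of \<open>F\<close>.\<close>

lemma vert_G:
  assumes q: "q \<in> S" and s: "s \<bullet> s = 1" and v: "v \<bullet> s = 0" and G: "local_rep F (tw_point q s) W G"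
  shows "vert (tw_point q s) (bivec_of (E q) (Kmat v)) F = frechet_derivative G (at (x q, s)) (0, v)"
proof -
  let ?z = "tw_point q s"
  define c where "c \<tau> = (1 / sqrt (1 + \<tau>\<^sup>2 * (v \<bullet> v))) *\<^sub>R (s + \<tau> *\<^sub>R v)" for \<tau>
  have z: "?z \<in> tw_restr" by (rule tw_point_N[OF q s])
  have norm: "(s + \<tau> *\<^sub>R v) \<bullet> (s + \<tau> *\<^sub>R v) = 1 + \<tau>\<^sup>2 * (v \<bullet> v)" for \<tau>
    using s v by (simp add: inner_add_left inner_add_right inner_commute power2_eq_square)
  have pos: "0 < 1 + \<tau>\<^sup>2 * (v \<bullet> v)" for \<tau> by (simp add: add_pos_nonneg)
  have cc: "c \<tau> \<bullet> c \<tau> = 1" for \<tau>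
    using pos[of \<tau>] by (simp add: c_def norm power2_eq_square[symmetric] power_divide)
  have curve: "(let \<tau>' = snd ?z + \<tau> *\<^sub>R bivec_of (E q) (Kmat v) in
      F (fst ?z, sqrt (5 / biv_inner (fst ?z) \<tau>' \<tau>') *\<^sub>R \<tau>')) = F (tw_point q (c \<tau>))" for \<tau>
  proof -
    have t: "snd ?z + \<tau> *\<^sub>R bivec_of (E q) (Kmat v) = bivec_of (E q) (Kmat (s + \<tau> *\<^sub>R v))"
      by (simp only: tw_point_def snd_conv Kmat_linear bivec_of_add bivec_of_scale)
    have r: "sqrt (5 / (5 * (1 + \<tau>\<^sup>2 * (v \<bullet> v)))) = 1 / sqrt (1 + \<tau>\<^sup>2 * (v \<bullet> v))"
    proof -
      have "(5::real) / (5 * a) = 1 / a" for a by simp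
      then show ?thesis by (simp only: real_sqrt_divide real_sqrt_one)
    qed
    show ?thesis
      unfolding Let_def t fst_pt biv_inner_kappa[OF q] norm r
      by (simp only: tw_point_def c_def Kmat_linear bivec_of_scale)
  qed
  have dc: "(c has_derivative (\<lambda>\<tau>. \<tau> *\<^sub>R v)) (at 0)"
    unfolding c_def by (rule has_derivative_normalized[OF s v])
  have c0: "c 0 = s" by (simp add: c_def)
  have dG: "(G has_derivative frechet_derivative G (at (x q, s))) (at (x q, c 0))"
    using local_rep_has_derivative[OF G] by (simp add: tw_coord_pt[OF q] c0)
  have "((\<lambda>\<tau>. (x q, c \<tau>)) has_derivative (\<lambda>\<tau>. (0, \<tau> *\<^sub>R v))) (at 0)"
    by (intro has_derivative_Pair dc has_derivative_const)
  from has_derivative_compose[OF this dG]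
  have "((\<lambda>\<tau>. G (x q, c \<tau>)) has_derivative (\<lambda>\<tau>. frechet_derivative G (at (x q, s)) (0, \<tau> *\<^sub>R v))) (at 0)" .
  moreover have "frechet_derivative G (at (x q, s)) (0, \<tau> *\<^sub>R v) = \<tau> * frechet_derivative G (at (x q, s)) (0, v)" for \<tau>
  proof -
    have "linear (frechet_derivative G (at (x q, s)))" using local_rep_linear[OF G] by (simp add: tw_coord_pt[OF q])
    from linear_cmul[OF this, of \<tau> "(0, v)"] show ?thesis by simp
  qed
  ultimately have der: "((\<lambda>\<tau>. G (x q, c \<tau>)) has_real_derivative frechet_derivative G (at (x q, s)) (0, v)) (at 0)"
    by (simp add: has_field_derivative_def mult.commute[of _ "frechet_derivative G (at (x q, s)) (0, v)"])
  have cont: "continuous_on UNIV c"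
    unfolding c_def using pos by (intro continuous_intros) (auto simp: less_imp_neq[symmetric])
  have "((\<lambda>\<tau>. F (tw_point q (c \<tau>))) has_real_derivative frechet_derivative G (at (x q, s)) (0, v)) (at 0)"
  proof (rule has_field_derivative_transform_within_open[OF der])
    show "open ((\<lambda>\<tau>. (x q, c \<tau>)) -` W)"
      using G cont by (intro open_vimage continuous_on_Pair continuous_on_const) (auto simp: local_rep_def)
    show "0 \<in> (\<lambda>\<tau>. (x q, c \<tau>)) -` W" using G by (simp add: local_rep_def tw_coord_pt[OF q] c0)
    show "G (x q, c \<tau>) = F (tw_point q (c \<tau>))" if "\<tau> \<in> (\<lambda>\<tau>. (x q, c \<tau>)) -` W" for \<tau>
      using G that tw_point_N[OF q cc[of \<tau>]] by (simp add: local_rep_def tw_coord_pt[OF q])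
  qed
  then have "deriv (\<lambda>\<tau>. F (tw_point q (c \<tau>))) 0 = frechet_derivative G (at (x q, s)) (0, v)"
    by (rule DERIV_imp_deriv)
  moreover have "smooth_near twistor_charts ?z F"
    using smooth_near_T[OF z] local_rep_sm[OF z G] by simp
  ultimately show ?thesis unfolding vert_def curve by simp
qed

lemma vert_not_sm: "z \<in> tw_restr \<Longrightarrow> \<not> smooth_via tw_restr tw_coord z F \<Longrightarrow> vert z V F = 0"
  by (simp add: vert_def smooth_near_T)

text \<open>The chain rule along a section whose fibre coordinates are \<open>\<sigma>\<close>.
  Horizontal lifts use it for constant \<open>\<sigma>\<close> and for the arbitrary section in the
  definition of \<open>hlift\<close>.\<close>

lemma local_rep_const_section:
  assumes "local_rep F (tw_point q s) W G" "q \<in> S" "s \<bullet> s = 1" "X \<in> TM q" "open V" "V \<subseteq> S" "q \<in> V"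
    and \<sigma>: "\<And>r. r \<in> V \<Longrightarrow> \<sigma> r \<bullet> \<sigma> r = 1" "\<sigma> q = s" and smooth_via: "smooth_via S x q \<sigma>"
    and F': "\<And>r. r \<in> V \<Longrightarrow> F' r = F (tw_point r (\<sigma> r))"
  shows "X F' = frechet_derivative G (at (x q, s)) (coord X, \<chi> c. X (\<lambda>r. \<sigma> r $ c))"
proof -
  note q = assms(2) and XT = assms(4)[unfolded TM_eq[OF assms(2)]]
  have G: "open W" "(x q, s) \<in> W" "smooth_on W G" "\<forall>z'\<in>tw_restr. tw_coord z' \<in> W \<longrightarrow> F z' = G (tw_coord z')"
    using assms(1) by (auto simp: local_rep_def tw_coord_pt[OF q])
  have smp: "smooth_via S x q (\<lambda>r. (x r, \<sigma> r))" by (rule smooth_via_Pair[OF smooth_via_param[OF q] smooth_via])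
  have pW: "(x q, \<sigma> q) \<in> W" using G(2) \<sigma>(2) by simp
  have "X F' = X (\<lambda>r. G (x r, \<sigma> r))"
  proof (rule TS_local[OF XT, symmetric])
    show "smooth_via S x q (\<lambda>r. G (x r, \<sigma> r))" by (rule smooth_via_compose[OF smp G(1,3) pW])
    have "eventually (\<lambda>r. r \<in> V) (param_nhds S x q)"
      unfolding param_nhds_eq[OF q] by (rule eventually_nhds_in_open[OF assms(5,7)])
    then show "eventually (\<lambda>r. G (x r, \<sigma> r) = F' r) (param_nhds S x q)"
      using eventually_param_nhds_sm[OF smp G(1) pW]
    proof eventually_elim
      case (elim r)
      then have r: "r \<in> S" using assms(6) by blast
      then show ?case using F'[OF elim(1)] G(4) tw_point_N[OF r \<sigma>(1)[OF elim(1)]] elim(2) by (simp add: tw_coord_pt)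
    qed
  qed
  also have "\<dots> = frechet_derivative G (at (x q, \<sigma> q)) (\<Sum>b\<in>Basis. X (\<lambda>r. (x r, \<sigma> r) \<bullet> b) *\<^sub>R b)"
    by (rule TS_chain[OF XT smp G(1,3) pW])
  also have "(\<Sum>b\<in>Basis. X (\<lambda>r. (x r, \<sigma> r) \<bullet> b) *\<^sub>R b) = (coord X, \<chi> c. X (\<lambda>r. \<sigma> r $ c))"
    by (simp add: sum_Basis_prod sum_Basis_vec coord_def inner_axis)
  finally show ?thesis by (simp add: \<sigma>(2))
qed

text \<open>The derivative of the fibre coordinates of a section enters once through the derivative
  along the section and once through \<open>D_biv\<close>. The two cancel, so every section gives
  the same vector as the one with constant coordinates.\<close>

lemma hlift_eq:
  assumes q: "q \<in> S" and s: "s \<bullet> s = 1" and X: "X \<in> TM q"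
  shows "hlift (tw_point q s) X = (\<lambda>F. if smooth_near twistor_charts (tw_point q s) F then X (\<lambda>r. F (tw_point r s)) else 0)
    - vert (tw_point q s) (bivec_of (E q) (Kmat (cross3 (conn_vec q X) s)))" (is "_ = ?w")
  unfolding hlift_def
proof (rule the_equality)
  let ?z = "tw_point q s"
  have z: "?z \<in> tw_restr" by (rule tw_point_N[OF q s])
  have XT: "X \<in> TS S x q" using X TM_eq[OF q] by simp
  \<comment> \<open>With constant fibre coordinates only the connection term of the covariant
    derivative survives.\<close>
  let ?s0 = "\<lambda>r. snd (tw_point r s)"
  have z0: "(\<chi> c. X (\<lambda>r. s $ c)) = (0::real^3)"
    using TS_const[OF XT q] by (simp add: vec_eq_iff)
  have "D_biv q X ?s0 = bivec_of (E q) (Kmat ((\<chi> c. X (\<lambda>r. s $ c)) + cross3 (conn_vec q X) s))"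
    by (rule D_biv_kappa[OF S_open q order_refl X, where \<sigma> = "\<lambda>_. s"]) (auto simp: tw_point_def intro: smooth_via_const)
  then have D0: "D_biv q X ?s0 = bivec_of (E q) (Kmat (cross3 (conn_vec q X) s))" by (simp only: z0 add_0_left)
  have sec: "local_section S ?s0"
    unfolding local_section_def
  proof (intro ballI conjI allI impI)
    fix r assume r: "r \<in> S"
    have pr: "(r, ?s0 r) = tw_point r s" by (simp add: tw_point_def)
    have prN: "tw_point r s \<in> tw_restr" by (rule tw_point_N[OF r s])
    then show "(r, ?s0 r) \<in> twistor_space" by (simp add: pr tw_restr_def)
    fix F assume "smooth_near twistor_charts (r, ?s0 r) F"
    then have F: "smooth_via tw_restr tw_coord (tw_point r s) F" by (simp add: pr smooth_near_T[OF prN])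
    have "smooth_via S x r (\<lambda>r. F (tw_point r s))"
    proof (rule smooth_via_pullback[where m = "\<lambda>r. tw_point r s", OF F])
      have "smooth_via S x r (\<lambda>r. (x r, s))" by (rule smooth_via_Pair[OF smooth_via_param[OF r] smooth_via_const[OF r]])
      then show "smooth_via S x r (\<lambda>r. tw_coord (tw_point r s))"
        by (rule smooth_via_cong) (use eventually_param_nhds_mem in eventually_elim, simp add: tw_coord_pt)
      show "eventually (\<lambda>r. tw_point r s \<in> tw_restr) (param_nhds S x r)"
        using eventually_param_nhds_mem by eventually_elim (rule tw_point_N[OF _ s])
    qed
    then show "smooth_near A r (\<lambda>q'. F (q', ?s0 q'))"
      by (simp add: smooth_near_iff[OF r] tw_point_def)
  qed
  show "\<exists>U s'. open U \<and> fst ?z \<in> U \<and> local_section U s' \<and> s' (fst ?z) = snd ?z \<and>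
    ?w = (\<lambda>F. if smooth_near twistor_charts ?z F then X (\<lambda>q. F (q, s' q)) else 0)
        - vert ?z (D_biv (fst ?z) X s')"
    by (rule exI[of _ S], rule exI[of _ ?s0], intro conjI)
       (use S_open q sec D0 in \<open>simp_all only: fst_pt fst_conv snd_conv tw_point_def\<close>)
  fix w assume "\<exists>U s'. open U \<and> fst ?z \<in> U \<and> local_section U s' \<and> s' (fst ?z) = snd ?z \<and>
    w = (\<lambda>F. if smooth_near twistor_charts ?z F then X (\<lambda>q. F (q, s' q)) else 0)
        - vert ?z (D_biv (fst ?z) X s')"
  then obtain U' s' where U': "open U'" "q \<in> U'" "local_section U' s'" "s' q = bivec_of (E q) (Kmat s)"
    and w: "w = (\<lambda>F. if smooth_near twistor_charts ?z F then X (\<lambda>q. F (q, s' q)) else 0) - vert ?z (D_biv q X s')"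
    by (auto simp: tw_point_def)
  define \<sigma> where "\<sigma> r = fibre_coord (r, s' r)" for r
  let ?V = "U' \<inter> S"
  have V: "open ?V" "q \<in> ?V" "?V \<subseteq> S" using U' q S_open by auto
  have secN: "(r, s' r) \<in> tw_restr" if "r \<in> ?V" for r
    using that U'(3) unfolding local_section_def tw_restr_def by auto
  have \<sigma>: "(r, s' r) = tw_point r (\<sigma> r)" "\<sigma> r \<bullet> \<sigma> r = 1" if "r \<in> ?V" for r
    using tw_restr_point(2,3)[OF secN[OF that]] by (simp_all add: \<sigma>_def)
  have \<sigma>smooth_via: "smooth_via S x r (\<lambda>r. \<sigma> r $ c)" if r: "r \<in> ?V" for r c
  proof -
    have "smooth_near twistor_charts (r, s' r) (\<lambda>z. fibre_coord z $ c)"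
      unfolding smooth_near_T[OF secN[OF r]] by (rule smooth_via_nth[OF smooth_via_sc[OF secN[OF r]]])
    then have "smooth_near A r (\<lambda>r'. fibre_coord (r', s' r') $ c)"
      using U'(3) r unfolding local_section_def by blast
    then show ?thesis using smooth_near_iff r by (simp add: \<sigma>_def)
  qed
  have \<sigma>q: "\<sigma> q = s" using U'(4) fibre_coord_pt[OF q] by (simp add: \<sigma>_def tw_point_def)
  define u where "u = (\<chi> c. X (\<lambda>r. \<sigma> r $ c))"
  have D': "D_biv q X s' = bivec_of (E q) (Kmat (u + cross3 (conn_vec q X) s))"
    using D_biv_kappa[OF V X, of s' \<sigma>] \<sigma>(1) \<sigma>smooth_via by (simp add: tw_point_def \<sigma>q u_def)
  \<comment> \<open>Differentiating the constant length of \<open>\<sigma>\<close> makes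
    \<open>u\<close> tangent to the sphere, as \<open>vert_G\<close> requires.\<close>
  have us: "u \<bullet> s = 0"
  proof -
    have "X (\<lambda>r. \<Sum>c\<in>UNIV. \<sigma> r $ c * \<sigma> r $ c) = X (\<lambda>r. 1)"
    proof (rule TS_local[OF XT])
      show "smooth_via S x q (\<lambda>r. \<Sum>c\<in>UNIV. \<sigma> r $ c * \<sigma> r $ c)" by (intro smooth_via_sum smooth_via_mult \<sigma>smooth_via V q)
      have "eventually (\<lambda>r. r \<in> ?V) (param_nhds S x q)"
        unfolding param_nhds_eq[OF q] by (rule eventually_nhds_in_open[OF V(1,2)])
      then show "eventually (\<lambda>r. (\<Sum>c\<in>UNIV. \<sigma> r $ c * \<sigma> r $ c) = 1) (param_nhds S x q)"
      proof eventually_elim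
        case (elim r)
        then show ?case using \<sigma>(2)[OF elim] by (simp add: inner_vec_def)
      qed
    qed
    moreover have "X (\<lambda>r. \<Sum>c\<in>UNIV. \<sigma> r $ c * \<sigma> r $ c) = 2 * (u \<bullet> s)"
      by (subst TS_sum[OF XT q])
         (auto simp: TS_mult[OF XT \<sigma>smooth_via[OF V(2)] \<sigma>smooth_via[OF V(2)]] \<sigma>q u_def inner_vec_def sum_distrib_left mult_ac
           intro!: smooth_via_mult \<sigma>smooth_via V)
    ultimately show ?thesis using TS_const[OF XT q, of 1] by simp
  qed
  have cs: "cross3 (conn_vec q X) s \<bullet> s = 0" by (simp add: dot_cross_self inner_commute)
  show "w = ?w"
  proof
    fix F
    show "w F = ?w F"
    proof (cases "smooth_near twistor_charts ?z F")
      case True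
      then obtain W G where G: "local_rep F ?z W G" using smooth_via_rp smooth_near_T[OF z] by blast
      have lin: "linear (frechet_derivative G (at (x q, s)))" using local_rep_linear[OF G] by (simp add: tw_coord_pt[OF q])
      have "X (\<lambda>r. F (r, s' r)) = frechet_derivative G (at (x q, s)) (coord X, u)"
        unfolding u_def
        by (rule local_rep_const_section[OF G q s X V(1,3,2) \<sigma>(2) \<sigma>q smooth_via_vec[OF \<sigma>smooth_via[OF V(2)]]]) (simp_all add: \<sigma>(1))
      moreover have "X (\<lambda>r. F (tw_point r s)) = frechet_derivative G (at (x q, s)) (coord X, \<chi> c. X (\<lambda>r. s $ c))"
        by (rule local_rep_const_section[where \<sigma> = "\<lambda>_. s", OF G q s X S_open order_refl q _ _ smooth_via_const[OF q]])
           (simp_all add: s)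
      moreover have "vert ?z (D_biv q X s') F = frechet_derivative G (at (x q, s)) (0, u + cross3 (conn_vec q X) s)"
        unfolding D' by (rule vert_G[OF q s _ G]) (simp add: inner_add_left us cs)
      moreover have "vert ?z (bivec_of (E q) (Kmat (cross3 (conn_vec q X) s))) F = frechet_derivative G (at (x q, s)) (0, cross3 (conn_vec q X) s)"
        by (rule vert_G[OF q s cs G])
      ultimately show ?thesis
        using True by (simp add: w z0 flip: linear_diff[OF lin])
    next
      case False
      then show ?thesis by (simp add: w vert_def)
    qed
  qed
qed

lemma hlift_G:
  assumes q: "q \<in> S" and s: "s \<bullet> s = 1" and X: "X \<in> TM q" and G: "local_rep F (tw_point q s) W G"
  shows "hlift (tw_point q s) X F = frechet_derivative G (at (x q, s)) (coord X, - cross3 (conn_vec q X) s)"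
proof -
  have z: "tw_point q s \<in> tw_restr" by (rule tw_point_N[OF q s])
  have XT: "X \<in> TS S x q" using X TM_eq[OF q] by simp
  have z0: "(\<chi> c. X (\<lambda>r. s $ c)) = (0::real^3)"
    using TS_const[OF XT q] by (simp add: vec_eq_iff)
  have lin: "linear (frechet_derivative G (at (x q, s)))" using local_rep_linear[OF G] by (simp add: tw_coord_pt[OF q])
  have "X (\<lambda>r. F (tw_point r s)) = frechet_derivative G (at (x q, s)) (coord X, \<chi> c. X (\<lambda>r. s $ c))"
    by (rule local_rep_const_section[where \<sigma> = "\<lambda>_. s", OF G q s X S_open order_refl q _ _ smooth_via_const[OF q]])
       (simp_all add: s)
  moreover have "vert (tw_point q s) (bivec_of (E q) (Kmat (cross3 (conn_vec q X) s))) F = frechet_derivative G (at (x q, s)) (0, cross3 (conn_vec q X) s)"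
    by (rule vert_G[OF q s _ G]) (simp add: dot_cross_self inner_commute)
  ultimately show ?thesis
    using smooth_near_T[OF z] local_rep_sm[OF z G] by (simp add: hlift_eq[OF q s X] z0 flip: linear_diff[OF lin])
qed

lemma hlift_not_sm:
  assumes "q \<in> S" "s \<bullet> s = 1" "X \<in> TM q" "\<not> smooth_via tw_restr tw_coord (tw_point q s) F"
  shows "hlift (tw_point q s) X F = 0"
  using assms by (simp add: hlift_eq smooth_near_T[OF tw_point_N] vert_def)

section \<open>The tangent space of the twistor space\<close>

definition tangent_vec :: "'m \<Rightarrow> real^3 \<Rightarrow> real^5 \<Rightarrow> real^3 \<Rightarrow> ('m \<times> 'm bivec) tvec"
  where "tangent_vec q s u v = hlift (tw_point q s) (vec_of (E q) u) + vert (tw_point q s) (bivec_of (E q) (Kmat v))"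

text \<open>The connection enters the fibre component alone, through the term with
  \<open>cross3\<close>.\<close>

lemma tangent_vec_G:
  assumes q: "q \<in> S" and s: "s \<bullet> s = 1" and v: "v \<bullet> s = 0" and G: "local_rep F (tw_point q s) W G"
  shows "tangent_vec q s u v F = frechet_derivative G (at (x q, s))
    (coord (vec_of (E q) u), v - cross3 (conn_vec q (vec_of (E q) u)) s)"
proof -
  have lin: "linear (frechet_derivative G (at (x q, s)))" using local_rep_linear[OF G] by (simp add: tw_coord_pt[OF q])
  show ?thesis
    by (simp add: tangent_vec_def hlift_G[OF q s vec_of_TM[OF q E_onb[OF q]] G] vert_G[OF q s v G] flip: linear_add[OF lin])
qed

lemma tangent_vec_TS:
  assumes q: "q \<in> S" and s: "s \<bullet> s = 1" and v: "v \<bullet> s = 0"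
  shows "tangent_vec q s u v \<in> TS tw_restr tw_coord (tw_point q s)"
proof (rule TS_I)
  let ?z = "tw_point q s" and ?u = "(coord (vec_of (E q) u), v - cross3 (conn_vec q (vec_of (E q) u)) s)"
  note T = tangent_vec_G[OF q s v]
  have z: "?z \<in> tw_restr" by (rule tw_point_N[OF q s])
  show "tangent_vec q s u v F = 0" if "\<not> smooth_via tw_restr tw_coord ?z F" for F
    using hlift_not_sm[OF q s vec_of_TM[OF q E_onb[OF q]] that] vert_not_sm[OF z that] by (simp add: tangent_vec_def)
  fix F H :: "'m \<times> 'm bivec \<Rightarrow> real" and c
  assume F: "smooth_via tw_restr tw_coord ?z F"
  then obtain W G where G: "local_rep F ?z W G" using smooth_via_rp by blast
  have "local_rep (\<lambda>z. c * F z) ?z W (\<lambda>z. c * G z)"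
    using G smooth_on_bilinear[OF bounded_bilinear_mult, of W "\<lambda>_. c" G] smooth_on_const[of W c]
    by (auto simp: local_rep_def)
  from T[OF this] T[OF G]
  show "tangent_vec q s u v (\<lambda>z. c * F z) = c * tangent_vec q s u v F"
    using frechet_derivative_at[OF has_derivative_mult_right[OF local_rep_has_derivative[OF G], of c], symmetric]
    by (simp add: tw_coord_pt[OF q])
  assume H: "smooth_via tw_restr tw_coord ?z H"
  obtain W G1 G2 where W: "?z \<in> tw_restr" "open W" "tw_coord ?z \<in> W" "smooth_on W G1" "smooth_on W G2"
    "\<forall>z\<in>tw_restr. tw_coord z \<in> W \<longrightarrow> F z = G1 (tw_coord z) \<and> H z = G2 (tw_coord z)"
    using smooth_via_common[OF F H] .
  have G: "local_rep F ?z W G1" "local_rep H ?z W G2" using W by (auto simp: local_rep_def)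
  have G': "local_rep (\<lambda>z. F z + H z) ?z W (\<lambda>z. G1 z + G2 z)" "local_rep (\<lambda>z. F z * H z) ?z W (\<lambda>z. G1 z * G2 z)"
    using W smooth_on_add[of W G1 G2] smooth_on_bilinear[OF bounded_bilinear_mult, of W G1 G2]
    by (auto simp: local_rep_def)
  note d = local_rep_has_derivative[OF G(1), unfolded tw_coord_pt[OF q]] local_rep_has_derivative[OF G(2), unfolded tw_coord_pt[OF q]]
  show "tangent_vec q s u v (\<lambda>z. F z + H z) = tangent_vec q s u v F + tangent_vec q s u v H"
    unfolding T[OF G(1)] T[OF G(2)] T[OF G'(1)]
    by (simp only: frechet_derivative_at[OF has_derivative_add[OF d], symmetric])
  have FH: "F ?z = G1 (x q, s)" "H ?z = G2 (x q, s)" using W by (auto simp: tw_coord_pt[OF q])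
  show "tangent_vec q s u v (\<lambda>z. F z * H z) = tangent_vec q s u v F * H ?z + F ?z * tangent_vec q s u v H"
    unfolding T[OF G(1)] T[OF G(2)] T[OF G'(2)] FH
    by (simp only: frechet_derivative_at[OF has_derivative_mult[OF d], symmetric])
qed

text \<open>A function of the base point has a local extension that is constant in the fibre
  direction, so the vertical part and the connection term both drop out.\<close>

lemma tangent_vec_base:
  assumes q: "q \<in> S" and s: "s \<bullet> s = 1" and v: "v \<bullet> s = 0" and f: "smooth_via S x q f"
  shows "tangent_vec q s u v (\<lambda>z. f (fst z)) = vec_of (E q) u f"
proof -
  obtain W G where W: "open W" "x q \<in> W" "smooth_on W G" "\<forall>r\<in>S. x r \<in> W \<longrightarrow> f r = G (x r)"
    using f unfolding smooth_via_def by blast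
  have sG: "smooth_on (W \<times> UNIV) (\<lambda>y::(real^5)\<times>(real^3). G (fst y))"
    by (rule smooth_on_compose[OF _ W(1,3) smooth_on_linear[OF _ bounded_linear_fst]])
       (auto intro: open_Times W)
  have R: "local_rep (\<lambda>z. f (fst z)) (tw_point q s) (W \<times> UNIV) (\<lambda>y. G (fst y))"
    unfolding local_rep_def using W sG tw_restr_point(1) by (auto simp: tw_coord_def q intro: open_Times)
  have dG: "((\<lambda>y::(real^5)\<times>(real^3). G (fst y)) has_derivative (\<lambda>h. frechet_derivative G (at (x q)) (fst h))) (at (x q, s))"
    by (rule has_derivative_compose[OF has_derivative_fst[OF has_derivative_ident]])
       (simp add: smooth_on_has_derivative[OF W(3,2)])
  note T = vec_of_TM[OF q E_onb[OF q], unfolded TM_eq[OF q]]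
  have "vec_of (E q) u f = vec_of (E q) u (\<lambda>r. G (x r))"
    by (rule TS_local[OF T f]) (rule eventually_param_nhdsI[where W = W], use W in auto)
  also have "\<dots> = frechet_derivative G (at (x q)) (coord (vec_of (E q) u))"
    using TS_chain[where f = x, OF T smooth_via_param[OF q] W(1,3,2)] by (simp add: coord_basis)
  finally show ?thesis
    by (simp add: tangent_vec_G[OF q s v R] frechet_derivative_at[OF dG, symmetric])
qed

lemma tangent_vec_sc:
  assumes q: "q \<in> S" and s: "s \<bullet> s = 1" and v: "v \<bullet> s = 0"
    and P: "open V" "smooth_on V P" "s \<in> V"
  shows "tangent_vec q s u v (\<lambda>z. P (fibre_coord z)) = frechet_derivative P (at s) (v - cross3 (conn_vec q (vec_of (E q) u)) s)"
proof -
  have sP: "smooth_on (UNIV \<times> V) (\<lambda>y::(real^5)\<times>(real^3). P (snd y))"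
    by (rule smooth_on_compose[OF _ P(1,2) smooth_on_linear[OF _ bounded_linear_snd]])
       (auto intro: open_Times P)
  have R: "local_rep (\<lambda>z. P (fibre_coord z)) (tw_point q s) (UNIV \<times> V) (\<lambda>y. P (snd y))"
    unfolding local_rep_def using P sP by (auto simp: tw_coord_def fibre_coord_pt[OF q] intro: open_Times)
  have dP: "((\<lambda>y::(real^5)\<times>(real^3). P (snd y)) has_derivative (\<lambda>h. frechet_derivative P (at s) (snd h))) (at (x q, s))"
    by (rule has_derivative_compose[OF has_derivative_snd[OF has_derivative_ident]])
       (simp add: smooth_on_has_derivative[OF P(2,3)])
  show ?thesis by (simp add: tangent_vec_G[OF q s v R] frechet_derivative_at[OF dP, symmetric])
qed

text \<open>Functions of the base point determine \<open>u\<close>; the connection terms then agree,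
  and the fibre coordinates determine \<open>v\<close>. The descriptions behind \<open>Phi\<close>
  and \<open>h_metric\<close> rest on this.\<close>

lemma tangent_vec_unique:
  assumes q: "q \<in> S" and s: "s \<bullet> s = 1" and v: "v \<bullet> s = 0" "v' \<bullet> s = 0"
    and eq: "tangent_vec q s u v = tangent_vec q s u' v'"
  shows "u = u'" "v = v'"
proof -
  have "u $ i = u' $ i" for i
    using tangent_vec_base[OF q s v(1) dual_fun(1)[OF q, of i], of u] tangent_vec_base[OF q s v(2) dual_fun(1)[OF q, of i], of u'] eq
    by (simp add: dual_fun(2)[OF q])
  then show u: "u = u'" by (simp add: vec_eq_iff)
  have "v $ c = v' $ c" for c
  proof -
    have d: "frechet_derivative (\<lambda>y::real^3. y $ c) (at s) = (\<lambda>y. y $ c)"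
      by (rule frechet_derivative_at[symmetric]) (rule bounded_linear_imp_has_derivative[OF bounded_linear_vec_nth])
    note t = tangent_vec_sc[OF q s _ open_UNIV smooth_on_linear[OF open_UNIV bounded_linear_vec_nth, of c] UNIV_I]
    show ?thesis using t[OF v(1), of u] t[OF v(2), of u'] eq by (simp add: d u)
  qed
  then show "v = v'" by (simp add: vec_eq_iff)
qed

text \<open>The horizontal part comes from the push-forward of \<open>w\<close> to the base. The
  values on the fibre coordinates, corrected by the connection term, give the vertical part, which
  is tangent to the sphere because the length of \<open>fibre_coord\<close> is constant.\<close>

lemma TS_tv:
  assumes q: "q \<in> S" and s: "s \<bullet> s = 1" and w: "w \<in> TS tw_restr tw_coord (tw_point q s)"
  obtains u v where "v \<bullet> s = 0" "w = tangent_vec q s u v"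
proof -
  let ?z = "tw_point q s"
  have z: "?z \<in> tw_restr" by (rule tw_point_N[OF q s])
  \<comment> \<open>Tangent vectors of the base must vanish on functions that are not smooth, hence
    the default \<open>0\<close>.\<close>
  define Y where "Y f = (if smooth_via S x q f then w (\<lambda>z. f (fst z)) else 0)" for f
  have base: "smooth_via tw_restr tw_coord ?z (\<lambda>z. f (fst z))" if "smooth_via S x q f" for f
    by (rule smooth_via_base[OF z]) (simp add: that)
  have "Y \<in> TM q"
    unfolding TM_eq[OF q]
    by (rule TS_I) (simp_all add: Y_def smooth_via_add smooth_via_mult smooth_via_const q base TS_add[OF w] TS_mult[OF w] TS_scale[OF w])
  then obtain u where u: "Y = vec_of (E q) u" using TM_ve[OF q E_onb[OF q]] by metis
  define b where "b = (\<chi> c. w (\<lambda>z. fibre_coord z $ c))"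
  define v where "v = b + cross3 (conn_vec q Y) s"
  have scs: "smooth_via tw_restr tw_coord ?z (\<lambda>z. fibre_coord z $ c)" for c by (rule smooth_via_nth[OF smooth_via_sc[OF z]])
  have "b \<bullet> s = 0"
  proof -
    have "w (\<lambda>z. \<Sum>c\<in>UNIV. fibre_coord z $ c * fibre_coord z $ c) = w (\<lambda>z. 1)"
    proof (rule TS_local[OF w])
      show "smooth_via tw_restr tw_coord ?z (\<lambda>z. \<Sum>c\<in>UNIV. fibre_coord z $ c * fibre_coord z $ c)" by (intro smooth_via_sum smooth_via_mult scs z)
      show "eventually (\<lambda>z. (\<Sum>c\<in>UNIV. fibre_coord z $ c * fibre_coord z $ c) = 1) (param_nhds tw_restr tw_coord ?z)"
        using eventually_param_nhds_mem
      proof eventually_elim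
        case (elim z)
        then show ?case using tw_restr_point(3)[OF elim] by (simp add: inner_vec_def)
      qed
    qed
    moreover have "w (\<lambda>z. \<Sum>c\<in>UNIV. fibre_coord z $ c * fibre_coord z $ c) = 2 * (b \<bullet> s)"
      by (subst TS_sum[OF w z])
         (auto simp: TS_mult[OF w scs scs] fibre_coord_pt[OF q] b_def inner_vec_def sum_distrib_left mult_ac intro!: smooth_via_mult scs)
    ultimately show ?thesis using TS_const[OF w z, of 1] by simp
  qed
  moreover have "cross3 (conn_vec q Y) s \<bullet> s = 0" by (simp add: dot_cross_self inner_commute)
  ultimately have vs: "v \<bullet> s = 0" by (simp add: v_def inner_add_left)
  have "w = tangent_vec q s u v"
  proof
    fix F
    show "w F = tangent_vec q s u v F"
    proof (cases "smooth_via tw_restr tw_coord ?z F")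
      case True
      then obtain W G where G: "local_rep F ?z W G" using smooth_via_rp by blast
      then have G': "open W" "smooth_on W G" "tw_coord ?z \<in> W" by (auto simp: local_rep_def)
      have "w F = w (\<lambda>z. G (tw_coord z))"
        by (rule TS_local[OF w True]) (rule eventually_param_nhdsI[of W], use G in \<open>auto simp: local_rep_def\<close>)
      also have "\<dots> = frechet_derivative G (at (tw_coord ?z)) (\<Sum>b\<in>Basis. w (\<lambda>z. tw_coord z \<bullet> b) *\<^sub>R b)"
        by (rule TS_chain[OF w smooth_via_param[OF z] G'])
      also have "(\<Sum>b\<in>Basis. w (\<lambda>z. tw_coord z \<bullet> b) *\<^sub>R b) = (coord Y, b)"
      proof -
        have "smooth_via S x q (\<lambda>r. x r $ i)" for i by (rule smooth_via_nth[OF smooth_via_param[OF q]])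
        then show ?thesis
          by (simp add: sum_Basis_prod sum_Basis_vec coord_def inner_axis tw_coord_def b_def Y_def)
      qed
      finally have "w F = frechet_derivative G (at (x q, s)) (coord Y, b)" by (simp only: tw_coord_pt[OF q])
      moreover have "b = v - cross3 (conn_vec q Y) s" by (simp add: v_def)
      ultimately show ?thesis using tangent_vec_G[OF q s vs G, of u] by (simp only: u)
    next
      case False
      then show ?thesis using TS_outside w tangent_vec_TS[OF q s vs] by metis
    qed
  qed
  then show ?thesis using that vs by blast
qed

end

section \<open>The polynomials of the structure and their derivatives at kappa_3\<close>

lemma smooth_on_minus: "open S \<Longrightarrow> smooth_on S f \<Longrightarrow> smooth_on S (\<lambda>x. - f x :: real)"
  using smooth_on_bilinear[OF bounded_bilinear_mult, of S "\<lambda>_. - 1" f] smooth_on_const[of S "- 1 :: real"] by simp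

lemma smooth_on_diff:
  "open S \<Longrightarrow> smooth_on S f \<Longrightarrow> smooth_on S g \<Longrightarrow> smooth_on S (\<lambda>x. f x - g x :: real)"
  using smooth_on_add[of S f "\<lambda>x. - g x"] smooth_on_minus[of S g] by simp

lemma smooth_on_nth: "smooth_on UNIV (\<lambda>s::real^'n. s $ i)"
  by (intro smooth_on_linear bounded_linear_vec_nth open_UNIV)

lemma smooth_on_divide_const: "open S \<Longrightarrow> smooth_on S f \<Longrightarrow> smooth_on S (\<lambda>x. f x / c :: real)"
  using smooth_on_bilinear[OF bounded_bilinear_mult, of S f "\<lambda>_. inverse c"] smooth_on_const[of S "inverse c"]
  by (simp add: divide_inverse)

lemmas smooth_real_intros = open_UNIV smooth_on_const smooth_on_add smooth_on_minus smooth_on_diff smooth_on_nth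
  smooth_on_divide_const smooth_on_bilinear[OF bounded_bilinear_mult]

lemma smooth_Kmat: "smooth_on UNIV (\<lambda>s. Kmat s $ i $ j)"
proof -
  have "\<forall>i j. smooth_on UNIV (\<lambda>s. Kmat s $ i $ j)"
    unfolding forall_5 Kmat_nth mk5_nth by (intro conjI smooth_real_intros)
  then show ?thesis by blast
qed

lemma smooth_xi_vec: "smooth_on UNIV (\<lambda>s. xi_vec s $ i)"
proof -
  have "\<forall>i. smooth_on UNIV (\<lambda>s. xi_vec s $ i)"
    unfolding forall_5 xi_vec_eq mk5_nth by (intro conjI smooth_real_intros)
  then show ?thesis by blast
qed

lemma smooth_phi_mat: "smooth_on UNIV (\<lambda>s. phi_mat \<epsilon> s $ i $ j)"
proof -
  have "\<forall>i j. smooth_on UNIV (\<lambda>s. star (xi_vec s) (Kmat s) $ i $ j)"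
    unfolding forall_5 star_def Let_def skew5_def mk5_nth
    by (intro conjI smooth_real_intros smooth_Kmat smooth_xi_vec)
  then show ?thesis
    unfolding phi_mat_def vector_scaleR_component vector_add_component real_scaleR_def
    by (intro smooth_real_intros smooth_Kmat) blast
qed

text \<open>This reduces directional derivatives to one variable. The polynomials are defined on all
  of R^3, so the line may leave the sphere.\<close>

lemma frechet_derivative_line:
  assumes H: "smooth_on UNIV H" and d: "((\<lambda>\<tau>. H (s + \<tau> *\<^sub>R v)) has_real_derivative d) (at 0)"
  shows "frechet_derivative H (at s) v = d"
proof -
  have dH: "(H has_derivative frechet_derivative H (at s)) (at (s + 0 *\<^sub>R v))"
    using smooth_on_has_derivative[OF H UNIV_I, of s] by simp
  have "((\<lambda>\<tau>. s + \<tau> *\<^sub>R v) has_derivative (\<lambda>\<tau>. \<tau> *\<^sub>R v)) (at 0)"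
    by (auto intro!: derivative_eq_intros)
  from has_derivative_compose[OF this dH]
  have "((\<lambda>\<tau>. H (s + \<tau> *\<^sub>R v)) has_derivative (\<lambda>\<tau>. frechet_derivative H (at s) (\<tau> *\<^sub>R v))) (at 0)" .
  from has_derivative_unique[OF this d[unfolded has_field_derivative_def]]
  have "frechet_derivative H (at s) (1 *\<^sub>R v) = d * 1" by (rule fun_cong)
  then show ?thesis by simp
qed

definition unit3 :: "3 \<Rightarrow> real^3"
  where "unit3 c = axis c 1"

lemma unit3_line1: "unit3 3 + \<tau> *\<^sub>R unit3 1 = vector [\<tau>, 0, 1]" and unit3_line2: "unit3 3 + \<tau> *\<^sub>R unit3 2 = vector [0, \<tau>, 1]"
  by (simp_all add: unit3_def vec_eq_iff forall_3 vector_3 axis_def)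

lemma unit3_eq: "unit3 3 = vector [0, 0, 1]"
  by (simp add: unit3_def vec_eq_iff forall_3 vector_3 axis_def)

text \<open>The sum over \<open>j\<close> in the tensor needs the whole third row in the direction
  kappa_1, while in the direction kappa_2 only the tested columns 1 and 4 occur.\<close>

lemma phi_mat_derivatives:
  assumes "\<epsilon> = 1 \<or> \<epsilon> = - 1"
  shows "frechet_derivative (\<lambda>s. phi_mat \<epsilon> s $ 3 $ j) (at (unit3 3)) (unit3 1) = (if j = 2 then (\<epsilon> - 1) / (2 + \<epsilon>) else 0)"
    and "frechet_derivative (\<lambda>s. phi_mat \<epsilon> s $ 3 $ 1) (at (unit3 3)) (unit3 2) = (- sqrt 3 - 2 * sqrt 3 * \<epsilon>) / (2 + \<epsilon>)"
    and "frechet_derivative (\<lambda>s. phi_mat \<epsilon> s $ 3 $ 4) (at (unit3 3)) (unit3 2) = (1 - \<epsilon>) / (2 + \<epsilon>)"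
proof -
  have r: "sqrt 3 * (sqrt 3 * y) = 3 * y" for y :: real by (simp add: mult.assoc[symmetric])
  note ev = phi_mat_def star_def Let_def skew5_def Kmat_nth xi_vec_eq vector_3 algebra_simps r
  note F = frechet_derivative_line[OF smooth_phi_mat]
  have d: "((\<lambda>\<tau>. phi_mat \<epsilon> (vector [\<tau>, 0, 1]) $ 3 $ 1) has_real_derivative 0) (at 0)"
    "((\<lambda>\<tau>. phi_mat \<epsilon> (vector [\<tau>, 0, 1]) $ 3 $ 2) has_real_derivative (\<epsilon> - 1) / (2 + \<epsilon>)) (at 0)"
    "((\<lambda>\<tau>. phi_mat \<epsilon> (vector [\<tau>, 0, 1]) $ 3 $ 3) has_real_derivative 0) (at 0)"
    "((\<lambda>\<tau>. phi_mat \<epsilon> (vector [\<tau>, 0, 1]) $ 3 $ 4) has_real_derivative 0) (at 0)"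
    "((\<lambda>\<tau>. phi_mat \<epsilon> (vector [\<tau>, 0, 1]) $ 3 $ 5) has_real_derivative 0) (at 0)"
    "((\<lambda>\<tau>. phi_mat \<epsilon> (vector [0, \<tau>, 1]) $ 3 $ 1) has_real_derivative (- sqrt 3 - 2 * sqrt 3 * \<epsilon>) / (2 + \<epsilon>)) (at 0)"
    "((\<lambda>\<tau>. phi_mat \<epsilon> (vector [0, \<tau>, 1]) $ 3 $ 4) has_real_derivative (1 - \<epsilon>) / (2 + \<epsilon>)) (at 0)"
    using assms by (elim disjE; auto simp: ev intro!: derivative_eq_intros)+
  have "frechet_derivative (\<lambda>s. phi_mat \<epsilon> s $ 3 $ j) (at (unit3 3)) (unit3 1) = (if j = 2 then (\<epsilon> - 1) / (2 + \<epsilon>) else 0)"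
    if "j \<in> {1, 2, 3, 4, 5}" for j
    using that by (elim insertE emptyE; simp; intro F; simp add: unit3_line1 d)
  then show "frechet_derivative (\<lambda>s. phi_mat \<epsilon> s $ 3 $ j) (at (unit3 3)) (unit3 1) = (if j = 2 then (\<epsilon> - 1) / (2 + \<epsilon>) else 0)"
    using exhaust_5[of j] by blast
  show "frechet_derivative (\<lambda>s. phi_mat \<epsilon> s $ 3 $ 1) (at (unit3 3)) (unit3 2) = (- sqrt 3 - 2 * sqrt 3 * \<epsilon>) / (2 + \<epsilon>)"
    by (rule F) (simp only: unit3_line2 d)
  show "frechet_derivative (\<lambda>s. phi_mat \<epsilon> s $ 3 $ 4) (at (unit3 3)) (unit3 2) = (1 - \<epsilon>) / (2 + \<epsilon>)"
    by (rule F) (simp only: unit3_line2 d)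
qed

lemma phi_mat_e3:
  assumes "\<epsilon> = 1 \<or> \<epsilon> = - 1"
  shows "phi_mat \<epsilon> (unit3 3) $ 2 $ 1 = 0" "phi_mat \<epsilon> (unit3 3) $ 2 $ 4 = 1"
  using assms by (auto simp: unit3_eq phi_mat_def star_def Let_def skew5_def Kmat_nth xi_vec_eq vector_3)

lemma xi_vec_e3: "xi_vec (unit3 3) $ 1 = - 1" "xi_vec (unit3 3) $ 4 = 0"
  by (simp_all add: unit3_eq xi_vec_eq vector_3)

lemma xi_vec_derivative: "frechet_derivative (\<lambda>s. xi_vec s $ 3) (at (unit3 3)) (unit3 1) = sqrt 3"
  by (rule frechet_derivative_line[OF smooth_xi_vec])
     (auto simp: unit3_line1 xi_vec_eq vector_3 intro!: derivative_eq_intros)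

context framed
begin

section \<open>The almost contact structure in the frame\<close>

definition phi_vec :: "real \<Rightarrow> real^3 \<Rightarrow> real^5 \<Rightarrow> real^5"
  where "phi_vec \<epsilon> s u = (\<chi> j. \<Sum>i\<in>UNIV. u $ i * phi_mat \<epsilon> s $ i $ j)"

lemma phi_vec_zero [simp]: "phi_vec \<epsilon> s 0 = 0"
  by (simp add: phi_vec_def vec_eq_iff)

lemma cross3_orth: "((- 1) ^ n *\<^sub>R cross3 s v) \<bullet> s = 0"
  by (simp add: dot_cross_self inner_commute)

text \<open>By \<open>tangent_vec_unique\<close> every splitting into a horizontal lift and a
  vertical vector is the given one, so the description has a single value.\<close>

lemma Phi_tv:
  assumes q: "q \<in> S" and s: "s \<bullet> s = 1" and v: "v \<bullet> s = 0"
  shows "Phi n \<epsilon> (tw_point q s) (tangent_vec q s u v) = tangent_vec q s (phi_vec \<epsilon> s u) ((- 1) ^ n *\<^sub>R cross3 s v)"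
    (is "_ = ?w")
  unfolding Phi_def
proof (rule the_equality)
  let ?z = "tw_point q s"
  have step: "hlift ?z (phi \<epsilon> ?z (vec_of (E q) u')) + vert ?z ((- 1) ^ n *\<^sub>R vprod (fst ?z) (snd ?z) (bivec_of (E q) (Kmat v')))
      = tangent_vec q s (phi_vec \<epsilon> s u') ((- 1) ^ n *\<^sub>R cross3 s v')" for u' v'
  proof -
    have "phi \<epsilon> ?z (vec_of (E q) u') = vec_of (E q) (phi_vec \<epsilon> s u')"
      unfolding tw_point_def phi_vec_def by (rule phi_eq[OF q s])
    moreover have "(- 1) ^ n *\<^sub>R vprod (fst ?z) (snd ?z) (bivec_of (E q) (Kmat v')) = bivec_of (E q) (Kmat ((- 1) ^ n *\<^sub>R cross3 s v'))"
      by (simp only: tw_point_def fst_conv snd_conv vprod_eq[OF q] Kmat_linear bivec_of_scale)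
    ultimately show ?thesis by (simp only: tangent_vec_def)
  qed
  show "\<exists>X\<in>TM (fst ?z). \<exists>V\<in>vertical ?z. tangent_vec q s u v = hlift ?z X + vert ?z V \<and>
    ?w = hlift ?z (phi \<epsilon> ?z X) + vert ?z ((- 1) ^ n *\<^sub>R vprod (fst ?z) (snd ?z) V)"
  proof (rule bexI[of _ "vec_of (E q) u"], rule bexI[of _ "bivec_of (E q) (Kmat v)"], intro conjI)
    show "tangent_vec q s u v = hlift ?z (vec_of (E q) u) + vert ?z (bivec_of (E q) (Kmat v))" by (rule tangent_vec_def)
    show "?w = hlift ?z (phi \<epsilon> ?z (vec_of (E q) u)) + vert ?z ((- 1) ^ n *\<^sub>R vprod (fst ?z) (snd ?z) (bivec_of (E q) (Kmat v)))"
      by (rule step[symmetric])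
    show "bivec_of (E q) (Kmat v) \<in> vertical ?z" unfolding tw_point_def vertical_iff[OF q] using v by blast
    show "vec_of (E q) u \<in> TM (fst ?z)" using vec_of_TM[OF q E_onb[OF q]] by simp
  qed
  fix w' assume "\<exists>X\<in>TM (fst ?z). \<exists>V\<in>vertical ?z. tangent_vec q s u v = hlift ?z X + vert ?z V \<and>
    w' = hlift ?z (phi \<epsilon> ?z X) + vert ?z ((- 1) ^ n *\<^sub>R vprod (fst ?z) (snd ?z) V)"
  then obtain X V where X: "X \<in> TM q" "V \<in> vertical ?z" "tangent_vec q s u v = hlift ?z X + vert ?z V"
    and w': "w' = hlift ?z (phi \<epsilon> ?z X) + vert ?z ((- 1) ^ n *\<^sub>R vprod (fst ?z) (snd ?z) V)"
    by auto
  obtain u' where u': "X = vec_of (E q) u'" using TM_ve[OF q E_onb[OF q] X(1)] .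
  obtain v' where v': "V = bivec_of (E q) (Kmat v')" "v' \<bullet> s = 0"
    using X(2) unfolding tw_point_def vertical_iff[OF q] by blast
  have "tangent_vec q s u v = tangent_vec q s u' v'" using X(3) by (simp only: u' v'(1) tangent_vec_def)
  from tangent_vec_unique[OF q s v v'(2) this] have "u' = u" "v' = v" by simp_all
  then show "w' = ?w" unfolding w' u' v'(1) step by simp
qed

lemma tangent_vec_horizontal:
  assumes q: "q \<in> S" and s: "s \<bullet> s = 1"
  shows "hlift (tw_point q s) (vec_of (E q) u) = tangent_vec q s u 0"
proof
  fix F
  show "hlift (tw_point q s) (vec_of (E q) u) F = tangent_vec q s u 0 F"
  proof (cases "smooth_via tw_restr tw_coord (tw_point q s) F")
    case True
    then obtain W G where G: "local_rep F (tw_point q s) W G" using smooth_via_rp by blast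
    show ?thesis
      using hlift_G[OF q s vec_of_TM[OF q E_onb[OF q]] G, of u] tangent_vec_G[OF q s _ G, of 0 u] by simp
  next
    case False
    then show ?thesis
      using hlift_not_sm[OF q s vec_of_TM[OF q E_onb[OF q]] False] TS_outside[OF tangent_vec_TS[OF q s, of 0 u] False] by simp
  qed
qed

text \<open>Where the cut-off vanishes the test fields take this value; it has to match the zero
  field outside the framed domain.\<close>

lemma tangent_vec_zero:
  assumes q: "q \<in> S" and s: "s \<bullet> s = 1"
  shows "tangent_vec q s 0 0 F = 0"
proof (cases "smooth_via tw_restr tw_coord (tw_point q s) F")
  case True
  then obtain W G where G: "local_rep F (tw_point q s) W G" using smooth_via_rp by blast
  have lin: "linear (frechet_derivative G (at (x q, s)))" using local_rep_linear[OF G] by (simp add: tw_coord_pt[OF q])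
  have c: "coord (vec_of (E q) 0) = 0" by (simp add: coord_ve[OF q E_onb[OF q]])
  have o: "conn_vec q (vec_of (E q) 0) = 0" by (simp add: conn_vec_ve[OF q])
  show ?thesis using tangent_vec_G[OF q s _ G, of 0 0] linear_0[OF lin] by (simp add: c o zero_prod_def)
next
  case False
  then show ?thesis using TS_outside[OF tangent_vec_TS[OF q s, of 0 0] False] by simp
qed

lemma chi_eq:
  assumes q: "q \<in> S" and s: "s \<bullet> s = 1"
  shows "chi_field (tw_point q s) = tangent_vec q s (xi_vec s) 0"
proof -
  have "xi (tw_point q s) = vec_of (E q) (xi_vec s)" unfolding tw_point_def by (rule xi_eq[OF q s])
  then show ?thesis unfolding chi_field_def using tangent_vec_horizontal[OF q s] by simp
qed

text \<open>\<open>chi_field\<close> is horizontal, so the vertical summand of the metric vanishes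
  against it.\<close>

lemma eta_tv:
  assumes q: "q \<in> S" and s: "s \<bullet> s = 1" and v: "v \<bullet> s = 0"
  shows "eta t (tw_point q s) (tangent_vec q s u v) = u \<bullet> xi_vec s"
  unfolding eta_def h_metric_def chi_eq[OF q s]
proof (rule the_equality)
  let ?z = "tw_point q s" and ?w = "tangent_vec q s u v" and ?w' = "tangent_vec q s (xi_vec s) 0"
  have val: "g (fst ?z) (vec_of (E q) u) (vec_of (E q) (xi_vec s)) + t * biv_inner (fst ?z) (bivec_of (E q) (Kmat v)) (bivec_of (E q) (Kmat 0)) =
      u \<bullet> xi_vec s"
    by (simp add: biv_inner_kappa[OF q] g_ve[OF q E_onb[OF q]])
  have T: "vec_of (E q) y \<in> TM (fst ?z)" for y using vec_of_TM[OF q E_onb[OF q]] by simp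
  have VV: "bivec_of (E q) (Kmat y) \<in> vertical ?z" if "y \<bullet> s = 0" for y
    unfolding tw_point_def vertical_iff[OF q] using that by blast
  show "\<exists>X\<in>TM (fst ?z). \<exists>Y\<in>TM (fst ?z). \<exists>V\<in>vertical ?z. \<exists>W\<in>vertical ?z.
    ?w = hlift ?z X + vert ?z V \<and> ?w' = hlift ?z Y + vert ?z W \<and>
    u \<bullet> xi_vec s = g (fst ?z) X Y + t * biv_inner (fst ?z) V W"
    by (rule bexI[OF _ T[of u]], rule bexI[OF _ T[of "xi_vec s"]], rule bexI[OF _ VV[OF v]], rule bexI[OF _ VV[of 0]])
       (simp_all only: tangent_vec_def val inner_zero_left simp_thms)
  fix r assume "\<exists>X\<in>TM (fst ?z). \<exists>Y\<in>TM (fst ?z). \<exists>V\<in>vertical ?z. \<exists>W\<in>vertical ?z.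
    ?w = hlift ?z X + vert ?z V \<and> ?w' = hlift ?z Y + vert ?z W \<and>
    r = g (fst ?z) X Y + t * biv_inner (fst ?z) V W"
  then obtain X Y V W where X: "X \<in> TM q" "Y \<in> TM q" "V \<in> vertical ?z" "W \<in> vertical ?z"
    "?w = hlift ?z X + vert ?z V" "?w' = hlift ?z Y + vert ?z W"
    and r: "r = g (fst ?z) X Y + t * biv_inner (fst ?z) V W" by auto
  obtain u1 where u1: "X = vec_of (E q) u1" using TM_ve[OF q E_onb[OF q] X(1)] .
  obtain u2 where u2: "Y = vec_of (E q) u2" using TM_ve[OF q E_onb[OF q] X(2)] .
  obtain v1 where v1: "V = bivec_of (E q) (Kmat v1)" "v1 \<bullet> s = 0"
    using X(3) unfolding tw_point_def vertical_iff[OF q] by blast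
  obtain v2 where v2: "W = bivec_of (E q) (Kmat v2)" "v2 \<bullet> s = 0"
    using X(4) unfolding tw_point_def vertical_iff[OF q] by blast
  have "?w = tangent_vec q s u1 v1" "?w' = tangent_vec q s u2 v2" using X(5,6) by (simp_all only: u1 u2 v1(1) v2(1) tangent_vec_def)
  from tangent_vec_unique[OF q s v v1(2) this(1)] tangent_vec_unique[OF q s _ v2(2) this(2)]
  have "u1 = u" "v1 = v" "u2 = xi_vec s" "v2 = 0" by simp_all
  then show "r = u \<bullet> xi_vec s" unfolding r u1 u2 v1(1) v2(1) using val by simp
qed

section \<open>Fields with smooth coefficients and their brackets\<close>

text \<open>Through a local extension \<open>G\<close> of \<open>F\<close> the value becomes a sum
  of partial derivatives of \<open>G\<close>, weighted by functions that are smooth in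
  \<open>a\<close>, \<open>b\<close>, the frame and the connection.\<close>

lemma field_sm:
  assumes z: "z \<in> tw_restr" and a: "smooth_via tw_restr tw_coord z a" and b: "smooth_via tw_restr tw_coord z b"
    and bs: "eventually (\<lambda>z. b z \<bullet> fibre_coord z = 0) (param_nhds tw_restr tw_coord z)" and F: "smooth_via tw_restr tw_coord z F"
  shows "smooth_via tw_restr tw_coord z (\<lambda>z. tangent_vec (fst z) (fibre_coord z) (a z) (b z) F)"
proof -
  obtain W G where G: "local_rep F z W G" using smooth_via_rp[OF F] by blast
  then have W: "open W" "tw_coord z \<in> W" "smooth_on W G" by (auto simp: local_rep_def)
  note q = tw_restr_point(1)[OF z]
  let ?conn_vec = "\<lambda>z. \<Sum>i\<in>UNIV. a z $ i *\<^sub>R conn_vec (fst z) (E (fst z) i)"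
  let ?u = "\<lambda>z. (\<chi> i. \<Sum>j\<in>UNIV. a z $ j * E (fst z) j (\<lambda>r. x r $ i), b z - cross3 (?conn_vec z) (fibre_coord z))"
  have bb: "bounded_bilinear cross3"
    using bilinear_cross bilinear_conv_bounded_bilinear by blast
  have omsm: "smooth_via tw_restr tw_coord z (\<lambda>z. conn_vec (fst z) (E (fst z) i))" for i
    by (rule smooth_via_vec) (rule smooth_via_base[OF z conn_vec_sm[OF q]])
  have "smooth_via tw_restr tw_coord z ?u"
  proof (intro smooth_via_Pair smooth_via_diff b smooth_via_bilinear[OF bb] smooth_via_sc z smooth_via_sum smooth_via_scaleR smooth_via_nth[OF a] omsm)
    have "smooth_via S x (fst z) (\<lambda>r. E r j (\<lambda>r. x r $ i))" for i j
      by (rule E_sm[OF q smooth_via_nth[OF smooth_via_param[OF q]]])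
    then have E: "smooth_via tw_restr tw_coord z (\<lambda>z. E (fst z) j (\<lambda>r. x r $ i))" for i j
      by (rule smooth_via_base[OF z])
    show "smooth_via tw_restr tw_coord z (\<lambda>z. \<chi> i. \<Sum>j\<in>UNIV. a z $ j * E (fst z) j (\<lambda>r. x r $ i))"
      by (rule smooth_via_vec, unfold vec_lambda_beta, intro smooth_via_sum smooth_via_mult smooth_via_nth[OF a] E z)
  qed
  then have "smooth_via tw_restr tw_coord z (\<lambda>z. \<Sum>c\<in>Basis. (?u z \<bullet> c) * frechet_derivative G (at (tw_coord z)) c)"
    by (intro smooth_via_sum z smooth_via_mult smooth_via_inner smooth_via_const
        smooth_via_compose[where f = tw_coord, OF smooth_via_param[OF z] W(1) smooth_on_frechet_derivative[OF W(3)] W(2)])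
  then show ?thesis
  proof (rule smooth_via_cong)
    have "eventually (\<lambda>z. tw_coord z \<in> W) (param_nhds tw_restr tw_coord z)"
      by (rule eventually_param_nhds_sm[where f = tw_coord, OF smooth_via_param[OF z] W(1,2)])
    then show "eventually (\<lambda>z. (\<Sum>c\<in>Basis. (?u z \<bullet> c) * frechet_derivative G (at (tw_coord z)) c) =
        tangent_vec (fst z) (fibre_coord z) (a z) (b z) F) (param_nhds tw_restr tw_coord z)"
      using eventually_param_nhds_mem bs
    proof eventually_elim
      case (elim z')
      note p = tw_restr_point[OF elim(2)]
      have R: "local_rep F (tw_point (fst z') (fibre_coord z')) W G" using G elim(1) p(2) by (simp add: local_rep_def)
      have u: "?u z' = (coord (vec_of (E (fst z')) (a z')), b z' - cross3 (conn_vec (fst z') (vec_of (E (fst z')) (a z'))) (fibre_coord z'))"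
        by (simp add: conn_vec_ve[OF p(1)] coord_def vec_of_apply)
      have "G differentiable (at (tw_coord z'))"
        using smooth_on_has_derivative[OF W(3) elim(1)] by (auto simp: differentiable_def)
      from frechet_derivative_basis_expansion[OF this, of "?u z'"]
      have "(\<Sum>c\<in>Basis. (?u z' \<bullet> c) * frechet_derivative G (at (tw_coord z')) c) = frechet_derivative G (at (tw_coord z')) (?u z')"
        by simp
      also have "\<dots> = tangent_vec (fst z') (fibre_coord z') (a z') (b z') F"
        unfolding u using tangent_vec_G[OF p(1,3) elim(3) R, of "a z'"] by (simp add: tw_coord_def)
      finally show ?case .
    qed
  qed
qed

lemma field_vf:
  assumes z: "z \<in> tw_restr" and a: "smooth_via tw_restr tw_coord z a" and b: "smooth_via tw_restr tw_coord z b"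
    and bs: "eventually (\<lambda>z. b z \<bullet> fibre_coord z = 0) (param_nhds tw_restr tw_coord z)"
    and X: "eventually (\<lambda>z. X z = tangent_vec (fst z) (fibre_coord z) (a z) (b z)) (param_nhds tw_restr tw_coord z)"
  shows "vf_near tw_restr tw_coord z X"
proof (rule vf_near_cong)
  show "eventually (\<lambda>z. tangent_vec (fst z) (fibre_coord z) (a z) (b z) = X z) (param_nhds tw_restr tw_coord z)"
    using X by eventually_elim simp
  show "vf_near tw_restr tw_coord z (\<lambda>z. tangent_vec (fst z) (fibre_coord z) (a z) (b z))"
    unfolding vf_near_def
    using eventually_param_nhds_mem smooth_via_eventually[OF a] smooth_via_eventually[OF b] eventually_param_nhds_nb[OF bs] bs
  proof eventually_elim
    case (elim z')
    show ?case
      using tangent_vec_TS[OF tw_restr_point(1,3)[OF elim(1)] elim(5), of "a z'"] tw_restr_point(2)[OF elim(1)]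
        field_sm[OF elim(1-4)] by simp
  qed
qed

text \<open>The identity is needed at all nearby points, because in a bracket a second field
  differentiates it.\<close>

lemma tangent_vec_base_near:
  assumes z: "z \<in> tw_restr" and f: "smooth_via S x (fst z) f"
    and bs: "eventually (\<lambda>z. b z \<bullet> fibre_coord z = 0) (param_nhds tw_restr tw_coord z)"
    and X: "eventually (\<lambda>z. X z = tangent_vec (fst z) (fibre_coord z) (a z) (b z)) (param_nhds tw_restr tw_coord z)"
  shows "eventually (\<lambda>z. (\<Sum>j\<in>UNIV. a z $ j * E (fst z) j f) = X z (\<lambda>z. f (fst z))) (param_nhds tw_restr tw_coord z)"
proof -
  have "eventually (\<lambda>r. smooth_via S x r f) (param_nhds S x (fst z))" by (rule smooth_via_eventually[OF f])
  then obtain W where W: "open W" "x (fst z) \<in> W" "\<forall>r\<in>S. x r \<in> W \<longrightarrow> smooth_via S x r f"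
    unfolding eventually_param_nhds by blast
  have "eventually (\<lambda>z. x (fst z) \<in> W) (param_nhds tw_restr tw_coord z)"
    by (rule eventually_param_nhds_sm[OF smooth_via_fst_th[OF z] W(1,2)])
  then show ?thesis
    using bs X eventually_param_nhds_mem
  proof eventually_elim
    case (elim z')
    note p = tw_restr_point[OF elim(4)]
    have "smooth_via S x (fst z') f" using W(3) p(1) elim(1) by blast
    from tangent_vec_base[OF p(1,3) elim(2) this, of "a z'"] show ?case by (simp add: elim(3) vec_of_apply)
  qed
qed

text \<open>A component of the projection to the base; it is meant for vectors over
  \<open>p\<close>, where the functions used are dual to the frame.\<close>

definition base_comp :: "'m \<Rightarrow> 5 \<Rightarrow> ('m \<times> 'm bivec) tvec \<Rightarrow> real"
  where "base_comp p b w = w (\<lambda>z. dual_fun p b (fst z))"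

lemma base_comp_tv: "p \<in> S \<Longrightarrow> s \<bullet> s = 1 \<Longrightarrow> v \<bullet> s = 0 \<Longrightarrow> base_comp p b (tangent_vec p s u v) = u $ b"
  unfolding base_comp_def by (simp add: tangent_vec_base dual_fun)

text \<open>On a function of the base point the vertical coefficients drop out in the first
  application of a field, so the second one differentiates an expression in the horizontal
  coefficients and the frame.\<close>

lemma base_comp_bracket:
  assumes p: "p \<in> S" and s: "s \<bullet> s = 1"
    and a: "smooth_via tw_restr tw_coord (tw_point p s) a" "smooth_via tw_restr tw_coord (tw_point p s) a'"
    and bs: "eventually (\<lambda>z. b z \<bullet> fibre_coord z = 0) (param_nhds tw_restr tw_coord (tw_point p s))" "eventually (\<lambda>z. b' z \<bullet> fibre_coord z = 0) (param_nhds tw_restr tw_coord (tw_point p s))"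
    and X: "eventually (\<lambda>z. X z = tangent_vec (fst z) (fibre_coord z) (a z) (b z)) (param_nhds tw_restr tw_coord (tw_point p s))"
    and Y: "eventually (\<lambda>z. Y z = tangent_vec (fst z) (fibre_coord z) (a' z) (b' z)) (param_nhds tw_restr tw_coord (tw_point p s))"
  shows "base_comp p c (lie_bracket twistor_charts X Y (tw_point p s)) =
    X (tw_point p s) (\<lambda>z. \<Sum>j\<in>UNIV. a' z $ j * E (fst z) j (dual_fun p c))
    - Y (tw_point p s) (\<lambda>z. \<Sum>j\<in>UNIV. a z $ j * E (fst z) j (dual_fun p c))"
proof -
  let ?z = "tw_point p s"
  have z: "?z \<in> tw_restr" by (rule tw_point_N[OF p s])
  have f: "smooth_via S x (fst ?z) (dual_fun p c)" using dual_fun(1)[OF p] by simp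
  have TX: "X ?z \<in> TS tw_restr tw_coord ?z"
    using eventually_param_nhds_self[OF X z] eventually_param_nhds_self[OF bs(1) z] tangent_vec_TS[OF p s] by (simp add: fibre_coord_pt[OF p])
  have TY: "Y ?z \<in> TS tw_restr tw_coord ?z"
    using eventually_param_nhds_self[OF Y z] eventually_param_nhds_self[OF bs(2) z] tangent_vec_TS[OF p s] by (simp add: fibre_coord_pt[OF p])
  have sma: "smooth_via tw_restr tw_coord ?z (\<lambda>z. \<Sum>j\<in>UNIV. a z $ j * E (fst z) j (dual_fun p c))" if "smooth_via tw_restr tw_coord ?z a" for a :: "_ \<Rightarrow> real^5"
    by (intro smooth_via_sum smooth_via_mult z smooth_via_nth[OF that] smooth_via_base[OF z] E_sm) (use p f in auto)
  have "X ?z (\<lambda>z. Y z (\<lambda>z. dual_fun p c (fst z))) = X ?z (\<lambda>z. \<Sum>j\<in>UNIV. a' z $ j * E (fst z) j (dual_fun p c))"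
    by (rule TS_local[OF TX sma[OF a(2)] tangent_vec_base_near[OF z f bs(2) Y], symmetric])
  moreover have "Y ?z (\<lambda>z. X z (\<lambda>z. dual_fun p c (fst z))) = Y ?z (\<lambda>z. \<Sum>j\<in>UNIV. a z $ j * E (fst z) j (dual_fun p c))"
    by (rule TS_local[OF TY sma[OF a(1)] tangent_vec_base_near[OF z f bs(1) X], symmetric])
  moreover have "smooth_near twistor_charts ?z (\<lambda>z. dual_fun p c (fst z))"
    unfolding smooth_near_T[OF z] by (rule smooth_via_base[OF z f])
  ultimately show ?thesis by (simp add: base_comp_def lie_bracket_def)
qed

lemma bracket_tv:
  assumes p: "p \<in> S" and s: "s \<bullet> s = 1" and X: "vf_near tw_restr tw_coord (tw_point p s) X" "vf_near tw_restr tw_coord (tw_point p s) Y"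
  obtains u v where "v \<bullet> s = 0" "lie_bracket twistor_charts X Y (tw_point p s) = tangent_vec p s u v"
proof -
  have z: "tw_point p s \<in> tw_restr" by (rule tw_point_N[OF p s])
  have "lie_bracket twistor_charts X Y (tw_point p s) = lie_bracket {(tw_restr, tw_coord)} X Y (tw_point p s)"
    by (simp add: lie_bracket_def smooth_near_T[OF z] smooth_near_single)
  then have "lie_bracket twistor_charts X Y (tw_point p s) \<in> TS tw_restr tw_coord (tw_point p s)"
    using lie_bracket_TS[OF X z] by simp
  then show ?thesis using TS_tv[OF p s] that by metis
qed

text \<open>A vertical vector differentiates only the fibre coordinates.\<close>

lemma vertical_derivative:
  fixes P :: "5 \<Rightarrow> real^3 \<Rightarrow> real"
  assumes p: "p \<in> S" and s: "s \<bullet> s = 1" and v: "v \<bullet> s = 0"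
    and P: "\<And>j. smooth_on UNIV (P j)" and h: "\<And>j. smooth_via S x p (h j)" "\<And>j. h j p = (if j = c then k else 0)"
  shows "tangent_vec p s 0 v (\<lambda>z. \<Sum>j\<in>UNIV. P j (fibre_coord z) * h j (fst z)) = k * frechet_derivative (P c) (at s) v"
proof -
  let ?z = "tw_point p s"
  have z: "?z \<in> tw_restr" by (rule tw_point_N[OF p s])
  note T = tangent_vec_TS[OF p s v, of 0]
  have Ps: "smooth_via tw_restr tw_coord ?z (\<lambda>z. P j (fibre_coord z))" for j
    by (rule smooth_via_compose[OF smooth_via_sc[OF z] open_UNIV P UNIV_I])
  have hs: "smooth_via tw_restr tw_coord ?z (\<lambda>z. h j (fst z))" for j by (rule smooth_via_base[OF z]) (simp add: h)
  have "conn_vec p (vec_of (E p) 0) = 0" by (simp add: conn_vec_ve[OF p])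
  then have dP: "tangent_vec p s 0 v (\<lambda>z. P j (fibre_coord z)) = frechet_derivative (P j) (at s) v" for j
    using tangent_vec_sc[OF p s v open_UNIV P UNIV_I, of 0 j] by simp
  have dh: "tangent_vec p s 0 v (\<lambda>z. h j (fst z)) = 0" for j
    using tangent_vec_base[OF p s v h(1), of 0 j] by (simp add: vec_of_apply)
  have "tangent_vec p s 0 v (\<lambda>z. \<Sum>j\<in>UNIV. P j (fibre_coord z) * h j (fst z)) =
      (\<Sum>j\<in>UNIV. frechet_derivative (P j) (at s) v * h j p)"
    by (subst TS_sum[OF T z]) (auto simp: smooth_via_mult Ps hs TS_mult[OF T Ps hs] dP dh)
  also have "\<dots> = k * frechet_derivative (P c) (at s) v"
    by (simp add: h(2) if_distrib mult.commute cong: if_cong)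
  finally show ?thesis .
qed

text \<open>Cutting off by a function \<open>\<beta>\<close> on the base gives global fields. The vertical component
  \<open>c \<times> \<sigma>\<close> is the velocity of a rotation of the fibre.\<close>

definition gfield :: "('m \<Rightarrow> real) \<Rightarrow> real^5 \<Rightarrow> real^3 \<Rightarrow> 'm \<times> 'm bivec \<Rightarrow> ('m \<times> 'm bivec) tvec"
  where "gfield \<beta> a c z = (if z \<in> tw_restr then tangent_vec (fst z) (fibre_coord z) (\<beta> (fst z) *\<^sub>R a) (\<beta> (fst z) *\<^sub>R cross3 c (fibre_coord z)) else 0)"

lemma bounded_bilinear_cross3: "bounded_bilinear cross3"
  using bilinear_cross bilinear_conv_bounded_bilinear by blast

lemma gfield_sm:
  assumes "z \<in> tw_restr" "smooth_via S x (fst z) \<beta>"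
  shows "smooth_via tw_restr tw_coord z (\<lambda>z. \<beta> (fst z) *\<^sub>R a)" "smooth_via tw_restr tw_coord z (\<lambda>z. \<beta> (fst z) *\<^sub>R cross3 c (fibre_coord z))"
    "eventually (\<lambda>z. (\<beta> (fst z) *\<^sub>R cross3 c (fibre_coord z)) \<bullet> fibre_coord z = 0) (param_nhds tw_restr tw_coord z)"
    "eventually (\<lambda>z. gfield \<beta> a c z = tangent_vec (fst z) (fibre_coord z) (\<beta> (fst z) *\<^sub>R a) (\<beta> (fst z) *\<^sub>R cross3 c (fibre_coord z))) (param_nhds tw_restr tw_coord z)"
proof -
  show "smooth_via tw_restr tw_coord z (\<lambda>z. \<beta> (fst z) *\<^sub>R a)" "smooth_via tw_restr tw_coord z (\<lambda>z. \<beta> (fst z) *\<^sub>R cross3 c (fibre_coord z))"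
    by (intro smooth_via_scaleR smooth_via_base[OF assms] smooth_via_const assms(1) smooth_via_bilinear[OF bounded_bilinear_cross3] smooth_via_sc)+
  show "eventually (\<lambda>z. (\<beta> (fst z) *\<^sub>R cross3 c (fibre_coord z)) \<bullet> fibre_coord z = 0) (param_nhds tw_restr tw_coord z)"
    by (simp add: dot_cross_self inner_commute)
  show "eventually (\<lambda>z. gfield \<beta> a c z = tangent_vec (fst z) (fibre_coord z) (\<beta> (fst z) *\<^sub>R a) (\<beta> (fst z) *\<^sub>R cross3 c (fibre_coord z))) (param_nhds tw_restr tw_coord z)"
    using eventually_param_nhds_mem by eventually_elim (simp add: gfield_def)
qed

text \<open>Two open sets cover the twistor space: over \<open>S\<close> the field has smooth
  coefficients, and off the closed set \<open>K\<close> it vanishes, also over the part of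
  \<open>S\<close> outside \<open>K\<close>.\<close>

lemma gfield_vfield:
  assumes \<beta>: "\<And>q. q \<in> S \<Longrightarrow> smooth_via S x q \<beta>" and K: "closed K" "K \<subseteq> S" "\<And>q. q \<notin> K \<Longrightarrow> \<beta> q = 0"
  shows "vfield_on twistor_charts (chart_space twistor_charts) (gfield \<beta> a c)"
  unfolding vfield_on_def
proof (intro ballI)
  fix z assume "z \<in> chart_space twistor_charts"
  then obtain V y where V: "(V, y) \<in> A" "z \<in> tw_dom V"
    unfolding chart_space_def twistor_charts_def by auto
  show "gfield \<beta> a c z \<in> tangent_space twistor_charts z \<and>
      (\<forall>f. smooth_near twistor_charts z f \<longrightarrow> smooth_near twistor_charts z (\<lambda>q. gfield \<beta> a c q f))"
  proof (cases "z \<in> tw_restr")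
    case True
    have "vf_near tw_restr tw_coord z (gfield \<beta> a c)"
      by (rule field_vf[OF True gfield_sm[OF True \<beta>[OF tw_restr_point(1)[OF True]]]])
    from vf_nearD[OF this True] show ?thesis
      unfolding TT_eq[OF True] smooth_near_T[OF True] by blast
  next
    case False
    then have zK: "fst z \<notin> K" using V(2) K(2) by (auto simp: tw_restr_def)
    have g0: "gfield \<beta> a c q f = 0" if "fst q \<notin> K" for q f
    proof (cases "q \<in> tw_restr")
      case True
      then show ?thesis using tangent_vec_zero tw_restr_point[OF True] K(3)[OF that] by (simp add: gfield_def)
    qed (simp add: gfield_def)
    have "gfield \<beta> a c z = 0" using False by (simp add: gfield_def)
    moreover have "(0 :: ('m \<times> 'm bivec) tvec) \<in> tangent_space twistor_charts z"
      by (simp add: tangent_space_def)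
    moreover have "smooth_via (tw_dom V) (tw y) z (\<lambda>q. gfield \<beta> a c q f)" for f
    proof (rule smooth_via_cong[OF smooth_via_const[OF V(2), of "tw y" 0]])
      \<comment> \<open>Vanishing off \<open>K\<close> must hold on a neighbourhood in the chart, so
        the part of \<open>V\<close> outside \<open>K\<close> needs an open image.\<close>
      have yV: "open (y ` (V \<inter> - K))" using chart_image_open[OF V(1)] K(1) by blast
      show "eventually (\<lambda>q. 0 = gfield \<beta> a c q f) (param_nhds (tw_dom V) (tw y) z)"
      proof (rule eventually_param_nhdsI[where W = "y ` (V \<inter> - K) \<times> UNIV"])
        show "open (y ` (V \<inter> - K) \<times> (UNIV :: (real^5^5) set))" using yV by (intro open_Times) auto
        show "tw y z \<in> y ` (V \<inter> - K) \<times> UNIV" using V(2) zK by (auto simp: split_beta)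
        fix q assume q: "q \<in> tw_dom V" "tw y q \<in> y ` (V \<inter> - K) \<times> UNIV"
        then obtain r where "r \<in> V \<inter> - K" "y (fst q) = y r" by (auto simp: split_beta)
        moreover have "fst q \<in> V" using q(1) by auto
        ultimately have "fst q \<notin> K" using inj_onD[OF chart_inj[OF V(1)]] by (metis ComplD Int_iff)
        then show "0 = gfield \<beta> a c q f" by (simp add: g0)
      qed
    qed
    then have "smooth_near twistor_charts z (\<lambda>q. gfield \<beta> a c q f)" for f
      unfolding smooth_near_tw using V(1) by blast
    ultimately show ?thesis by simp
  qed
qed

text \<open>A bump function of the chart is extended by zero. \<open>K\<close> is the image of a
  closed ball, hence compact and, the manifold being Hausdorff, closed.\<close>

lemma bump:
  assumes p: "p \<in> S"
  obtains \<beta> :: "'m \<Rightarrow> real" and K where "\<forall>q\<in>S. smooth_via S x q \<beta>" "closed K" "K \<subseteq> S" "\<forall>q. q \<notin> K \<longrightarrow> \<beta> q = 0" "\<beta> p \<noteq> 0"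
proof -
  obtain r where r: "r > 0" "cball (x p) r \<subseteq> x ` S"
    using x_image_open p open_contains_cball by (metis imageI)
  obtain \<gamma> :: "real^5 \<Rightarrow> real" where \<gamma>: "smooth_on UNIV \<gamma>" "\<gamma> (x p) \<noteq> 0" "\<And>u. u \<notin> cball (x p) r \<Longrightarrow> \<gamma> u = 0"
    using smooth_bump[OF r(1), of "x p"] by blast
  define K where "K = inv_into U x ` cball (x p) r"
  define \<beta> where "\<beta> q = (if q \<in> S then \<gamma> (x q) else 0)" for q
  have inv: "inv_into U x (x q) = q" if "q \<in> S" for q
    using that S_sub chart_inj[OF chart_A] by (auto simp: inv_into_f_f)
  show ?thesis
  proof (rule that[of \<beta> K])
    show "\<forall>q\<in>S. smooth_via S x q \<beta>"
    proof
      fix q assume q: "q \<in> S"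
      have "eventually (\<lambda>q. \<gamma> (x q) = \<beta> q) (param_nhds S x q)"
        using eventually_param_nhds_mem by eventually_elim (simp add: \<beta>_def)
      then show "smooth_via S x q \<beta>"
        by (rule smooth_via_cong[OF smooth_via_compose[where f = x, OF smooth_via_param[OF q] open_UNIV \<gamma>(1) UNIV_I]])
    qed
    show "K \<subseteq> S" using r(2) inv by (auto simp: K_def)
    have "continuous_on (x ` U) (inv_into U x)" using chart[OF chart_A] by (simp add: homeomorphism_def)
    moreover have "cball (x p) r \<subseteq> x ` U" using r(2) S_sub by blast
    ultimately have "compact K"
      unfolding K_def by (intro compact_continuous_image compact_cball) (rule continuous_on_subset)
    then show "closed K" by (rule compact_imp_closed)
    show "\<forall>q. q \<notin> K \<longrightarrow> \<beta> q = 0"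
    proof (intro allI impI)
      fix q assume "q \<notin> K"
      then have "\<not> (q \<in> S \<and> x q \<in> cball (x p) r)" unfolding K_def using inv by (metis imageI)
      then show "\<beta> q = 0" using \<gamma>(3) by (auto simp: \<beta>_def)
    qed
    show "\<beta> p \<noteq> 0" using \<gamma>(2) p by (simp add: \<beta>_def)
  qed
qed

section \<open>The normality tensor on a vertical and a horizontal field\<close>

text \<open>Derivatives of the cut-off never contribute: vertical vectors annihilate functions of
  the base point, and the vertical field has no horizontal coefficients for a horizontal vector to
  differentiate. Each of the two fields contributes one factor \<open>\<beta> p\<close>, and the
  product is divided out.\<close>

lemma normality_condition:
  assumes p: "p \<in> S" and normal: "normal_twistor n \<epsilon> t"
  shows "(- 1) ^ n * frechet_derivative (\<lambda>s. phi_mat \<epsilon> s $ 3 $ b) (at (unit3 3)) (unit3 2)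
    - (\<Sum>j\<in>UNIV. frechet_derivative (\<lambda>s. phi_mat \<epsilon> s $ 3 $ j) (at (unit3 3)) (unit3 1) * phi_mat \<epsilon> (unit3 3) $ j $ b)
    + frechet_derivative (\<lambda>s. xi_vec s $ 3) (at (unit3 3)) (unit3 1) * xi_vec (unit3 3) $ b = 0"
proof -
  define s where "s = unit3 3"
  let ?z = "tw_point p s" and ?T = twistor_charts
  have s: "s \<bullet> s = 1" by (simp add: s_def unit3_def inner_axis_axis)
  have z: "?z \<in> tw_restr" by (rule tw_point_N[OF p s])
  have zC: "?z \<in> chart_space ?T"
  proof -
    have c: "(tw_dom U, tw x) \<in> ?T"
      unfolding twistor_charts_def by (rule image_eqI[OF _ chart_A]) simp
    have "?z \<in> tw_dom U" using z S_sub by (auto simp: tw_restr_def tw_point_def)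
    then show ?thesis unfolding chart_space_def by (intro UN_I[OF c]) simp
  qed
  obtain \<beta> :: "'m \<Rightarrow> real" and K where \<beta>0: "\<forall>q\<in>S. smooth_via S x q \<beta>" "closed K" "K \<subseteq> S" "\<forall>q. q \<notin> K \<longrightarrow> \<beta> q = 0"
    and \<beta>p: "\<beta> p \<noteq> 0"
    using bump[OF p] .
  note \<beta> = \<beta>0(1)[rule_format] \<beta>0(2,3) \<beta>0(4)[rule_format] \<beta>p
  define u3 :: "real^5" where "u3 = axis 3 1"
  \<comment> \<open>At kappa_3 the rotation about kappa_2 has the velocity kappa_1, the vector
    product of kappa_2 and kappa_3, and \<open>Phi\<close> sends it to (-1)^n times kappa_2, the
    vector product of kappa_3 and kappa_1.\<close>
  let ?V = "gfield \<beta> 0 (unit3 2)" and ?X = "gfield \<beta> u3 0"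
  let ?\<Phi> = "Phi n \<epsilon>"
  have c1: "cross3 (unit3 2) s = unit3 1" and c2: "cross3 s (unit3 1) = unit3 2"
    by (simp_all add: s_def unit3_def cross3_def vec_eq_iff forall_3 vector_3 axis_def)
  have orth: "unit3 1 \<bullet> s = 0" "unit3 2 \<bullet> s = 0" by (simp_all add: s_def unit3_def inner_axis_axis)
  have \<beta>z: "smooth_via S x (fst ?z) \<beta>" using \<beta>(1)[OF p] by simp
  note V = gfield_sm(1)[OF z \<beta>z, of 0] gfield_sm(2,3)[OF z \<beta>z, of "unit3 2"] gfield_sm(4)[OF z \<beta>z, of 0 "unit3 2"]
    and X = gfield_sm(1)[OF z \<beta>z, of u3] gfield_sm(2,3)[OF z \<beta>z, of 0] gfield_sm(4)[OF z \<beta>z, of u3 0]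
  define aX bX where "aX z = \<beta> (fst z) *\<^sub>R phi_vec \<epsilon> (fibre_coord z) u3" and "bX z = (0::real^3)" for z :: "'m \<times> 'm bivec"
  define bV where "bV z = (- 1) ^ n *\<^sub>R \<beta> (fst z) *\<^sub>R cross3 (fibre_coord z) (cross3 (unit3 2) (fibre_coord z))" for z :: "'m \<times> 'm bivec"
  have \<Phi>V: "eventually (\<lambda>z. ?\<Phi> z (?V z) = tangent_vec (fst z) (fibre_coord z) 0 (bV z)) (param_nhds tw_restr tw_coord ?z)"
    using V(4) V(3) eventually_param_nhds_mem
  proof eventually_elim
    case (elim z)
    note q = tw_restr_point[OF elim(3)]
    have "?\<Phi> z (?V z) = ?\<Phi> (tw_point (fst z) (fibre_coord z)) (tangent_vec (fst z) (fibre_coord z) 0 (\<beta> (fst z) *\<^sub>R cross3 (unit3 2) (fibre_coord z)))"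
      using q(2) elim(1) by simp
    also have "\<dots> = tangent_vec (fst z) (fibre_coord z) 0 (bV z)"
      by (subst Phi_tv[OF q(1,3) elim(2)]) (simp add: bV_def cross_mult_right)
    finally show ?case .
  qed
  have \<Phi>X: "eventually (\<lambda>z. ?\<Phi> z (?X z) = tangent_vec (fst z) (fibre_coord z) (aX z) (bX z)) (param_nhds tw_restr tw_coord ?z)"
    using X(4) eventually_param_nhds_mem
  proof eventually_elim
    case (elim z)
    note q = tw_restr_point[OF elim(2)]
    have ph: "phi_vec \<epsilon> (fibre_coord z) (\<beta> (fst z) *\<^sub>R u3) = aX z"
      by (simp add: aX_def phi_vec_def vec_eq_iff sum_distrib_left mult.assoc)
    have "?\<Phi> z (?X z) = ?\<Phi> (tw_point (fst z) (fibre_coord z)) (tangent_vec (fst z) (fibre_coord z) (\<beta> (fst z) *\<^sub>R u3) 0)"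
      using q(2) elim(1) by (simp add: cross_zero_left)
    also have "\<dots> = tangent_vec (fst z) (fibre_coord z) (aX z) (bX z)"
      by (subst Phi_tv[OF q(1,3)]) (simp_all add: ph bX_def cross_zero_right)
    finally show ?case .
  qed
  have phv3: "phi_vec \<epsilon> r u3 $ j = phi_mat \<epsilon> r $ 3 $ j" for r j
    by (simp add: phi_vec_def u3_def axis_def if_distrib if_distribR cong: if_cong)
  have aXsm: "smooth_via tw_restr tw_coord ?z aX"
  proof (rule smooth_via_vec)
    have "smooth_via tw_restr tw_coord ?z (\<lambda>z. phi_mat \<epsilon> (fibre_coord z) $ 3 $ i)" for i
      by (rule smooth_via_compose[OF smooth_via_sc[OF z] open_UNIV smooth_phi_mat UNIV_I])
    then show "smooth_via tw_restr tw_coord ?z (\<lambda>z. aX z $ i)" for i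
      unfolding aX_def vector_scaleR_component real_scaleR_def phv3 by (intro smooth_via_mult smooth_via_base[OF z \<beta>z])
  qed
  have bXsm: "smooth_via tw_restr tw_coord ?z bX" "eventually (\<lambda>z. bX z \<bullet> fibre_coord z = 0) (param_nhds tw_restr tw_coord ?z)"
    unfolding bX_def using smooth_via_const[OF z] by simp_all
  have bVsm: "smooth_via tw_restr tw_coord ?z bV" "eventually (\<lambda>z. bV z \<bullet> fibre_coord z = 0) (param_nhds tw_restr tw_coord ?z)"
    unfolding bV_def
    by (intro smooth_via_scaleR smooth_via_base[OF z \<beta>z] smooth_via_const z smooth_via_bilinear[OF bounded_bilinear_cross3] smooth_via_sc)
       (simp add: dot_cross_self inner_commute)
  have zsm: "smooth_via tw_restr tw_coord ?z (\<lambda>z. 0 :: real^5)" by (rule smooth_via_const[OF z])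
  have V0: "eventually (\<lambda>z. ?V z = tangent_vec (fst z) (fibre_coord z) 0 (\<beta> (fst z) *\<^sub>R cross3 (unit3 2) (fibre_coord z))) (param_nhds tw_restr tw_coord ?z)"
    using V(4) by simp
  note vfV = field_vf[OF z zsm V(2,3) V0] and vfX = field_vf[OF z X]
    and vf\<Phi>V = field_vf[OF z zsm bVsm \<Phi>V] and vf\<Phi>X = field_vf[OF z aXsm bXsm \<Phi>X]
  have Vz: "?V ?z = tangent_vec p s 0 (\<beta> p *\<^sub>R unit3 1)"
    using eventually_param_nhds_self[OF V0 z] by (simp add: fibre_coord_pt[OF p] c1)
  have \<Phi>Vz: "?\<Phi> ?z (?V ?z) = tangent_vec p s 0 (((- 1) ^ n * \<beta> p) *\<^sub>R unit3 2)"
    using eventually_param_nhds_self[OF \<Phi>V z] by (simp add: fibre_coord_pt[OF p] bV_def c1 c2)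
  have zero: "w (\<lambda>z. \<Sum>j\<in>UNIV. (0::real^5) $ j * E (fst z) j f) = 0" if "w \<in> TS tw_restr tw_coord ?z" for w f
    using TS_const[OF that z, of 0] by simp
  have TX: "?X ?z \<in> TS tw_restr tw_coord ?z" "?\<Phi> ?z (?X ?z) \<in> TS tw_restr tw_coord ?z"
    using vf_nearD(1)[OF vfX z] vf_nearD(1)[OF vf\<Phi>X z] by auto
  have hE: "smooth_via S x p (\<lambda>r. \<beta> r * E r j (dual_fun p c))" for j c
    by (intro smooth_via_mult \<beta>(1)[OF p] E_sm dual_fun(1) p)
  have hE': "\<beta> p * E p j (dual_fun p c) = (if j = c then \<beta> p else 0)" for j c by (simp add: E_dual_fun[OF p])
  have sm1: "smooth_on UNIV (\<lambda>s::real^3. u3 $ j)" for j by (rule smooth_on_const[OF open_UNIV])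
  have der0: "frechet_derivative (\<lambda>s::real^3. u3 $ c) (at s) v = 0" for c v
    using frechet_derivative_at[OF has_derivative_const, of "u3 $ c" s] by (metis)
  \<comment> \<open>The coefficients of \<open>?X\<close> are constant along the fibres, so vertical
    vectors annihilate them; this removes the horizontal parts of the two brackets that contain
    \<open>?X\<close> itself.\<close>
  have base0: "tangent_vec p s 0 v (\<lambda>z. \<Sum>j\<in>UNIV. (\<beta> (fst z) *\<^sub>R u3) $ j * E (fst z) j (dual_fun p c)) = 0" if "v \<bullet> s = 0" for v c
    using vertical_derivative[where P = "\<lambda>j s. u3 $ j" and h = "\<lambda>j r. \<beta> r * E r j (dual_fun p c)" and c = c and k = "\<beta> p", OF p s that sm1 hE hE'] by (simp add: der0 mult_ac)
  \<comment> \<open>The image of \<open>?X\<close> under \<open>Phi\<close> has a row of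
    \<open>phi_mat\<close> as its coefficients, and this row varies along the fibre.\<close>
  have fib: "tangent_vec p s 0 v (\<lambda>z. \<Sum>j\<in>UNIV. aX z $ j * E (fst z) j (dual_fun p c)) =
      \<beta> p * frechet_derivative (\<lambda>s. phi_mat \<epsilon> s $ 3 $ c) (at s) v" if "v \<bullet> s = 0" for v c
    using vertical_derivative[where P = "\<lambda>j s. phi_mat \<epsilon> s $ 3 $ j" and h = "\<lambda>j r. \<beta> r * E r j (dual_fun p c)" and c = c and k = "\<beta> p",
        OF p s that smooth_phi_mat hE hE']
    by (simp add: aX_def phv3 mult_ac)
  have o1: "(\<beta> p *\<^sub>R unit3 1) \<bullet> s = 0" and o2: "(((- 1) ^ n * \<beta> p) *\<^sub>R unit3 2) \<bullet> s = 0" using orth by simp_all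
  have hVX: "base_comp p c (lie_bracket ?T ?V ?X ?z) = 0" for c
    using base_comp_bracket[OF p s zsm X(1) V(3) X(3) V0 X(4), of c] base0[OF o1] zero[OF TX(1)] by (simp add: Vz)
  have h\<Phi>VX: "base_comp p c (lie_bracket ?T (\<lambda>z. ?\<Phi> z (?V z)) ?X ?z) = 0" for c
    using base_comp_bracket[OF p s zsm X(1) bVsm(2) X(3) \<Phi>V X(4), of c] base0[OF o2] zero[OF TX(1)] by (simp add: \<Phi>Vz)
  have hV\<Phi>X: "base_comp p c (lie_bracket ?T ?V (\<lambda>z. ?\<Phi> z (?X z)) ?z) =
      \<beta> p * frechet_derivative (\<lambda>s. phi_mat \<epsilon> s $ 3 $ c) (at s) (\<beta> p *\<^sub>R unit3 1)" for c
    using base_comp_bracket[OF p s zsm aXsm V(3) bXsm(2) V0 \<Phi>X, of c] fib[OF o1] zero[OF TX(2)] by (simp add: Vz)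
  have h\<Phi>V\<Phi>X: "base_comp p c (lie_bracket ?T (\<lambda>z. ?\<Phi> z (?V z)) (\<lambda>z. ?\<Phi> z (?X z)) ?z) =
      \<beta> p * frechet_derivative (\<lambda>s. phi_mat \<epsilon> s $ 3 $ c) (at s) (((- 1) ^ n * \<beta> p) *\<^sub>R unit3 2)" for c
    using base_comp_bracket[OF p s zsm aXsm bVsm(2) bXsm(2) \<Phi>V \<Phi>X, of c] fib[OF o2] zero[OF TX(2)] by (simp add: \<Phi>Vz)
  have base_comp\<Phi>: "base_comp p b (?\<Phi> ?z w) = (\<Sum>j\<in>UNIV. base_comp p j w * phi_mat \<epsilon> s $ j $ b)"
    if "v \<bullet> s = 0" "w = tangent_vec p s u v" for w u v b
    unfolding that(2) Phi_tv[OF p s that(1)] base_comp_tv[OF p s cross3_orth] base_comp_tv[OF p s that(1)]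
    by (simp add: phi_vec_def)
  obtain u1 v1 where w1: "v1 \<bullet> s = 0" "lie_bracket ?T ?V ?X ?z = tangent_vec p s u1 v1"
    using bracket_tv[OF p s vfV vfX] .
  obtain u2 v2 where w2: "v2 \<bullet> s = 0" "lie_bracket ?T (\<lambda>z. ?\<Phi> z (?V z)) ?X ?z = tangent_vec p s u2 v2"
    using bracket_tv[OF p s vf\<Phi>V vfX] .
  obtain u3' v3 where w3: "v3 \<bullet> s = 0" "lie_bracket ?T ?V (\<lambda>z. ?\<Phi> z (?X z)) ?z = tangent_vec p s u3' v3"
    using bracket_tv[OF p s vfV vf\<Phi>X] .
  \<comment> \<open>The bracket of \<open>?V\<close> and \<open>?X\<close> is vertical and
    \<open>Phi\<close> preserves vertical vectors, so the term with the square of \<open>Phi\<close>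
    has no horizontal component.\<close>
  have u1: "u1 = 0" using hVX base_comp_tv[OF p s w1(1), of _ u1] by (simp add: w1(2) vec_eq_iff)
  have t1: "base_comp p b (?\<Phi> ?z (?\<Phi> ?z (lie_bracket ?T ?V ?X ?z))) = 0"
    unfolding w1(2) u1 Phi_tv[OF p s w1(1)] phi_vec_zero Phi_tv[OF p s cross3_orth] base_comp_tv[OF p s cross3_orth] by simp
  have t2: "base_comp p b (?\<Phi> ?z (lie_bracket ?T (\<lambda>z. ?\<Phi> z (?V z)) ?X ?z)) = 0"
    unfolding base_comp\<Phi>[OF w2] h\<Phi>VX by simp
  have t3: "base_comp p b (?\<Phi> ?z (lie_bracket ?T ?V (\<lambda>z. ?\<Phi> z (?X z)) ?z)) =
      (\<Sum>j\<in>UNIV. (\<beta> p * frechet_derivative (\<lambda>s. phi_mat \<epsilon> s $ 3 $ j) (at s) (\<beta> p *\<^sub>R unit3 1)) * phi_mat \<epsilon> s $ j $ b)"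
    unfolding base_comp\<Phi>[OF w3] hV\<Phi>X ..
  have etaX: "?V ?z (\<lambda>z. eta t z (?X z)) = \<beta> p * frechet_derivative (\<lambda>s. xi_vec s $ 3) (at s) (\<beta> p *\<^sub>R unit3 1)"
  proof -
    \<comment> \<open>\<open>vertical_derivative\<close> expects a sum over all indices; these
      weights single out the third, the direction of \<open>?X\<close>.\<close>
    let ?h = "\<lambda>j r. if j = (3::5) then \<beta> r else 0" and ?P = "\<lambda>j s. xi_vec s $ j"
    have TV: "?V ?z \<in> TS tw_restr tw_coord ?z" by (rule vf_nearD(1)[OF vfV z])
    have hs: "smooth_via S x p (?h j)" for j by (cases "j = 3") (simp_all add: \<beta>(1)[OF p] smooth_via_const[OF p])
    have "?V ?z (\<lambda>z. eta t z (?X z)) = ?V ?z (\<lambda>z. \<Sum>j\<in>UNIV. ?P j (fibre_coord z) * ?h j (fst z))"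
    proof (rule TS_local[OF TV, symmetric])
      show "smooth_via tw_restr tw_coord ?z (\<lambda>z. \<Sum>j\<in>UNIV. ?P j (fibre_coord z) * ?h j (fst z))"
      proof (intro smooth_via_sum smooth_via_mult z)
        show "smooth_via tw_restr tw_coord ?z (\<lambda>z. ?P j (fibre_coord z))" for j
          by (rule smooth_via_compose[OF smooth_via_sc[OF z] open_UNIV smooth_xi_vec UNIV_I])
        show "smooth_via tw_restr tw_coord ?z (\<lambda>z. ?h j (fst z))" for j
          by (rule smooth_via_base[OF z]) (simp add: hs)
      qed
      show "eventually (\<lambda>z. (\<Sum>j\<in>UNIV. ?P j (fibre_coord z) * ?h j (fst z)) = eta t z (?X z)) (param_nhds tw_restr tw_coord ?z)"
        using X(4) eventually_param_nhds_mem X(3)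
      proof eventually_elim
        case (elim z)
        note q = tw_restr_point[OF elim(2)]
        have "eta t z (?X z) = eta t (tw_point (fst z) (fibre_coord z)) (tangent_vec (fst z) (fibre_coord z) (\<beta> (fst z) *\<^sub>R u3) (\<beta> (fst z) *\<^sub>R cross3 0 (fibre_coord z)))"
          using q(2) elim(1) by simp
        also have "\<dots> = (\<beta> (fst z) *\<^sub>R u3) \<bullet> xi_vec (fibre_coord z)" by (rule eta_tv[OF q(1,3) elim(3)])
        also have "\<dots> = (\<Sum>j\<in>UNIV. ?P j (fibre_coord z) * ?h j (fst z))"
          by (simp add: u3_def inner_axis' if_distrib cong: if_cong)
        finally show ?case by simp
      qed
    qed
    also have "\<dots> = \<beta> p * frechet_derivative (\<lambda>s. xi_vec s $ 3) (at s) (\<beta> p *\<^sub>R unit3 1)"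
      unfolding Vz by (rule vertical_derivative[OF p s o1 smooth_xi_vec hs]) simp
    finally show ?thesis .
  qed
  have etaV: "?X ?z (\<lambda>z. eta t z (?V z)) = 0"
  proof -
    have "?X ?z (\<lambda>z. 0) = ?X ?z (\<lambda>z. eta t z (?V z))"
    proof (rule TS_local[OF TX(1) smooth_via_const[OF z]])
      show "eventually (\<lambda>z. 0 = eta t z (?V z)) (param_nhds tw_restr tw_coord ?z)"
        using V0 eventually_param_nhds_mem V(3)
      proof eventually_elim
        case (elim z)
        note q = tw_restr_point[OF elim(2)]
        have "eta t z (?V z) = eta t (tw_point (fst z) (fibre_coord z)) (tangent_vec (fst z) (fibre_coord z) 0 (\<beta> (fst z) *\<^sub>R cross3 (unit3 2) (fibre_coord z)))"
          using q(2) elim(1) by simp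
        also have "\<dots> = 0 \<bullet> xi_vec (fibre_coord z)" by (rule eta_tv[OF q(1,3) elim(3)])
        finally show ?case by simp
      qed
    qed
    then show ?thesis using TS_const[OF TX(1) z, of 0] by simp
  qed
  have "eta t ?z (lie_bracket ?T ?V ?X ?z) = 0"
    unfolding w1(2) u1 eta_tv[OF p s w1(1)] by simp
  then have ext: "ext_deriv ?T (eta t) ?V ?X ?z = \<beta> p * frechet_derivative (\<lambda>s. xi_vec s $ 3) (at s) (\<beta> p *\<^sub>R unit3 1)"
    by (simp add: ext_deriv_def etaX etaV)
  have hchi: "base_comp p b (chi_field ?z) = xi_vec s $ b"
    unfolding chi_eq[OF p s] by (rule base_comp_tv[OF p s]) simp
  have "?\<Phi> ?z (?\<Phi> ?z (lie_bracket ?T ?V ?X ?z))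
         + lie_bracket ?T (\<lambda>q. ?\<Phi> q (?V q)) (\<lambda>q. ?\<Phi> q (?X q)) ?z
         - ?\<Phi> ?z (lie_bracket ?T (\<lambda>q. ?\<Phi> q (?V q)) ?X ?z)
         - ?\<Phi> ?z (lie_bracket ?T ?V (\<lambda>q. ?\<Phi> q (?X q)) ?z)
         + ext_deriv ?T (eta t) ?V ?X ?z *\<^sub>R chi_field ?z = 0"
    using normal zC gfield_vfield[OF \<beta>(1-4)] unfolding normal_twistor_def normal_structure_def by blast
  then have "base_comp p b (?\<Phi> ?z (?\<Phi> ?z (lie_bracket ?T ?V ?X ?z))
         + lie_bracket ?T (\<lambda>q. ?\<Phi> q (?V q)) (\<lambda>q. ?\<Phi> q (?X q)) ?z
         - ?\<Phi> ?z (lie_bracket ?T (\<lambda>q. ?\<Phi> q (?V q)) ?X ?z)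
         - ?\<Phi> ?z (lie_bracket ?T ?V (\<lambda>q. ?\<Phi> q (?X q)) ?z)
         + ext_deriv ?T (eta t) ?V ?X ?z *\<^sub>R chi_field ?z) = base_comp p b 0"
    by (rule arg_cong)
  moreover have "base_comp p b (w1 + w2 - w3 - w4 + c *\<^sub>R w5) = base_comp p b w1 + base_comp p b w2 - base_comp p b w3 - base_comp p b w4 + c * base_comp p b w5"
    for w1 w2 w3 w4 w5 and c :: real by (simp add: base_comp_def scaleR_fun_def)
  moreover have "base_comp p b 0 = 0" by (simp add: base_comp_def)
  ultimately have "\<beta> p * frechet_derivative (\<lambda>s. phi_mat \<epsilon> s $ 3 $ b) (at s) (((- 1) ^ n * \<beta> p) *\<^sub>R unit3 2)
      - (\<Sum>j\<in>UNIV. (\<beta> p * frechet_derivative (\<lambda>s. phi_mat \<epsilon> s $ 3 $ j) (at s) (\<beta> p *\<^sub>R unit3 1)) * phi_mat \<epsilon> s $ j $ b)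
      + \<beta> p * frechet_derivative (\<lambda>s. xi_vec s $ 3) (at s) (\<beta> p *\<^sub>R unit3 1) * xi_vec s $ b = 0"
    by (simp only: t1 t2 t3 h\<Phi>V\<Phi>X ext hchi)
  moreover have "frechet_derivative H (at s) (k *\<^sub>R v) = k * frechet_derivative H (at s) v" if "smooth_on UNIV H"
    for H :: "real^3 \<Rightarrow> real" and k v
    using linear_cmul[OF has_derivative_linear[OF smooth_on_has_derivative[OF that UNIV_I]]] by simp
  \<comment> \<open>Linearity in the direction takes the second factor \<open>\<beta> p\<close> out
    of the derivatives.\<close>
  ultimately have "(\<beta> p * \<beta> p) * ((- 1) ^ n * frechet_derivative (\<lambda>s. phi_mat \<epsilon> s $ 3 $ b) (at s) (unit3 2)
    - (\<Sum>j\<in>UNIV. frechet_derivative (\<lambda>s. phi_mat \<epsilon> s $ 3 $ j) (at s) (unit3 1) * phi_mat \<epsilon> s $ j $ b)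
    + frechet_derivative (\<lambda>s. xi_vec s $ 3) (at s) (unit3 1) * xi_vec s $ b) = 0"
    by (simp add: smooth_phi_mat smooth_xi_vec sum_distrib_left algebra_simps)
  then show ?thesis using \<beta>(5) by (simp add: s_def)
qed

end

section \<open>The three sign cases\<close>

theorem proposition4:
  fixes A :: "('m::{t2_space, second_countable_topology}, real^5) chart set"
    and g :: "'m \<Rightarrow> 'm tvec \<Rightarrow> 'm tvec \<Rightarrow> real"
    and \<Upsilon> :: "'m \<Rightarrow> 'm tvec \<Rightarrow> 'm tvec \<Rightarrow> 'm tvec \<Rightarrow> real"
    and D :: "'m \<Rightarrow> 'm tvec \<Rightarrow> ('m \<Rightarrow> 'm tvec) \<Rightarrow> 'm tvec"
    and t :: real
  assumes "SO3_connection A g \<Upsilon> D"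
    and "t > 0"
  shows "\<not> SO3_connection.normal_twistor A g \<Upsilon> D 1 (-1) t \<and>
    \<not> SO3_connection.normal_twistor A g \<Upsilon> D 2 1 t \<and>
    \<not> SO3_connection.normal_twistor A g \<Upsilon> D 2 (-1) t"
proof -
  interpret SO3_connection A g \<Upsilon> D by fact
  \<comment> \<open>Types are inhabited, so there is a point at which to test.\<close>
  fix p :: 'm
  obtain V and F :: "5 \<Rightarrow> 'm \<Rightarrow> 'm tvec" where F: "open V" "p \<in> V" "\<forall>i. vfield_on A V (F i)"
    "\<forall>q\<in>V. oriented_onb q (\<lambda>i. F i q) \<and>
      (\<forall>x. let X = (\<Sum>i\<in>UNIV. x $ i *\<^sub>R F i q) in \<Upsilon> q X X X = upsilon_cubic x)"
    using adapted_frame[of p] by blast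
  have "p \<in> chart_space A" using cover by simp
  then obtain U x where U: "(U, x) \<in> A" "p \<in> U" unfolding chart_space_def by auto
  interpret framed A g \<Upsilon> D U "U \<inter> V" x "\<lambda>q i. F i q"
  proof unfold_locales
    show "open (U \<inter> V)" using chart_open(1)[OF U(1)] F(1) by blast
    show "vfield_on A (U \<inter> V) (\<lambda>q. F i q)" for i using F(3) unfolding vfield_on_def by blast
    show "adapted q (\<lambda>i. F i q)" if "q \<in> U \<inter> V" for q
      using F(4) that unfolding adapted_def by blast
  qed (use U in auto)
  have p: "p \<in> U \<inter> V" using U F by blast
  have 3: "sqrt 3 > 0" by simp
  note C = normality_condition[OF p]
  have s1: "(\<Sum>j\<in>UNIV. (if j = 2 then a else 0) * f j) = a * f (2::5)" for a :: real and f
    by (simp add: if_distribR if_distrib cong: if_cong)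
  note ev = phi_mat_derivatives xi_vec_derivative phi_mat_e3 xi_vec_e3 s1
  have "\<not> normal_twistor 1 (- 1) t"
  proof
    assume "normal_twistor 1 (- 1) t"
    \<comment> \<open>The first and the last term are both \<open>- sqrt 3\<close>, and the sum over
      \<open>j\<close> vanishes.\<close>
    from C[OF this, of 1] show False using 3 by (simp add: ev)
  qed
  moreover have "\<not> normal_twistor 2 1 t"
  proof
    assume "normal_twistor 2 1 t"
    from C[OF this, of 1] show False using 3 by (simp add: ev)
  qed
  moreover have "\<not> normal_twistor 2 (- 1) t"
  proof
    assume "normal_twistor 2 (- 1) t"
    \<comment> \<open>Component 1 is of no use here, as its terms \<open>sqrt 3\<close> and
      \<open>- sqrt 3\<close> cancel. In component 4 the first term and the negative of the sum are
      both \<open>2\<close>, and xi contributes nothing.\<close>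
    from C[OF this, of 4] show False by (simp add: ev)
  qed
  ultimately show ?thesis by blast
qed

end
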